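(* Let $\mathcal{A}$ be an AB3 abelian category and let $\mathcal{B}$ be an additive (full) subcategory of $\mathcal{A}$. The following assertions are equivalent: (1) $\mathcal{B}$ is a coreflective abelian exact subcategory with a set of projective generators. (2) There is a set $\mathcal{U}$ of objects that satisfies the following properties: (a) $\mathcal{B}=\operatorname{Pres}(\mathcal{U})$; (b) each epimorphism $p:\tilde{U}\twoheadrightarrow B$, with $\tilde{U}\in\operatorname{Sum}(\mathcal{U})$ and $B\in\mathcal{B}$, is a $\mathcal{U}$-epimorphism with kernel in $\operatorname{Gen}(\mathcal{U})$; (c) each morphism in $\operatorname{Sum}(\mathcal{U})$ has its kernel in $\operatorname{Gen}(\mathcal{U})$. In such case, $\mathcal{B}$ is (equivalent to) a module category over a (small) preadditive category (resp. over a ring) if, and only if, the set $\mathcal{U}$ may be chosen to be self-small (resp. self-small and having just one object).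
   Context: AB3 means cocomplete. Subcategories are full and closed under isomorphisms; an additive subcategory contains $0$ and is closed under finite coproducts. $\mathcal{B}$ is coreflective if its inclusion has a right adjoint; it is abelian exact if it is abelian and its inclusion functor is exact (equivalently, closed under finite coproducts, kernels and cokernels in $\mathcal{A}$). "A set of projective generators" of $\mathcal{B}$ is a set of objects of $\mathcal{B}$, projective in $\mathcal{B}$ (not necessarily in $\mathcal{A}$), such that each object of $\mathcal{B}$ is an epimorphic image of a coproduct of objects of the set. The module category over a small preadditive category $\mathcal{C}$ is the category of additive functors $\mathcal{C}^{\mathrm{op}}\to\mathrm{Ab}$; rings are associative and unital. $\operatorname{Sum}(\mathcal{U})$ is the full subcategory of all (set-indexed) coproducts of objects from $\mathcal{U}$; $\operatorname{Gen}(\mathcal{U})$ consists of the epimorphic images of objects of $\operatorname{Sum}(\mathcal{U})$; $\operatorname{Pres}(\mathcal{U})$ consists of the objects isomorphic to cokernels of morphisms in $\operatorname{Sum}(\mathcal{U})$. A morphism $p$ is a $\mathcal{U}$-epimorphism if $\mathcal{A}(U,p)$ is surjective for every $U\in\mathcal{U}$. A set $\mathcal{U}$ of objects is self-small if for each family $\{U_i\mid i\in I\}\subseteq\mathcal{U}$ and each $U\in\mathcal{U}$, the canonical map $\coprod_{i\in I}\mathcal{A}(U,U_i)\to\mathcal{A}(U,\coprod_{i\in I}U_i)$ is an isomorphism. *)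

theory Defs
  imports "HOL-Algebra.Product_Groups" "HOL-Algebra.Ring"
begin

unbundle cardinal_syntax

section \<open>Size\<close>

text \<open>HOL has no set/class distinction.  Smallness is relative to a cardinal \<open>\<kappa>\<close>:
  the ``sets'' of a Grothendieck universe are, up to bijection, the sets of cardinality less than
  a regular strong limit cardinal \<open>\<kappa>\<close>.  Uncountable \<open>\<kappa>\<close> (inaccessible cardinals) give the universes
  containing the natural numbers; \<open>\<kappa> = \<aleph>\<^sub>0\<close> gives the universe of hereditarily finite sets.
  Every small set is in bijection with a subset of the type \<open>'u\<close> underlying \<open>\<kappa>\<close>, so it loses
  nothing to take index sets, carriers of small groups, etc., inside \<open>'u\<close>.\<close>

definition universe :: "'u rel \<Rightarrow> bool" where
  "universe \<kappa> \<longleftrightarrow> Cinfinite \<kappa> \<and> regularCard \<kappa> \<and>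
     (\<forall>S :: 'u set. |S| <o \<kappa> \<longrightarrow> |Pow S| <o \<kappa>)"

definition small :: "'u rel \<Rightarrow> 'a set \<Rightarrow> bool" where
  "small \<kappa> S \<longleftrightarrow> |S| <o \<kappa>"


section \<open>Categories\<close>

record ('o, 'm) cat =
  Obj :: "'o set"
  Arr :: "'m set"
  Dom :: "'m \<Rightarrow> 'o"
  Cod :: "'m \<Rightarrow> 'o"
  Ide :: "'o \<Rightarrow> 'm"
  Cmp :: "'m \<Rightarrow> 'm \<Rightarrow> 'm"  (infixl \<open>\<cdot>\<index>\<close> 70)

definition Hom :: "('o, 'm, 'x) cat_scheme \<Rightarrow> 'o \<Rightarrow> 'o \<Rightarrow> 'm set" where
  "Hom C a b = {f \<in> Arr C. Dom C f = a \<and> Cod C f = b}"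

locale category =
  fixes C :: "('o, 'm, 'x) cat_scheme" (structure)
  assumes dom_obj: "f \<in> Arr C \<Longrightarrow> Dom C f \<in> Obj C"
    and cod_obj: "f \<in> Arr C \<Longrightarrow> Cod C f \<in> Obj C"
    and ide_hom: "a \<in> Obj C \<Longrightarrow> Ide C a \<in> Hom C a a"
    and cmp_hom: "f \<in> Hom C a b \<Longrightarrow> g \<in> Hom C b c \<Longrightarrow> g \<cdot> f \<in> Hom C a c"
    and cmp_ide_right: "f \<in> Hom C a b \<Longrightarrow> f \<cdot> Ide C a = f"
    and cmp_ide_left: "f \<in> Hom C a b \<Longrightarrow> Ide C b \<cdot> f = f"
    and cmp_assoc: "f \<in> Hom C a b \<Longrightarrow> g \<in> Hom C b c \<Longrightarrow> h \<in> Hom C c d \<Longrightarrow>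
      h \<cdot> (g \<cdot> f) = (h \<cdot> g) \<cdot> f"

definition small_category :: "'u rel \<Rightarrow> ('o, 'm, 'x) cat_scheme \<Rightarrow> bool" where
  "small_category \<kappa> C \<longleftrightarrow> category C \<and> small \<kappa> (Obj C) \<and> small \<kappa> (Arr C)"

definition locally_small :: "'u rel \<Rightarrow> ('o, 'm, 'x) cat_scheme \<Rightarrow> bool" where
  "locally_small \<kappa> C \<longleftrightarrow> (\<forall>a\<in>Obj C. \<forall>b\<in>Obj C. small \<kappa> (Hom C a b))"

definition monic :: "('o, 'm, 'x) cat_scheme \<Rightarrow> 'm \<Rightarrow> bool" where
  "monic C f \<longleftrightarrow> f \<in> Arr C \<and>
     (\<forall>a\<in>Obj C. \<forall>g\<in>Hom C a (Dom C f). \<forall>h\<in>Hom C a (Dom C f).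
        f \<cdot>\<^bsub>C\<^esub> g = f \<cdot>\<^bsub>C\<^esub> h \<longrightarrow> g = h)"

definition epic :: "('o, 'm, 'x) cat_scheme \<Rightarrow> 'm \<Rightarrow> bool" where
  "epic C f \<longleftrightarrow> f \<in> Arr C \<and>
     (\<forall>b\<in>Obj C. \<forall>g\<in>Hom C (Cod C f) b. \<forall>h\<in>Hom C (Cod C f) b.
        g \<cdot>\<^bsub>C\<^esub> f = h \<cdot>\<^bsub>C\<^esub> f \<longrightarrow> g = h)"

definition iso_arr :: "('o, 'm, 'x) cat_scheme \<Rightarrow> 'm \<Rightarrow> bool" where
  "iso_arr C f \<longleftrightarrow> f \<in> Arr C \<and>
     (\<exists>g\<in>Hom C (Cod C f) (Dom C f).
        g \<cdot>\<^bsub>C\<^esub> f = Ide C (Dom C f) \<and> f \<cdot>\<^bsub>C\<^esub> g = Ide C (Cod C f))"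

definition isomorphic :: "('o, 'm, 'x) cat_scheme \<Rightarrow> 'o \<Rightarrow> 'o \<Rightarrow> bool" where
  "isomorphic C a b \<longleftrightarrow> (\<exists>f\<in>Hom C a b. iso_arr C f)"

definition zero_object :: "('o, 'm, 'x) cat_scheme \<Rightarrow> 'o \<Rightarrow> bool" where
  "zero_object C z \<longleftrightarrow> z \<in> Obj C \<and>
     (\<forall>a\<in>Obj C. (\<exists>!f. f \<in> Hom C a z) \<and> (\<exists>!f. f \<in> Hom C z a))"

definition is_coproduct ::
    "('o, 'm, 'x) cat_scheme \<Rightarrow> 'i set \<Rightarrow> ('i \<Rightarrow> 'o) \<Rightarrow> 'o \<Rightarrow> ('i \<Rightarrow> 'm) \<Rightarrow> bool" where
  "is_coproduct C I X P \<iota> \<longleftrightarrow> P \<in> Obj C \<and> (\<forall>i\<in>I. \<iota> i \<in> Hom C (X i) P) \<and>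
     (\<forall>Y\<in>Obj C. \<forall>f. (\<forall>i\<in>I. f i \<in> Hom C (X i) Y) \<longrightarrow>
        (\<exists>!h. h \<in> Hom C P Y \<and> (\<forall>i\<in>I. h \<cdot>\<^bsub>C\<^esub> \<iota> i = f i)))"

definition projective :: "('o, 'm, 'x) cat_scheme \<Rightarrow> 'o \<Rightarrow> bool" where
  "projective C P \<longleftrightarrow> P \<in> Obj C \<and>
     (\<forall>e f. epic C e \<and> f \<in> Hom C P (Cod C e) \<longrightarrow> (\<exists>g\<in>Hom C P (Dom C e). e \<cdot>\<^bsub>C\<^esub> g = f))"

definition full_subcategory :: "('o, 'm, 'x) cat_scheme \<Rightarrow> 'o set \<Rightarrow> ('o, 'm, 'x) cat_scheme" where
  "full_subcategory C B =
     C\<lparr>Obj := B, Arr := {f \<in> Arr C. Dom C f \<in> B \<and> Cod C f \<in> B}\<rparr>"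


section \<open>Functors, equivalences, adjunctions, colimits\<close>

record ('o, 'm, 'p, 'n) ftor =
  FO :: "'o \<Rightarrow> 'p"
  FA :: "'m \<Rightarrow> 'n"

definition is_functor ::
    "('o, 'm, 'x) cat_scheme \<Rightarrow> ('p, 'n, 'y) cat_scheme \<Rightarrow> ('o, 'm, 'p, 'n) ftor \<Rightarrow> bool" where
  "is_functor C D F \<longleftrightarrow> category C \<and> category D \<and>
     (\<forall>a\<in>Obj C. FO F a \<in> Obj D \<and> FA F (Ide C a) = Ide D (FO F a)) \<and>
     (\<forall>f\<in>Arr C. FA F f \<in> Hom D (FO F (Dom C f)) (FO F (Cod C f))) \<and>
     (\<forall>f\<in>Arr C. \<forall>g\<in>Arr C. Cod C f = Dom C g \<longrightarrow> FA F (g \<cdot>\<^bsub>C\<^esub> f) = FA F g \<cdot>\<^bsub>D\<^esub> FA F f)"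

definition id_functor :: "('o, 'm, 'o, 'm) ftor" where
  "id_functor = \<lparr>FO = (\<lambda>a. a), FA = (\<lambda>f. f)\<rparr>"

definition comp_functor ::
    "('p, 'n, 'q, 'k) ftor \<Rightarrow> ('o, 'm, 'p, 'n) ftor \<Rightarrow> ('o, 'm, 'q, 'k) ftor" where
  "comp_functor G F = \<lparr>FO = (\<lambda>a. FO G (FO F a)), FA = (\<lambda>f. FA G (FA F f))\<rparr>"

definition nat_trans :: "('o, 'm, 'x) cat_scheme \<Rightarrow> ('p, 'n, 'y) cat_scheme \<Rightarrow>
    ('o, 'm, 'p, 'n) ftor \<Rightarrow> ('o, 'm, 'p, 'n) ftor \<Rightarrow> ('o \<Rightarrow> 'n) \<Rightarrow> bool" where
  "nat_trans C D F G \<eta> \<longleftrightarrow>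
     (\<forall>a\<in>Obj C. \<eta> a \<in> Hom D (FO F a) (FO G a)) \<and>
     (\<forall>f\<in>Arr C. \<eta> (Cod C f) \<cdot>\<^bsub>D\<^esub> FA F f = FA G f \<cdot>\<^bsub>D\<^esub> \<eta> (Dom C f))"

definition nat_iso :: "('o, 'm, 'x) cat_scheme \<Rightarrow> ('p, 'n, 'y) cat_scheme \<Rightarrow>
    ('o, 'm, 'p, 'n) ftor \<Rightarrow> ('o, 'm, 'p, 'n) ftor \<Rightarrow> ('o \<Rightarrow> 'n) \<Rightarrow> bool" where
  "nat_iso C D F G \<eta> \<longleftrightarrow> nat_trans C D F G \<eta> \<and> (\<forall>a\<in>Obj C. iso_arr D (\<eta> a))"

definition equivalent :: "('o, 'm, 'x) cat_scheme \<Rightarrow> ('p, 'n, 'y) cat_scheme \<Rightarrow> bool" where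
  "equivalent C D \<longleftrightarrow> (\<exists>F G \<eta> \<epsilon>. is_functor C D F \<and> is_functor D C G \<and>
     nat_iso C C id_functor (comp_functor G F) \<eta> \<and>
     nat_iso D D (comp_functor F G) id_functor \<epsilon>)"

text \<open>\<open>G\<close> is right adjoint to \<open>F\<close>: a bijection \<open>D(F c, d) \<cong> C(c, G d)\<close>, natural in \<open>c\<close> and \<open>d\<close>.\<close>

definition right_adjoint :: "('o, 'm, 'x) cat_scheme \<Rightarrow> ('p, 'n, 'y) cat_scheme \<Rightarrow>
    ('o, 'm, 'p, 'n) ftor \<Rightarrow> ('p, 'n, 'o, 'm) ftor \<Rightarrow> bool" where
  "right_adjoint C D F G \<longleftrightarrow> is_functor C D F \<and> is_functor D C G \<and>
     (\<exists>\<phi>. (\<forall>c\<in>Obj C. \<forall>d\<in>Obj D. bij_betw (\<phi> c d) (Hom D (FO F c) d) (Hom C c (FO G d))) \<and>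
          (\<forall>c\<in>Obj C. \<forall>c'\<in>Obj C. \<forall>d\<in>Obj D. \<forall>d'\<in>Obj D.
             \<forall>f\<in>Hom C c' c. \<forall>h\<in>Hom D (FO F c) d. \<forall>g\<in>Hom D d d'.
               \<phi> c' d' (g \<cdot>\<^bsub>D\<^esub> h \<cdot>\<^bsub>D\<^esub> FA F f) = FA G g \<cdot>\<^bsub>C\<^esub> \<phi> c d h \<cdot>\<^bsub>C\<^esub> f))"

definition coreflective :: "('o, 'm, 'x) cat_scheme \<Rightarrow> 'o set \<Rightarrow> bool" where
  "coreflective A B \<longleftrightarrow> (\<exists>G. right_adjoint (full_subcategory A B) A id_functor G)"

definition is_colimit :: "('j, 'k, 'x) cat_scheme \<Rightarrow> ('o, 'm, 'y) cat_scheme \<Rightarrow>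
    ('j, 'k, 'o, 'm) ftor \<Rightarrow> 'o \<Rightarrow> ('j \<Rightarrow> 'm) \<Rightarrow> bool" where
  "is_colimit J C D L \<iota> \<longleftrightarrow> L \<in> Obj C \<and>
     (\<forall>j\<in>Obj J. \<iota> j \<in> Hom C (FO D j) L) \<and>
     (\<forall>f\<in>Arr J. \<iota> (Cod J f) \<cdot>\<^bsub>C\<^esub> FA D f = \<iota> (Dom J f)) \<and>
     (\<forall>Y\<in>Obj C. \<forall>\<mu>. (\<forall>j\<in>Obj J. \<mu> j \<in> Hom C (FO D j) Y) \<and>
          (\<forall>f\<in>Arr J. \<mu> (Cod J f) \<cdot>\<^bsub>C\<^esub> FA D f = \<mu> (Dom J f)) \<longrightarrow>
        (\<exists>!h. h \<in> Hom C L Y \<and> (\<forall>j\<in>Obj J. h \<cdot>\<^bsub>C\<^esub> \<iota> j = \<mu> j)))"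

definition cocomplete :: "'u rel \<Rightarrow> ('o, 'm, 'x) cat_scheme \<Rightarrow> bool" where
  "cocomplete \<kappa> C \<longleftrightarrow> (\<forall>(J :: ('u, 'u) cat) D. small_category \<kappa> J \<and> is_functor J C D \<longrightarrow>
     (\<exists>L \<iota>. is_colimit J C D L \<iota>))"


section \<open>Preadditive and abelian categories\<close>

record ('o, 'm) precat = "('o, 'm) cat" +
  Add :: "'m \<Rightarrow> 'm \<Rightarrow> 'm"
  Zero :: "'o \<Rightarrow> 'o \<Rightarrow> 'm"

text \<open>The abelian group \<open>C(a, b)\<close>.  Its operation is \<open>Add\<close>, although HOL-Algebra writes
  commutative groups with a multiplicative signature.\<close>

definition hom_group :: "('o, 'm, 'x) precat_scheme \<Rightarrow> 'o \<Rightarrow> 'o \<Rightarrow> 'm monoid" where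
  "hom_group C a b = \<lparr>carrier = Hom C a b, monoid.mult = Add C, one = Zero C a b\<rparr>"

locale preadditive_category = category C
  for C :: "('o, 'm, 'x) precat_scheme" (structure) +
  assumes hom_comm_group: "a \<in> Obj C \<Longrightarrow> b \<in> Obj C \<Longrightarrow> comm_group (hom_group C a b)"
    and cmp_add_left: "f \<in> Hom C a b \<Longrightarrow> g \<in> Hom C b c \<Longrightarrow> h \<in> Hom C b c \<Longrightarrow>
      Add C g h \<cdot> f = Add C (g \<cdot> f) (h \<cdot> f)"
    and cmp_add_right: "f \<in> Hom C a b \<Longrightarrow> g \<in> Hom C a b \<Longrightarrow> h \<in> Hom C b c \<Longrightarrow>
      h \<cdot> Add C f g = Add C (h \<cdot> f) (h \<cdot> g)"

definition is_kernel :: "('o, 'm, 'x) precat_scheme \<Rightarrow> 'm \<Rightarrow> 'm \<Rightarrow> bool" where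
  "is_kernel C f k \<longleftrightarrow> f \<in> Arr C \<and> k \<in> Hom C (Dom C k) (Dom C f) \<and>
     f \<cdot>\<^bsub>C\<^esub> k = Zero C (Dom C k) (Cod C f) \<and>
     (\<forall>a\<in>Obj C. \<forall>g\<in>Hom C a (Dom C f). f \<cdot>\<^bsub>C\<^esub> g = Zero C a (Cod C f) \<longrightarrow>
        (\<exists>!h. h \<in> Hom C a (Dom C k) \<and> k \<cdot>\<^bsub>C\<^esub> h = g))"

definition is_cokernel :: "('o, 'm, 'x) precat_scheme \<Rightarrow> 'm \<Rightarrow> 'm \<Rightarrow> bool" where
  "is_cokernel C f c \<longleftrightarrow> f \<in> Arr C \<and> c \<in> Hom C (Cod C f) (Cod C c) \<and>
     c \<cdot>\<^bsub>C\<^esub> f = Zero C (Dom C f) (Cod C c) \<and>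
     (\<forall>b\<in>Obj C. \<forall>g\<in>Hom C (Cod C f) b. g \<cdot>\<^bsub>C\<^esub> f = Zero C (Dom C f) b \<longrightarrow>
        (\<exists>!h. h \<in> Hom C (Cod C c) b \<and> h \<cdot>\<^bsub>C\<^esub> c = g))"

locale abelian_category = preadditive_category C
  for C :: "('o, 'm, 'x) precat_scheme" (structure) +
  assumes has_zero: "\<exists>z. zero_object C z"
    and has_binary_coproducts: "a \<in> Obj C \<Longrightarrow> b \<in> Obj C \<Longrightarrow>
      \<exists>P \<iota>. is_coproduct C (UNIV :: bool set) (\<lambda>i. if i then a else b) P \<iota>"
    and has_kernels: "f \<in> Arr C \<Longrightarrow> \<exists>k. is_kernel C f k"
    and has_cokernels: "f \<in> Arr C \<Longrightarrow> \<exists>c. is_cokernel C f c"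
    and monic_normal: "monic C m \<Longrightarrow> \<exists>f. is_kernel C f m"
    and epic_normal: "epic C e \<Longrightarrow> \<exists>f. is_cokernel C f e"

definition additive_functor ::
    "('o, 'm, 'x) precat_scheme \<Rightarrow> ('p, 'n, 'y) precat_scheme \<Rightarrow> ('o, 'm, 'p, 'n) ftor \<Rightarrow> bool" where
  "additive_functor C D F \<longleftrightarrow> is_functor C D F \<and>
     (\<forall>a\<in>Obj C. \<forall>b\<in>Obj C. \<forall>f\<in>Hom C a b. \<forall>g\<in>Hom C a b.
        FA F (Add C f g) = Add D (FA F f) (FA F g))"

definition short_exact :: "('o, 'm, 'x) precat_scheme \<Rightarrow> 'm \<Rightarrow> 'm \<Rightarrow> bool" where
  "short_exact C f g \<longleftrightarrow> is_kernel C g f \<and> is_cokernel C f g"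

definition exact_functor ::
    "('o, 'm, 'x) precat_scheme \<Rightarrow> ('p, 'n, 'y) precat_scheme \<Rightarrow> ('o, 'm, 'p, 'n) ftor \<Rightarrow> bool" where
  "exact_functor C D F \<longleftrightarrow> additive_functor C D F \<and>
     (\<forall>f g. short_exact C f g \<longrightarrow> short_exact D (FA F f) (FA F g))"

definition additive_subcategory :: "('o, 'm, 'x) precat_scheme \<Rightarrow> 'o set \<Rightarrow> bool" where
  "additive_subcategory A B \<longleftrightarrow> B \<subseteq> Obj A \<and>
     (\<forall>b\<in>B. \<forall>a\<in>Obj A. isomorphic A a b \<longrightarrow> a \<in> B) \<and>
     (\<forall>z. zero_object A z \<longrightarrow> z \<in> B) \<and>
     (\<forall>(I :: nat set) X P \<iota>. finite I \<and> (\<forall>i\<in>I. X i \<in> B) \<and> is_coproduct A I X P \<iota> \<longrightarrow> P \<in> B)"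

definition abelian_exact :: "('o, 'm, 'x) precat_scheme \<Rightarrow> 'o set \<Rightarrow> bool" where
  "abelian_exact A B \<longleftrightarrow> abelian_category (full_subcategory A B) \<and>
     exact_functor (full_subcategory A B) A id_functor"


section \<open>Classes of objects generated by a set\<close>

definition Sum :: "'u rel \<Rightarrow> ('o, 'm, 'x) cat_scheme \<Rightarrow> 'o set \<Rightarrow> 'o set" where
  "Sum \<kappa> C \<U> = {P. \<exists>(I :: 'u set) X \<iota>. small \<kappa> I \<and> (\<forall>i\<in>I. X i \<in> \<U>) \<and> is_coproduct C I X P \<iota>}"

definition Gen :: "'u rel \<Rightarrow> ('o, 'm, 'x) cat_scheme \<Rightarrow> 'o set \<Rightarrow> 'o set" where
  "Gen \<kappa> C \<U> = {Y. \<exists>P\<in>Sum \<kappa> C \<U>. \<exists>e\<in>Hom C P Y. epic C e}"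

definition Pres :: "'u rel \<Rightarrow> ('o, 'm, 'x) precat_scheme \<Rightarrow> 'o set \<Rightarrow> 'o set" where
  "Pres \<kappa> C \<U> = {Y. \<exists>f c. Dom C f \<in> Sum \<kappa> C \<U> \<and> Cod C f \<in> Sum \<kappa> C \<U> \<and>
     is_cokernel C f c \<and> isomorphic C (Cod C c) Y}"

definition set_of_projective_generators ::
    "'u rel \<Rightarrow> ('o, 'm, 'x) cat_scheme \<Rightarrow> 'o set \<Rightarrow> bool" where
  "set_of_projective_generators \<kappa> C \<G> \<longleftrightarrow> small \<kappa> \<G> \<and> (\<forall>P\<in>\<G>. projective C P) \<and> Obj C \<subseteq> Gen \<kappa> C \<G>"

definition rel_epimorphism :: "('o, 'm, 'x) cat_scheme \<Rightarrow> 'o set \<Rightarrow> 'm \<Rightarrow> bool" where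
  "rel_epimorphism C \<U> p \<longleftrightarrow> p \<in> Arr C \<and>
     (\<forall>U\<in>\<U>. (\<lambda>f. p \<cdot>\<^bsub>C\<^esub> f) ` Hom C U (Dom C p) = Hom C U (Cod C p))"

text \<open>The canonical map \<open>\<Coprod>\<^sub>i C(U, X\<^sub>i) \<rightarrow> C(U, P)\<close>, \<open>x \<mapsto> \<Sum>\<^sub>i \<iota>\<^sub>i x\<^sub>i\<close>, is written as a finite
  sum over the support of \<open>x\<close>, because \<^const>\<open>finprod\<close> is trivial on infinite index sets.\<close>

definition canonical_map :: "('o, 'm, 'x) precat_scheme \<Rightarrow> 'o \<Rightarrow> 'i set \<Rightarrow> ('i \<Rightarrow> 'o) \<Rightarrow>
    'o \<Rightarrow> ('i \<Rightarrow> 'm) \<Rightarrow> ('i \<Rightarrow> 'm) \<Rightarrow> 'm" where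
  "canonical_map C U I X P \<iota> x =
     finprod (hom_group C U P) (\<lambda>i. \<iota> i \<cdot>\<^bsub>C\<^esub> x i) {i \<in> I. x i \<noteq> Zero C U (X i)}"

definition self_small :: "'u rel \<Rightarrow> ('o, 'm, 'x) precat_scheme \<Rightarrow> 'o set \<Rightarrow> bool" where
  "self_small \<kappa> C \<U> \<longleftrightarrow>
     (\<forall>(I :: 'u set) X P \<iota>. \<forall>U\<in>\<U>.
        small \<kappa> I \<and> (\<forall>i\<in>I. X i \<in> \<U>) \<and> is_coproduct C I X P \<iota> \<longrightarrow>
        canonical_map C U I X P \<iota>
          \<in> iso (sum_group I (\<lambda>i. hom_group C U (X i))) (hom_group C U P))"


section \<open>Module categories\<close>

definition opposite :: "('o, 'm) precat \<Rightarrow> ('o, 'm) precat" where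
  "opposite C = \<lparr>Obj = Obj C, Arr = Arr C, Dom = Cod C, Cod = Dom C, Ide = Ide C,
     Cmp = (\<lambda>g f. f \<cdot>\<^bsub>C\<^esub> g), Add = Add C, Zero = (\<lambda>a b. Zero C b a)\<rparr>"

text \<open>Small abelian groups with carrier in \<open>'u\<close>.  An arrow is a homomorphism together with its
  domain and codomain, extensional on its domain so that equal maps are equal arrows.\<close>

definition Ab :: "'u rel \<Rightarrow> ('u monoid, 'u monoid \<times> 'u monoid \<times> ('u \<Rightarrow> 'u)) precat" where
  "Ab \<kappa> = \<lparr>
     Obj = {G. comm_group G \<and> small \<kappa> (carrier G)},
     Arr = {(G, H, f). comm_group G \<and> small \<kappa> (carrier G) \<and> comm_group H \<and> small \<kappa> (carrier H) \<and>
        f \<in> hom G H \<and> f \<in> extensional (carrier G)},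
     Dom = (\<lambda>(G, H, f). G),
     Cod = (\<lambda>(G, H, f). H),
     Ide = (\<lambda>G. (G, G, \<lambda>x\<in>carrier G. x)),
     Cmp = (\<lambda>(H', K, g) (G, H, f). (G, K, \<lambda>x\<in>carrier G. g (f x))),
     Add = (\<lambda>(G, H, f) (G', H', g). (G, H, \<lambda>x\<in>carrier G. f x \<otimes>\<^bsub>H\<^esub> g x)),
     Zero = (\<lambda>G H. (G, H, \<lambda>x\<in>carrier G. \<one>\<^bsub>H\<^esub>))\<rparr>"

type_synonym ('o, 'm, 'p, 'n) functor_arr =
  "('o, 'm, 'p, 'n) ftor \<times> ('o, 'm, 'p, 'n) ftor \<times> ('o \<Rightarrow> 'n)"

definition additive_functors :: "('o, 'm) precat \<Rightarrow> ('p, 'n) precat \<Rightarrow>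
    ('o, 'm, 'p, 'n) ftor set" where
  "additive_functors C D =
     {F. additive_functor C D F \<and> FO F \<in> extensional (Obj C) \<and> FA F \<in> extensional (Arr C)}"

definition additive_functor_category :: "('o, 'm) precat \<Rightarrow> ('p, 'n) precat \<Rightarrow>
    (('o, 'm, 'p, 'n) ftor, ('o, 'm, 'p, 'n) functor_arr) cat" where
  "additive_functor_category C D = \<lparr>
     Obj = additive_functors C D,
     Arr = {(F, G, \<eta>). F \<in> additive_functors C D \<and> G \<in> additive_functors C D \<and>
        nat_trans C D F G \<eta> \<and> \<eta> \<in> extensional (Obj C)},
     Dom = (\<lambda>(F, G, \<eta>). F),
     Cod = (\<lambda>(F, G, \<eta>). G),
     Ide = (\<lambda>F. (F, F, \<lambda>a\<in>Obj C. Ide D (FO F a))),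
     Cmp = (\<lambda>(G', H, \<theta>) (F, G, \<eta>). (F, H, \<lambda>a\<in>Obj C. \<theta> a \<cdot>\<^bsub>D\<^esub> \<eta> a))\<rparr>"

definition module_category :: "'u rel \<Rightarrow> ('o, 'm) precat \<Rightarrow>
    (('o, 'm, 'u monoid, 'u monoid \<times> 'u monoid \<times> ('u \<Rightarrow> 'u)) ftor,
     ('o, 'm, 'u monoid, 'u monoid \<times> 'u monoid \<times> ('u \<Rightarrow> 'u)) functor_arr) cat" where
  "module_category \<kappa> C = additive_functor_category (opposite C) (Ab \<kappa>)"

text \<open>A ring as a preadditive category with one object; \<open>module_category \<kappa> (ring_category R)\<close> is then the
  category of small right \<open>R\<close>-modules.  The underlying rings of HOL-Algebra are associative and
  unital.\<close>

definition ring_category :: "('a, 'x) ring_scheme \<Rightarrow> (unit, 'a) precat" where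
  "ring_category R = \<lparr>Obj = {()}, Arr = carrier R, Dom = (\<lambda>_. ()), Cod = (\<lambda>_. ()),
     Ide = (\<lambda>_. \<one>\<^bsub>R\<^esub>), Cmp = (\<lambda>r s. r \<otimes>\<^bsub>R\<^esub> s),
     Add = (\<lambda>r s. r \<oplus>\<^bsub>R\<^esub> s), Zero = (\<lambda>_ _. \<zero>\<^bsub>R\<^esub>)\<rparr>"

definition is_module_category_over_preadditive ::
    "'u rel \<Rightarrow> ('o, 'm, 'x) cat_scheme \<Rightarrow> bool" where
  "is_module_category_over_preadditive \<kappa> \<B> \<longleftrightarrow>
     (\<exists>C :: ('u, 'u) precat. preadditive_category C \<and> small_category \<kappa> C \<and> equivalent \<B> (module_category \<kappa> C))"

definition is_module_category_over_ring ::
    "'u rel \<Rightarrow> ('o, 'm, 'x) cat_scheme \<Rightarrow> bool" where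
  "is_module_category_over_ring \<kappa> \<B> \<longleftrightarrow>
     (\<exists>R :: 'u ring. ring R \<and> small \<kappa> (carrier R) \<and> equivalent \<B> (module_category \<kappa> (ring_category R)))"


section \<open>The two conditions\<close>

definition coreflective_abelian_exact_with_generators ::
    "'u rel \<Rightarrow> ('o, 'm, 'x) precat_scheme \<Rightarrow> 'o set \<Rightarrow> bool" where
  "coreflective_abelian_exact_with_generators \<kappa> A B \<longleftrightarrow>
     coreflective A B \<and> abelian_exact A B \<and>
     (\<exists>\<G>. set_of_projective_generators \<kappa> (full_subcategory A B) \<G>)"

definition presenting_set ::
    "'u rel \<Rightarrow> ('o, 'm, 'x) precat_scheme \<Rightarrow> 'o set \<Rightarrow> 'o set \<Rightarrow> bool" where
  "presenting_set \<kappa> A B \<U> \<longleftrightarrow> small \<kappa> \<U> \<and> \<U> \<subseteq> Obj A \<and>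
     B = Pres \<kappa> A \<U> \<and>
     (\<forall>p. epic A p \<and> Dom A p \<in> Sum \<kappa> A \<U> \<and> Cod A p \<in> B \<longrightarrow>
        rel_epimorphism A \<U> p \<and> (\<exists>k. is_kernel A p k \<and> Dom A k \<in> Gen \<kappa> A \<U>)) \<and>
     (\<forall>f\<in>Arr A. Dom A f \<in> Sum \<kappa> A \<U> \<and> Cod A f \<in> Sum \<kappa> A \<U> \<longrightarrow>
        (\<exists>k. is_kernel A f k \<and> Dom A k \<in> Gen \<kappa> A \<U>))"

end

theory Submission
  imports Defs
begin

text \<open>Let \<open>\<U>\<close> be as in (2).  The coreflection of \<open>M\<close> is obtained from the canonical morphism \<open>q\<close> to \<open>M\<close> from the
  coproduct of all \<open>U \<rightarrow> M\<close> with \<open>U \<in> \<U>\<close>, by dividing its domain by the trace of \<open>\<U>\<close> in the kernel of \<open>q\<close>; (b) makes the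
  result universal for morphisms from \<open>\<U>\<close>, hence from \<open>Pres(\<U>)\<close>.  Pulling back along epimorphisms from \<open>Sum(\<U>)\<close> and
  using (b) and (c), kernels of morphisms of \<open>B\<close> are in \<open>Gen(\<U>)\<close>, hence in \<open>Pres(\<U>)\<close>, and (b) makes \<open>\<U>\<close>
  projective in \<open>B\<close>.  Conversely, kernels and epimorphisms of an abelian exact coreflective subcategory are those of
  \<open>A\<close>, and every set of projective generators is presenting.

  If \<open>\<U>\<close> is self-small, then \<open>X \<mapsto> A(-, X)\<close> is an equivalence from \<open>B\<close> to the modules over \<open>\<U>\<close>: a property of arrows
  \<open>U \<rightarrow> \<Coprod>\<^sub>i U\<^sub>i\<close> that is stable under sums needs to be checked on the \<open>\<iota>\<^sub>i z\<close> only.  If \<open>B\<close> is equivalent to a module category,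
  the objects that correspond to the representable modules are projective generators and self-small.  Both properties
  come from one observation: if a submodule of \<open>F X\<close> corresponds to a subobject of \<open>X\<close> that is also an epimorphism onto
  \<open>X\<close>, it is the whole module.  For projectivity it is applied to the image of an epimorphism, for self-smallness to
  the elements that are fixed by some finite sum of the idempotents \<open>\<iota>\<^sub>i \<pi>\<^sub>i\<close>.\<close>

section \<open>Small sets\<close>

text \<open>Coreflectivity alone makes \<open>B\<close> closed under the coproducts and cokernels of
  \<open>A\<close>, because lifting the structure maps through the counit splits it. The substantial
  closure property is that of kernels. Conditions (b) and (c) put certain kernels into
  \<open>Gen\<close>, one step short of \<open>Pres\<close>; the missing relations come from
  applying the same result once more to a cover of the kernel. In the other direction, exactness of
  the inclusion speaks of short exact sequences only, so kernels in \<open>A\<close> are reached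
  through image factorisations in \<open>B\<close>.

  Two encodings shape the rest. \<open>Sum\<close>, \<open>cocomplete\<close> and
  \<open>self_small\<close> index families by subsets of \<open>'u\<close>, whereas the natural
  index sets consist of arrows or of elements, so families are re-indexed along injections. Modules
  have their elements in \<open>'u\<close>, whereas the arrows of \<open>A\<close> live in
  \<open>'m\<close>, so hom groups are transported. Modules are taken over an arbitrary
  \<open>D\<close> with a fully faithful additive functor \<open>K\<close> onto \<U>; a small copy
  of \<U> and an endomorphism ring are then two instances of one argument.\<close>

lemma small_mono: "small \<kappa> T \<Longrightarrow> S \<subseteq> T \<Longrightarrow> small \<kappa> S"
  unfolding small_def using card_of_mono1 ordLeq_ordLess_trans by blast

lemma small_image: "small \<kappa> S \<Longrightarrow> small \<kappa> (f ` S)"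
  unfolding small_def using card_of_image ordLeq_ordLess_trans by blast

lemma small_finite:
  assumes "universe \<kappa>" "finite S"
  shows "small \<kappa> S"
proof -
  have "Well_order \<kappa>" "infinite (Field \<kappa>)"
    using assms(1) by (auto simp: universe_def cinfinite_def card_order_on_well_order_on)
  then show ?thesis
    unfolding small_def using assms(2)
        by (intro finite_ordLess_infinite) (auto simp: card_of_Well_order[unfolded Field_card_of] Field_card_of)
qed

text \<open>Regularity of \<kappa> enters here: a regular infinite cardinal is stable under unions
  indexed by smaller sets.\<close>

lemma small_UN:
  assumes "universe \<kappa>" "small \<kappa> I" "\<And>i. i \<in> I \<Longrightarrow> small \<kappa> (S i)"
  shows "small \<kappa> (\<Union>i\<in>I. S i)"
proof -
  have "stable \<kappa>"
    using assms(1) unfolding universe_def cinfinite_def by (blast intro: regularCard_stable)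
  then show ?thesis
    using assms(2,3) unfolding small_def by (blast intro: stable_UNION)
qed

lemma small_Sigma:
  assumes "universe \<kappa>" "small \<kappa> I" "\<And>i. i \<in> I \<Longrightarrow> small \<kappa> (S i)"
  shows "small \<kappa> (Sigma I S)"
proof -
  have "Sigma I S = (\<Union>i\<in>I. Pair i ` S i)" by auto
  then show ?thesis
    using small_UN[OF assms(1,2), of "\<lambda>i. Pair i ` S i"] assms(3) by (simp add: small_image)
qed

text \<open>Moves a small set of any type into \<open>'u\<close>, the type to which index sets and
  elements of modules are confined. A set smaller than \<kappa> injects into the field of \<kappa>,
  which has cardinality \<kappa>.\<close>

lemma small_embed:
  fixes \<kappa> :: "'u rel" and S :: "'a set"
  assumes "universe \<kappa>" "small \<kappa> S"
  obtains g :: "'a \<Rightarrow> 'u" where "inj_on g S"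
proof -
  have "Card_order \<kappa>" using assms(1) by (simp add: universe_def)
  then have "|Field \<kappa>| =o \<kappa>" by (rule card_of_Field_ordIso)
  then have "|S| \<le>o |Field \<kappa>|"
    using assms(2) unfolding small_def
    by (meson ordIso_symmetric ordLess_imp_ordLeq ordLeq_ordIso_trans)
  then show thesis using that unfolding card_of_ordLeq[symmetric] by blast
qed


section \<open>Categories\<close>

lemma HomI: "f \<in> Arr C \<Longrightarrow> Dom C f = a \<Longrightarrow> Cod C f = b \<Longrightarrow> f \<in> Hom C a b"
  by (simp add: Hom_def)

lemma HomD: "f \<in> Hom C a b \<Longrightarrow> f \<in> Arr C" "f \<in> Hom C a b \<Longrightarrow> Dom C f = a" "f \<in> Hom C a b \<Longrightarrow> Cod C f = b"
  by (simp_all add: Hom_def)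

lemma zero_objectD:
  assumes "zero_object C z" "a \<in> Obj C"
  shows "f \<in> Hom C a z \<Longrightarrow> f' \<in> Hom C a z \<Longrightarrow> f = f'" "g \<in> Hom C z a \<Longrightarrow> g' \<in> Hom C z a \<Longrightarrow> g = g'"
  using assms unfolding zero_object_def by metis+

context category
begin

lemma arr_cmp [simp]: "f \<in> Arr C \<Longrightarrow> g \<in> Arr C \<Longrightarrow> Cod C f = Dom C g \<Longrightarrow> g \<cdot> f \<in> Arr C"
  and dom_cmp [simp]: "f \<in> Arr C \<Longrightarrow> g \<in> Arr C \<Longrightarrow> Cod C f = Dom C g \<Longrightarrow> Dom C (g \<cdot> f) = Dom C f"
  and cod_cmp [simp]: "f \<in> Arr C \<Longrightarrow> g \<in> Arr C \<Longrightarrow> Cod C f = Dom C g \<Longrightarrow> Cod C (g \<cdot> f) = Cod C g"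
  using cmp_hom[of f "Dom C f" "Cod C f" g "Cod C g"] by (simp_all add: Hom_def)

lemma arr_ide [simp]: "a \<in> Obj C \<Longrightarrow> Ide C a \<in> Arr C"
  and dom_ide [simp]: "a \<in> Obj C \<Longrightarrow> Dom C (Ide C a) = a"
  and cod_ide [simp]: "a \<in> Obj C \<Longrightarrow> Cod C (Ide C a) = a"
  using ide_hom[of a] by (simp_all add: Hom_def)

lemma ide_right [simp]: "f \<in> Arr C \<Longrightarrow> Dom C f = a \<Longrightarrow> f \<cdot> Ide C a = f"
  and ide_left [simp]: "f \<in> Arr C \<Longrightarrow> Cod C f = b \<Longrightarrow> Ide C b \<cdot> f = f"
  using cmp_ide_right[of f a "Cod C f"] cmp_ide_left[of f "Dom C f" b] by (simp_all add: Hom_def)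

lemma cmp_assoc_arr [simp]: "f \<in> Arr C \<Longrightarrow> g \<in> Arr C \<Longrightarrow> h \<in> Arr C \<Longrightarrow> Cod C f = Dom C g \<Longrightarrow> Cod C g = Dom C h \<Longrightarrow>
    (h \<cdot> g) \<cdot> f = h \<cdot> (g \<cdot> f)"
  using cmp_assoc[of f "Dom C f" "Cod C f" g "Cod C g" h "Cod C h"] by (simp add: Hom_def)

text \<open>Composites are normalised to the right, so an equation between two composites has to be
  extended to the right before it can be used.\<close>

lemma cmp_eq_right:
  assumes "p \<cdot> k = p' \<cdot> k'" "x \<in> Hom C z a" "k \<in> Hom C a b" "p \<in> Hom C b c" "k' \<in> Hom C a b'" "p' \<in> Hom C b' c"
  shows "p \<cdot> (k \<cdot> x) = p' \<cdot> (k' \<cdot> x)"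
  by (simp only: cmp_assoc[OF assms(2,3,4)] cmp_assoc[OF assms(2,5,6)] assms(1))

lemma cmp_eq_right1:
  assumes "p \<cdot> k = q" "x \<in> Hom C z a" "k \<in> Hom C a b" "p \<in> Hom C b c"
  shows "p \<cdot> (k \<cdot> x) = q \<cdot> x"
  by (simp only: cmp_assoc[OF assms(2,3,4)] assms(1))

declare dom_obj [simp] cod_obj [simp]

lemma hom_obj: "f \<in> Hom C a b \<Longrightarrow> a \<in> Obj C" "f \<in> Hom C a b \<Longrightarrow> b \<in> Obj C"
  by (auto simp: Hom_def)

lemma monicD: "monic C m \<Longrightarrow> g \<in> Hom C a (Dom C m) \<Longrightarrow> h \<in> Hom C a (Dom C m) \<Longrightarrow> m \<cdot> g = m \<cdot> h \<Longrightarrow> g = h"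
  unfolding monic_def using hom_obj by blast

lemma epicD: "epic C e \<Longrightarrow> g \<in> Hom C (Cod C e) b \<Longrightarrow> h \<in> Hom C (Cod C e) b \<Longrightarrow> g \<cdot> e = h \<cdot> e \<Longrightarrow> g = h"
  unfolding epic_def using hom_obj by blast

lemma epic_arr: "epic C e \<Longrightarrow> e \<in> Arr C" and monic_arr: "monic C e \<Longrightarrow> e \<in> Arr C"
  by (auto simp: epic_def monic_def)

lemma epic_cmp:
  assumes "epic C f" "epic C g" "Cod C f = Dom C g"
  shows "epic C (g \<cdot> f)"
  unfolding epic_def
proof (intro conjI ballI impI)
  show "g \<cdot> f \<in> Arr C" using assms by (simp add: epic_arr)
  fix b x y
  assume *: "x \<in> Hom C (Cod C (g \<cdot> f)) b" "y \<in> Hom C (Cod C (g \<cdot> f)) b" "x \<cdot> (g \<cdot> f) = y \<cdot> (g \<cdot> f)"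
  have "(x \<cdot> g) \<cdot> f = (y \<cdot> g) \<cdot> f" using * assms by (simp add: epic_arr Hom_def)
  then have "x \<cdot> g = y \<cdot> g"
    using epicD[OF assms(1), of "x \<cdot> g" b "y \<cdot> g"] * assms by (simp add: epic_arr Hom_def)
  then show "x = y" using epicD[OF assms(2), of x b y] * assms by (simp add: epic_arr Hom_def)
qed

lemma monic_cmp:
  assumes "monic C f" "monic C g" "Cod C f = Dom C g"
  shows "monic C (g \<cdot> f)"
  unfolding monic_def
proof (intro conjI ballI impI)
  show "g \<cdot> f \<in> Arr C" using assms by (simp add: monic_arr)
  fix b x y
  assume *: "x \<in> Hom C b (Dom C (g \<cdot> f))" "y \<in> Hom C b (Dom C (g \<cdot> f))" "g \<cdot> f \<cdot> x = g \<cdot> f \<cdot> y"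
  have "g \<cdot> (f \<cdot> x) = g \<cdot> (f \<cdot> y)" using * assms by (simp add: monic_arr Hom_def)
  then have "f \<cdot> x = f \<cdot> y"
    using monicD[OF assms(2), of "f \<cdot> x" b "f \<cdot> y"] * assms by (simp add: monic_arr Hom_def)
  then show "x = y" using monicD[OF assms(1), of x b y] * assms by (simp add: monic_arr Hom_def)
qed

lemma epic_factor:
  assumes "epic C (g \<cdot> f)" "f \<in> Arr C" "g \<in> Arr C" "Cod C f = Dom C g"
  shows "epic C g"
  unfolding epic_def
proof (intro conjI ballI impI)
  fix b x y
  assume *: "x \<in> Hom C (Cod C g) b" "y \<in> Hom C (Cod C g) b" "x \<cdot> g = y \<cdot> g"
  have "x \<cdot> (g \<cdot> f) = y \<cdot> (g \<cdot> f)"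
    by (rule cmp_eq_right[OF *(3)]) (use * assms in \<open>auto simp: Hom_def\<close>)
  then show "x = y" using epicD[OF assms(1), of x b y] *(1,2) assms by simp
qed (use assms in simp)

lemma isoE:
  assumes "iso_arr C f"
  obtains g where "g \<in> Hom C (Cod C f) (Dom C f)" "g \<cdot> f = Ide C (Dom C f)" "f \<cdot> g = Ide C (Cod C f)"
  using assms unfolding iso_arr_def by blast

lemma isoI:
  assumes "f \<in> Hom C a b" "g \<in> Hom C b a" "g \<cdot> f = Ide C a" "f \<cdot> g = Ide C b"
  shows "iso_arr C f"
  unfolding iso_arr_def using assms by (auto simp: Hom_def)

lemma iso_arr: "iso_arr C f \<Longrightarrow> f \<in> Arr C"
  by (simp add: iso_arr_def)

lemma retraction_epic:
  assumes "f \<in> Hom C a b" "g \<in> Hom C b a" "f \<cdot> g = Ide C b"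
  shows "epic C f"
  unfolding epic_def
proof (intro conjI ballI impI)
  show "f \<in> Arr C" using assms by (simp add: Hom_def)
  fix c x y
  assume *: "x \<in> Hom C (Cod C f) c" "y \<in> Hom C (Cod C f) c" "x \<cdot> f = y \<cdot> f"
  then have "(x \<cdot> f) \<cdot> g = (y \<cdot> f) \<cdot> g" by simp
  then show "x = y" using HomD[OF *(1)] HomD[OF *(2)] HomD[OF assms(1)] HomD[OF assms(2)] assms(3) by simp
qed

lemma section_monic:
  assumes "f \<in> Hom C a b" "g \<in> Hom C b a" "g \<cdot> f = Ide C a"
  shows "monic C f"
  unfolding monic_def
proof (intro conjI ballI impI)
  show "f \<in> Arr C" using assms by (simp add: Hom_def)
  fix c x y
  assume *: "x \<in> Hom C c (Dom C f)" "y \<in> Hom C c (Dom C f)" "f \<cdot> x = f \<cdot> y"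
  have "x = (g \<cdot> f) \<cdot> x" using * assms(3) HomD[OF assms(1)] HomD[OF *(1)] by simp
  also have "\<dots> = g \<cdot> (f \<cdot> y)" using * HomD[OF assms(1)] HomD[OF assms(2)] HomD[OF *(1)] by simp
  also have "\<dots> = (g \<cdot> f) \<cdot> y" using * HomD[OF assms(1)] HomD[OF assms(2)] HomD[OF *(2)] by simp
  also have "\<dots> = y" using * assms(3) HomD[OF assms(1)] HomD[OF *(2)] by simp
  finally show "x = y" .
qed

lemma iso_epic: "iso_arr C f \<Longrightarrow> epic C f"
  by (metis HomI isoE iso_arr retraction_epic)

lemma iso_monic: "iso_arr C f \<Longrightarrow> monic C f"
  by (metis HomI isoE iso_arr section_monic)

lemma isomorphicI: "f \<in> Hom C a b \<Longrightarrow> g \<in> Hom C b a \<Longrightarrow> g \<cdot> f = Ide C a \<Longrightarrow> f \<cdot> g = Ide C b \<Longrightarrow> isomorphic C a b"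
  unfolding isomorphic_def using isoI by blast

lemma isomorphicE:
  assumes "isomorphic C a b"
  obtains f g where "f \<in> Hom C a b" "g \<in> Hom C b a" "g \<cdot> f = Ide C a" "f \<cdot> g = Ide C b"
  using assms unfolding isomorphic_def by (metis HomD(2,3) isoE)

lemma isomorphic_refl: "a \<in> Obj C \<Longrightarrow> isomorphic C a a"
  by (rule isomorphicI[of "Ide C a" a a "Ide C a"]) (auto simp: Hom_def)

lemma zero_object_hom_ex:
  assumes "zero_object C z" "a \<in> Obj C"
  shows "\<exists>f. f \<in> Hom C a z" "\<exists>f. f \<in> Hom C z a"
  using assms unfolding zero_object_def by blast+

subsection \<open>Coproducts\<close>

lemma coproduct_obj: "is_coproduct C I X P \<iota> \<Longrightarrow> P \<in> Obj C"
  and coproduct_inj: "is_coproduct C I X P \<iota> \<Longrightarrow> i \<in> I \<Longrightarrow> \<iota> i \<in> Hom C (X i) P"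
  by (auto simp: is_coproduct_def)

lemma coproduct_inj_ball: "is_coproduct C I X P \<iota> \<Longrightarrow> \<forall>i\<in>I. \<iota> i \<in> Hom C (X i) P"
  by (simp add: is_coproduct_def)

lemma coproduct_summand_obj: "is_coproduct C I X P \<iota> \<Longrightarrow> i \<in> I \<Longrightarrow> X i \<in> Obj C"
  by (rule hom_obj(1)[OF coproduct_inj])

lemma coproduct_ex1:
  assumes "is_coproduct C I X P \<iota>" "Y \<in> Obj C" "\<And>i. i \<in> I \<Longrightarrow> f i \<in> Hom C (X i) Y"
  shows "\<exists>!h. h \<in> Hom C P Y \<and> (\<forall>i\<in>I. h \<cdot> \<iota> i = f i)"
  by (rule assms(1)[unfolded is_coproduct_def, THEN conjunct2, THEN conjunct2, THEN bspec, OF assms(2),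
        THEN spec[of _ f], THEN mp]) (simp add: assms(3))

lemma coproduct_desc:
  assumes "is_coproduct C I X P \<iota>" "Y \<in> Obj C" "\<forall>i\<in>I. f i \<in> Hom C (X i) Y"
  obtains h where "h \<in> Hom C P Y" "\<forall>i\<in>I. h \<cdot> \<iota> i = f i"
proof -
  have "\<exists>!h. h \<in> Hom C P Y \<and> (\<forall>i\<in>I. h \<cdot> \<iota> i = f i)"
    by (rule coproduct_ex1[OF assms(1,2)]) (simp add: assms(3))
  then show thesis by (elim ex1E conjE) (rule that)
qed

lemma coproduct_eqI:
  assumes "is_coproduct C I X P \<iota>" "h \<in> Hom C P Y" "h' \<in> Hom C P Y"
    and eq: "\<And>i. i \<in> I \<Longrightarrow> h \<cdot> \<iota> i = h' \<cdot> \<iota> i"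
  shows "h = h'"
proof -
  have "\<exists>!k. k \<in> Hom C P Y \<and> (\<forall>i\<in>I. k \<cdot> \<iota> i = h' \<cdot> \<iota> i)"
    by (rule coproduct_ex1[OF assms(1) hom_obj(2)[OF assms(3)]]) (rule cmp_hom[OF coproduct_inj[OF assms(1)] assms(3)])
  then obtain k where k: "\<And>l. l \<in> Hom C P Y \<and> (\<forall>i\<in>I. l \<cdot> \<iota> i = h' \<cdot> \<iota> i) \<Longrightarrow> l = k" by (elim ex1E) blast
  have "h = k" by (rule k) (simp add: assms(2) eq)
  moreover have "h' = k" by (rule k) (simp add: assms(3))
  ultimately show ?thesis by simp
qed

lemma coproductI:
  assumes "P \<in> Obj C" "\<And>i. i \<in> I \<Longrightarrow> \<iota> i \<in> Hom C (X i) P"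
    and "\<And>Y f. Y \<in> Obj C \<Longrightarrow> (\<And>i. i \<in> I \<Longrightarrow> f i \<in> Hom C (X i) Y) \<Longrightarrow>
          \<exists>h. h \<in> Hom C P Y \<and> (\<forall>i\<in>I. h \<cdot> \<iota> i = f i)"
    and "\<And>Y h h'. h \<in> Hom C P Y \<Longrightarrow> h' \<in> Hom C P Y \<Longrightarrow> (\<And>i. i \<in> I \<Longrightarrow> h \<cdot> \<iota> i = h' \<cdot> \<iota> i) \<Longrightarrow> h = h'"
  shows "is_coproduct C I X P \<iota>"
  unfolding is_coproduct_def
proof (intro conjI ballI allI impI)
  fix Y f
  assume Y: "Y \<in> Obj C" and "\<forall>i\<in>I. f i \<in> Hom C (X i) Y"
  then obtain h where h: "h \<in> Hom C P Y" "\<forall>i\<in>I. h \<cdot> \<iota> i = f i" using assms(3)[OF Y, of f] by blast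
  show "\<exists>!h. h \<in> Hom C P Y \<and> (\<forall>i\<in>I. h \<cdot> \<iota> i = f i)"
  proof (rule ex1I[of _ h])
    fix k assume "k \<in> Hom C P Y \<and> (\<forall>i\<in>I. k \<cdot> \<iota> i = f i)"
    then show "k = h" using h by (intro assms(4)[of k Y h]) auto
  qed (use h in blast)
qed (use assms(1,2) in blast)+

text \<open>Serves to change the type of an index set: sets of pairs become subsets of
  \<open>'u\<close>, and \<open>bool\<close> becomes a set of natural numbers. A cocone over
  \<open>J\<close> is turned into one over \<open>I\<close> along the inverse bijection.\<close>

lemma coproduct_reindex:
  assumes "bij_betw g J I" "is_coproduct C I X P \<iota>"
  shows "is_coproduct C J (\<lambda>j. X (g j)) P (\<lambda>j. \<iota> (g j))"
proof (rule coproductI)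
  have I: "I = g ` J" and inj: "inj_on g J" using assms(1) by (auto simp: bij_betw_def)
  fix Y f
  assume Y: "Y \<in> Obj C" and f: "\<And>j. j \<in> J \<Longrightarrow> f j \<in> Hom C (X (g j)) Y"
  have f': "\<forall>i\<in>I. f (the_inv_into J g i) \<in> Hom C (X i) Y"
  proof
    fix i assume "i \<in> I"
    then obtain j where "j \<in> J" "i = g j" using I by blast
    then show "f (the_inv_into J g i) \<in> Hom C (X i) Y" using f[of j] by (simp add: the_inv_into_f_f[OF inj])
  qed
  obtain h where h: "h \<in> Hom C P Y" "\<forall>i\<in>I. h \<cdot> \<iota> i = f (the_inv_into J g i)"
    by (rule coproduct_desc[where f = "\<lambda>i. f (the_inv_into J g i)", OF assms(2) Y f'])
  have "h \<cdot> \<iota> (g j) = f j" if "j \<in> J" for j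
    using h(2)[rule_format, of "g j"] that by (simp add: I the_inv_into_f_f[OF inj])
  then show "\<exists>h. h \<in> Hom C P Y \<and> (\<forall>i\<in>J. h \<cdot> \<iota> (g i) = f i)"
    using h(1) by (intro exI[of _ h]) simp
next
  fix Y h h'
  assume "h \<in> Hom C P Y" "h' \<in> Hom C P Y" "\<And>i. i \<in> J \<Longrightarrow> h \<cdot> \<iota> (g i) = h' \<cdot> \<iota> (g i)"
  then show "h = h'" using assms(1) by - (rule coproduct_eqI[OF assms(2)], auto simp: bij_betw_def)
next
  show "P \<in> Obj C" using assms(2) by (rule coproduct_obj)
  show "\<iota> (g j) \<in> Hom C (X (g j)) P" if "j \<in> J" for j
    using coproduct_inj[OF assms(2), of "g j"] that assms(1) by (auto simp: bij_betw_def)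
qed

lemma coproduct_cong:
  assumes "\<And>i. i \<in> I \<Longrightarrow> X i = X' i" "\<And>i. i \<in> I \<Longrightarrow> \<iota> i = \<iota>' i"
  shows "is_coproduct C I X P \<iota> \<longleftrightarrow> is_coproduct C I X' P \<iota>'"
proof -
  have "(\<forall>i\<in>I. \<iota> i \<in> Hom C (X i) P) = (\<forall>i\<in>I. \<iota>' i \<in> Hom C (X' i) P)"
    and "\<And>f Y. (\<forall>i\<in>I. f i \<in> Hom C (X i) Y) = (\<forall>i\<in>I. f i \<in> Hom C (X' i) Y)"
    and "\<And>h f. (\<forall>i\<in>I. h \<cdot> \<iota> i = f i) = (\<forall>i\<in>I. h \<cdot> \<iota>' i = f i)"
    using assms by auto
  then show ?thesis unfolding is_coproduct_def by simp
qed

text \<open>Used to recognise a coproduct of a full subcategory as one of the ambient category, by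
  comparison with an ambient coproduct that lies in the subcategory.\<close>

lemma coproduct_iso:
  assumes "is_coproduct C I X P \<iota>" "s \<in> Hom C P Q" "t \<in> Hom C Q P" "t \<cdot> s = Ide C P" "s \<cdot> t = Ide C Q"
  shows "is_coproduct C I X Q (\<lambda>i. s \<cdot> \<iota> i)"
proof (rule coproductI)
  show "Q \<in> Obj C" using assms hom_obj by blast
  show "s \<cdot> \<iota> i \<in> Hom C (X i) Q" if "i \<in> I" for i
    using cmp_hom[OF coproduct_inj[OF assms(1) that] assms(2)] .
next
  fix Y f assume Y: "Y \<in> Obj C" and "\<And>i. i \<in> I \<Longrightarrow> f i \<in> Hom C (X i) Y"
  then have f: "\<forall>i\<in>I. f i \<in> Hom C (X i) Y" by simp
  obtain h where h: "h \<in> Hom C P Y" "\<forall>i\<in>I. h \<cdot> \<iota> i = f i"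
    by (rule coproduct_desc[OF assms(1) Y f])
  have "(h \<cdot> t) \<cdot> (s \<cdot> \<iota> i) = f i" if i: "i \<in> I" for i
  proof -
    have "(h \<cdot> t) \<cdot> (s \<cdot> \<iota> i) = h \<cdot> ((t \<cdot> s) \<cdot> \<iota> i)"
      using HomD[OF assms(2)] HomD[OF assms(3)] HomD[OF h(1)] HomD[OF coproduct_inj[OF assms(1) i]] by simp
    then show ?thesis using h i assms(4) coproduct_obj[OF assms(1)] HomD[OF coproduct_inj[OF assms(1) i]] by simp
  qed
  then show "\<exists>h. h \<in> Hom C Q Y \<and> (\<forall>i\<in>I. h \<cdot> (s \<cdot> \<iota> i) = f i)"
    using h(1) assms(3) cmp_hom by blast
next
  fix Y h h'
  assume *: "h \<in> Hom C Q Y" "h' \<in> Hom C Q Y" "\<And>i. i \<in> I \<Longrightarrow> h \<cdot> (s \<cdot> \<iota> i) = h' \<cdot> (s \<cdot> \<iota> i)"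
  have "h \<cdot> s = h' \<cdot> s"
  proof (rule coproduct_eqI[OF assms(1)])
    fix i assume i: "i \<in> I"
    show "h \<cdot> s \<cdot> \<iota> i = h' \<cdot> s \<cdot> \<iota> i"
      using *(3)[OF i] HomD[OF assms(2)] HomD[OF *(1)] HomD[OF *(2)] HomD[OF coproduct_inj[OF assms(1) i]] by simp
  qed (use * assms cmp_hom in blast)+
  then have "(h \<cdot> s) \<cdot> t = (h' \<cdot> s) \<cdot> t" by simp
  then show "h = h'" using assms * HomD[OF assms(2)] HomD[OF assms(3)] HomD[OF *(1)] HomD[OF *(2)] by simp
qed

lemma coproduct_unique:
  assumes "is_coproduct C I X P \<iota>" "is_coproduct C I X Q \<kappa>"
  obtains s t where "s \<in> Hom C P Q" "t \<in> Hom C Q P" "t \<cdot> s = Ide C P" "s \<cdot> t = Ide C Q"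
    "\<And>i. i \<in> I \<Longrightarrow> s \<cdot> \<iota> i = \<kappa> i" "\<And>i. i \<in> I \<Longrightarrow> t \<cdot> \<kappa> i = \<iota> i"
proof -
  note P = coproduct_obj[OF assms(1)] and Q = coproduct_obj[OF assms(2)]
  obtain s where s: "s \<in> Hom C P Q" "\<forall>i\<in>I. s \<cdot> \<iota> i = \<kappa> i"
    by (rule coproduct_desc[OF assms(1) Q coproduct_inj_ball[OF assms(2)]])
  obtain t where t: "t \<in> Hom C Q P" "\<forall>i\<in>I. t \<cdot> \<kappa> i = \<iota> i"
    by (rule coproduct_desc[OF assms(2) P coproduct_inj_ball[OF assms(1)]])
  note h = HomD[OF s(1)] HomD[OF t(1)]
  have "t \<cdot> s = Ide C P"
    by (rule coproduct_eqI[OF assms(1), of _ P])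
       (use h s t P in \<open>auto simp: HomD[OF coproduct_inj[OF assms(1)]] intro!: HomI\<close>)
  moreover have "s \<cdot> t = Ide C Q"
    by (rule coproduct_eqI[OF assms(2), of _ Q])
       (use h s t Q in \<open>auto simp: HomD[OF coproduct_inj[OF assms(2)]] intro!: HomI\<close>)
  ultimately show thesis using that s t by blast
qed

end


section \<open>Preadditive categories\<close>

context preadditive_category
begin

text \<open>The record of a preadditive category carries no negatives, so they are taken in the hom
  group that the domain and codomain of the arrow determine.\<close>

definition neg where
  "neg f = inv\<^bsub>hom_group C (Dom C f) (Cod C f)\<^esub> f"

lemma carrier_hom_group [simp]: "carrier (hom_group C a b) = Hom C a b"
  and mult_hom_group [simp]: "monoid.mult (hom_group C a b) = Add C"
  and one_hom_group [simp]: "one (hom_group C a b) = Zero C a b"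
  by (simp_all add: hom_group_def)

lemma group_hom_group: "a \<in> Obj C \<Longrightarrow> b \<in> Obj C \<Longrightarrow> group (hom_group C a b)"
  using hom_comm_group comm_group.axioms(2) by blast

lemma add_hom: "f \<in> Hom C a b \<Longrightarrow> g \<in> Hom C a b \<Longrightarrow> Add C f g \<in> Hom C a b"
  using monoid.m_closed[OF group.is_monoid[OF group_hom_group[of a b]], of f g] hom_obj by auto

lemma zero_hom: "a \<in> Obj C \<Longrightarrow> b \<in> Obj C \<Longrightarrow> Zero C a b \<in> Hom C a b"
  using monoid.one_closed[OF group.is_monoid[OF group_hom_group[of a b]]] by auto

lemma neg_hom: "f \<in> Hom C a b \<Longrightarrow> neg f \<in> Hom C a b"
  using group.inv_closed[OF group_hom_group[of a b], of f] hom_obj by (auto simp: neg_def HomD)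

lemma arr_add [simp]: "f \<in> Arr C \<Longrightarrow> g \<in> Arr C \<Longrightarrow> Dom C f = Dom C g \<Longrightarrow> Cod C f = Cod C g \<Longrightarrow> Add C f g \<in> Arr C"
  and dom_add [simp]: "f \<in> Arr C \<Longrightarrow> g \<in> Arr C \<Longrightarrow> Dom C f = Dom C g \<Longrightarrow> Cod C f = Cod C g \<Longrightarrow> Dom C (Add C f g) = Dom C g"
  and cod_add [simp]: "f \<in> Arr C \<Longrightarrow> g \<in> Arr C \<Longrightarrow> Dom C f = Dom C g \<Longrightarrow> Cod C f = Cod C g \<Longrightarrow> Cod C (Add C f g) = Cod C g"
  using add_hom[of f "Dom C g" "Cod C g" g] by (auto simp: Hom_def)

lemma arr_zero [simp]: "a \<in> Obj C \<Longrightarrow> b \<in> Obj C \<Longrightarrow> Zero C a b \<in> Arr C"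
  and dom_zero [simp]: "a \<in> Obj C \<Longrightarrow> b \<in> Obj C \<Longrightarrow> Dom C (Zero C a b) = a"
  and cod_zero [simp]: "a \<in> Obj C \<Longrightarrow> b \<in> Obj C \<Longrightarrow> Cod C (Zero C a b) = b"
  using zero_hom[of a b] by (auto simp: Hom_def)

lemma arr_neg [simp]: "f \<in> Arr C \<Longrightarrow> neg f \<in> Arr C"
  and dom_neg [simp]: "f \<in> Arr C \<Longrightarrow> Dom C (neg f) = Dom C f"
  and cod_neg [simp]: "f \<in> Arr C \<Longrightarrow> Cod C (neg f) = Cod C f"
  using neg_hom[of f "Dom C f" "Cod C f"] by (auto simp: Hom_def)

lemma add_zero_left [simp]: "f \<in> Hom C a b \<Longrightarrow> Add C (Zero C a b) f = f"
  using monoid.l_one[OF group.is_monoid[OF group_hom_group[of a b]], of f] hom_obj by auto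

lemma add_zero_right [simp]: "f \<in> Hom C a b \<Longrightarrow> Add C f (Zero C a b) = f"
  using monoid.r_one[OF group.is_monoid[OF group_hom_group[of a b]], of f] hom_obj by auto

lemma add_commute: "f \<in> Hom C a b \<Longrightarrow> g \<in> Hom C a b \<Longrightarrow> Add C f g = Add C g f"
  using comm_monoid.m_comm[OF comm_group.axioms(1)[OF hom_comm_group[of a b]], of f g] hom_obj by auto

lemma add_neg: "f \<in> Hom C a b \<Longrightarrow> Add C f (neg f) = Zero C a b"
  using group.r_inv[OF group_hom_group[of a b], of f] hom_obj by (auto simp: neg_def HomD)

lemma add_left_cancel: "f \<in> Hom C a b \<Longrightarrow> g \<in> Hom C a b \<Longrightarrow> h \<in> Hom C a b \<Longrightarrow> Add C f g = Add C f h \<Longrightarrow> g = h"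
  using group.right_cancel[OF group_hom_group[of a b], of f g h] hom_obj[of f a b] add_commute[of f a b g] add_commute[of f
      a b h] by auto

lemma sub_eq_zero: "f \<in> Hom C a b \<Longrightarrow> g \<in> Hom C a b \<Longrightarrow> Add C f (neg g) = Zero C a b \<longleftrightarrow> f = g"
  using add_neg[of g a b] add_left_cancel[of "neg g" a b f g] neg_hom[of g a b]
    add_commute[of f a b "neg g"] add_commute[of g a b "neg g"] by auto

lemma cmp_zero_right: "f \<in> Hom C b c \<Longrightarrow> a \<in> Obj C \<Longrightarrow> f \<cdot> Zero C a b = Zero C a c"
proof -
  assume f: "f \<in> Hom C b c" and a: "a \<in> Obj C"
  have b: "b \<in> Obj C" "c \<in> Obj C" using f hom_obj by auto
  have z: "Zero C a b \<in> Hom C a b" using a b zero_hom by auto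
  have "Add C (f \<cdot> Zero C a b) (f \<cdot> Zero C a b) = Add C (f \<cdot> Zero C a b) (Zero C a c)"
    using cmp_add_right[OF z z f] z cmp_hom[OF z f] by simp
  then show ?thesis using add_left_cancel[of "f \<cdot> Zero C a b" a c] cmp_hom[OF z f] zero_hom a b by blast
qed

lemma cmp_zero_left: "f \<in> Hom C a b \<Longrightarrow> c \<in> Obj C \<Longrightarrow> Zero C b c \<cdot> f = Zero C a c"
proof -
  assume f: "f \<in> Hom C a b" and c: "c \<in> Obj C"
  have b: "a \<in> Obj C" "b \<in> Obj C" using f hom_obj by auto
  have z: "Zero C b c \<in> Hom C b c" using c b zero_hom by auto
  have "Add C (Zero C b c \<cdot> f) (Zero C b c \<cdot> f) = Add C (Zero C b c \<cdot> f) (Zero C a c)"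
    using cmp_add_left[OF f z z] z cmp_hom[OF f z] by simp
  then show ?thesis using add_left_cancel[of "Zero C b c \<cdot> f" a c] cmp_hom[OF f z] zero_hom c b by blast
qed

lemma cmp_zero_right' [simp]: "f \<in> Arr C \<Longrightarrow> Dom C f = b \<Longrightarrow> a \<in> Obj C \<Longrightarrow> f \<cdot> Zero C a b = Zero C a (Cod C f)"
  and cmp_zero_left' [simp]: "f \<in> Arr C \<Longrightarrow> Cod C f = b \<Longrightarrow> c \<in> Obj C \<Longrightarrow> Zero C b c \<cdot> f = Zero C (Dom C f) c"
  using cmp_zero_right[of f b "Cod C f" a] cmp_zero_left[of f "Dom C f" b c] by (auto simp: Hom_def)

lemma cmp_neg_left: "f \<in> Hom C a b \<Longrightarrow> g \<in> Hom C b c \<Longrightarrow> neg g \<cdot> f = neg (g \<cdot> f)"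
proof -
  assume f: "f \<in> Hom C a b" and g: "g \<in> Hom C b c"
  have "Add C (g \<cdot> f) (neg g \<cdot> f) = Add C (g \<cdot> f) (neg (g \<cdot> f))"
    using cmp_add_left[OF f g neg_hom[OF g]] add_neg[OF g] add_neg[OF cmp_hom[OF f g]]
      cmp_zero_left[OF f] hom_obj[OF g] by simp
  then show ?thesis
    using add_left_cancel[of "g \<cdot> f" a c] cmp_hom[OF f g] cmp_hom[OF f neg_hom[OF g]] neg_hom by blast
qed

lemma cmp_neg_right: "f \<in> Hom C a b \<Longrightarrow> g \<in> Hom C b c \<Longrightarrow> g \<cdot> neg f = neg (g \<cdot> f)"
proof -
  assume f: "f \<in> Hom C a b" and g: "g \<in> Hom C b c"
  have "Add C (g \<cdot> f) (g \<cdot> neg f) = Add C (g \<cdot> f) (neg (g \<cdot> f))"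
    using cmp_add_right[OF f neg_hom[OF f] g] add_neg[OF f] add_neg[OF cmp_hom[OF f g]]
      cmp_zero_right[OF g] hom_obj[OF f] by simp
  then show ?thesis
    using add_left_cancel[of "g \<cdot> f" a c] cmp_hom[OF f g] cmp_hom[OF neg_hom[OF f] g] neg_hom by blast
qed

lemma monicI_zero:
  assumes "f \<in> Hom C b c" "\<And>a g. g \<in> Hom C a b \<Longrightarrow> f \<cdot> g = Zero C a c \<Longrightarrow> g = Zero C a b"
  shows "monic C f"
  unfolding monic_def
proof (intro conjI ballI impI)
  show "f \<in> Arr C" using assms(1) by (rule HomD)
  fix a g h assume "a \<in> Obj C" and *: "g \<in> Hom C a (Dom C f)" "h \<in> Hom C a (Dom C f)" "f \<cdot> g = f \<cdot> h"
  then have g: "g \<in> Hom C a b" and h: "h \<in> Hom C a b" by (simp_all add: HomD[OF assms(1)])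
  have "f \<cdot> Add C g (neg h) = Zero C a c"
    using cmp_add_right[OF g neg_hom[OF h] assms(1)] cmp_neg_right[OF h assms(1)] *(3)
      add_neg[OF cmp_hom[OF h assms(1)]] by simp
  then show "g = h" using assms(2)[OF add_hom[OF g neg_hom[OF h]]] sub_eq_zero[OF g h] by simp
qed

lemma epicI_zero:
  assumes "f \<in> Hom C a b" "\<And>c g. g \<in> Hom C b c \<Longrightarrow> g \<cdot> f = Zero C a c \<Longrightarrow> g = Zero C b c"
  shows "epic C f"
  unfolding epic_def
proof (intro conjI ballI impI)
  show "f \<in> Arr C" using assms(1) by (rule HomD)
  fix c g h assume "c \<in> Obj C" and *: "g \<in> Hom C (Cod C f) c" "h \<in> Hom C (Cod C f) c" "g \<cdot> f = h \<cdot> f"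
  then have g: "g \<in> Hom C b c" and h: "h \<in> Hom C b c" by (simp_all add: HomD[OF assms(1)])
  have "Add C g (neg h) \<cdot> f = Zero C a c"
    using cmp_add_left[OF assms(1) g neg_hom[OF h]] cmp_neg_left[OF assms(1) h] *(3)
      add_neg[OF cmp_hom[OF assms(1) h]] by simp
  then show "g = h" using assms(2)[OF add_hom[OF g neg_hom[OF h]]] sub_eq_zero[OF g h] by simp
qed

lemma epic_zero: "epic C f \<Longrightarrow> f \<in> Hom C a b \<Longrightarrow> g \<in> Hom C b c \<Longrightarrow> g \<cdot> f = Zero C a c \<Longrightarrow> g = Zero C b c"
  using epicD[of f g c "Zero C b c"] cmp_zero_left[of f a b c] zero_hom[of b c] hom_obj[of g b c] by (simp add: HomD)

lemma monic_zero: "monic C f \<Longrightarrow> f \<in> Hom C b c \<Longrightarrow> g \<in> Hom C a b \<Longrightarrow> f \<cdot> g = Zero C a c \<Longrightarrow> g = Zero C a b"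
  using monicD[of f g a "Zero C a b"] cmp_zero_right[of f b c a] zero_hom[of a b] hom_obj[of g a b] by (simp add: HomD)

subsection \<open>Finite sums of arrows\<close>

lemma comm_monoid_hom_group: "a \<in> Obj C \<Longrightarrow> b \<in> Obj C \<Longrightarrow> comm_monoid (hom_group C a b)"
  using hom_comm_group comm_group.axioms(1) by blast

lemma finprod_hom:
  assumes "a \<in> Obj C" "b \<in> Obj C" "\<And>i. i \<in> F \<Longrightarrow> g i \<in> Hom C a b"
  shows "finprod (hom_group C a b) g F \<in> Hom C a b"
  using comm_monoid.finprod_closed[OF comm_monoid_hom_group[OF assms(1,2)], of g F] assms(3) by auto

lemma cmp_finprod_right:
  assumes "a \<in> Obj C" "h \<in> Hom C b c" "finite F" "\<And>i. i \<in> F \<Longrightarrow> g i \<in> Hom C a b"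
  shows "h \<cdot> finprod (hom_group C a b) g F = finprod (hom_group C a c) (\<lambda>i. h \<cdot> g i) F"
proof -
  have o: "b \<in> Obj C" "c \<in> Obj C" using assms(2) hom_obj by auto
  interpret ab: comm_monoid "hom_group C a b" using assms(1) o comm_monoid_hom_group by simp
  interpret ac: comm_monoid "hom_group C a c" using assms(1) o comm_monoid_hom_group by simp
  show ?thesis using assms(3,4)
  proof (induction F)
    case empty
    then show ?case using assms(1,2) cmp_zero_right by simp
  next
    case (insert i F)
    have "h \<cdot> g j \<in> Hom C a c" if "j \<in> insert i F" for j using insert.prems[OF that] assms(2) cmp_hom by blast
    then have "(\<lambda>j. h \<cdot> g j) \<in> F \<rightarrow> Hom C a c" "h \<cdot> g i \<in> Hom C a c" by auto
    moreover have gi: "g \<in> F \<rightarrow> Hom C a b" "g i \<in> Hom C a b" using insert.prems by auto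
    moreover have fin: "finprod (hom_group C a b) g F \<in> Hom C a b" by (rule finprod_hom) (use assms(1) o insert.prems in auto)
    ultimately show ?case using insert cmp_add_right[OF gi(2) fin assms(2)] by simp
  qed
qed

lemma cmp_finprod_left:
  assumes "c \<in> Obj C" "h \<in> Hom C a b" "finite F" "\<And>i. i \<in> F \<Longrightarrow> g i \<in> Hom C b c"
  shows "finprod (hom_group C b c) g F \<cdot> h = finprod (hom_group C a c) (\<lambda>i. g i \<cdot> h) F"
proof -
  have o: "a \<in> Obj C" "b \<in> Obj C" using assms(2) hom_obj by auto
  interpret bc: comm_monoid "hom_group C b c" using assms(1) o comm_monoid_hom_group by simp
  interpret ac: comm_monoid "hom_group C a c" using assms(1) o comm_monoid_hom_group by simp
  show ?thesis using assms(3,4)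
  proof (induction F)
    case empty
    then show ?case using assms(1,2) cmp_zero_left by simp
  next
    case (insert i F)
    have "g j \<cdot> h \<in> Hom C a c" if "j \<in> insert i F" for j using insert.prems[OF that] assms(2) cmp_hom by blast
    then have "(\<lambda>j. g j \<cdot> h) \<in> F \<rightarrow> Hom C a c" "g i \<cdot> h \<in> Hom C a c" by auto
    moreover have gi: "g \<in> F \<rightarrow> Hom C b c" "g i \<in> Hom C b c" using insert.prems by auto
    moreover have fin: "finprod (hom_group C b c) g F \<in> Hom C b c" by (rule finprod_hom) (use assms(1) o insert.prems in auto)
    ultimately show ?case using insert cmp_add_left[OF assms(2) gi(2) fin] by simp
  qed
qed

text \<open>Zero arrows supply the missing components: \<open>\<pi> i\<close> is the arrow out of
  \<open>P\<close> that is the identity on the summand \<open>i\<close> and zero on the others. This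
  works for infinite families as well, where the identity of \<open>P\<close> is in general no
  finite sum of arrows \<open>\<iota> i \<cdot> \<pi> i\<close>.\<close>

lemma coproduct_projections:
  assumes "is_coproduct C I X P \<iota>"
  obtains \<pi> where "\<forall>i\<in>I. \<pi> i \<in> Hom C P (X i)"
    "\<forall>i\<in>I. \<forall>j\<in>I. \<pi> i \<cdot> \<iota> j = (if i = j then Ide C (X i) else Zero C (X j) (X i))"
proof -
  have o: "X j \<in> Obj C" if "j \<in> I" for j using coproduct_summand_obj[OF assms that] .
  have "\<forall>i\<in>I. \<exists>h. h \<in> Hom C P (X i) \<and> (\<forall>j\<in>I. h \<cdot> \<iota> j = (if i = j then Ide C (X i) else Zero C (X j) (X i)))"
  proof
    fix i assume i: "i \<in> I"
    let ?f = "\<lambda>j. if i = j then Ide C (X i) else Zero C (X j) (X i)"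
    have "\<forall>j\<in>I. ?f j \<in> Hom C (X j) (X i)" using o i by (simp add: ide_hom zero_hom)
    then obtain h where "h \<in> Hom C P (X i)" "\<forall>j\<in>I. h \<cdot> \<iota> j = ?f j"
      by (rule coproduct_desc[OF assms o[OF i]])
    then show "\<exists>h. h \<in> Hom C P (X i) \<and> (\<forall>j\<in>I. h \<cdot> \<iota> j = ?f j)" by blast
  qed
  then obtain \<pi> where "\<forall>i\<in>I. \<pi> i \<in> Hom C P (X i) \<and>
      (\<forall>j\<in>I. \<pi> i \<cdot> \<iota> j = (if i = j then Ide C (X i) else Zero C (X j) (X i)))"
    by (rule bchoice[THEN exE])
  then show thesis by (intro that[of \<pi>]) blast+
qed

lemma zero_object_Zero:
  assumes "zero_object C z" "a \<in> Obj C"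
  shows "f \<in> Hom C a z \<Longrightarrow> f = Zero C a z" "f \<in> Hom C z a \<Longrightarrow> f = Zero C z a"
  using zero_objectD[OF assms] zero_hom assms unfolding zero_object_def by blast+

lemma zero_objectI:
  assumes "z \<in> Obj C" "Ide C z = Zero C z z"
  shows "zero_object C z"
  unfolding zero_object_def
proof (intro conjI ballI)
  fix a assume a: "a \<in> Obj C"
  have "f = Zero C a z" if "f \<in> Hom C a z" for f
    using cmp_ide_left[OF that] cmp_zero_left[OF that assms(1)] assms(2) by simp
  moreover have "f = Zero C z a" if "f \<in> Hom C z a" for f
    using cmp_ide_right[OF that] cmp_zero_right[OF that assms(1)] assms(2) by simp
  ultimately show "\<exists>!f. f \<in> Hom C a z" "\<exists>!f. f \<in> Hom C z a" using zero_hom a assms(1) by blast+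
qed (use assms in simp)

end


section \<open>Kernels and cokernels\<close>

context preadditive_category
begin

lemma kernelI:
  assumes "f \<in> Hom C a b" "k \<in> Hom C K a" "f \<cdot> k = Zero C K b" "monic C k"
    and "\<And>x g. g \<in> Hom C x a \<Longrightarrow> f \<cdot> g = Zero C x b \<Longrightarrow> \<exists>h\<in>Hom C x K. k \<cdot> h = g"
  shows "is_kernel C f k"
  unfolding is_kernel_def HomD[OF assms(1)] HomD[OF assms(2)]
proof (intro conjI ballI impI)
  fix x g assume "x \<in> Obj C" and g: "g \<in> Hom C x a" "f \<cdot> g = Zero C x b"
  obtain h where "h \<in> Hom C x K" "k \<cdot> h = g" using assms(5)[OF g] by blast
  then show "\<exists>!h. h \<in> Hom C x K \<and> k \<cdot> h = g"
    using monicD[OF assms(4)] by (intro ex1I[of _ h]) (auto simp: HomD[OF assms(2)])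
qed (use assms(1-3) in \<open>auto simp: HomD\<close>)

lemma cokernelI:
  assumes "f \<in> Hom C a b" "c \<in> Hom C b Q" "c \<cdot> f = Zero C a Q" "epic C c"
    and "\<And>x g. g \<in> Hom C b x \<Longrightarrow> g \<cdot> f = Zero C a x \<Longrightarrow> \<exists>h\<in>Hom C Q x. h \<cdot> c = g"
  shows "is_cokernel C f c"
  unfolding is_cokernel_def HomD[OF assms(1)] HomD[OF assms(2)]
proof (intro conjI ballI impI)
  fix x g assume "x \<in> Obj C" and g: "g \<in> Hom C b x" "g \<cdot> f = Zero C a x"
  obtain h where "h \<in> Hom C Q x" "h \<cdot> c = g" using assms(5)[OF g] by blast
  then show "\<exists>!h. h \<in> Hom C Q x \<and> h \<cdot> c = g"
    using epicD[OF assms(4)] by (intro ex1I[of _ h]) (auto simp: HomD[OF assms(2)])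
qed (use assms(1-3) in \<open>auto simp: HomD\<close>)

lemma kernelD:
  assumes "is_kernel C f k" "f \<in> Hom C a b"
  shows "k \<in> Hom C (Dom C k) a" "f \<cdot> k = Zero C (Dom C k) b" "monic C k"
    and "g \<in> Hom C x a \<Longrightarrow> f \<cdot> g = Zero C x b \<Longrightarrow> \<exists>h\<in>Hom C x (Dom C k). k \<cdot> h = g"
proof -
  have u: "x \<in> Obj C \<Longrightarrow> g \<in> Hom C x a \<Longrightarrow> f \<cdot> g = Zero C x b \<Longrightarrow> \<exists>!h. h \<in> Hom C x (Dom C k) \<and> k \<cdot> h = g" for x g
    using assms by (simp add: is_kernel_def HomD[OF assms(2)])
  show k: "k \<in> Hom C (Dom C k) a" and z: "f \<cdot> k = Zero C (Dom C k) b"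
    using assms by (simp_all add: is_kernel_def HomD[OF assms(2)])
  show "\<exists>h\<in>Hom C x (Dom C k). k \<cdot> h = g" if "g \<in> Hom C x a" "f \<cdot> g = Zero C x b"
    using u[OF hom_obj(1)[OF that(1)] that] by blast
  show "monic C k"
    unfolding monic_def
  proof (intro conjI ballI impI)
    fix x g h assume x: "x \<in> Obj C" and gh: "g \<in> Hom C x (Dom C k)" "h \<in> Hom C x (Dom C k)" "k \<cdot> g = k \<cdot> h"
    have "f \<cdot> (k \<cdot> h) = Zero C (Dom C k) b \<cdot> h" by (rule cmp_eq_right1[OF z gh(2) k assms(2)])
    then have "f \<cdot> (k \<cdot> h) = Zero C x b"
      using gh(2) cmp_zero_left hom_obj(2)[OF assms(2)] by simp
    from u[OF x cmp_hom[OF gh(2) k] this] gh show "g = h" by (elim ex1E) (metis (no_types))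
  qed (use HomD(1)[OF k] in simp)
qed

lemma cokernelD:
  assumes "is_cokernel C f c" "f \<in> Hom C a b"
  shows "c \<in> Hom C b (Cod C c)" "c \<cdot> f = Zero C a (Cod C c)" "epic C c"
    and "g \<in> Hom C b x \<Longrightarrow> g \<cdot> f = Zero C a x \<Longrightarrow> \<exists>h\<in>Hom C (Cod C c) x. h \<cdot> c = g"
proof -
  have u: "x \<in> Obj C \<Longrightarrow> g \<in> Hom C b x \<Longrightarrow> g \<cdot> f = Zero C a x \<Longrightarrow> \<exists>!h. h \<in> Hom C (Cod C c) x \<and> h \<cdot> c = g" for x g
    using assms by (simp add: is_cokernel_def HomD[OF assms(2)])
  show c: "c \<in> Hom C b (Cod C c)" and z: "c \<cdot> f = Zero C a (Cod C c)"
    using assms by (simp_all add: is_cokernel_def HomD[OF assms(2)])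
  show "\<exists>h\<in>Hom C (Cod C c) x. h \<cdot> c = g" if "g \<in> Hom C b x" "g \<cdot> f = Zero C a x"
    using u[OF hom_obj(2)[OF that(1)] that] by blast
  show "epic C c"
    unfolding epic_def
  proof (intro conjI ballI impI)
    fix x g h assume x: "x \<in> Obj C" and gh: "g \<in> Hom C (Cod C c) x" "h \<in> Hom C (Cod C c) x" "g \<cdot> c = h \<cdot> c"
    have "(h \<cdot> c) \<cdot> f = h \<cdot> (c \<cdot> f)" by (rule cmp_assoc[symmetric, OF assms(2) c gh(2)])
    then have "(h \<cdot> c) \<cdot> f = Zero C a x"
      using z gh(2) cmp_zero_right hom_obj(1)[OF assms(2)] by simp
    from u[OF x cmp_hom[OF c gh(2)] this] gh show "g = h" by (elim ex1E) (metis (no_types))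
  qed (use HomD(1)[OF c] in simp)
qed

lemma kernel_iso:
  assumes "is_kernel C f k" "is_kernel C f k'" "f \<in> Hom C a b"
  shows "isomorphic C (Dom C k) (Dom C k')"
proof -
  note K = kernelD[OF assms(1,3)] and K' = kernelD[OF assms(2,3)]
  obtain h where h: "h \<in> Hom C (Dom C k) (Dom C k')" "k' \<cdot> h = k" using K'(4)[OF K(1,2)] by blast
  obtain h' where h': "h' \<in> Hom C (Dom C k') (Dom C k)" "k \<cdot> h' = k'" using K(4)[OF K'(1,2)] by blast
  have "k' \<cdot> (h \<cdot> h') = k \<cdot> h'" by (rule cmp_eq_right1[OF h(2) h'(1) h(1) K'(1)])
  then have "h \<cdot> h' = Ide C (Dom C k')"
    using h'(2) cmp_ide_right[OF K'(1)]
    by (intro monicD[OF K'(3) cmp_hom[OF h'(1) h(1)] ide_hom[OF hom_obj(1)[OF K'(1)]]]) simp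
  moreover have "k \<cdot> (h' \<cdot> h) = k' \<cdot> h" by (rule cmp_eq_right1[OF h'(2) h(1) h'(1) K(1)])
  then have "h' \<cdot> h = Ide C (Dom C k)"
    using h(2) cmp_ide_right[OF K(1)]
    by (intro monicD[OF K(3) cmp_hom[OF h(1) h'(1)] ide_hom[OF hom_obj(1)[OF K(1)]]]) simp
  ultimately show ?thesis using h(1) h'(1) by (intro isomorphicI)
qed

text \<open>\<open>Pres\<close> is defined up to isomorphism. Moving the cokernel along the
  isomorphism lets \<open>PresE\<close> deliver a presentation that ends at the given object
  itself.\<close>

lemma cokernel_of_iso:
  assumes "is_cokernel C f c" "f \<in> Hom C a b" "s \<in> Hom C (Cod C c) Q" "t \<in> Hom C Q (Cod C c)"
    "t \<cdot> s = Ide C (Cod C c)" "s \<cdot> t = Ide C Q"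
  shows "is_cokernel C f (s \<cdot> c)"
proof -
  note K = cokernelD[OF assms(1,2)]
  show ?thesis
  proof (rule cokernelI[OF assms(2) cmp_hom[OF K(1) assms(3)]])
    show "s \<cdot> c \<cdot> f = Zero C a Q"
      using K(2) cmp_assoc[OF assms(2) K(1) assms(3)] cmp_zero_right[OF assms(3) hom_obj(1)[OF assms(2)]] by simp
    show "epic C (s \<cdot> c)"
      using epic_cmp[OF K(3), of s] retraction_epic[OF assms(3,4,6)] by (simp add: HomD[OF assms(3)])
    fix x g assume g: "g \<in> Hom C b x" "g \<cdot> f = Zero C a x"
    obtain h where h: "h \<in> Hom C (Cod C c) x" "h \<cdot> c = g" using K(4)[OF g] by blast
    have "(h \<cdot> t) \<cdot> (s \<cdot> c) = h \<cdot> (t \<cdot> (s \<cdot> c))"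
      by (rule cmp_assoc[symmetric, OF cmp_hom[OF K(1) assms(3)] assms(4) h(1)])
    also have "t \<cdot> (s \<cdot> c) = Ide C (Cod C c) \<cdot> c" by (rule cmp_eq_right1[OF assms(5) K(1) assms(3,4)])
    finally show "\<exists>h\<in>Hom C Q x. h \<cdot> (s \<cdot> c) = g"
      using h cmp_ide_left[OF K(1)] cmp_hom[OF assms(4) h(1)] by auto
  qed
qed

lemma kernel_monic_cmp:
  assumes "is_kernel C f k" "f \<in> Hom C a b" "monic C m" "m \<in> Hom C b c"
  shows "is_kernel C (m \<cdot> f) k"
proof -
  note K = kernelD[OF assms(1,2)]
  show ?thesis
  proof (rule kernelI[OF cmp_hom[OF assms(2,4)] K(1) _ K(3)])
    show "m \<cdot> f \<cdot> k = Zero C (Dom C k) c"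
      using K(2) cmp_assoc[OF K(1) assms(2,4)] cmp_zero_right[OF assms(4) hom_obj(1)[OF K(1)]] by simp
    fix x g assume g: "g \<in> Hom C x a" "m \<cdot> f \<cdot> g = Zero C x c"
    have "m \<cdot> (f \<cdot> g) = Zero C x c" using g(2) cmp_assoc[OF g(1) assms(2,4)] by simp
    then have "f \<cdot> g = Zero C x b" by (rule monic_zero[OF assms(3,4) cmp_hom[OF g(1) assms(2)]])
    then show "\<exists>h\<in>Hom C x (Dom C k). k \<cdot> h = g" using K(4) g(1) by blast
  qed
qed

lemma kernel_monic_cmp_iff:
  assumes "is_kernel C (m \<cdot> f) k" "f \<in> Hom C a b" "monic C m" "m \<in> Hom C b c"
  shows "is_kernel C f k"
proof -
  note K = kernelD[OF assms(1) cmp_hom[OF assms(2,4)]]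
  show ?thesis
  proof (rule kernelI[OF assms(2) K(1) _ K(3)])
    have "m \<cdot> (f \<cdot> k) = Zero C (Dom C k) c" using K(2) cmp_assoc[OF K(1) assms(2,4)] by simp
    then show "f \<cdot> k = Zero C (Dom C k) b" by (rule monic_zero[OF assms(3,4) cmp_hom[OF K(1) assms(2)]])
    fix x g assume g: "g \<in> Hom C x a" "f \<cdot> g = Zero C x b"
    have "m \<cdot> f \<cdot> g = Zero C x c"
      using g(2) cmp_assoc[OF g(1) assms(2,4)] cmp_zero_right[OF assms(4) hom_obj(1)[OF g(1)]] by simp
    then show "\<exists>h\<in>Hom C x (Dom C k). k \<cdot> h = g" using K(4) g(1) by blast
  qed
qed

lemma cokernel_epic_cmp:
  assumes "is_cokernel C f c" "f \<in> Hom C a b" "epic C e" "e \<in> Hom C z a"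
  shows "is_cokernel C (f \<cdot> e) c"
proof -
  note K = cokernelD[OF assms(1,2)]
  show ?thesis
  proof (rule cokernelI[OF cmp_hom[OF assms(4,2)] K(1) _ K(3)])
    show "c \<cdot> (f \<cdot> e) = Zero C z (Cod C c)"
      using cmp_eq_right1[OF K(2) assms(4,2) K(1)] cmp_zero_left[OF assms(4) hom_obj(2)[OF K(1)]] by simp
    fix x g assume g: "g \<in> Hom C b x" "g \<cdot> (f \<cdot> e) = Zero C z x"
    have "(g \<cdot> f) \<cdot> e = Zero C z x" using g(2) cmp_assoc[OF assms(4,2) g(1)] by simp
    then have "g \<cdot> f = Zero C a x" by (rule epic_zero[OF assms(3,4) cmp_hom[OF assms(2) g(1)]])
    then show "\<exists>h\<in>Hom C (Cod C c) x. h \<cdot> c = g" using K(4) g(1) by blast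
  qed
qed

end


section \<open>Abelian categories\<close>

context abelian_category
begin

lemma kernel_ex:
  assumes "f \<in> Hom C a b"
  obtains k K where "is_kernel C f k" "k \<in> Hom C K a"
  using has_kernels[OF HomD(1)[OF assms]] kernelD(1)[OF _ assms] by blast

lemma cokernel_ex:
  assumes "f \<in> Hom C a b"
  obtains c Q where "is_cokernel C f c" "c \<in> Hom C b Q"
  using has_cokernels[OF HomD(1)[OF assms]] cokernelD(1)[OF _ assms] by blast

text \<open>By normality \<open>e\<close> is the cokernel of some \<open>f\<close>, and
  \<open>f\<close> factors through the kernel \<open>k\<close>. So an arrow that kills
  \<open>k\<close> also kills \<open>f\<close> and therefore factors through
  \<open>e\<close>.\<close>

lemma epic_cokernel_of_kernel:
  assumes "epic C e" "is_kernel C e k" "e \<in> Hom C a b"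
  shows "is_cokernel C k e"
proof -
  obtain f where f: "is_cokernel C f e" using epic_normal[OF assms(1)] by blast
  have fh: "f \<in> Hom C (Dom C f) a"
    using f HomD[OF assms(3)] unfolding is_cokernel_def by (simp add: Hom_def)
  note E = cokernelD[OF f fh, unfolded HomD(3)[OF assms(3)]] and K = kernelD[OF assms(2,3)]
  obtain l where l: "l \<in> Hom C (Dom C f) (Dom C k)" "k \<cdot> l = f" using K(4)[OF fh E(2)] by blast
  show ?thesis
  proof (rule cokernelI[OF K(1) assms(3) K(2) assms(1)])
    fix x g assume g: "g \<in> Hom C a x" "g \<cdot> k = Zero C (Dom C k) x"
    have "g \<cdot> (k \<cdot> l) = Zero C (Dom C k) x \<cdot> l" by (rule cmp_eq_right1[OF g(2) l(1) K(1) g(1)])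
    then have "g \<cdot> f = Zero C (Dom C f) x" using l cmp_zero_left[OF l(1) hom_obj(2)[OF g(1)]] by simp
    then show "\<exists>h\<in>Hom C b x. h \<cdot> e = g" using E(4)[OF g(1)] by blast
  qed
qed

lemma monic_kernel_of_cokernel:
  assumes "monic C m" "is_cokernel C m c" "m \<in> Hom C a b"
  shows "is_kernel C c m"
proof -
  obtain f where f: "is_kernel C f m" using monic_normal[OF assms(1)] by blast
  have fh: "f \<in> Hom C b (Cod C f)"
    using f HomD[OF assms(3)] unfolding is_kernel_def by (simp add: Hom_def)
  note E = kernelD[OF f fh, unfolded HomD(2)[OF assms(3)]] and K = cokernelD[OF assms(2,3)]
  obtain l where l: "l \<in> Hom C (Cod C c) (Cod C f)" "l \<cdot> c = f" using K(4)[OF fh E(2)] by blast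
  show ?thesis
  proof (rule kernelI[OF K(1) assms(3) K(2) assms(1)])
    fix x g assume g: "g \<in> Hom C x b" "c \<cdot> g = Zero C x (Cod C c)"
    have "(l \<cdot> c) \<cdot> g = l \<cdot> (c \<cdot> g)" by (rule cmp_assoc[symmetric, OF g(1) K(1) l(1)])
    then have "f \<cdot> g = Zero C x (Cod C f)" using l g cmp_zero_right[OF l(1) hom_obj(1)[OF g(1)]] by simp
    then show "\<exists>h\<in>Hom C x a. m \<cdot> h = g" using E(4)[OF g(1)] by blast
  qed
qed

text \<open>As a monomorphism, \<open>f\<close> is the kernel of its cokernel \<open>c\<close>; as
  an epimorphism, it forces \<open>c\<close> to be zero. So the identity of \<open>b\<close> is
  killed by \<open>c\<close> and factors through \<open>f\<close>.\<close>

lemma monic_epic_iso: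
  assumes "monic C f" "epic C f" "f \<in> Hom C a b"
  obtains g where "g \<in> Hom C b a" "g \<cdot> f = Ide C a" "f \<cdot> g = Ide C b"
proof -
  obtain c Q where c: "is_cokernel C f c" "c \<in> Hom C b Q" using cokernel_ex[OF assms(3)] .
  note K = cokernelD[OF c(1) assms(3), unfolded HomD(3)[OF c(2)]]
  have k: "is_kernel C c f" by (rule monic_kernel_of_cokernel[OF assms(1) c(1) assms(3)])
  have b: "b \<in> Obj C" "a \<in> Obj C" using hom_obj[OF assms(3)] by auto
  have "c = Zero C b Q" by (rule epic_zero[OF assms(2,3) c(2) K(2)])
  then have "c \<cdot> Ide C b = Zero C b Q" using cmp_ide_right[OF c(2)] by simp
  then obtain g where g: "g \<in> Hom C b a" "f \<cdot> g = Ide C b"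
    using kernelD(4)[OF k c(2) ide_hom[OF b(1)]] HomD(2)[OF assms(3)] by auto
  have "f \<cdot> (g \<cdot> f) = Ide C b \<cdot> f" by (rule cmp_eq_right1[OF g(2) assms(3) g(1) assms(3)])
  then have "f \<cdot> (g \<cdot> f) = f \<cdot> Ide C a" using cmp_ide_left[OF assms(3)] cmp_ide_right[OF assms(3)] by simp
  then have "g \<cdot> f = Ide C a"
    using monicD[OF assms(1), of "g \<cdot> f" a "Ide C a"] cmp_hom[OF assms(3) g(1)] ide_hom[OF b(2)] HomD(2)[OF assms(3)] by simp
  then show thesis using g that by blast
qed

text \<open>The factor \<open>e\<close> exists because \<open>c\<close> kills \<open>f\<close>; the
  content is that it is epic. If \<open>h\<close> kills \<open>e\<close>, then \<open>e\<close>
  factors through the kernel of \<open>h\<close>, so \<open>f\<close> factors through a smaller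
  subobject of \<open>b\<close>. But \<open>m\<close>, the kernel of the cokernel, is the smallest
  normal subobject through which \<open>f\<close> factors.\<close>

lemma image_factorization:
  assumes "f \<in> Hom C a b" "is_cokernel C f c" "is_kernel C c m"
  obtains e where "e \<in> Hom C a (Dom C m)" "epic C e" "m \<cdot> e = f"
proof -
  note K = cokernelD[OF assms(2,1)]
  note M = kernelD[OF assms(3) K(1)]
  obtain e where e: "e \<in> Hom C a (Dom C m)" "m \<cdot> e = f" using M(4)[OF assms(1) K(2)] by blast
  have "epic C e"
  proof (rule epicI_zero[OF e(1)])
    fix z h assume h: "h \<in> Hom C (Dom C m) z" "h \<cdot> e = Zero C a z"
    obtain k Kk where k: "is_kernel C h k" "k \<in> Hom C Kk (Dom C m)" using kernel_ex[OF h(1)] .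
    note H = kernelD[OF k(1) h(1), unfolded HomD(2)[OF k(2)]]
    obtain e' where e': "e' \<in> Hom C a Kk" "k \<cdot> e' = e" using H(4)[OF e(1) h(2)] by blast
    \<comment> \<open>This is the smaller subobject. It is monic, hence the kernel of its cokernel
      \<open>r\<close>; since \<open>r\<close> kills \<open>f\<close>, it factors through
      \<open>c\<close> and kills \<open>m\<close>. So \<open>m\<close> factors through
      \<open>n\<close>, which gives \<open>k\<close> a right inverse.\<close>
    define n where "n = m \<cdot> k"
    have n: "n \<in> Hom C Kk b" unfolding n_def by (rule cmp_hom[OF k(2) M(1)])
    have nm: "monic C n" unfolding n_def by (rule monic_cmp[OF H(3) M(3)]) (simp add: HomD[OF k(2)])
    have ne: "n \<cdot> e' = f"
      unfolding n_def using cmp_assoc[OF e'(1) k(2) M(1)] e'(2) e(2) by simp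
    obtain r R where r: "is_cokernel C n r" "r \<in> Hom C b R" using cokernel_ex[OF n] .
    note RR = cokernelD[OF r(1) n, unfolded HomD(3)[OF r(2)]]
    have "r \<cdot> (n \<cdot> e') = Zero C Kk R \<cdot> e'" by (rule cmp_eq_right1[OF RR(2) e'(1) n r(2)])
    then have "r \<cdot> f = Zero C a R" using ne cmp_zero_left[OF e'(1) hom_obj(2)[OF r(2)]] by simp
    then obtain r' where r': "r' \<in> Hom C (Cod C c) R" "r' \<cdot> c = r" using K(4)[OF r(2)] by blast
    have "r \<cdot> m = Zero C (Dom C m) R"
      using cmp_assoc[OF M(1) K(1) r'(1)] r'(2) M(2) cmp_zero_right[OF r'(1) hom_obj(1)[OF M(1)]] by simp
    then obtain s where s: "s \<in> Hom C (Dom C m) Kk" "n \<cdot> s = m"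
      using kernelD(4)[OF monic_kernel_of_cokernel[OF nm r(1) n] r(2) M(1)] HomD(2)[OF n] by auto
    have "m \<cdot> (k \<cdot> s) = m \<cdot> Ide C (Dom C m)"
      using s cmp_assoc[OF s(1) k(2) M(1)] cmp_ide_right[OF M(1)] by (simp add: n_def)
    then have ks: "k \<cdot> s = Ide C (Dom C m)"
      by (rule monicD[OF M(3) cmp_hom[OF s(1) k(2)] ide_hom[OF hom_obj(1)[OF M(1)]]])
    have "h \<cdot> (k \<cdot> s) = Zero C Kk z \<cdot> s" by (rule cmp_eq_right1[OF H(2) s(1) k(2) h(1)])
    then show "h = Zero C (Dom C m) z"
      using ks cmp_ide_right[OF h(1)] cmp_zero_left[OF s(1) hom_obj(2)[OF h(1)]] by simp
  qed
  then show thesis using e that by blast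
qed

text \<open>The projections are those of any coproduct in a preadditive category. The decomposition
  of the identity is tested on the two injections, which determine arrows out of
  \<open>P\<close>.\<close>

lemma biproduct:
  assumes "a \<in> Obj C" "b \<in> Obj C"
  obtains P i1 i2 p1 p2 where
    "is_coproduct C (UNIV :: bool set) (\<lambda>i. if i then a else b) P (\<lambda>i. if i then i1 else i2)"
    "i1 \<in> Hom C a P" "i2 \<in> Hom C b P" "p1 \<in> Hom C P a" "p2 \<in> Hom C P b"
    "p1 \<cdot> i1 = Ide C a" "p2 \<cdot> i2 = Ide C b" "p1 \<cdot> i2 = Zero C b a" "p2 \<cdot> i1 = Zero C a b"
    "Add C (i1 \<cdot> p1) (i2 \<cdot> p2) = Ide C P"
proof -
  obtain P \<iota> where P: "is_coproduct C (UNIV :: bool set) (\<lambda>i. if i then a else b) P \<iota>"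
    using has_binary_coproducts[OF assms] by blast
  obtain \<pi> where p: "\<forall>i\<in>UNIV. \<pi> i \<in> Hom C P (if i then a else b)"
    "\<forall>i\<in>UNIV. \<forall>j\<in>UNIV. \<pi> i \<cdot> \<iota> j = (if i = j then Ide C (if i then a else b)
        else Zero C (if j then a else b) (if i then a else b))"
    by (rule coproduct_projections[OF P])
  have i1: "\<iota> True \<in> Hom C a P" and i2: "\<iota> False \<in> Hom C b P"
    using coproduct_inj[OF P, of True] coproduct_inj[OF P, of False] by simp_all
  have p1: "\<pi> True \<in> Hom C P a" and p2: "\<pi> False \<in> Hom C P b"
    using p(1)[THEN bspec[of _ _ True]] p(1)[THEN bspec[of _ _ False]] by simp_all
  have q: "\<pi> True \<cdot> \<iota> True = Ide C a" "\<pi> False \<cdot> \<iota> False = Ide C b"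
      "\<pi> True \<cdot> \<iota> False = Zero C b a" "\<pi> False \<cdot> \<iota> True = Zero C a b"
    using p(2) by simp_all
  have h1: "\<iota> True \<cdot> \<pi> True \<in> Hom C P P" and h2: "\<iota> False \<cdot> \<pi> False \<in> Hom C P P"
    by (rule cmp_hom[OF p1 i1] cmp_hom[OF p2 i2])+
  have "Add C (\<iota> True \<cdot> \<pi> True) (\<iota> False \<cdot> \<pi> False) = Ide C P"
  proof (rule coproduct_eqI[OF P add_hom[OF h1 h2] ide_hom[OF coproduct_obj[OF P]]])
    fix i :: bool
    show "Add C (\<iota> True \<cdot> \<pi> True) (\<iota> False \<cdot> \<pi> False) \<cdot> \<iota> i = Ide C P \<cdot> \<iota> i"
    proof (cases i)
      case True
      have "Add C (\<iota> True \<cdot> \<pi> True) (\<iota> False \<cdot> \<pi> False) \<cdot> \<iota> True = Add C (\<iota> True) (Zero C a P)"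
        using cmp_add_left[OF i1 h1 h2] cmp_assoc[OF i1 p1 i1] cmp_assoc[OF i1 p2 i2] q
          cmp_ide_right[OF i1] cmp_zero_right[OF i2 assms(1)] by simp
      then show ?thesis using True i1 cmp_ide_left[OF i1] by simp
    next
      case False
      have "Add C (\<iota> True \<cdot> \<pi> True) (\<iota> False \<cdot> \<pi> False) \<cdot> \<iota> False = Add C (Zero C b P) (\<iota> False)"
        using cmp_add_left[OF i2 h1 h2] cmp_assoc[OF i2 p1 i1] cmp_assoc[OF i2 p2 i2] q
          cmp_ide_right[OF i2] cmp_zero_right[OF i1 assms(2)] by simp
      then show ?thesis using False i2 cmp_ide_left[OF i2] by simp
    qed
  qed
  moreover have "(\<lambda>i. if i then \<iota> True else \<iota> False) = \<iota>" by auto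
  ultimately show thesis using P i1 i2 p1 p2 q by (intro that[of P "\<iota> True" "\<iota> False"]) simp_all
qed

text \<open>\<open>N\<close> is the usual pullback, the kernel of the difference \<open>d\<close> of
  the two arrows from \<open>x \<oplus> t\<close> to \<open>z\<close>. The restriction of
  \<open>d\<close> to \<open>x\<close> is \<open>e\<close>, so \<open>d\<close> is epic and hence
  the cokernel of its kernel. If \<open>h\<close> kills \<alpha>, then \<open>h \<cdot> p2\<close>
  factors as \<open>l \<cdot> d\<close>; on \<open>x\<close> this says that
  \<open>l \<cdot> e\<close> is zero, so \<open>l\<close> vanishes and \<open>h\<close> with
  it.\<close>

lemma epic_pullback:
  assumes "epic C e" "e \<in> Hom C x z" "g \<in> Hom C t z"
  obtains N \<alpha> \<beta> where "\<alpha> \<in> Hom C N t" "epic C \<alpha>" "\<beta> \<in> Hom C N x" "e \<cdot> \<beta> = g \<cdot> \<alpha>"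
proof -
  have o: "x \<in> Obj C" "t \<in> Obj C" "z \<in> Obj C" using hom_obj[OF assms(2)] hom_obj[OF assms(3)] by auto
  obtain P i1 i2 p1 p2 where P:
    "is_coproduct C (UNIV :: bool set) (\<lambda>i. if i then x else t) P (\<lambda>i. if i then i1 else i2)"
    and i: "i1 \<in> Hom C x P" "i2 \<in> Hom C t P" and p: "p1 \<in> Hom C P x" "p2 \<in> Hom C P t"
    and q: "p1 \<cdot> i1 = Ide C x" "p2 \<cdot> i2 = Ide C t" "p1 \<cdot> i2 = Zero C t x" "p2 \<cdot> i1 = Zero C x t"
    by (rule biproduct[OF o(1,2)])
  define d where "d = Add C (e \<cdot> p1) (neg (g \<cdot> p2))"
  have ep: "e \<cdot> p1 \<in> Hom C P z" and gp: "g \<cdot> p2 \<in> Hom C P z"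
    by (rule cmp_hom[OF p(1) assms(2)] cmp_hom[OF p(2) assms(3)])+
  have d: "d \<in> Hom C P z" unfolding d_def by (rule add_hom[OF ep neg_hom[OF gp]])
  have "d \<cdot> i1 = Add C (e \<cdot> p1 \<cdot> i1) (neg (g \<cdot> p2) \<cdot> i1)" 
    unfolding d_def by (rule cmp_add_left[OF i(1) ep neg_hom[OF gp]])
  also have "neg (g \<cdot> p2) \<cdot> i1 = neg (g \<cdot> p2 \<cdot> i1)" by (rule cmp_neg_left[OF i(1) gp])
  also have "g \<cdot> p2 \<cdot> i1 = Zero C x z"
    using cmp_assoc[OF i(1) p(2) assms(3)] q(4) cmp_zero_right[OF assms(3) o(1)] by simp
  also have "neg (Zero C x z) = Zero C x z"
    using add_neg[OF zero_hom[OF o(1,3)]] neg_hom[OF zero_hom[OF o(1,3)]] by simp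
  also have "e \<cdot> p1 \<cdot> i1 = e"
    using cmp_assoc[OF i(1) p(1) assms(2)] q(1) cmp_ide_right[OF assms(2)] by simp
  finally have di: "d \<cdot> i1 = e" using assms(2) by simp
  have "epic C d"
    using epic_factor[of d i1] assms(1) HomD[OF i(1)] HomD[OF d] by (simp add: di)
  obtain k N where k: "is_kernel C d k" "k \<in> Hom C N P" using kernel_ex[OF d] .
  note K = kernelD[OF k(1) d, unfolded HomD(2)[OF k(2)]]
  note D = epic_cokernel_of_kernel[OF \<open>epic C d\<close> k(1) d]
  show thesis
  proof (rule that)
    show a: "p2 \<cdot> k \<in> Hom C N t" and b: "p1 \<cdot> k \<in> Hom C N x"
      by (rule cmp_hom[OF k(2)], fact)+
    show "epic C (p2 \<cdot> k)"
    proof (rule epicI_zero[OF a])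
      fix c h assume h: "h \<in> Hom C t c" "h \<cdot> (p2 \<cdot> k) = Zero C N c"
      have hp: "h \<cdot> p2 \<in> Hom C P c" by (rule cmp_hom[OF p(2) h(1)])
      have "(h \<cdot> p2) \<cdot> k = Zero C N c" using h(2) cmp_assoc[OF k(2) p(2) h(1)] by simp
      then obtain l where l: "l \<in> Hom C z c" "l \<cdot> d = h \<cdot> p2"
        using cokernelD(4)[OF D k(2) hp] HomD(3)[OF d] by auto
      have "l \<cdot> e = (l \<cdot> d) \<cdot> i1" using cmp_assoc[OF i(1) d l(1)] di by simp
      also have "\<dots> = h \<cdot> (p2 \<cdot> i1)" using l(2) cmp_assoc[OF i(1) p(2) h(1)] by simp
      also have "\<dots> = Zero C x c" using q(4) cmp_zero_right[OF h(1) o(1)] by simp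
      finally have "l = Zero C z c" by (rule epic_zero[OF assms(1,2) l(1)])
      then have "h \<cdot> p2 = Zero C P c" using l(2) cmp_zero_left[OF d hom_obj(2)[OF h(1)]] by simp
      then have "h \<cdot> (p2 \<cdot> i2) = Zero C P c \<cdot> i2" using cmp_assoc[OF i(2) p(2) h(1)] by simp
      then show "h = Zero C t c"
        using q(2) cmp_ide_right[OF h(1)] cmp_zero_left[OF i(2) hom_obj(2)[OF h(1)]] by simp
    qed
    have "d \<cdot> k = Add C (e \<cdot> p1 \<cdot> k) (neg (g \<cdot> p2) \<cdot> k)"
      unfolding d_def by (rule cmp_add_left[OF k(2) ep neg_hom[OF gp]])
    also have "\<dots> = Add C (e \<cdot> (p1 \<cdot> k)) (neg (g \<cdot> (p2 \<cdot> k)))"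
      using cmp_neg_left[OF k(2) gp] cmp_assoc[OF k(2) p(1) assms(2)] cmp_assoc[OF k(2) p(2) assms(3)] by simp
    finally show "e \<cdot> (p1 \<cdot> k) = g \<cdot> (p2 \<cdot> k)"
      using K(2) sub_eq_zero[OF cmp_hom[OF b assms(2)] cmp_hom[OF a assms(3)]] by simp
  qed
qed

end


section \<open>Coproducts of small families\<close>

lemma coproduct_exists_index:
  fixes \<kappa> :: "'u rel" and I :: "'u set" and C :: "('o, 'm, 'x) cat_scheme"
  assumes "category C" "cocomplete \<kappa> C" "universe \<kappa>" "small \<kappa> I" "\<forall>i\<in>I. X i \<in> Obj C"
  obtains P \<iota> where "is_coproduct C I X P \<iota>"
proof -
  interpret category C by fact
  \<comment> \<open>A coproduct is a colimit over the discrete category on \<open>I\<close>, in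
    which each index serves as an object and as its own identity arrow.\<close>
  let ?J = "\<lparr>Obj = I, Arr = I, Dom = (\<lambda>i. i), Cod = (\<lambda>i. i), Ide = (\<lambda>i. i), Cmp = (\<lambda>i j. i)\<rparr>"
  let ?D = "\<lparr>FO = X, FA = (\<lambda>i. Ide C (X i))\<rparr>"
  have J: "category ?J" by unfold_locales (auto simp: Hom_def)
  then have "small_category \<kappa> ?J" using assms(4) by (simp add: small_category_def)
  moreover have "is_functor ?J C ?D"
    unfolding is_functor_def using J assms(1,5) by (auto simp: Hom_def)
  ultimately obtain L \<iota> where L: "is_colimit ?J C ?D L \<iota>"
    using assms(2) unfolding cocomplete_def by blast
  have "is_coproduct C I X L \<iota>"
    unfolding is_coproduct_def
  proof (intro conjI allI ballI impI)
    fix Y f assume Y: "Y \<in> Obj C" and f: "\<forall>i\<in>I. f i \<in> Hom C (X i) Y"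
    have "\<forall>i\<in>I. f i \<cdot>\<^bsub>C\<^esub> Ide C (X i) = f i" using f by (auto simp: Hom_def)
    then show "\<exists>!h. h \<in> Hom C L Y \<and> (\<forall>i\<in>I. h \<cdot>\<^bsub>C\<^esub> \<iota> i = f i)"
      using L Y f unfolding is_colimit_def by simp
  qed (use L in \<open>auto simp: is_colimit_def\<close>)
  then show thesis by (rule that)
qed

lemma coproduct_exists:
  fixes \<kappa> :: "'u rel" and I :: "'i set" and C :: "('o, 'm, 'x) cat_scheme"
  assumes "category C" "cocomplete \<kappa> C" "universe \<kappa>" "small \<kappa> I" "\<forall>i\<in>I. X i \<in> Obj C"
  obtains P \<iota> where "is_coproduct C I X P \<iota>"
proof -
  interpret category C by fact
  obtain g :: "'i \<Rightarrow> 'u" where g: "inj_on g I" using small_embed[OF assms(3,4)] .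
  have "\<forall>j\<in>g ` I. X (the_inv_into I g j) \<in> Obj C" using assms(5) by (auto simp: the_inv_into_f_f[OF g])
  then obtain P \<iota> where "is_coproduct C (g ` I) (\<lambda>j. X (the_inv_into I g j)) P \<iota>"
    by (rule coproduct_exists_index[OF assms(1-3) small_image[OF assms(4)]])
  then have "is_coproduct C I (\<lambda>i. X (the_inv_into I g (g i))) P (\<lambda>i. \<iota> (g i))"
    by (rule coproduct_reindex[rotated]) (use g in \<open>simp add: bij_betw_def\<close>)
  then have "is_coproduct C I X P (\<lambda>i. \<iota> (g i))"
    using coproduct_cong[of I "\<lambda>i. X (the_inv_into I g (g i))" X "\<lambda>i. \<iota> (g i)" "\<lambda>i. \<iota> (g i)"]
    by (simp add: the_inv_into_f_f[OF g])
  then show thesis by (rule that)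
qed

text \<open>Admits index sets of any type, whereas \<open>Sum\<close> itself speaks of subsets of
  \<open>'u\<close>.\<close>

lemma SumI:
  fixes \<kappa> :: "'u rel" and I :: "'i set" and C :: "('o, 'm, 'x) cat_scheme"
  assumes "category C" "universe \<kappa>" "small \<kappa> I" "\<forall>i\<in>I. X i \<in> \<U>" "is_coproduct C I X P \<iota>"
  shows "P \<in> Sum \<kappa> C \<U>"
proof -
  interpret category C by fact
  obtain g :: "'i \<Rightarrow> 'u" where g: "inj_on g I" using small_embed[OF assms(2,3)] .
  have "bij_betw (the_inv_into I g) (g ` I) I"
    using g by (metis bij_betw_the_inv_into inj_on_imp_bij_betw)
  from coproduct_reindex[OF this assms(5)] show ?thesis
    unfolding Sum_def using small_image[OF assms(3)] assms(4)
    by (auto simp: the_inv_into_f_f[OF g] intro!: exI[of _ "g ` I"] exI[of _ "\<lambda>j. X (the_inv_into I g j)"])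
qed

lemma SumE:
  fixes \<kappa> :: "'u rel"
  assumes "P \<in> Sum \<kappa> C \<U>"
  obtains I :: "'u set" and X \<iota> where "small \<kappa> I" "\<forall>i\<in>I. X i \<in> \<U>" "is_coproduct C I X P \<iota>"
  using assms unfolding Sum_def by blast

section \<open>Sums, quotients and presentations in a cocomplete abelian category\<close>

locale cocomplete_abelian = abelian_category A
  for A :: "('o, 'm, 'x) precat_scheme" (structure) +
  fixes \<kappa> :: "'u rel"
  assumes universe: "universe \<kappa>" and locally_small: "locally_small \<kappa> A" and cocomplete: "cocomplete \<kappa> A"
begin

lemma small_Hom: "a \<in> Obj A \<Longrightarrow> b \<in> Obj A \<Longrightarrow> small \<kappa> (Hom A a b)"
  using locally_small by (simp add: locally_small_def)

lemma coproduct_ex: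
  assumes "small \<kappa> I" "\<forall>i\<in>I. X i \<in> Obj A"
  obtains P \<iota> where "is_coproduct A I X P \<iota>"
  using coproduct_exists[OF category_axioms cocomplete universe assms] .

lemmas Sum_I = SumI[OF category_axioms universe]

lemma Sum_obj: "P \<in> Sum \<kappa> A \<U> \<Longrightarrow> P \<in> Obj A"
  by (elim SumE) (rule coproduct_obj)

lemma Sum_generator:
  assumes "U \<in> \<U>" "U \<in> Obj A"
  shows "U \<in> Sum \<kappa> A \<U>"
proof (rule Sum_I[of "{()}" "\<lambda>_. U"])
  show "is_coproduct A {()} (\<lambda>_. U) U (\<lambda>_. Ide A U)"
  proof (rule coproductI)
    fix Y f assume "Y \<in> Obj A" "\<And>i. i \<in> {()} \<Longrightarrow> f i \<in> Hom A U Y"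
    then show "\<exists>h. h \<in> Hom A U Y \<and> (\<forall>i\<in>{()}. h \<cdot> Ide A U = f i)"
      by (intro exI[of _ "f ()"]) (auto simp: HomD)
  next
    fix Y h h' assume "h \<in> Hom A U Y" "h' \<in> Hom A U Y" "\<And>i. i \<in> {()} \<Longrightarrow> h \<cdot> Ide A U = h' \<cdot> Ide A U"
    then show "h = h'" using cmp_ide_right by auto
  qed (use assms in \<open>auto intro: ide_hom\<close>)
qed (use assms universe in \<open>auto intro: small_finite\<close>)

text \<open>A zero object is the coproduct of the empty family.\<close>

lemma Sum_zero:
  assumes "zero_object A z"
  shows "z \<in> Sum \<kappa> A \<U>"
proof (rule Sum_I[of "{} :: unit set"])
  have z: "z \<in> Obj A" using assms by (simp add: zero_object_def)
  show "is_coproduct A ({} :: unit set) X z \<iota>" for X \<iota>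
  proof (rule coproductI)
    show "h = h'" if "h \<in> Hom A z Y" "h' \<in> Hom A z Y" for Y h h'
      by (rule zero_objectD(2)[OF assms hom_obj(2)[OF that(1)] that])
    show "\<exists>h. h \<in> Hom A z Y \<and> (\<forall>i\<in>({} :: unit set). h \<cdot> \<iota> i = f i)" if "Y \<in> Obj A" for Y f
      using zero_object_hom_ex(2)[OF assms that] by simp
  qed (use z in simp_all)
qed (use universe in \<open>auto intro: small_finite\<close>)

text \<open>The summands of both objects are indexed together by the disjoint union of the two index
  sets, tagged by a Boolean.\<close>

lemma Sum_binary:
  assumes "P \<in> Sum \<kappa> A \<U>" "Q \<in> Sum \<kappa> A \<U>"
    and R: "is_coproduct A (UNIV :: bool set) (\<lambda>i. if i then P else Q) R \<rho>"
  shows "R \<in> Sum \<kappa> A \<U>"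
proof -
  obtain I :: "'u set" and X \<iota> where I: "small \<kappa> I" "\<forall>i\<in>I. X i \<in> \<U>" and P: "is_coproduct A I X P \<iota>"
    using assms(1) by (rule SumE)
  obtain J :: "'u set" and Y \<mu> where J: "small \<kappa> J" "\<forall>i\<in>J. Y i \<in> \<U>" and Q: "is_coproduct A J Y Q \<mu>"
    using assms(2) by (rule SumE)
  let ?K = "(\<lambda>i. (True, i)) ` I \<union> (\<lambda>i. (False, i)) ` J"
  have "?K = (\<Union>b\<in>UNIV. Pair b ` (if b then I else J))" by (auto split: if_splits)
  moreover have "small \<kappa> (\<Union>b\<in>UNIV. Pair b ` (if b then I else J))"
    by (rule small_UN[OF universe]) (use I(1) J(1) in \<open>auto intro: small_image small_finite[OF universe]\<close>)
  ultimately have sm: "small \<kappa> ?K" by simp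
  let ?Z = "\<lambda>(b, i). if b then X i else Y i" and ?\<zeta> = "\<lambda>(b, i). \<rho> b \<cdot> (if b then \<iota> i else \<mu> i)"
  have r: "\<rho> True \<in> Hom A P R" "\<rho> False \<in> Hom A Q R"
    using coproduct_inj[OF R, of True] coproduct_inj[OF R, of False] by simp_all
  have "is_coproduct A ?K ?Z R ?\<zeta>"
  proof (rule coproductI)
    show "R \<in> Obj A" by (rule coproduct_obj[OF R])
    show "?\<zeta> k \<in> Hom A (?Z k) R" if K: "k \<in> ?K" for k
    proof -
      obtain b i where k: "k = (b, i)" by (cases k)
      then consider "b" "i \<in> I" | "\<not> b" "i \<in> J" using K by blast
      then show ?thesis
        using cmp_hom[OF coproduct_inj[OF P, of i] r(1)] cmp_hom[OF coproduct_inj[OF Q, of i] r(2)]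
        by cases (simp_all add: k)
    qed
  next
    fix T f assume T: "T \<in> Obj A" and f: "\<And>k. k \<in> ?K \<Longrightarrow> f k \<in> Hom A (?Z k) T"
    have "\<forall>i\<in>I. f (True, i) \<in> Hom A (X i) T" using f[of "(True, _)"] by simp
    then obtain h where h: "h \<in> Hom A P T" "\<forall>i\<in>I. h \<cdot> \<iota> i = f (True, i)" by (rule coproduct_desc[OF P T])
    have "\<forall>i\<in>J. f (False, i) \<in> Hom A (Y i) T" using f[of "(False, _)"] by simp
    then obtain h' where h': "h' \<in> Hom A Q T" "\<forall>i\<in>J. h' \<cdot> \<mu> i = f (False, i)" by (rule coproduct_desc[OF Q T])
    have "\<forall>b\<in>UNIV. (if b then h else h') \<in> Hom A (if b then P else Q) T" using h(1) h'(1) by simp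
    then obtain l where l: "l \<in> Hom A R T" "\<forall>b\<in>UNIV. l \<cdot> \<rho> b = (if b then h else h')"
      by (rule coproduct_desc[OF R T])
    have "l \<cdot> (\<rho> True \<cdot> \<iota> i) = f (True, i)" if "i \<in> I" for i
      using cmp_assoc[OF coproduct_inj[OF P that] r(1) l(1)] l(2) h(2) that by simp
    moreover have "l \<cdot> (\<rho> False \<cdot> \<mu> i) = f (False, i)" if "i \<in> J" for i
      using cmp_assoc[OF coproduct_inj[OF Q that] r(2) l(1)] l(2) h'(2) that by simp
    ultimately show "\<exists>h. h \<in> Hom A R T \<and> (\<forall>k\<in>?K. h \<cdot> ?\<zeta> k = f k)"
      using l(1) by (intro exI[of _ l] conjI ballI) (assumption, elim UnE imageE, simp_all)
  next
    fix T h h' assume h: "h \<in> Hom A R T" "h' \<in> Hom A R T" and eq: "\<And>k. k \<in> ?K \<Longrightarrow> h \<cdot> ?\<zeta> k = h' \<cdot> ?\<zeta> k"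
    have T: "h \<cdot> \<rho> True = h' \<cdot> \<rho> True"
    proof (rule coproduct_eqI[OF P cmp_hom[OF r(1) h(1)] cmp_hom[OF r(1) h(2)]])
      fix i assume i: "i \<in> I"
      show "h \<cdot> \<rho> True \<cdot> \<iota> i = h' \<cdot> \<rho> True \<cdot> \<iota> i"
        using eq[of "(True, i)"] i cmp_assoc[OF coproduct_inj[OF P i] r(1) h(1)]
          cmp_assoc[OF coproduct_inj[OF P i] r(1) h(2)] by auto
    qed
    have F: "h \<cdot> \<rho> False = h' \<cdot> \<rho> False"
    proof (rule coproduct_eqI[OF Q cmp_hom[OF r(2) h(1)] cmp_hom[OF r(2) h(2)]])
      fix i assume i: "i \<in> J"
      show "h \<cdot> \<rho> False \<cdot> \<mu> i = h' \<cdot> \<rho> False \<cdot> \<mu> i"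
        using eq[of "(False, i)"] i cmp_assoc[OF coproduct_inj[OF Q i] r(2) h(1)]
          cmp_assoc[OF coproduct_inj[OF Q i] r(2) h(2)] by auto
    qed
    show "h = h'"
    proof (rule coproduct_eqI[OF R h])
      fix b :: bool show "h \<cdot> \<rho> b = h' \<cdot> \<rho> b" using T F by (cases b) simp_all
    qed
  qed
  then show ?thesis by (rule Sum_I[OF sm, rotated]) (use I(2) J(2) in auto)
qed

lemma GenE:
  assumes "Y \<in> Gen \<kappa> A \<U>"
  obtains P e where "P \<in> Sum \<kappa> A \<U>" "e \<in> Hom A P Y" "epic A e"
  using assms unfolding Gen_def by blast

lemma Gen_quotient:
  assumes "Y \<in> Gen \<kappa> A \<U>" "e \<in> Hom A Y Z" "epic A e"
  shows "Z \<in> Gen \<kappa> A \<U>"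
proof -
  obtain P p where p: "P \<in> Sum \<kappa> A \<U>" "p \<in> Hom A P Y" "epic A p" using assms(1) by (rule GenE)
  have "epic A (e \<cdot> p)" by (rule epic_cmp[OF p(3) assms(3)]) (simp add: HomD[OF p(2)] HomD[OF assms(2)])
  then show ?thesis unfolding Gen_def using p(1) cmp_hom[OF p(2) assms(2)] by blast
qed

text \<open>Lifts are chosen on each summand and glued by the universal property, so a
  \<U>-epimorphism lifts arrows from all of \<open>Sum\<close>.\<close>

lemma rel_epimorphism_lift:
  assumes "rel_epimorphism A \<U> p" "p \<in> Hom A a b" "P \<in> Sum \<kappa> A \<U>" "f \<in> Hom A P b"
  obtains g where "g \<in> Hom A P a" "p \<cdot> g = f"
proof -
  obtain I :: "'u set" and X \<iota> where I: "\<forall>i\<in>I. X i \<in> \<U>" and P: "is_coproduct A I X P \<iota>"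
    using assms(3) by (rule SumE)
  have "\<forall>i\<in>I. \<exists>h. h \<in> Hom A (X i) a \<and> p \<cdot> h = f \<cdot> \<iota> i"
  proof
    fix i assume i: "i \<in> I"
    have "f \<cdot> \<iota> i \<in> Hom A (X i) b" by (rule cmp_hom[OF coproduct_inj[OF P i] assms(4)])
    moreover have "(\<lambda>f. p \<cdot> f) ` Hom A (X i) a = Hom A (X i) b"
      using assms(1) I i HomD[OF assms(2)] by (simp add: rel_epimorphism_def)
    ultimately have "f \<cdot> \<iota> i \<in> (\<lambda>f. p \<cdot> f) ` Hom A (X i) a" by simp
    then show "\<exists>h. h \<in> Hom A (X i) a \<and> p \<cdot> h = f \<cdot> \<iota> i" by (elim imageE) auto
  qed
  then obtain h where h: "\<forall>i\<in>I. h i \<in> Hom A (X i) a \<and> p \<cdot> h i = f \<cdot> \<iota> i" by (rule bchoice[THEN exE])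
  then have "\<forall>i\<in>I. h i \<in> Hom A (X i) a" by blast
  then obtain g where g: "g \<in> Hom A P a" "\<forall>i\<in>I. g \<cdot> \<iota> i = h i"
    by (rule coproduct_desc[OF P hom_obj(1)[OF assms(2)]])
  have "p \<cdot> g = f"
  proof (rule coproduct_eqI[OF P cmp_hom[OF g(1) assms(2)] assms(4)])
    fix i assume i: "i \<in> I"
    show "p \<cdot> g \<cdot> \<iota> i = f \<cdot> \<iota> i"
      using cmp_assoc[OF coproduct_inj[OF P i] g(1) assms(2)] g(2) h i by simp
  qed
  then show thesis using g(1) that by blast
qed

text \<open>Local smallness makes the set of all arrows from \<U> to \<open>M\<close> small, so
  their coproduct exists. Every such arrow factors through \<open>q\<close>, whose image is the
  trace of \<U> in \<open>M\<close>.\<close>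

lemma trace_coproduct:
  assumes "small \<kappa> \<U>" "\<U> \<subseteq> Obj A" "M \<in> Obj A"
  obtains P \<iota> q where "is_coproduct A (SIGMA U:\<U>. Hom A U M) fst P \<iota>" "P \<in> Sum \<kappa> A \<U>" "q \<in> Hom A P M"
    "\<forall>i\<in>(SIGMA U:\<U>. Hom A U M). q \<cdot> \<iota> i = snd i"
proof -
  have sm: "small \<kappa> (SIGMA U:\<U>. Hom A U M)"
    by (rule small_Sigma[OF universe assms(1)]) (use assms(2,3) in \<open>auto intro: small_Hom\<close>)
  have "\<forall>i\<in>(SIGMA U:\<U>. Hom A U M). fst i \<in> Obj A" using assms(2) by auto
  then obtain P \<iota> where P: "is_coproduct A (SIGMA U:\<U>. Hom A U M) fst P \<iota>" by (rule coproduct_ex[OF sm])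
  have "\<forall>i\<in>(SIGMA U:\<U>. Hom A U M). snd i \<in> Hom A (fst i) M" by auto
  then obtain q where "q \<in> Hom A P M" "\<forall>i\<in>(SIGMA U:\<U>. Hom A U M). q \<cdot> \<iota> i = snd i"
    by (rule coproduct_desc[OF P assms(3)])
  moreover have "P \<in> Sum \<kappa> A \<U>" by (rule Sum_I[OF sm _ P]) auto
  ultimately show thesis using P that by blast
qed

lemma PresI:
  assumes "f \<in> Hom A P Q" "P \<in> Sum \<kappa> A \<U>" "Q \<in> Sum \<kappa> A \<U>" "is_cokernel A f c"
  shows "Cod A c \<in> Pres \<kappa> A \<U>"
  unfolding Pres_def
  using assms HomD[OF assms(1)] isomorphic_refl[OF hom_obj(2)[OF cokernelD(1)[OF assms(4,1)]]] by auto

lemma PresE: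
  assumes "Y \<in> Pres \<kappa> A \<U>"
  obtains P Q f c where "P \<in> Sum \<kappa> A \<U>" "Q \<in> Sum \<kappa> A \<U>" "f \<in> Hom A P Q" "is_cokernel A f c" "c \<in> Hom A Q Y" "epic A c"
proof -
  obtain f c where f: "Dom A f \<in> Sum \<kappa> A \<U>" "Cod A f \<in> Sum \<kappa> A \<U>" "is_cokernel A f c" "isomorphic A (Cod A c) Y"
    using assms unfolding Pres_def by blast
  have fh: "f \<in> Hom A (Dom A f) (Cod A f)" using f(3) by (simp add: is_cokernel_def Hom_def)
  obtain s t where s: "s \<in> Hom A (Cod A c) Y" "t \<in> Hom A Y (Cod A c)" "t \<cdot> s = Ide A (Cod A c)" "s \<cdot> t = Ide A Y"
    using f(4) by (rule isomorphicE)
  have c: "is_cokernel A f (s \<cdot> c)" by (rule cokernel_of_iso[OF f(3) fh s])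
  have "s \<cdot> c \<in> Hom A (Cod A f) Y" by (rule cmp_hom[OF cokernelD(1)[OF f(3) fh] s(1)])
  then show thesis using that[OF f(1,2) fh c] cokernelD(3)[OF c fh] by blast
qed

text \<open>\<open>P\<close> is the cokernel of the zero arrow from a zero object, which is itself
  an empty sum.\<close>

lemma Sum_Pres: "P \<in> Sum \<kappa> A \<U> \<Longrightarrow> P \<in> Pres \<kappa> A \<U>"
proof -
  assume P: "P \<in> Sum \<kappa> A \<U>"
  obtain z where z: "zero_object A z" using has_zero by blast
  have o: "z \<in> Obj A" "P \<in> Obj A" using z Sum_obj[OF P] by (auto simp: zero_object_def)
  have "is_cokernel A (Zero A z P) (Ide A P)"
  proof (rule cokernelI[OF zero_hom[OF o] ide_hom[OF o(2)]])
    show "epic A (Ide A P)" by (rule retraction_epic[OF ide_hom ide_hom]) (use o in simp_all)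
    show "\<exists>h\<in>Hom A P x. h \<cdot> Ide A P = g" if "g \<in> Hom A P x" for x g using that cmp_ide_right by auto
  qed (use o in simp)
  from PresI[OF zero_hom[OF o] Sum_zero[OF z] P this] show ?thesis using o by simp
qed

lemma Pres_Gen: "Y \<in> Pres \<kappa> A \<U> \<Longrightarrow> Y \<in> Gen \<kappa> A \<U>"
  unfolding Gen_def by (elim PresE) blast

end


section \<open>Full subcategories\<close>

lemma full_subcategory_simps [simp]:
  "Obj (full_subcategory C B) = B"
  "Arr (full_subcategory C B) = {f \<in> Arr C. Dom C f \<in> B \<and> Cod C f \<in> B}"
  "Dom (full_subcategory C B) = Dom C" "Cod (full_subcategory C B) = Cod C"
  "Ide (full_subcategory C B) = Ide C" "Cmp (full_subcategory C B) = Cmp C"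
  by (simp_all add: full_subcategory_def)

lemma full_subcategory_simps' [simp]:
  fixes C :: "('o, 'm, 'x) precat_scheme"
  shows "Add (full_subcategory C B) = Add C" "Zero (full_subcategory C B) = Zero C"
  by (simp_all add: full_subcategory_def)

lemma Hom_full [simp]: "a \<in> B \<Longrightarrow> b \<in> B \<Longrightarrow> Hom (full_subcategory C B) a b = Hom C a b"
  by (auto simp: Hom_def)

lemma Hom_full_iff: "f \<in> Hom (full_subcategory C B) a b \<longleftrightarrow> f \<in> Hom C a b \<and> a \<in> B \<and> b \<in> B"
  by (auto simp: Hom_def)

lemma id_functor_simps [simp]: "FO id_functor a = a" "FA id_functor f = f"
  by (simp_all add: id_functor_def)

lemma comp_functor_simps [simp]: "FO (comp_functor G F) a = FO G (FO F a)" "FA (comp_functor G F) f = FA G (FA F f)"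
  by (simp_all add: comp_functor_def)

lemma category_full:
  assumes "category C" "B \<subseteq> Obj C"
  shows "category (full_subcategory C B)"
proof -
  interpret category C by fact
  show ?thesis
    by unfold_locales (use assms(2) in \<open>auto simp: Hom_def subset_iff\<close>)
qed

lemma epic_fullI: "epic C e \<Longrightarrow> B \<subseteq> Obj C \<Longrightarrow> e \<in> Hom C a b \<Longrightarrow> a \<in> B \<Longrightarrow> b \<in> B \<Longrightarrow> epic (full_subcategory C B) e"
  unfolding epic_def by (auto simp: Hom_def)

lemma monic_fullI: "monic C e \<Longrightarrow> B \<subseteq> Obj C \<Longrightarrow> e \<in> Hom C a b \<Longrightarrow> a \<in> B \<Longrightarrow> b \<in> B \<Longrightarrow> monic (full_subcategory C B) e"
  unfolding monic_def by (auto simp: Hom_def)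

lemma is_coproduct_fullI:
  assumes "is_coproduct C I X P \<iota>" "B \<subseteq> Obj C" "\<forall>i\<in>I. X i \<in> B" "P \<in> B"
  shows "is_coproduct (full_subcategory C B) I X P \<iota>"
  unfolding is_coproduct_def
proof (intro conjI ballI allI impI)
  show "\<iota> i \<in> Hom (full_subcategory C B) (X i) P" if "i \<in> I" for i
    using assms that by (simp add: is_coproduct_def)
  fix Y f assume "Y \<in> Obj (full_subcategory C B)" "\<forall>i\<in>I. f i \<in> Hom (full_subcategory C B) (X i) Y"
  then have Y: "Y \<in> B" "Y \<in> Obj C" "\<forall>i\<in>I. f i \<in> Hom C (X i) Y" using assms(2,3) by (auto simp: Hom_full_iff)
  have "\<exists>!h. h \<in> Hom C P Y \<and> (\<forall>i\<in>I. h \<cdot>\<^bsub>C\<^esub> \<iota> i = f i)"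
    using assms(1) Y(2,3) by (simp add: is_coproduct_def)
  then show "\<exists>!h. h \<in> Hom (full_subcategory C B) P Y \<and> (\<forall>i\<in>I. h \<cdot>\<^bsub>full_subcategory C B\<^esub> \<iota> i = f i)"
    using Y(1) assms(4) by simp
qed (use assms in simp)

lemma (in preadditive_category) preadditive_full:
  assumes "B \<subseteq> Obj C"
  shows "preadditive_category (full_subcategory C B)"
proof -
  have "comm_group (hom_group (full_subcategory C B) a b)"
    if "a \<in> Obj (full_subcategory C B)" "b \<in> Obj (full_subcategory C B)" for a b
  proof -
    have "hom_group (full_subcategory C B) a b = hom_group C a b" using that by (simp add: hom_group_def)
    then show ?thesis using hom_comm_group that assms by auto
  qed
  then show ?thesis
    by (intro preadditive_category.intro preadditive_category_axioms.intro category_full[OF category_axioms assms])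
       (auto simp: Hom_full_iff intro: cmp_add_left cmp_add_right)
qed

lemma is_kernel_fullI:
  fixes C :: "('o, 'm, 'x) precat_scheme"
  assumes "is_kernel C f k" "B \<subseteq> Obj C" "Dom C f \<in> B" "Cod C f \<in> B" "Dom C k \<in> B"
  shows "is_kernel (full_subcategory C B) f k"
  using assms unfolding is_kernel_def by (auto simp: subset_iff)

lemma is_cokernel_fullI:
  fixes C :: "('o, 'm, 'x) precat_scheme"
  assumes "is_cokernel C f c" "B \<subseteq> Obj C" "Dom C f \<in> B" "Cod C f \<in> B" "Cod C c \<in> B"
  shows "is_cokernel (full_subcategory C B) f c"
  using assms unfolding is_cokernel_def by (auto simp: subset_iff)


section \<open>Coreflections\<close>

text \<open>The pointwise form of a right adjoint to the inclusion: \<epsilon> is the counit at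
  \<open>M\<close>, a universal arrow from \<open>B\<close> to \<open>M\<close>.\<close>

definition coreflection :: "('o, 'm, 'x) cat_scheme \<Rightarrow> 'o set \<Rightarrow> 'o \<Rightarrow> 'o \<Rightarrow> 'm \<Rightarrow> bool" where
  "coreflection C B M R \<epsilon> \<longleftrightarrow> R \<in> B \<and> \<epsilon> \<in> Hom C R M \<and>
     (\<forall>X\<in>B. \<forall>f\<in>Hom C X M. \<exists>!g. g \<in> Hom C X R \<and> \<epsilon> \<cdot>\<^bsub>C\<^esub> g = f)"

context category
begin

lemma coreflectionD:
  assumes "coreflection C B M R \<epsilon>"
  shows "R \<in> B" "\<epsilon> \<in> Hom C R M"
    and "X \<in> B \<Longrightarrow> f \<in> Hom C X M \<Longrightarrow> \<exists>g. g \<in> Hom C X R \<and> \<epsilon> \<cdot> g = f"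
    and "X \<in> B \<Longrightarrow> g \<in> Hom C X R \<Longrightarrow> h \<in> Hom C X R \<Longrightarrow> \<epsilon> \<cdot> g = \<epsilon> \<cdot> h \<Longrightarrow> g = h"
proof -
  show R: "R \<in> B" "\<epsilon> \<in> Hom C R M" using assms by (simp_all add: coreflection_def)
  have u: "X \<in> B \<Longrightarrow> f \<in> Hom C X M \<Longrightarrow> \<exists>!g. g \<in> Hom C X R \<and> \<epsilon> \<cdot> g = f" for X f
    using assms by (simp add: coreflection_def)
  then show "X \<in> B \<Longrightarrow> f \<in> Hom C X M \<Longrightarrow> \<exists>g. g \<in> Hom C X R \<and> \<epsilon> \<cdot> g = f" by blast
  show "g = h" if "X \<in> B" "g \<in> Hom C X R" "h \<in> Hom C X R" "\<epsilon> \<cdot> g = \<epsilon> \<cdot> h"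
    using u[OF that(1) cmp_hom[OF that(3) R(2)]] that by (elim ex1E) (metis (no_types))
qed

text \<open>\<open>s \<cdot> \<epsilon>\<close> and the identity of \<open>R\<close> agree after
  \<epsilon>, hence are equal by uniqueness of lifts. Closure of \<open>B\<close> under colimits is
  obtained from this by exhibiting a section of the counit.\<close>

lemma coreflection_retract:
  assumes "coreflection C B M R \<epsilon>" "s \<in> Hom C M R" "\<epsilon> \<cdot> s = Ide C M"
  shows "isomorphic C M R"
proof -
  note R = coreflectionD[OF assms(1)]
  have "\<epsilon> \<cdot> (s \<cdot> \<epsilon>) = Ide C M \<cdot> \<epsilon>" by (rule cmp_eq_right1[OF assms(3) R(2) assms(2) R(2)])
  then have "\<epsilon> \<cdot> (s \<cdot> \<epsilon>) = \<epsilon> \<cdot> Ide C R" using cmp_ide_left[OF R(2)] cmp_ide_right[OF R(2)] by simp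
  then have "s \<cdot> \<epsilon> = Ide C R"
    by (rule R(4)[OF R(1) cmp_hom[OF R(2) assms(2)] ide_hom[OF hom_obj(1)[OF R(2)]]])
  then show ?thesis using assms R by (intro isomorphicI[of s _ _ \<epsilon>])
qed

text \<open>The counit is the arrow that the bijection \<phi> of the adjunction sends to the
  identity of \<open>G M\<close>. By naturality \<phi> sends \<open>\<epsilon> \<cdot> g\<close>
  back to \<open>g\<close>, so composition with \<epsilon> is inverse to \<phi>.\<close>

lemma coreflective_coreflection:
  assumes "coreflective C B" "B \<subseteq> Obj C" "M \<in> Obj C"
  obtains R \<epsilon> where "coreflection C B M R \<epsilon>"
proof -
  obtain G \<phi> where G: "is_functor C (full_subcategory C B) G"
    and bij: "\<forall>c\<in>B. \<forall>d\<in>Obj C. bij_betw (\<phi> c d) (Hom C c d) (Hom (full_subcategory C B) c (FO G d))"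
    and nat: "\<forall>c\<in>B. \<forall>c'\<in>B. \<forall>d\<in>Obj C. \<forall>d'\<in>Obj C. \<forall>f\<in>Hom (full_subcategory C B) c' c. \<forall>h\<in>Hom C c d. \<forall>g\<in>Hom C d d'.
             \<phi> c' d' (g \<cdot> h \<cdot> f) = FA G g \<cdot> \<phi> c d h \<cdot> f"
    using assms(1) unfolding coreflective_def right_adjoint_def by auto
  let ?R = "FO G M"
  have R: "?R \<in> B" and Gid: "FA G (Ide C M) = Ide C ?R" using G assms(3) by (auto simp: is_functor_def)
  have RO: "?R \<in> Obj C" using R assms(2) by blast
  have b: "bij_betw (\<phi> X M) (Hom C X M) (Hom C X ?R)" if "X \<in> B" for X
    using bspec[OF bspec[OF bij that] assms(3)] by (simp add: Hom_full[OF that R])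
  obtain \<epsilon> where e: "\<epsilon> \<in> Hom C ?R M" "\<phi> ?R M \<epsilon> = Ide C ?R"
    using b[OF R] ide_hom[OF RO] unfolding bij_betw_def by (metis (no_types, lifting) imageE)
  have key: "\<phi> X M (\<epsilon> \<cdot> g) = g" if X: "X \<in> B" and g: "g \<in> Hom C X ?R" for X g
  proof -
    have "\<phi> X M (Ide C M \<cdot> \<epsilon> \<cdot> g) = FA G (Ide C M) \<cdot> \<phi> ?R M \<epsilon> \<cdot> g"
      using nat R X assms(3) g e(1) ide_hom[OF assms(3)] by (simp add: Hom_full_iff)
    then show ?thesis using Gid e cmp_ide_left[OF e(1)] cmp_ide_left[OF g] cmp_ide_left[OF ide_hom[OF RO]] by simp
  qed
  have "coreflection C B M ?R \<epsilon>"
    unfolding coreflection_def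
  proof (intro conjI ballI ex1I)
    fix X f assume X: "X \<in> B" and f: "f \<in> Hom C X M"
    have pf: "\<phi> X M f \<in> Hom C X ?R" using b[OF X] f bij_betwE by blast
    then show "\<phi> X M f \<in> Hom C X ?R" .
    show "\<epsilon> \<cdot> \<phi> X M f = f"
      using key[OF X pf] b[OF X] f cmp_hom[OF pf e(1)] unfolding bij_betw_def by (meson inj_onD)
    fix g assume "g \<in> Hom C X ?R \<and> \<epsilon> \<cdot> g = f"
    then show "g = \<phi> X M f" using key[OF X, of g] by simp
  qed (use R e in auto)
  then show thesis by (rule that)
qed

text \<open>Universal arrows are chosen for all \<open>M\<close>; \<open>l\<close> takes an arrow to
  its unique lift, and \<open>G\<close> sends \<open>f\<close> to the lift of
  \<open>f \<cdot> \<epsilon>\<close>. Functoriality and naturality then follow from uniqueness of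
  lifts.\<close>

lemma coreflectiveI:
  assumes "B \<subseteq> Obj C" "\<forall>M\<in>Obj C. \<exists>R \<epsilon>. coreflection C B M R \<epsilon>"
  shows "coreflective C B"
proof -
  obtain R \<epsilon> where "\<forall>M\<in>Obj C. coreflection C B M (R M) (\<epsilon> M)"
    using assms(2) by metis
  then have r: "coreflection C B M (R M) (\<epsilon> M)" if "M \<in> Obj C" for M using that by blast
  define l where "l X M f = (THE g. g \<in> Hom C X (R M) \<and> \<epsilon> M \<cdot> g = f)" for X M f
  have RB: "R M \<in> B" "\<epsilon> M \<in> Hom C (R M) M" if "M \<in> Obj C" for M
    by (rule coreflectionD(1)[OF r[OF that]] coreflectionD(2)[OF r[OF that]])+
  have RO: "R M \<in> Obj C" if "M \<in> Obj C" for M using RB(1)[OF that] assms(1) by (rule subsetD[rotated])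
  have l: "l X M f \<in> Hom C X (R M) \<and> \<epsilon> M \<cdot> l X M f = f" if "M \<in> Obj C" "X \<in> B" "f \<in> Hom C X M" for X M f
    unfolding l_def by (rule theI') (use r[OF that(1)] that in \<open>simp add: coreflection_def\<close>)
  have lu: "l X M (\<epsilon> M \<cdot> g) = g" if "M \<in> Obj C" "X \<in> B" "g \<in> Hom C X (R M)" for X M g
    using l[OF that(1,2) cmp_hom[OF that(3) RB(2)[OF that(1)]]]
    by - (rule coreflectionD(4)[OF r[OF that(1)] that(2)], use that in auto)
  define G where "G = \<lparr>FO = R, FA = (\<lambda>f. l (R (Dom C f)) (Cod C f) (f \<cdot> \<epsilon> (Dom C f)))\<rparr>"
  have GO: "FO G M = R M" for M by (simp add: G_def)
  have GA: "FA G f \<in> Hom C (R a) (R b) \<and> \<epsilon> b \<cdot> FA G f = f \<cdot> \<epsilon> a" if "f \<in> Hom C a b" for f a b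
    using l[OF hom_obj(2)[OF that] RB(1)[OF hom_obj(1)[OF that]] cmp_hom[OF RB(2)[OF hom_obj(1)[OF that]] that]]
    by (simp add: G_def HomD[OF that])
  have GAu: "FA G f = g" if "f \<in> Hom C a b" "g \<in> Hom C (R a) (R b)" "\<epsilon> b \<cdot> g = f \<cdot> \<epsilon> a" for f a b g
    using GA[OF that(1)] that
    by - (rule coreflectionD(4)[OF r[OF hom_obj(2)[OF that(1)]] RB(1)[OF hom_obj(1)[OF that(1)]]], auto)
  have fun_G: "is_functor C (full_subcategory C B) G"
    unfolding is_functor_def
  proof (intro conjI ballI impI)
    fix a assume a: "a \<in> Obj C"
    show "FO G a \<in> Obj (full_subcategory C B)" using RB[OF a] by (simp add: GO)
    show "FA G (Ide C a) = Ide (full_subcategory C B) (FO G a)"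
      using GAu[OF ide_hom[OF a] ide_hom[OF RO[OF a]]] RB[OF a] by (simp add: GO cmp_ide_left cmp_ide_right)
  next
    fix f assume f: "f \<in> Arr C"
    show "FA G f \<in> Hom (full_subcategory C B) (FO G (Dom C f)) (FO G (Cod C f))"
      using GA[OF HomI[OF f refl refl]] RB f by (simp add: GO)
    fix g assume g: "g \<in> Arr C" and fg: "Cod C f = Dom C g"
    have f': "f \<in> Hom C (Dom C f) (Dom C g)" and g': "g \<in> Hom C (Dom C g) (Cod C g)"
      using f g fg by (auto simp: Hom_def)
    have o: "Dom C f \<in> Obj C" "Dom C g \<in> Obj C" "Cod C g \<in> Obj C" using f g by auto
    note F = GA[OF f', THEN conjunct1] GA[OF f', THEN conjunct2] and G = GA[OF g', THEN conjunct1] GA[OF g', THEN conjunct2]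
    have "\<epsilon> (Cod C g) \<cdot> (FA G g \<cdot> FA G f) = g \<cdot> (\<epsilon> (Dom C g) \<cdot> FA G f)"
      by (rule cmp_eq_right[OF G(2) F(1) G(1) RB(2)[OF o(3)] RB(2)[OF o(2)] g'])
    also have "\<dots> = (g \<cdot> f) \<cdot> \<epsilon> (Dom C f)"
      using F(2) cmp_assoc[OF RB(2)[OF o(1)] f' g'] by simp
    finally show "FA G (g \<cdot> f) = FA G g \<cdot>\<^bsub>full_subcategory C B\<^esub> FA G f"
      using GAu[OF cmp_hom[OF f' g'] cmp_hom[OF F(1) G(1)]] by simp
  qed (use category_axioms category_full[OF category_axioms assms(1)] in auto)
  have fun_I: "is_functor (full_subcategory C B) C id_functor"
    unfolding is_functor_def using category_axioms category_full[OF category_axioms assms(1)] assms(1)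
    by (auto simp: Hom_def)
  have "right_adjoint (full_subcategory C B) C id_functor G"
    unfolding right_adjoint_def
  proof (intro conjI exI[of _ l] ballI)
    fix c d assume c: "c \<in> Obj (full_subcategory C B)" and d: "d \<in> Obj C"
    then have cB: "c \<in> B" by simp
    show "bij_betw (l c d) (Hom C (FO id_functor c) d) (Hom (full_subcategory C B) c (FO G d))"
      unfolding id_functor_simps GO Hom_full[OF cB RB(1)[OF d]]
      by (rule bij_betw_byWitness[where f' = "\<lambda>g. \<epsilon> d \<cdot> g"])
         (use l[OF d cB] lu[OF d cB] cmp_hom[OF _ RB(2)[OF d]] in auto)
  next
    fix c c' d d' f h g
    assume "c \<in> Obj (full_subcategory C B)" "c' \<in> Obj (full_subcategory C B)" and d: "d \<in> Obj C" "d' \<in> Obj C"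
      and "f \<in> Hom (full_subcategory C B) c' c" "h \<in> Hom C (FO id_functor c) d" and g: "g \<in> Hom C d d'"
    then have c: "c \<in> B" "c' \<in> B" and f: "f \<in> Hom C c' c" and h: "h \<in> Hom C c d" by (simp_all add: Hom_full_iff)
    note L = l[OF d(1) c(1) h, THEN conjunct1] l[OF d(1) c(1) h, THEN conjunct2]
    note G = GA[OF g, THEN conjunct1] GA[OF g, THEN conjunct2]
    have k: "FA G g \<cdot> l c d h \<cdot> f \<in> Hom C c' (R d')" by (rule cmp_hom[OF f cmp_hom[OF L(1) G(1)]])
    have "\<epsilon> d' \<cdot> (FA G g \<cdot> l c d h \<cdot> f) = \<epsilon> d' \<cdot> (FA G g \<cdot> (l c d h \<cdot> f))"
      using cmp_assoc[OF f L(1) G(1)] by simp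
    also have "\<dots> = g \<cdot> (\<epsilon> d \<cdot> (l c d h \<cdot> f))"
      by (rule cmp_eq_right[OF G(2) cmp_hom[OF f L(1)] G(1) RB(2)[OF d(2)] RB(2)[OF d(1)] g])
    also have "\<epsilon> d \<cdot> (l c d h \<cdot> f) = h \<cdot> f" by (rule cmp_eq_right1[OF L(2) f L(1) RB(2)[OF d(1)]])
    also have "g \<cdot> (h \<cdot> f) = g \<cdot> h \<cdot> f" by (rule cmp_assoc[OF f h g])
    finally have "l c' d' (g \<cdot> h \<cdot> f) = FA G g \<cdot> l c d h \<cdot> f"
      using lu[OF d(2) c(2) k] by simp
    then show "l c' d' (g \<cdot> h \<cdot> FA id_functor f) = FA G g \<cdot>\<^bsub>full_subcategory C B\<^esub> l c d h \<cdot>\<^bsub>full_subcategory C B\<^esub> f"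
      by simp
  qed (rule fun_I fun_G)+
  then show ?thesis unfolding coreflective_def by blast
qed

end

section \<open>Closure properties of additive and of coreflective subcategories\<close>

locale additive_sub = cocomplete_abelian A \<kappa>
  for A :: "('o, 'm, 'x) precat_scheme" (structure) and \<kappa> :: "'u rel" +
  fixes B :: "'o set"
  assumes additive: "additive_subcategory A B"
begin

lemmas additiveD = additive[unfolded additive_subcategory_def, THEN conjunct1]
  additive[unfolded additive_subcategory_def, THEN conjunct2, THEN conjunct1]
  additive[unfolded additive_subcategory_def, THEN conjunct2, THEN conjunct2, THEN conjunct1]
  additive[unfolded additive_subcategory_def, THEN conjunct2, THEN conjunct2, THEN conjunct2]

lemma B_sub: "B \<subseteq> Obj A"
  by (rule additiveD(1))

lemma B_obj: "b \<in> B \<Longrightarrow> b \<in> Obj A"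
  using B_sub by (rule subsetD)

lemma B_iso:
  assumes "isomorphic A a b" "b \<in> B"
  shows "a \<in> B"
proof -
  obtain f where "f \<in> Hom A a b" using assms(1) unfolding isomorphic_def by (elim bexE)
  then show ?thesis using additiveD(2) assms hom_obj(1) by simp
qed

lemma B_zero: "zero_object A z \<Longrightarrow> z \<in> B"
  using additiveD(3) by simp

lemma B_binary_coproduct:
  assumes "is_coproduct A (UNIV :: bool set) X P \<iota>" "\<forall>i. X i \<in> B"
  shows "P \<in> B"
proof -
  \<comment> \<open>\<open>additive_subcategory\<close> speaks of finite sets of natural numbers as
    indices, so the Booleans \<open>True\<close> and \<open>False\<close> are renamed to 0 and
    1.\<close>
  have "bij_betw (\<lambda>n. n = (0::nat)) {0, 1} (UNIV :: bool set)" by (auto simp: bij_betw_def inj_on_def)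
  from coproduct_reindex[OF this assms(1)] show ?thesis
    using additiveD(4)[rule_format, of "{0, 1}" "\<lambda>n. X (n = 0)" P "\<lambda>n. \<iota> (n = 0)"] assms(2) by simp
qed

sublocale full: preadditive_category "full_subcategory A B"
  by (rule preadditive_full[OF B_sub])

end

locale coreflective_sub = additive_sub A \<kappa> B
  for A :: "('o, 'm, 'x) precat_scheme" (structure) and \<kappa> :: "'u rel" and B :: "'o set" +
  assumes coreflections: "M \<in> Obj A \<Longrightarrow> \<exists>R \<epsilon>. coreflection A B M R \<epsilon>"
begin

text \<open>The injections lift through the counit because the summands lie in \<open>B\<close>; the
  lifts glue to a section of the counit.\<close>

lemma B_coproduct:
  assumes "is_coproduct A I X P \<iota>" "\<forall>i\<in>I. X i \<in> B"
  shows "P \<in> B"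
proof -
  obtain R \<epsilon> where R: "coreflection A B P R \<epsilon>" using coreflections[OF coproduct_obj[OF assms(1)]] by blast
  note RD = coreflectionD[OF R]
  have "\<forall>i\<in>I. \<exists>g. g \<in> Hom A (X i) R \<and> \<epsilon> \<cdot> g = \<iota> i"
    using RD(3) coproduct_inj_ball[OF assms(1)] assms(2) by simp
  then obtain j where j: "\<forall>i\<in>I. j i \<in> Hom A (X i) R \<and> \<epsilon> \<cdot> j i = \<iota> i" by (rule bchoice[THEN exE])
  then have "\<forall>i\<in>I. j i \<in> Hom A (X i) R" by blast
  then obtain s where s: "s \<in> Hom A P R" "\<forall>i\<in>I. s \<cdot> \<iota> i = j i"
    by (rule coproduct_desc[OF assms(1) hom_obj(1)[OF RD(2)]])
  have "\<epsilon> \<cdot> s = Ide A P"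
  proof (rule coproduct_eqI[OF assms(1) cmp_hom[OF s(1) RD(2)] ide_hom[OF coproduct_obj[OF assms(1)]]])
    fix i assume i: "i \<in> I"
    show "\<epsilon> \<cdot> s \<cdot> \<iota> i = Ide A P \<cdot> \<iota> i"
      using cmp_assoc[OF coproduct_inj[OF assms(1) i] s(1) RD(2)] s(2) j i
        cmp_ide_left[OF coproduct_inj[OF assms(1) i]] by simp
  qed
  then show ?thesis using coreflection_retract[OF R s(1)] B_iso RD(1) by blast
qed

text \<open>The cokernel map lifts through the counit to some \<open>d\<close>. Uniqueness of lifts
  from \<open>X\<close> shows that \<open>d\<close> kills \<open>f\<close>, so \<open>d\<close>
  descends to a section of the counit.\<close>

lemma B_cokernel:
  assumes "f \<in> Hom A X Y" "X \<in> B" "Y \<in> B" "is_cokernel A f c"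
  shows "Cod A c \<in> B"
proof -
  note K = cokernelD[OF assms(4,1)]
  obtain R \<epsilon> where R: "coreflection A B (Cod A c) R \<epsilon>" using coreflections[OF hom_obj(2)[OF K(1)]] by blast
  note RD = coreflectionD[OF R]
  obtain d where d: "d \<in> Hom A Y R" "\<epsilon> \<cdot> d = c" using RD(3)[OF assms(3) K(1)] by blast
  have "\<epsilon> \<cdot> (d \<cdot> f) = c \<cdot> f" by (rule cmp_eq_right1[OF d(2) assms(1) d(1) RD(2)])
  then have "\<epsilon> \<cdot> (d \<cdot> f) = \<epsilon> \<cdot> Zero A X R"
    using K(2) cmp_zero_right[OF RD(2) B_obj[OF assms(2)]] by simp
  then have "d \<cdot> f = Zero A X R"
    by (rule RD(4)[OF assms(2) cmp_hom[OF assms(1) d(1)] zero_hom[OF B_obj[OF assms(2)] B_obj[OF RD(1)]]])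
  then obtain s where s: "s \<in> Hom A (Cod A c) R" "s \<cdot> c = d" using K(4)[OF d(1)] by blast
  have "(\<epsilon> \<cdot> s) \<cdot> c = Ide A (Cod A c) \<cdot> c"
    using cmp_assoc[OF K(1) s(1) RD(2)] s(2) d(2) cmp_ide_left[OF K(1)] by simp
  then have "\<epsilon> \<cdot> s = Ide A (Cod A c)"
    by (rule epicD[OF K(3) cmp_hom[OF s(1) RD(2)] ide_hom[OF hom_obj(2)[OF K(1)]]])
  then show ?thesis using coreflection_retract[OF R s(1)] B_iso RD(1) by blast
qed

lemma B_Sum:
  assumes "\<U> \<subseteq> B" "P \<in> Sum \<kappa> A \<U>"
  shows "P \<in> B"
  using assms(2) by (elim SumE, elim B_coproduct) (use assms(1) in auto)

lemma B_Pres: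
  assumes "\<U> \<subseteq> B" "Y \<in> Pres \<kappa> A \<U>"
  shows "Y \<in> B"
proof -
  obtain P Q f c where *: "P \<in> Sum \<kappa> A \<U>" "Q \<in> Sum \<kappa> A \<U>" "f \<in> Hom A P Q" "is_cokernel A f c" "c \<in> Hom A Q Y"
    using assms(2) by (rule PresE)
  show ?thesis using B_cokernel[OF *(3) B_Sum[OF assms(1) *(1)] B_Sum[OF assms(1) *(2)] *(4)] HomD(3)[OF *(5)] by simp
qed

end


section \<open>From presenting sets to abelian exact subcategories\<close>

locale presented = additive_sub A \<kappa> B
  for A :: "('o, 'm, 'x) precat_scheme" (structure) and \<kappa> :: "'u rel" and B :: "'o set" +
  fixes \<U> :: "'o set"
  assumes presenting: "presenting_set \<kappa> A B \<U>"
begin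

lemma U_small: "small \<kappa> \<U>" and U_obj: "\<U> \<subseteq> Obj A" and B_eq: "B = Pres \<kappa> A \<U>"
  using presenting by (auto simp: presenting_set_def)

lemma Sum_B: "P \<in> Sum \<kappa> A \<U> \<Longrightarrow> P \<in> B"
  using Sum_Pres B_eq by simp

lemma U_B: "U \<in> \<U> \<Longrightarrow> U \<in> B"
  by (rule Sum_B, rule Sum_generator) (use U_obj in auto)

lemma B_Gen: "Y \<in> B \<Longrightarrow> Y \<in> Gen \<kappa> A \<U>"
  using Pres_Gen B_eq by simp

lemma epic_rel_epimorphism:
  assumes "epic A p" "p \<in> Hom A P Y" "P \<in> Sum \<kappa> A \<U>" "Y \<in> B"
  shows "rel_epimorphism A \<U> p"
  using presenting assms(1,3,4) HomD[OF assms(2)] by (simp add: presenting_set_def)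

lemma epic_lift:
  assumes "epic A p" "p \<in> Hom A P Y" "P \<in> Sum \<kappa> A \<U>" "Y \<in> B" "U \<in> \<U>" "f \<in> Hom A U Y"
  obtains g where "g \<in> Hom A U P" "p \<cdot> g = f"
  by (rule rel_epimorphism_lift[OF epic_rel_epimorphism[OF assms(1-4)] assms(2) Sum_generator[OF assms(5)] assms(6)])
     (use assms(5) U_obj in auto)

text \<open>\<open>presenting_set\<close> only asserts that some kernel lies in \<open>Gen\<close>.
  This passes to every kernel of the same arrow, as these are isomorphic.\<close>

lemma Gen_kernel:
  assumes "is_kernel A f k" "f \<in> Hom A a b" "is_kernel A f k'" "Dom A k' \<in> Gen \<kappa> A \<U>"
  shows "Dom A k \<in> Gen \<kappa> A \<U>"
proof -
  obtain s t where s: "s \<in> Hom A (Dom A k') (Dom A k)" "t \<in> Hom A (Dom A k) (Dom A k')"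
    "t \<cdot> s = Ide A (Dom A k')" "s \<cdot> t = Ide A (Dom A k)"
    by (rule isomorphicE[OF kernel_iso[OF assms(3,1,2)]])
  show ?thesis by (rule Gen_quotient[OF assms(4) s(1) retraction_epic[OF s(1,2,4)]])
qed

lemma epic_kernel_Gen:
  assumes "epic A p" "p \<in> Hom A P Y" "P \<in> Sum \<kappa> A \<U>" "Y \<in> B" "is_kernel A p k"
  shows "Dom A k \<in> Gen \<kappa> A \<U>"
proof -
  obtain k' where "is_kernel A p k'" "Dom A k' \<in> Gen \<kappa> A \<U>"
    using presenting assms(1,3,4) HomD[OF assms(2)] by (auto simp: presenting_set_def)
  then show ?thesis by (rule Gen_kernel[OF assms(5,2)])
qed

lemma Sum_kernel_Gen:
  assumes "f \<in> Hom A P Q" "P \<in> Sum \<kappa> A \<U>" "Q \<in> Sum \<kappa> A \<U>" "is_kernel A f k"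
  shows "Dom A k \<in> Gen \<kappa> A \<U>"
proof -
  obtain k' where "is_kernel A f k'" "Dom A k' \<in> Gen \<kappa> A \<U>"
    using presenting assms(2,3) HomD[OF assms(1)] by (auto simp: presenting_set_def)
  then show ?thesis by (rule Gen_kernel[OF assms(4,1)])
qed

text \<open>The hypotheses \<open>sur\<close> and \<open>inj\<close> give existence and uniqueness
  of lifts for arrows from \<U>. Both extend to \<open>Sum\<close> by the universal property of
  coproducts, and then to \<open>B\<close>, whose objects are cokernels of arrows in
  \<open>Sum\<close>.\<close>

lemma coreflection_of_generators:
  assumes M: "M \<in> Obj A" and R: "R \<in> B" and \<epsilon>: "\<epsilon> \<in> Hom A R M"
    and sur: "\<And>U f. U \<in> \<U> \<Longrightarrow> f \<in> Hom A U M \<Longrightarrow> \<exists>g. g \<in> Hom A U R \<and> \<epsilon> \<cdot> g = f"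
    and inj: "\<And>U g. U \<in> \<U> \<Longrightarrow> g \<in> Hom A U R \<Longrightarrow> \<epsilon> \<cdot> g = Zero A U M \<Longrightarrow> g = Zero A U R"
  shows "coreflection A B M R \<epsilon>"
proof -
  have inj_Sum: "g = Zero A P R" if P: "P \<in> Sum \<kappa> A \<U>" and g: "g \<in> Hom A P R" "\<epsilon> \<cdot> g = Zero A P M" for P g
  proof -
    obtain I :: "'u set" and X \<iota> where X: "\<forall>i\<in>I. X i \<in> \<U>" and cP: "is_coproduct A I X P \<iota>"
      using P by (rule SumE)
    show ?thesis
    proof (rule coproduct_eqI[OF cP g(1) zero_hom[OF coproduct_obj[OF cP] B_obj[OF R]]])
      fix i assume i: "i \<in> I"
      note ii = coproduct_inj[OF cP i]
      have "\<epsilon> \<cdot> (g \<cdot> \<iota> i) = Zero A P M \<cdot> \<iota> i" by (rule cmp_eq_right1[OF g(2) ii g(1) \<epsilon>])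
      then have "g \<cdot> \<iota> i = Zero A (X i) R"
        using inj[OF bspec[OF X i] cmp_hom[OF ii g(1)]] cmp_zero_left[OF ii M] by simp
      then show "g \<cdot> \<iota> i = Zero A P R \<cdot> \<iota> i" using cmp_zero_left[OF ii B_obj[OF R]] by simp
    qed
  qed
  have sur_Sum: "\<exists>g. g \<in> Hom A P R \<and> \<epsilon> \<cdot> g = f" if P: "P \<in> Sum \<kappa> A \<U>" and f: "f \<in> Hom A P M" for P f
  proof -
    have "rel_epimorphism A \<U> \<epsilon>"
      unfolding rel_epimorphism_def HomD[OF \<epsilon>]
    proof (intro conjI ballI equalityI subsetI)
      fix U f assume "U \<in> \<U>" "f \<in> Hom A U M"
      then show "f \<in> (\<lambda>g. \<epsilon> \<cdot> g) ` Hom A U R" using sur by blast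
    next
      fix U f assume "U \<in> \<U>" "f \<in> (\<lambda>g. \<epsilon> \<cdot> g) ` Hom A U R"
      then show "f \<in> Hom A U M" using cmp_hom[OF _ \<epsilon>] by auto
    qed (rule HomD(1)[OF \<epsilon>])
    then show ?thesis by (rule rel_epimorphism_lift[OF _ \<epsilon> P f]) blast
  qed
  show ?thesis
    unfolding coreflection_def
  proof (intro conjI ballI R \<epsilon>)
    fix X f assume XB: "X \<in> B" and f: "f \<in> Hom A X M"
    have "X \<in> Pres \<kappa> A \<U>" using XB B_eq by simp
    then obtain P Q d c where P: "P \<in> Sum \<kappa> A \<U>" and Q: "Q \<in> Sum \<kappa> A \<U>" and d: "d \<in> Hom A P Q"
      and c: "is_cokernel A d c" "c \<in> Hom A Q X" "epic A c" by (rule PresE)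
    note K = cokernelD[OF c(1) d, unfolded HomD(3)[OF c(2)]]
    note fc = cmp_hom[OF c(2) f]
    obtain g where g: "g \<in> Hom A Q R" "\<epsilon> \<cdot> g = f \<cdot> c" using sur_Sum[OF Q fc] by blast
    \<comment> \<open>The lift \<open>g\<close> of \<open>f \<cdot> c\<close> kills the relations
      \<open>d\<close>, because no nonzero arrow from \<open>Sum\<close> to \<open>R\<close> is
      annihilated by \<epsilon>; so \<open>g\<close> descends along \<open>c\<close>.\<close>
    have "\<epsilon> \<cdot> (g \<cdot> d) = f \<cdot> (c \<cdot> d)" by (rule cmp_eq_right[OF g(2) d g(1) \<epsilon> c(2) f])
    then have "\<epsilon> \<cdot> (g \<cdot> d) = Zero A P M" using K(2) cmp_zero_right[OF f Sum_obj[OF P]] by simp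
    then have "g \<cdot> d = Zero A P R" by (rule inj_Sum[OF P cmp_hom[OF d g(1)]])
    then obtain h where h: "h \<in> Hom A X R" "h \<cdot> c = g" using K(4)[OF g(1)] by blast
    have "(\<epsilon> \<cdot> h) \<cdot> c = f \<cdot> c" using cmp_assoc[OF c(2) h(1) \<epsilon>] h(2) g(2) by simp
    then have eh: "\<epsilon> \<cdot> h = f" using epicD[OF c(3), of "\<epsilon> \<cdot> h" M f] cmp_hom[OF h(1) \<epsilon>] f HomD(3)[OF c(2)] by simp
    show "\<exists>!g. g \<in> Hom A X R \<and> \<epsilon> \<cdot> g = f"
    proof (rule ex1I[of _ h])
      fix l assume l: "l \<in> Hom A X R \<and> \<epsilon> \<cdot> l = f"
      \<comment> \<open>The difference of two lifts is killed by \<epsilon>; so it vanishes on the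
        cover \<open>c\<close>, hence is zero.\<close>
      let ?n = "Add A l (neg h)"
      have n: "?n \<in> Hom A X R" using l h(1) add_hom neg_hom by blast
      have "\<epsilon> \<cdot> ?n = Zero A X M"
        using cmp_add_right[OF conjunct1[OF l] neg_hom[OF h(1)] \<epsilon>] cmp_neg_right[OF h(1) \<epsilon>] l eh add_neg[OF f] by simp
      then have "\<epsilon> \<cdot> (?n \<cdot> c) = Zero A Q M"
        using cmp_assoc[OF c(2) n \<epsilon>] cmp_zero_left[OF c(2) M] by simp
      then have "?n \<cdot> c = Zero A Q R" by (rule inj_Sum[OF Q cmp_hom[OF c(2) n]])
      then have "?n = Zero A X R" by (rule epic_zero[OF c(3,2) n])
      then show "l = h" using sub_eq_zero[OF conjunct1[OF l] h(1)] by simp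
    qed (use h eh in simp)
  qed
qed

text \<open>The coreflection of \<open>M\<close> is the cokernel of the trace of \<open>\<U>\<close> in the kernel of the trace of \<open>\<U>\<close> in \<open>M\<close>.\<close>

lemma coreflection_ex:
  assumes M: "M \<in> Obj A"
  shows "\<exists>R \<epsilon>. coreflection A B M R \<epsilon>"
proof -
  obtain P \<iota> q where cP: "is_coproduct A (SIGMA U:\<U>. Hom A U M) fst P \<iota>" and P: "P \<in> Sum \<kappa> A \<U>" and q: "q \<in> Hom A P M"
    and qi: "\<forall>i\<in>(SIGMA U:\<U>. Hom A U M). q \<cdot> \<iota> i = snd i"
    by (rule trace_coproduct[OF U_small U_obj M])
  obtain k K where k: "is_kernel A q k" "k \<in> Hom A K P" by (rule kernel_ex[OF q])
  note KD = kernelD[OF k(1) q, unfolded HomD(2)[OF k(2)]]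
  obtain P' \<iota>' r where cP': "is_coproduct A (SIGMA U:\<U>. Hom A U K) fst P' \<iota>'" and P': "P' \<in> Sum \<kappa> A \<U>" and r: "r \<in> Hom A P' K"
    and ri: "\<forall>i\<in>(SIGMA U:\<U>. Hom A U K). r \<cdot> \<iota>' i = snd i"
    by (rule trace_coproduct[OF U_small U_obj hom_obj(1)[OF k(2)]])
  note kr = cmp_hom[OF r k(2)]
  obtain c R where c: "is_cokernel A (k \<cdot> r) c" "c \<in> Hom A P R" by (rule cokernel_ex[OF kr])
  note CD = cokernelD[OF c(1) kr, unfolded HomD(3)[OF c(2)]]
  \<comment> \<open>\<open>R\<close> is presented by \<open>k \<cdot> r\<close>, an arrow between
    objects of \<open>Sum\<close>, so it lies in \<open>B\<close> by (a).\<close>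
  have R: "R \<in> B" using PresI[OF kr P' P c(1)] HomD(3)[OF c(2)] B_eq by simp
  have "q \<cdot> (k \<cdot> r) = Zero A K M \<cdot> r" by (rule cmp_eq_right1[OF KD(2) r k(2) q])
  then have "q \<cdot> (k \<cdot> r) = Zero A P' M" using cmp_zero_left[OF r M] by simp
  then obtain \<epsilon> where e: "\<epsilon> \<in> Hom A R M" "\<epsilon> \<cdot> c = q" using CD(4)[OF q] by blast
  have "coreflection A B M R \<epsilon>"
  proof (rule coreflection_of_generators[OF M R e(1)])
    fix U f assume U: "U \<in> \<U>" and f: "f \<in> Hom A U M"
    have i: "(U, f) \<in> (SIGMA U:\<U>. Hom A U M)" using U f by simp
    note ii = coproduct_inj[OF cP i, unfolded fst_conv]
    have "\<epsilon> \<cdot> (c \<cdot> \<iota> (U, f)) = q \<cdot> \<iota> (U, f)" by (rule cmp_eq_right1[OF e(2) ii c(2) e(1)])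
    also have "\<dots> = f" using bspec[OF qi i] by simp
    finally show "\<exists>g. g \<in> Hom A U R \<and> \<epsilon> \<cdot> g = f" using cmp_hom[OF ii c(2)] by blast
  next
    fix U g assume U: "U \<in> \<U>" and g: "g \<in> Hom A U R" "\<epsilon> \<cdot> g = Zero A U M"
    \<comment> \<open>Condition (b) enters here: an arrow from \<U> to the quotient \<open>R\<close>
      lifts to \<open>P\<close>. The lift lies in the kernel of \<open>q\<close>, so it factors
      through the trace \<open>k \<cdot> r\<close>, which \<open>c\<close> kills.\<close>
    obtain h where h: "h \<in> Hom A U P" "c \<cdot> h = g" by (rule epic_lift[OF CD(3) c(2) P R U g(1)])
    have "\<epsilon> \<cdot> (c \<cdot> h) = q \<cdot> h" by (rule cmp_eq_right1[OF e(2) h(1) c(2) e(1)])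
    then have "q \<cdot> h = Zero A U M" using h(2) g(2) by simp
    then obtain l where l: "l \<in> Hom A U K" "k \<cdot> l = h" using KD(4)[OF h(1)] by blast
    have i: "(U, l) \<in> (SIGMA U:\<U>. Hom A U K)" using U l by simp
    note ii = coproduct_inj[OF cP' i, unfolded fst_conv]
    have "h = k \<cdot> (r \<cdot> \<iota>' (U, l))" using bspec[OF ri i] l(2) by simp
    also have "\<dots> = (k \<cdot> r) \<cdot> \<iota>' (U, l)" by (rule cmp_assoc[OF ii r k(2)])
    finally have "g = c \<cdot> ((k \<cdot> r) \<cdot> \<iota>' (U, l))" using h(2) by simp
    also have "\<dots> = Zero A P' R \<cdot> \<iota>' (U, l)" by (rule cmp_eq_right1[OF CD(2) ii kr c(2)])
    finally show "g = Zero A U R" using cmp_zero_left[OF ii B_obj[OF R]] by simp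
  qed
  then show ?thesis by blast
qed

sublocale coreflective_sub A \<kappa> B
  by unfold_locales (rule coreflection_ex)

section \<open>Kernels of morphisms of \<open>B\<close>\<close>

text \<open>The target \<open>Y\<close> is replaced by a sum. Given a cover \<open>q\<close> of
  \<open>Y\<close> by \<open>V\<close> in \<open>Sum\<close>, condition (b) lifts \<open>f\<close>
  to \<open>g\<close> and covers the kernel \<open>L\<close> of \<open>q\<close> by some
  \<open>W\<close> in \<open>Sum\<close>. The part of \<open>P \<oplus> W\<close> on which
  \<open>g\<close> and \<open>l \<cdot> w\<close> agree is the kernel of an arrow between sums, so
  it is in \<open>Gen\<close> by (c), and it maps onto the kernel of \<open>f\<close>.\<close>

lemma Sum_B_kernel_Gen:
  assumes f: "f \<in> Hom A P Y" and P: "P \<in> Sum \<kappa> A \<U>" and Y: "Y \<in> B" and k: "is_kernel A f k"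
  shows "Dom A k \<in> Gen \<kappa> A \<U>"
proof -
  note KD = kernelD[OF k f]
  let ?K = "Dom A k"
  obtain V q where V: "V \<in> Sum \<kappa> A \<U>" and q: "q \<in> Hom A V Y" "epic A q" using B_Gen[OF Y] by (rule GenE)
  obtain g where g: "g \<in> Hom A P V" "q \<cdot> g = f"
    by (rule rel_epimorphism_lift[OF epic_rel_epimorphism[OF q(2,1) V Y] q(1) P f])
  obtain l L where l: "is_kernel A q l" "l \<in> Hom A L V" by (rule kernel_ex[OF q(1)])
  note LD = kernelD[OF l(1) q(1), unfolded HomD(2)[OF l(2)]]
  have "L \<in> Gen \<kappa> A \<U>" using epic_kernel_Gen[OF q(2,1) V Y l(1)] HomD(2)[OF l(2)] by simp
  then obtain W w where W: "W \<in> Sum \<kappa> A \<U>" and w: "w \<in> Hom A W L" "epic A w" by (rule GenE)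
  have o: "P \<in> Obj A" "W \<in> Obj A" "Y \<in> Obj A" "V \<in> Obj A" using P W V Sum_obj B_obj[OF Y] by auto
  obtain S i1 i2 p1 p2 where cS: "is_coproduct A (UNIV :: bool set) (\<lambda>i. if i then P else W) S (\<lambda>i. if i then i1 else i2)"
    and i: "i1 \<in> Hom A P S" "i2 \<in> Hom A W S" and p: "p1 \<in> Hom A S P" "p2 \<in> Hom A S W"
    and pi: "p1 \<cdot> i1 = Ide A P" "p2 \<cdot> i2 = Ide A W" "p1 \<cdot> i2 = Zero A W P" "p2 \<cdot> i1 = Zero A P W"
    by (rule biproduct[OF o(1,2)])
  have S: "S \<in> Sum \<kappa> A \<U>" by (rule Sum_binary[OF P W cS])
  note lw = cmp_hom[OF w(1) l(2)]
  note gp = cmp_hom[OF p(1) g(1)] and lwp = cmp_hom[OF p(2) lw]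
  define d where "d = Add A (g \<cdot> p1) (neg (l \<cdot> w \<cdot> p2))"
  have d: "d \<in> Hom A S V" unfolding d_def by (rule add_hom[OF gp neg_hom[OF lwp]])
  \<comment> \<open>The difference \<open>d\<close> encodes the agreement of \<open>g\<close> and
    \<open>l \<cdot> w\<close>. One direction of this equivalence gives the map \<open>a\<close>
    from \<open>N\<close> to the kernel of \<open>f\<close>, the other shows that \<open>a\<close>
    is epic.\<close>
  have dx: "d \<cdot> x = Zero A z V \<longleftrightarrow> g \<cdot> (p1 \<cdot> x) = l \<cdot> (w \<cdot> (p2 \<cdot> x))" if x: "x \<in> Hom A z S" for x z
  proof -
    note px = cmp_hom[OF x p(1)] cmp_hom[OF x p(2)]
    have "d \<cdot> x = Add A (g \<cdot> p1 \<cdot> x) (neg (l \<cdot> w \<cdot> p2) \<cdot> x)"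
      unfolding d_def by (rule cmp_add_left[OF x gp neg_hom[OF lwp]])
    also have "\<dots> = Add A (g \<cdot> (p1 \<cdot> x)) (neg (l \<cdot> (w \<cdot> (p2 \<cdot> x))))"
      using cmp_neg_left[OF x lwp] cmp_assoc[OF x p(1) g(1)] cmp_assoc[OF x p(2) lw] cmp_assoc[OF px(2) w(1) l(2)] by simp
    finally show ?thesis
      using sub_eq_zero[OF cmp_hom[OF px(1) g(1)] cmp_hom[OF cmp_hom[OF px(2) w(1)] l(2)]] by simp
  qed
  obtain n N where n: "is_kernel A d n" "n \<in> Hom A N S" by (rule kernel_ex[OF d])
  note ND = kernelD[OF n(1) d, unfolded HomD(2)[OF n(2)]]
  have N: "N \<in> Gen \<kappa> A \<U>" using Sum_kernel_Gen[OF d S V n(1)] HomD(2)[OF n(2)] by simp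
  note pn = cmp_hom[OF n(2) p(1)] cmp_hom[OF n(2) p(2)]
  note wpn = cmp_hom[OF pn(2) w(1)]
  have "f \<cdot> (p1 \<cdot> n) = q \<cdot> (g \<cdot> (p1 \<cdot> n))" by (rule cmp_eq_right1[symmetric, OF g(2) pn(1) g(1) q(1)])
  also have "g \<cdot> (p1 \<cdot> n) = l \<cdot> (w \<cdot> (p2 \<cdot> n))" using dx[OF n(2)] ND(2) by simp
  also have "q \<cdot> (l \<cdot> (w \<cdot> (p2 \<cdot> n))) = Zero A L Y \<cdot> (w \<cdot> (p2 \<cdot> n))" by (rule cmp_eq_right1[OF LD(2) wpn l(2) q(1)])
  also have "\<dots> = Zero A N Y" by (rule cmp_zero_left[OF wpn o(3)])
  finally obtain a where a: "a \<in> Hom A N ?K" "k \<cdot> a = p1 \<cdot> n" using KD(4)[OF pn(1)] by blast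
  note gk = cmp_hom[OF KD(1) g(1)]
  have "q \<cdot> (g \<cdot> k) = f \<cdot> k" by (rule cmp_eq_right1[OF g(2) KD(1) g(1) q(1)])
  then obtain m where m: "m \<in> Hom A ?K L" "l \<cdot> m = g \<cdot> k" using LD(4)[OF gk] KD(2) by auto
  \<comment> \<open>To see that \<open>a\<close> is epic, \<open>m\<close> is pulled back along the
    cover \<open>w\<close>. The arrows \<open>k \<cdot> \<alpha>\<close> and \<beta> together form
    an arrow into \<open>N\<close> that lies over \<alpha>, so \<alpha> factors through
    \<open>a\<close>.\<close>
  obtain N' \<alpha> \<beta> where \<alpha>: "\<alpha> \<in> Hom A N' ?K" "epic A \<alpha>" and \<beta>: "\<beta> \<in> Hom A N' W" and ab: "w \<cdot> \<beta> = m \<cdot> \<alpha>"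
    by (rule epic_pullback[OF w(2,1) m(1)])
  note ka = cmp_hom[OF \<alpha>(1) KD(1)]
  note ik = cmp_hom[OF ka i(1)] and ib = cmp_hom[OF \<beta> i(2)]
  have N'o: "N' \<in> Obj A" using hom_obj[OF \<beta>] by simp
  define t where "t = Add A (i1 \<cdot> (k \<cdot> \<alpha>)) (i2 \<cdot> \<beta>)"
  have t: "t \<in> Hom A N' S" unfolding t_def by (rule add_hom[OF ik ib])
  have "p1 \<cdot> t = Add A (p1 \<cdot> (i1 \<cdot> (k \<cdot> \<alpha>))) (p1 \<cdot> (i2 \<cdot> \<beta>))" unfolding t_def by (rule cmp_add_right[OF ik ib p(1)])
  also have "p1 \<cdot> (i1 \<cdot> (k \<cdot> \<alpha>)) = Ide A P \<cdot> (k \<cdot> \<alpha>)" by (rule cmp_eq_right1[OF pi(1) ka i(1) p(1)])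
  also have "p1 \<cdot> (i2 \<cdot> \<beta>) = Zero A W P \<cdot> \<beta>" by (rule cmp_eq_right1[OF pi(3) \<beta> i(2) p(1)])
  finally have p1t: "p1 \<cdot> t = k \<cdot> \<alpha>"
    using cmp_ide_left[OF ka] cmp_zero_left[OF \<beta> o(1)] add_zero_right[OF ka] by simp
  have "p2 \<cdot> t = Add A (p2 \<cdot> (i1 \<cdot> (k \<cdot> \<alpha>))) (p2 \<cdot> (i2 \<cdot> \<beta>))" unfolding t_def by (rule cmp_add_right[OF ik ib p(2)])
  also have "p2 \<cdot> (i1 \<cdot> (k \<cdot> \<alpha>)) = Zero A P W \<cdot> (k \<cdot> \<alpha>)" by (rule cmp_eq_right1[OF pi(4) ka i(1) p(2)])
  also have "p2 \<cdot> (i2 \<cdot> \<beta>) = Ide A W \<cdot> \<beta>" by (rule cmp_eq_right1[OF pi(2) \<beta> i(2) p(2)])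
  finally have p2t: "p2 \<cdot> t = \<beta>"
    using cmp_ide_left[OF \<beta>] cmp_zero_left[OF ka o(2)] add_zero_left[OF \<beta>] by simp
  have "g \<cdot> (k \<cdot> \<alpha>) = l \<cdot> (m \<cdot> \<alpha>)" by (rule cmp_eq_right[OF m(2)[symmetric] \<alpha>(1) KD(1) g(1) m(1) l(2)])
  then have "d \<cdot> t = Zero A N' V" using dx[OF t] p1t p2t ab by simp
  then obtain \<gamma> where \<gamma>: "\<gamma> \<in> Hom A N' N" "n \<cdot> \<gamma> = t" using ND(4)[OF t] by blast
  have "k \<cdot> (a \<cdot> \<gamma>) = p1 \<cdot> (n \<cdot> \<gamma>)" by (rule cmp_eq_right[OF a(2) \<gamma>(1) a(1) KD(1) n(2) p(1)])
  then have "k \<cdot> (a \<cdot> \<gamma>) = k \<cdot> \<alpha>" using \<gamma>(2) p1t by simp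
  then have "a \<cdot> \<gamma> = \<alpha>" by (rule monicD[OF KD(3) cmp_hom[OF \<gamma>(1) a(1)] \<alpha>(1)])
  then have "epic A a" using epic_factor[of a \<gamma>] \<alpha>(2) HomD[OF a(1)] HomD[OF \<gamma>(1)] by simp
  then show ?thesis by (rule Gen_quotient[OF N a(1)])
qed

text \<open>The source \<open>X\<close> is replaced by a cover \<open>p\<close> from
  \<open>Sum\<close>. The kernel of \<open>f \<cdot> p\<close> is in \<open>Gen\<close> by the
  preceding case, and it maps onto the kernel of \<open>f\<close>, being the pullback of it along
  \<open>p\<close>.\<close>

lemma B_kernel_Gen:
  assumes f: "f \<in> Hom A X Y" and X: "X \<in> B" and Y: "Y \<in> B" and k: "is_kernel A f k"
  shows "Dom A k \<in> Gen \<kappa> A \<U>"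
proof -
  note KD = kernelD[OF k f]
  let ?K = "Dom A k"
  obtain P p where P: "P \<in> Sum \<kappa> A \<U>" and p: "p \<in> Hom A P X" "epic A p" using B_Gen[OF X] by (rule GenE)
  note fp = cmp_hom[OF p(1) f]
  obtain k' K' where k': "is_kernel A (f \<cdot> p) k'" "k' \<in> Hom A K' P" by (rule kernel_ex[OF fp])
  note KD' = kernelD[OF k'(1) fp, unfolded HomD(2)[OF k'(2)]]
  have K': "K' \<in> Gen \<kappa> A \<U>" using Sum_B_kernel_Gen[OF fp P Y k'(1)] HomD(2)[OF k'(2)] by simp
  note pk = cmp_hom[OF k'(2) p(1)]
  have "f \<cdot> (p \<cdot> k') = Zero A K' Y" using KD'(2) cmp_assoc[OF k'(2) p(1) f] by simp
  then obtain a where a: "a \<in> Hom A K' ?K" "k \<cdot> a = p \<cdot> k'" using KD(4)[OF pk] by blast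
  obtain N \<alpha> \<beta> where \<alpha>: "\<alpha> \<in> Hom A N ?K" "epic A \<alpha>" and \<beta>: "\<beta> \<in> Hom A N P" and ab: "p \<cdot> \<beta> = k \<cdot> \<alpha>"
    by (rule epic_pullback[OF p(2,1) KD(1)])
  have "f \<cdot> (k \<cdot> \<alpha>) = Zero A ?K Y \<cdot> \<alpha>" by (rule cmp_eq_right1[OF KD(2) \<alpha>(1) KD(1) f])
  then have "f \<cdot> p \<cdot> \<beta> = Zero A N Y" using ab cmp_assoc[OF \<beta> p(1) f] cmp_zero_left[OF \<alpha>(1) B_obj[OF Y]] by simp
  then obtain \<gamma> where \<gamma>: "\<gamma> \<in> Hom A N K'" "k' \<cdot> \<gamma> = \<beta>" using KD'(4)[OF \<beta>] by blast
  have "k \<cdot> (a \<cdot> \<gamma>) = p \<cdot> (k' \<cdot> \<gamma>)" by (rule cmp_eq_right[OF a(2) \<gamma>(1) a(1) KD(1) k'(2) p(1)])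
  then have "k \<cdot> (a \<cdot> \<gamma>) = k \<cdot> \<alpha>" using \<gamma>(2) ab by simp
  then have "a \<cdot> \<gamma> = \<alpha>" by (rule monicD[OF KD(3) cmp_hom[OF \<gamma>(1) a(1)] \<alpha>(1)])
  then have "epic A a" using epic_factor[of a \<gamma>] \<alpha>(2) HomD[OF a(1)] HomD[OF \<gamma>(1)] by simp
  then show ?thesis by (rule Gen_quotient[OF K' a(1)])
qed

text \<open>Membership in \<open>Gen\<close> yields a cover \<open>r\<close> by \<open>V\<close> in
  \<open>Sum\<close>. The kernel of \<open>r\<close> is also that of \<open>k \<cdot> r\<close>, an
  arrow of \<open>B\<close>, so it is again in \<open>Gen\<close>; covering it by \<open>W\<close>
  presents the kernel of \<open>f\<close> as the cokernel of an arrow from \<open>W\<close> to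
  \<open>V\<close>.\<close>

lemma B_kernel:
  assumes f: "f \<in> Hom A X Y" and X: "X \<in> B" and Y: "Y \<in> B" and k: "is_kernel A f k"
  shows "Dom A k \<in> B"
proof -
  note KD = kernelD[OF k f]
  let ?K = "Dom A k"
  obtain V r where V: "V \<in> Sum \<kappa> A \<U>" and r: "r \<in> Hom A V ?K" "epic A r"
    using B_kernel_Gen[OF assms] by (rule GenE)
  note kr = cmp_hom[OF r(1) KD(1)]
  obtain l L where l: "is_kernel A (k \<cdot> r) l" "l \<in> Hom A L V" by (rule kernel_ex[OF kr])
  have lr: "is_kernel A r l" by (rule kernel_monic_cmp_iff[OF l(1) r(1) KD(3,1)])
  have "L \<in> Gen \<kappa> A \<U>" using B_kernel_Gen[OF kr Sum_B[OF V] X l(1)] HomD(2)[OF l(2)] by simp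
  then obtain W w where W: "W \<in> Sum \<kappa> A \<U>" and w: "w \<in> Hom A W L" "epic A w" by (rule GenE)
  have "is_cokernel A (l \<cdot> w) r"
    by (rule cokernel_epic_cmp[OF epic_cokernel_of_kernel[OF r(2) lr r(1)] l(2) w(2,1)])
  then have "Cod A r \<in> Pres \<kappa> A \<U>" by (rule PresI[OF cmp_hom[OF w(1) l(2)] W V])
  then show ?thesis using HomD(3)[OF r(1)] B_eq by simp
qed

section \<open>Exactness of the inclusion of \<open>B\<close> and projectivity of \<U>\<close>

text \<open>The kernel taken in \<open>A\<close> lies in \<open>B\<close>, so an arrow that is monic
  in \<open>B\<close> has zero kernel in \<open>A\<close> already.\<close>

lemma monic_full_iff:
  assumes "f \<in> Hom A X Y" "X \<in> B" "Y \<in> B"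
  shows "monic (full_subcategory A B) f \<longleftrightarrow> monic A f"
proof
  assume m: "monic (full_subcategory A B) f"
  obtain k K where k: "is_kernel A f k" "k \<in> Hom A K X" by (rule kernel_ex[OF assms(1)])
  note KD = kernelD[OF k(1) assms(1), unfolded HomD(2)[OF k(2)]]
  have K: "K \<in> B" using B_kernel[OF assms k(1)] HomD(2)[OF k(2)] by simp
  have "k = Zero A K X"
    by (rule full.monic_zero[OF m, of X Y, unfolded full_subcategory_simps']) (use assms k K KD(2) in
        \<open>simp_all add: Hom_full_iff\<close>)
  show "monic A f"
  proof (rule monicI_zero[OF assms(1)])
    fix a g assume g: "g \<in> Hom A a X" "f \<cdot> g = Zero A a Y"
    obtain h where "h \<in> Hom A a K" "k \<cdot> h = g" using KD(4)[OF g] by blast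
    then show "g = Zero A a X" using cmp_zero_left[of h a K X] \<open>k = _\<close> B_obj[OF assms(2)] by simp
  qed
next
  show "monic A f \<Longrightarrow> monic (full_subcategory A B) f" by (rule monic_fullI[OF _ B_sub assms])
qed

lemma epic_full_iff:
  assumes "f \<in> Hom A X Y" "X \<in> B" "Y \<in> B"
  shows "epic (full_subcategory A B) f \<longleftrightarrow> epic A f"
proof
  assume m: "epic (full_subcategory A B) f"
  obtain c Q where c: "is_cokernel A f c" "c \<in> Hom A Y Q" by (rule cokernel_ex[OF assms(1)])
  note CD = cokernelD[OF c(1) assms(1), unfolded HomD(3)[OF c(2)]]
  have Q: "Q \<in> B" using B_cokernel[OF assms c(1)] HomD(3)[OF c(2)] by simp
  have "c = Zero A Y Q"
    by (rule full.epic_zero[OF m, of X Y, unfolded full_subcategory_simps']) (use assms c Q CD(2) in \<open>simp_all add: Hom_full_iff\<close>)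
  show "epic A f"
  proof (rule epicI_zero[OF assms(1)])
    fix a g assume g: "g \<in> Hom A Y a" "g \<cdot> f = Zero A X a"
    obtain h where h: "h \<in> Hom A Q a" "h \<cdot> c = g" using CD(4)[OF g] by blast
    then show "g = Zero A Y a" using cmp_zero_right[OF h(1) B_obj[OF assms(3)]] \<open>c = _\<close> by simp
  qed
next
  show "epic A f \<Longrightarrow> epic (full_subcategory A B) f" by (rule epic_fullI[OF _ B_sub assms])
qed

text \<open>Kernels, cokernels and binary coproducts formed in \<open>A\<close> stay in
  \<open>B\<close>. Normality is inherited because the monomorphisms and epimorphisms of
  \<open>B\<close> are those of \<open>A\<close>.\<close>

lemma abelian_full: "abelian_category (full_subcategory A B)"
proof (intro abelian_category.intro abelian_category_axioms.intro full.preadditive_category_axioms)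
  obtain z where z: "zero_object A z" using has_zero by blast
  have "zero_object (full_subcategory A B) z"
  proof (rule full.zero_objectI)
    have "z \<in> Obj A" using z by (simp add: zero_object_def)
    then show "Ide (full_subcategory A B) z = Zero (full_subcategory A B) z z"
      using zero_object_Zero(1)[OF z _ ide_hom] by simp
  qed (use B_zero[OF z] in simp)
  then show "\<exists>z. zero_object (full_subcategory A B) z" by blast
next
  fix a b assume "a \<in> Obj (full_subcategory A B)" "b \<in> Obj (full_subcategory A B)"
  then have ab: "a \<in> B" "b \<in> B" by simp_all
  obtain P \<iota> where P: "is_coproduct A (UNIV :: bool set) (\<lambda>i. if i then a else b) P \<iota>"
    using has_binary_coproducts[OF B_obj B_obj, OF ab] by blast
  have "P \<in> B" by (rule B_binary_coproduct[OF P]) (use ab in simp)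
  then have "is_coproduct (full_subcategory A B) (UNIV :: bool set) (\<lambda>i. if i then a else b) P \<iota>"
    by (rule is_coproduct_fullI[OF P B_sub, rotated]) (use ab in simp)
  then show "\<exists>P \<iota>. is_coproduct (full_subcategory A B) (UNIV :: bool set) (\<lambda>i. if i then a else b) P \<iota>"
    by (intro exI)
next
  fix f assume "f \<in> Arr (full_subcategory A B)"
  then have f: "f \<in> Hom A (Dom A f) (Cod A f)" "Dom A f \<in> B" "Cod A f \<in> B" by (auto simp: Hom_def)
  obtain k K where k: "is_kernel A f k" "k \<in> Hom A K (Dom A f)" by (rule kernel_ex[OF f(1)])
  show "\<exists>k. is_kernel (full_subcategory A B) f k"
    using is_kernel_fullI[OF k(1) B_sub f(2,3) B_kernel[OF f k(1)]] by blast
  obtain c Q where c: "is_cokernel A f c" "c \<in> Hom A (Cod A f) Q" by (rule cokernel_ex[OF f(1)])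
  show "\<exists>c. is_cokernel (full_subcategory A B) f c"
    using is_cokernel_fullI[OF c(1) B_sub f(2,3) B_cokernel[OF f c(1)]] by blast
next
  fix m assume m: "monic (full_subcategory A B) m"
  then have "m \<in> Arr (full_subcategory A B)" by (simp add: monic_def)
  then have f: "m \<in> Hom A (Dom A m) (Cod A m)" "Dom A m \<in> B" "Cod A m \<in> B" by (auto simp: Hom_def)
  have mA: "monic A m" using m monic_full_iff[OF f] by simp
  obtain c Q where c: "is_cokernel A m c" "c \<in> Hom A (Cod A m) Q" by (rule cokernel_ex[OF f(1)])
  have "is_kernel A c m" by (rule monic_kernel_of_cokernel[OF mA c(1) f(1)])
  then have "is_kernel (full_subcategory A B) c m"
    by (rule is_kernel_fullI[OF _ B_sub]) (use f B_cokernel[OF f c(1)] HomD[OF c(2)] in simp_all)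
  then show "\<exists>f. is_kernel (full_subcategory A B) f m" by blast
next
  fix e assume e: "epic (full_subcategory A B) e"
  then have "e \<in> Arr (full_subcategory A B)" by (simp add: epic_def)
  then have f: "e \<in> Hom A (Dom A e) (Cod A e)" "Dom A e \<in> B" "Cod A e \<in> B" by (auto simp: Hom_def)
  have eA: "epic A e" using e epic_full_iff[OF f] by simp
  obtain k K where k: "is_kernel A e k" "k \<in> Hom A K (Dom A e)" by (rule kernel_ex[OF f(1)])
  have "is_cokernel A k e" by (rule epic_cokernel_of_kernel[OF eA k(1) f(1)])
  then have "is_cokernel (full_subcategory A B) k e"
    by (rule is_cokernel_fullI[OF _ B_sub]) (use f B_kernel[OF f k(1)] HomD[OF k(2)] in simp_all)
  then show "\<exists>f. is_cokernel (full_subcategory A B) f e" by blast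
qed

text \<open>A kernel in \<open>B\<close> is tested against objects of \<open>B\<close> only. The
  kernel of \<open>g\<close> in \<open>A\<close> is such an object, so it factors through
  \<open>f\<close>, and then so does every arrow of \<open>A\<close> that \<open>g\<close>
  kills.\<close>

lemma exact_full: "exact_functor (full_subcategory A B) A id_functor"
  unfolding exact_functor_def
proof (intro conjI allI impI)
  show "additive_functor (full_subcategory A B) A id_functor"
    unfolding additive_functor_def is_functor_def
    using category_axioms full.category_axioms B_obj by (auto simp: Hom_def)
  fix f g assume "short_exact (full_subcategory A B) f g"
  then have K: "is_kernel (full_subcategory A B) g f" and C: "is_cokernel (full_subcategory A B) f g"
    by (simp_all add: short_exact_def)
  have g: "g \<in> Hom A (Dom A g) (Cod A g)" "Dom A g \<in> B" "Cod A g \<in> B"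
    using K by (auto simp: is_kernel_def Hom_def)
  have f: "f \<in> Hom A (Dom A f) (Dom A g)" "Dom A f \<in> B"
    using K by (auto simp: is_kernel_def Hom_def)
  have gF: "g \<in> Hom (full_subcategory A B) (Dom A g) (Cod A g)" and fF: "f \<in> Hom (full_subcategory A B) (Dom A f) (Dom A g)"
    using f g by simp_all
  note KF = full.kernelD[OF K gF, unfolded full_subcategory_simps full_subcategory_simps']
    and CF = full.cokernelD[OF C fF, unfolded full_subcategory_simps full_subcategory_simps']
  have mf: "monic A f" using KF(3) monic_full_iff[OF f(1,2) g(2)] by simp
  have "is_kernel A g f"
  proof (rule kernelI[OF g(1) f(1) KF(2) mf])
    fix x h assume h: "h \<in> Hom A x (Dom A g)" "g \<cdot> h = Zero A x (Cod A g)"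
    obtain k M where k: "is_kernel A g k" "k \<in> Hom A M (Dom A g)" by (rule kernel_ex[OF g(1)])
    note KD = kernelD[OF k(1) g(1), unfolded HomD(2)[OF k(2)]]
    have M: "M \<in> B" using B_kernel[OF g k(1)] HomD(2)[OF k(2)] by simp
    obtain s where s: "s \<in> Hom A M (Dom A f)" "f \<cdot> s = k"
      using KF(4)[of k M] k(2) KD(2) M f g by auto
    obtain l where l: "l \<in> Hom A x M" "k \<cdot> l = h" using KD(4)[OF h] by blast
    have "f \<cdot> (s \<cdot> l) = k \<cdot> l" by (rule cmp_eq_right1[OF s(2) l(1) s(1) f(1)])
    then show "\<exists>h'\<in>Hom A x (Dom A f). f \<cdot> h' = h" using l(2) cmp_hom[OF l(1) s(1)] by blast
  qed
  moreover have "is_cokernel A f g"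
    by (rule epic_cokernel_of_kernel[OF _ calculation g(1)]) (use CF(3) epic_full_iff[OF g] in simp)
  ultimately show "short_exact A (FA id_functor f) (FA id_functor g)" by (simp add: short_exact_def)
qed

text \<open>Condition (b) concerns epimorphisms from \<open>Sum\<close>. An epimorphism
  \<open>e\<close> of \<open>B\<close> is therefore precomposed with a cover of its domain by an
  object of \<open>Sum\<close>; a lift through the composite gives one through
  \<open>e\<close>.\<close>

lemma projective_generators: "set_of_projective_generators \<kappa> (full_subcategory A B) \<U>"
  unfolding set_of_projective_generators_def
proof (intro conjI ballI U_small)
  fix U assume U: "U \<in> \<U>"
  show "projective (full_subcategory A B) U"
    unfolding projective_def
  proof (intro conjI allI impI)
    fix e f assume "epic (full_subcategory A B) e \<and> f \<in> Hom (full_subcategory A B) U (Cod (full_subcategory A B) e)"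
    then have ef: "epic (full_subcategory A B) e" and f: "f \<in> Hom A U (Cod A e)" by (auto simp: Hom_full_iff)
    then have "e \<in> Arr (full_subcategory A B)" by (simp add: epic_def)
    then have e: "e \<in> Hom A (Dom A e) (Cod A e)" "Dom A e \<in> B" "Cod A e \<in> B" by (auto simp: Hom_def)
    have eA: "epic A e" using ef epic_full_iff[OF e] by simp
    obtain P p where P: "P \<in> Sum \<kappa> A \<U>" and p: "p \<in> Hom A P (Dom A e)" "epic A p" using B_Gen[OF e(2)] by (rule GenE)
    have "epic A (e \<cdot> p)" by (rule epic_cmp[OF p(2) eA]) (use HomD[OF p(1)] in simp)
    then obtain g where g: "g \<in> Hom A U P" "e \<cdot> p \<cdot> g = f" by (rule epic_lift[OF _ cmp_hom[OF p(1) e(1)] P e(3) U f])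
    then show "\<exists>g\<in>Hom (full_subcategory A B) U (Dom (full_subcategory A B) e). e \<cdot>\<^bsub>full_subcategory A B\<^esub> g = f"
      using U_B[OF U] e(2) cmp_hom[OF g(1) p(1)] cmp_assoc[OF g(1) p(1) e(1)] by auto
  qed (use U_B[OF U] in simp)
next
  show "Obj (full_subcategory A B) \<subseteq> Gen \<kappa> (full_subcategory A B) \<U>"
  proof
    fix Y assume "Y \<in> Obj (full_subcategory A B)"
    then have Y: "Y \<in> B" by simp
    obtain P p where P: "P \<in> Sum \<kappa> A \<U>" and p: "p \<in> Hom A P Y" "epic A p" using B_Gen[OF Y] by (rule GenE)
    obtain I :: "'u set" and X \<iota> where I: "small \<kappa> I" "\<forall>i\<in>I. X i \<in> \<U>" "is_coproduct A I X P \<iota>" using P by (rule SumE)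
    have "P \<in> Sum \<kappa> (full_subcategory A B) \<U>"
      unfolding Sum_def using I is_coproduct_fullI[OF I(3) B_sub _ Sum_B[OF P]] U_B by blast
    then show "Y \<in> Gen \<kappa> (full_subcategory A B) \<U>"
      unfolding Gen_def using p Y Sum_B[OF P] epic_fullI[OF p(2) B_sub p(1)] by (auto intro!: bexI[of _ P] bexI[of _ p])
  qed
qed

theorem coreflective_abelian_exact: "coreflective_abelian_exact_with_generators \<kappa> A B"
  unfolding coreflective_abelian_exact_with_generators_def abelian_exact_def
  using coreflectiveI[OF B_sub] coreflection_ex abelian_full exact_full projective_generators by blast

end


section \<open>From abelian exact subcategories to presenting sets\<close>

locale coreflective_abelian = additive_sub A \<kappa> B
  for A :: "('o, 'm, 'x) precat_scheme" (structure) and \<kappa> :: "'u rel" and B :: "'o set" +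
  assumes coreflective: "coreflective A B" and abelian_exact: "abelian_exact A B"
begin

sublocale coreflective_sub A \<kappa> B
  by unfold_locales (use coreflective_coreflection[OF coreflective B_sub] in blast)

sublocale fullab: abelian_category "full_subcategory A B"
  using abelian_exact by (simp add: abelian_exact_def)

lemma short_exact_full: "short_exact (full_subcategory A B) f g \<Longrightarrow> short_exact A f g"
  using abelian_exact by (simp add: abelian_exact_def exact_functor_def)

text \<open>In the abelian category \<open>B\<close>, the arrow \<open>e\<close> and its kernel form
  a short exact sequence, which the inclusion preserves. So \<open>e\<close> is epic in
  \<open>A\<close>, and its kernel in \<open>B\<close> is also its kernel in
  \<open>A\<close>.\<close>

lemma epic_full_cokernel:
  assumes "epic (full_subcategory A B) e"
  obtains k K where "is_kernel (full_subcategory A B) e k" "K \<in> B" "k \<in> Hom A K (Dom A e)" "is_kernel A e k" "epic A e"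
proof -
  have "e \<in> Arr (full_subcategory A B)" using assms by (simp add: epic_def)
  then have e: "e \<in> Hom A (Dom A e) (Cod A e)" "Dom A e \<in> B" "Cod A e \<in> B" by (auto simp: Hom_def)
  have eF: "e \<in> Hom (full_subcategory A B) (Dom A e) (Cod A e)" using e by simp
  obtain k K where k: "is_kernel (full_subcategory A B) e k" "k \<in> Hom (full_subcategory A B) K (Dom A e)"
    by (rule fullab.kernel_ex[OF eF])
  have "is_cokernel (full_subcategory A B) k e" by (rule fullab.epic_cokernel_of_kernel[OF assms k(1) eF])
  then have "short_exact A k e" using short_exact_full k(1) by (simp add: short_exact_def)
  then have "is_kernel A e k" "is_cokernel A k e" by (simp_all add: short_exact_def)
  moreover have kA: "k \<in> Hom A K (Dom A e)" "K \<in> B" using k(2) by (auto simp: Hom_full_iff)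
  moreover have "epic A e" using cokernelD(3)[OF \<open>is_cokernel A k e\<close> kA(1)] .
  ultimately show thesis using k(1) that by blast
qed

lemma monic_full_A:
  assumes "monic (full_subcategory A B) m"
  shows "monic A m"
proof -
  have "m \<in> Arr (full_subcategory A B)" using assms by (simp add: monic_def)
  then have m: "m \<in> Hom A (Dom A m) (Cod A m)" "Dom A m \<in> B" "Cod A m \<in> B" by (auto simp: Hom_def)
  have mF: "m \<in> Hom (full_subcategory A B) (Dom A m) (Cod A m)" using m by simp
  obtain c Q where c: "is_cokernel (full_subcategory A B) m c" "c \<in> Hom (full_subcategory A B) (Cod A m) Q"
    by (rule fullab.cokernel_ex[OF mF])
  have "is_kernel (full_subcategory A B) c m" by (rule fullab.monic_kernel_of_cokernel[OF assms c(1) mF])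
  then have "is_kernel A c m" using short_exact_full c(1) by (simp add: short_exact_def)
  moreover have "c \<in> Hom A (Cod A m) Q" using c(2) by (simp add: Hom_full_iff)
  ultimately show ?thesis by (rule kernelD(3))
qed

lemma epic_full_A: "epic (full_subcategory A B) e \<Longrightarrow> epic A e"
  by (rule epic_full_cokernel)

text \<open>Exactness of the inclusion says nothing directly about an arbitrary \<open>f\<close>, so
  \<open>f\<close> is factored in \<open>B\<close> as a monomorphism after an epimorphism
  \<open>e\<close>. The monomorphism stays monic in \<open>A\<close>; hence \<open>f\<close> has the
  same kernel as \<open>e\<close>, and that one lies in \<open>B\<close>.\<close>

lemma B_kernel:
  assumes "f \<in> Hom A X Y" "X \<in> B" "Y \<in> B" "is_kernel A f k"
  shows "Dom A k \<in> B"
proof -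
  have fF: "f \<in> Hom (full_subcategory A B) X Y" using assms by simp
  obtain c Q where c: "is_cokernel (full_subcategory A B) f c" "c \<in> Hom (full_subcategory A B) Y Q"
    by (rule fullab.cokernel_ex[OF fF])
  obtain m M where m: "is_kernel (full_subcategory A B) c m" "m \<in> Hom (full_subcategory A B) M Y"
    by (rule fullab.kernel_ex[OF c(2)])
  obtain e where e: "e \<in> Hom (full_subcategory A B) X M" "epic (full_subcategory A B) e" "m \<cdot> e = f"
    using fullab.image_factorization[OF fF c(1) m(1)] HomD(2)[OF m(2)] by auto
  have mA: "m \<in> Hom A M Y" "M \<in> B" and eA: "e \<in> Hom A X M" using m(2) e(1) by (auto simp: Hom_full_iff)
  have mm: "monic A m" by (rule monic_full_A[OF full.kernelD(3)[OF m(1) c(2)]])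
  obtain k' K' where k': "K' \<in> B" "k' \<in> Hom A K' (Dom A e)" "is_kernel A e k'" by (rule epic_full_cokernel[OF e(2)])
  have "is_kernel A f k'" using kernel_monic_cmp[OF k'(3) eA mm mA(1)] e(3) by simp
  then have "isomorphic A (Dom A k) K'" using kernel_iso[OF assms(4) _ assms(1)] HomD(2)[OF k'(2)] by auto
  then show ?thesis using B_iso k'(1) by blast
qed

text \<open>Sums and epimorphisms of \<open>B\<close> are those of \<open>A\<close>. So projectivity
  in \<open>B\<close> gives the lifting required in (b), and the kernel of any arrow between objects
  of \<open>B\<close> lies in \<open>B\<close>, hence in \<open>Gen\<close>.\<close>

theorem presenting_set_of_generators:
  assumes gen: "set_of_projective_generators \<kappa> (full_subcategory A B) \<G>"
  shows "presenting_set \<kappa> A B \<G>"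
proof -
  have sm: "small \<kappa> \<G>" and proj: "\<And>G. G \<in> \<G> \<Longrightarrow> projective (full_subcategory A B) G"
    and B: "B \<subseteq> Gen \<kappa> (full_subcategory A B) \<G>"
    using gen by (simp_all add: set_of_projective_generators_def)
  have GB: "\<G> \<subseteq> B" using proj by (auto simp: projective_def)
  have SumB: "P \<in> B" if "P \<in> Sum \<kappa> A \<G>" for P using B_Sum[OF GB that] .
  \<comment> \<open>A coproduct formed in \<open>B\<close> is compared with the coproduct of the
    same family in \<open>A\<close>, which exists and lies in \<open>B\<close>; both are coproducts
    in \<open>B\<close>, so they are isomorphic.\<close>
  have SumF: "P \<in> Sum \<kappa> A \<G>" if P: "P \<in> Sum \<kappa> (full_subcategory A B) \<G>" for P
  proof -
    obtain I :: "'u set" and X \<iota> where I: "small \<kappa> I" "\<forall>i\<in>I. X i \<in> \<G>" and cP: "is_coproduct (full_subcategory A B) I X P \<iota>"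
      using P by (rule SumE)
    have XB: "\<forall>i\<in>I. X i \<in> B" using I(2) GB by blast
    then have "\<forall>i\<in>I. X i \<in> Obj A" using B_sub by blast
    then obtain Q \<mu> where Q: "is_coproduct A I X Q \<mu>" by (rule coproduct_ex[OF I(1)])
    have "is_coproduct (full_subcategory A B) I X Q \<mu>" by (rule is_coproduct_fullI[OF Q B_sub XB B_coproduct[OF Q XB]])
    then obtain s t where "s \<in> Hom (full_subcategory A B) Q P" "t \<in> Hom (full_subcategory A B) P Q"
      "t \<cdot> s = Ide A Q" "s \<cdot> t = Ide A P"
      using full.coproduct_unique[OF _ cP] by (metis full_subcategory_simps(5,6))
    then have "is_coproduct A I X P (\<lambda>i. s \<cdot> \<mu> i)" by (intro coproduct_iso[OF Q]) (simp_all add: Hom_full_iff)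
    then show ?thesis by (rule Sum_I[OF I])
  qed
  have BGen: "Y \<in> Gen \<kappa> A \<G>" if Y: "Y \<in> B" for Y
  proof -
    have "Y \<in> Gen \<kappa> (full_subcategory A B) \<G>" using B Y by (rule subsetD)
    then obtain P e where "P \<in> Sum \<kappa> (full_subcategory A B) \<G>" "e \<in> Hom (full_subcategory A B) P Y"
        "epic (full_subcategory A B) e"
      unfolding Gen_def by (elim CollectE bexE)
    then have "P \<in> Sum \<kappa> A \<G>" "e \<in> Hom A P Y" "epic A e" using SumF epic_full_A by (simp_all add: Hom_full_iff)
    then show ?thesis unfolding Gen_def by (intro CollectI bexI)
  qed
  have lift: "\<exists>g\<in>Hom A U (Dom A p). p \<cdot> g = f"
    if p: "epic A p" "Dom A p \<in> Sum \<kappa> A \<G>" "Cod A p \<in> B" and U: "U \<in> \<G>" and f: "f \<in> Hom A U (Cod A p)" for p U f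
  proof -
    have "epic (full_subcategory A B) p"
      by (rule epic_fullI[OF p(1) B_sub, of "Dom A p" "Cod A p"]) (use p SumB epic_arr in \<open>auto simp: Hom_def\<close>)
    moreover have "f \<in> Hom (full_subcategory A B) U (Cod (full_subcategory A B) p)" using f U GB p(3) by (simp add: subset_iff)
    ultimately obtain g where "g \<in> Hom (full_subcategory A B) U (Dom (full_subcategory A B) p)" "p \<cdot>\<^bsub>full_subcategory A B\<^esub> g = f"
      using proj[OF U] unfolding projective_def by blast
    then show ?thesis by (auto simp: Hom_full_iff)
  qed
  \<comment> \<open>A cover of \<open>Y\<close>, followed by a cover of its kernel, which lies in
    \<open>B\<close>, is a presentation of \<open>Y\<close>.\<close>
  have Pres: "Y \<in> Pres \<kappa> A \<G>" if Y: "Y \<in> B" for Y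
  proof -
    obtain P e where P: "P \<in> Sum \<kappa> A \<G>" and e: "e \<in> Hom A P Y" "epic A e" using BGen[OF Y] by (rule GenE)
    obtain k K where k: "is_kernel A e k" "k \<in> Hom A K P" by (rule kernel_ex[OF e(1)])
    have "K \<in> B" using B_kernel[OF e(1) SumB[OF P] Y k(1)] HomD(2)[OF k(2)] by simp
    then obtain Q p where Q: "Q \<in> Sum \<kappa> A \<G>" and p: "p \<in> Hom A Q K" "epic A p" by (rule GenE[OF BGen])
    have "is_cokernel A (k \<cdot> p) e"
      by (rule cokernel_epic_cmp[OF epic_cokernel_of_kernel[OF e(2) k(1) e(1)] k(2) p(2,1)])
    then have "Cod A e \<in> Pres \<kappa> A \<G>" by (rule PresI[OF cmp_hom[OF p(1) k(2)] Q P])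
    then show ?thesis using HomD(3)[OF e(1)] by simp
  qed
  have kern: "\<exists>k. is_kernel A f k \<and> Dom A k \<in> Gen \<kappa> A \<G>" if f: "f \<in> Arr A" "Dom A f \<in> B" "Cod A f \<in> B" for f
  proof -
    have fh: "f \<in> Hom A (Dom A f) (Cod A f)" using f by (simp add: Hom_def)
    obtain k K where k: "is_kernel A f k" "k \<in> Hom A K (Dom A f)" by (rule kernel_ex[OF fh])
    then show ?thesis using BGen[OF B_kernel[OF fh f(2,3) k(1)]] by blast
  qed
  show ?thesis
    unfolding presenting_set_def
  proof (intro conjI allI ballI impI)
    show "B = Pres \<kappa> A \<G>" using Pres B_Pres[OF GB] by (intro subset_antisym subsetI)
    fix p assume p: "epic A p \<and> Dom A p \<in> Sum \<kappa> A \<G> \<and> Cod A p \<in> B"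
    then have ph: "p \<in> Hom A (Dom A p) (Cod A p)" by (simp add: Hom_def epic_arr)
    show "rel_epimorphism A \<G> p"
      unfolding rel_epimorphism_def
    proof (intro conjI ballI equalityI subsetI)
      fix U f assume "U \<in> \<G>" "f \<in> Hom A U (Cod A p)"
      then show "f \<in> (\<lambda>f. p \<cdot> f) ` Hom A U (Dom A p)" using lift[of p U f] p by auto
    next
      fix U f assume "U \<in> \<G>" "f \<in> (\<lambda>f. p \<cdot> f) ` Hom A U (Dom A p)"
      then show "f \<in> Hom A U (Cod A p)" using cmp_hom[OF _ ph] by auto
    qed (rule HomD(1)[OF ph])
    show "\<exists>k. is_kernel A p k \<and> Dom A k \<in> Gen \<kappa> A \<G>" 
      by (rule kern[OF HomD(1)[OF ph]]) (use p SumB in auto)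
  next
    fix f assume "f \<in> Arr A" "Dom A f \<in> Sum \<kappa> A \<G> \<and> Cod A f \<in> Sum \<kappa> A \<G>"
    then show "\<exists>k. is_kernel A f k \<and> Dom A k \<in> Gen \<kappa> A \<G>" using SumB by (intro kern) auto
  qed (use sm GB B_sub in auto)
qed

end


section \<open>Equivalences of categories\<close>

lemma functor_obj: "is_functor C D F \<Longrightarrow> a \<in> Obj C \<Longrightarrow> FO F a \<in> Obj D"
  by (simp add: is_functor_def)

lemma functor_ide: "is_functor C D F \<Longrightarrow> a \<in> Obj C \<Longrightarrow> FA F (Ide C a) = Ide D (FO F a)"
  by (simp add: is_functor_def)

lemma functor_hom:
  assumes "is_functor C D F" "f \<in> Hom C a b"
  shows "FA F f \<in> Hom D (FO F a) (FO F b)"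
  using assms(1) HomD[OF assms(2)] unfolding is_functor_def by metis

lemma functor_cmp:
  assumes "is_functor C D F" "f \<in> Hom C a b" "g \<in> Hom C b c"
  shows "FA F (g \<cdot>\<^bsub>C\<^esub> f) = FA F g \<cdot>\<^bsub>D\<^esub> FA F f"
  using assms(1) HomD[OF assms(2)] HomD[OF assms(3)] unfolding is_functor_def by simp

lemma functorI:
  assumes "category C" "category D" "\<And>a. a \<in> Obj C \<Longrightarrow> FO F a \<in> Obj D"
    and "\<And>a. a \<in> Obj C \<Longrightarrow> FA F (Ide C a) = Ide D (FO F a)"
    and "\<And>f a b. f \<in> Hom C a b \<Longrightarrow> FA F f \<in> Hom D (FO F a) (FO F b)"
    and "\<And>f g a b c. f \<in> Hom C a b \<Longrightarrow> g \<in> Hom C b c \<Longrightarrow> FA F (g \<cdot>\<^bsub>C\<^esub> f) = FA F g \<cdot>\<^bsub>D\<^esub> FA F f"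
  shows "is_functor C D F"
  unfolding is_functor_def
proof (intro conjI ballI impI)
  fix f assume f: "f \<in> Arr C"
  show "FA F f \<in> Hom D (FO F (Dom C f)) (FO F (Cod C f))" by (rule assms(5)) (simp add: HomI f)
  fix g assume "g \<in> Arr C" "Cod C f = Dom C g"
  then show "FA F (g \<cdot>\<^bsub>C\<^esub> f) = FA F g \<cdot>\<^bsub>D\<^esub> FA F f"
    by (intro assms(6)[of f "Dom C f" "Cod C f" g "Cod C g"]) (simp_all add: HomI f)
qed (use assms in auto)

text \<open>An equivalence expressed through one functor; surjectivity on objects is meant up to
  isomorphism.\<close>

definition fully_faithful_surjective ::
    "('o, 'm, 'x) cat_scheme \<Rightarrow> ('p, 'n, 'y) cat_scheme \<Rightarrow> ('o, 'm, 'p, 'n) ftor \<Rightarrow> bool" where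
  "fully_faithful_surjective C D F \<longleftrightarrow> is_functor C D F \<and>
     (\<forall>a\<in>Obj C. \<forall>b\<in>Obj C. bij_betw (FA F) (Hom C a b) (Hom D (FO F a) (FO F b))) \<and>
     (\<forall>d\<in>Obj D. \<exists>c\<in>Obj C. isomorphic D (FO F c) d)"

lemma fully_faithful_surjectiveD:
  assumes "fully_faithful_surjective C D F"
  shows "is_functor C D F"
    and "a \<in> Obj C \<Longrightarrow> b \<in> Obj C \<Longrightarrow> h \<in> Hom D (FO F a) (FO F b) \<Longrightarrow> \<exists>f. f \<in> Hom C a b \<and> FA F f = h"
    and "f \<in> Hom C a b \<Longrightarrow> g \<in> Hom C a b \<Longrightarrow> FA F f = FA F g \<Longrightarrow> f = g"
    and "d \<in> Obj D \<Longrightarrow> \<exists>c\<in>Obj C. isomorphic D (FO F c) d"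
proof -
  show F: "is_functor C D F" using assms by (simp add: fully_faithful_surjective_def)
  have b: "a \<in> Obj C \<Longrightarrow> b \<in> Obj C \<Longrightarrow> bij_betw (FA F) (Hom C a b) (Hom D (FO F a) (FO F b))" for a b
    using assms by (simp add: fully_faithful_surjective_def)
  show "\<exists>f. f \<in> Hom C a b \<and> FA F f = h" if "a \<in> Obj C" "b \<in> Obj C" "h \<in> Hom D (FO F a) (FO F b)"
  proof -
    have "h \<in> FA F ` Hom C a b" using b[OF that(1,2)] that(3) by (simp add: bij_betw_def)
    then show ?thesis by (elim imageE) blast
  qed
  show "f = g" if f: "f \<in> Hom C a b" and g: "g \<in> Hom C a b" and e: "FA F f = FA F g"
  proof -
    interpret category C using F by (simp add: is_functor_def)
    show ?thesis using b[OF hom_obj(1)[OF f] hom_obj(2)[OF f]] f g e unfolding bij_betw_def by (meson inj_onD)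
  qed
  show "d \<in> Obj D \<Longrightarrow> \<exists>c\<in>Obj C. isomorphic D (FO F c) d"
    using assms by (simp add: fully_faithful_surjective_def)
qed

text \<open>For each \<open>d\<close> an object \<open>R d\<close> and an isomorphism \<sigma> from
  its image to \<open>d\<close> are chosen, and \<open>G\<close> sends \<open>g\<close> to the
  preimage of its conjugate by \<sigma>. The counit is \<sigma>, the unit is the preimage of the
  inverse \<tau>. As \<open>F\<close> is faithful, equations in \<open>C\<close> are verified in
  \<open>D\<close>.\<close>

theorem equivalentI:
  assumes "fully_faithful_surjective C D F"
  shows "equivalent C D"
proof -
  note F = fully_faithful_surjectiveD(1)[OF assms] and full = fully_faithful_surjectiveD(2)[OF assms]
    and faith = fully_faithful_surjectiveD(3)[OF assms] and surj = fully_faithful_surjectiveD(4)[OF assms]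
  interpret C: category C using F by (simp add: is_functor_def)
  interpret D: category D using F by (simp add: is_functor_def)
  note Fo = functor_obj[OF F] and Fh = functor_hom[OF F] and Fc = functor_cmp[OF F] and Fi = functor_ide[OF F]
  have "\<forall>d\<in>Obj D. \<exists>c s t. c \<in> Obj C \<and> s \<in> Hom D (FO F c) d \<and> t \<in> Hom D d (FO F c) \<and>
      t \<cdot>\<^bsub>D\<^esub> s = Ide D (FO F c) \<and> s \<cdot>\<^bsub>D\<^esub> t = Ide D d"
  proof
    fix d assume "d \<in> Obj D"
    then obtain c where c: "c \<in> Obj C" "isomorphic D (FO F c) d" using surj by blast
    obtain s t where "s \<in> Hom D (FO F c) d" "t \<in> Hom D d (FO F c)"
      "t \<cdot>\<^bsub>D\<^esub> s = Ide D (FO F c)" "s \<cdot>\<^bsub>D\<^esub> t = Ide D d" by (rule D.isomorphicE[OF c(2)])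
    then show "\<exists>c s t. c \<in> Obj C \<and> s \<in> Hom D (FO F c) d \<and> t \<in> Hom D d (FO F c) \<and>
        t \<cdot>\<^bsub>D\<^esub> s = Ide D (FO F c) \<and> s \<cdot>\<^bsub>D\<^esub> t = Ide D d" using c(1) by blast
  qed
  then obtain R \<sigma> \<tau> where "\<forall>d\<in>Obj D. R d \<in> Obj C \<and> \<sigma> d \<in> Hom D (FO F (R d)) d \<and> \<tau> d \<in> Hom D d (FO F (R d)) \<and>
      \<tau> d \<cdot>\<^bsub>D\<^esub> \<sigma> d = Ide D (FO F (R d)) \<and> \<sigma> d \<cdot>\<^bsub>D\<^esub> \<tau> d = Ide D d" by metis
  then have R: "R d \<in> Obj C" and s: "\<sigma> d \<in> Hom D (FO F (R d)) d" and t: "\<tau> d \<in> Hom D d (FO F (R d))"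
    and ts: "\<tau> d \<cdot>\<^bsub>D\<^esub> \<sigma> d = Ide D (FO F (R d))" and st: "\<sigma> d \<cdot>\<^bsub>D\<^esub> \<tau> d = Ide D d" if "d \<in> Obj D" for d
    using that by auto
  define l where "l a b h = (SOME f. f \<in> Hom C a b \<and> FA F f = h)" for a b h
  have l: "l a b h \<in> Hom C a b" "FA F (l a b h) = h"
    if "a \<in> Obj C" "b \<in> Obj C" "h \<in> Hom D (FO F a) (FO F b)" for a b h
    using someI_ex[OF full[OF that]] by (simp_all add: l_def)
  define G where "G = \<lparr>FO = R, FA = (\<lambda>g. l (R (Dom D g)) (R (Cod D g)) (\<tau> (Cod D g) \<cdot>\<^bsub>D\<^esub> (g \<cdot>\<^bsub>D\<^esub> \<sigma> (Dom D g))))\<rparr>"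
  have GO: "FO G = R" by (simp add: G_def)
  have tgs: "\<tau> d' \<cdot>\<^bsub>D\<^esub> (g \<cdot>\<^bsub>D\<^esub> \<sigma> d) \<in> Hom D (FO F (R d)) (FO F (R d'))" if g: "g \<in> Hom D d d'" for g d d'
    using D.cmp_hom[OF D.cmp_hom[OF s[OF D.hom_obj(1)[OF g]] g] t[OF D.hom_obj(2)[OF g]]] .
  have GA: "FA G g \<in> Hom C (R d) (R d')" "FA F (FA G g) = \<tau> d' \<cdot>\<^bsub>D\<^esub> (g \<cdot>\<^bsub>D\<^esub> \<sigma> d)" if g: "g \<in> Hom D d d'" for g d d'
    using l[OF R[OF D.hom_obj(1)[OF g]] R[OF D.hom_obj(2)[OF g]] tgs[OF g]] by (simp_all add: G_def HomD[OF g])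
  have sG: "\<sigma> d' \<cdot>\<^bsub>D\<^esub> FA F (FA G g) = g \<cdot>\<^bsub>D\<^esub> \<sigma> d" if g: "g \<in> Hom D d d'" for g d d'
  proof -
    note o = D.hom_obj[OF g]
    note gs = D.cmp_hom[OF s[OF o(1)] g]
    have "\<sigma> d' \<cdot>\<^bsub>D\<^esub> (\<tau> d' \<cdot>\<^bsub>D\<^esub> (g \<cdot>\<^bsub>D\<^esub> \<sigma> d)) = Ide D d' \<cdot>\<^bsub>D\<^esub> (g \<cdot>\<^bsub>D\<^esub> \<sigma> d)"
      by (rule D.cmp_eq_right1[OF st[OF o(2)] gs t[OF o(2)] s[OF o(2)]])
    then show ?thesis using GA(2)[OF g] D.cmp_ide_left[OF gs] by simp
  qed
  have sm: "monic D (\<sigma> d)" if "d \<in> Obj D" for d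
    by (rule D.section_monic[OF s[OF that] t[OF that] ts[OF that]])
  \<comment> \<open>\<open>FA G g\<close> is characterised as the only arrow whose image \<sigma>
    intertwines with \<open>g\<close>; functoriality of \<open>G\<close> is read off from
    this.\<close>
  have G_eq: "FA G g = f" if g: "g \<in> Hom D d d'" and f: "f \<in> Hom C (R d) (R d')" and e: "\<sigma> d' \<cdot>\<^bsub>D\<^esub> FA F f = g \<cdot>\<^bsub>D\<^esub> \<sigma> d"
      for g f d d'
  proof (rule faith[OF GA(1)[OF g] f])
    have o: "d' \<in> Obj D" by (rule D.hom_obj(2)[OF g])
    have "FA F (FA G g) \<in> Hom D (FO F (R d)) (Dom D (\<sigma> d'))" "FA F f \<in> Hom D (FO F (R d)) (Dom D (\<sigma> d'))"
      using Fh[OF GA(1)[OF g]] Fh[OF f] HomD(2)[OF s[OF o]] by simp_all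
    then show "FA F (FA G g) = FA F f"
      by (rule D.monicD[OF sm[OF o]]) (simp only: sG[OF g] e)
  qed
  have fG: "is_functor D C G"
  proof (rule functorI[OF D.category_axioms C.category_axioms])
    fix d assume d: "d \<in> Obj D"
    show "FO G d \<in> Obj C" using R[OF d] by (simp add: GO)
    show "FA G (Ide D d) = Ide C (FO G d)"
      unfolding GO by (rule G_eq[OF D.ide_hom[OF d] C.ide_hom[OF R[OF d]]])
        (simp add: Fi[OF R[OF d]] D.cmp_ide_left[OF s[OF d]] D.cmp_ide_right[OF s[OF d]])
  next
    fix g d d' assume "g \<in> Hom D d d'"
    then show "FA G g \<in> Hom C (FO G d) (FO G d')" using GA(1) by (simp add: GO)
  next
    fix g g' d d' d'' assume g: "g \<in> Hom D d d'" and g': "g' \<in> Hom D d' d''"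
    note o = D.hom_obj[OF g] D.hom_obj[OF g']
    note G = GA(1)[OF g] GA(1)[OF g']
    have "\<sigma> d'' \<cdot>\<^bsub>D\<^esub> (FA F (FA G g') \<cdot>\<^bsub>D\<^esub> FA F (FA G g)) = g' \<cdot>\<^bsub>D\<^esub> (\<sigma> d' \<cdot>\<^bsub>D\<^esub> FA F (FA G g))"
      by (rule D.cmp_eq_right[OF sG[OF g'] Fh[OF G(1)] Fh[OF G(2)] s[OF o(4)] s[OF o(2)] g'])
    also have "\<dots> = (g' \<cdot>\<^bsub>D\<^esub> g) \<cdot>\<^bsub>D\<^esub> \<sigma> d" using sG[OF g] D.cmp_assoc[OF s[OF o(1)] g g'] by simp
    finally show "FA G (g' \<cdot>\<^bsub>D\<^esub> g) = FA G g' \<cdot>\<^bsub>C\<^esub> FA G g"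
      by (intro G_eq[OF D.cmp_hom[OF g g'] C.cmp_hom[OF G]]) (simp add: Fc[OF G])
  qed
  define \<eta> where "\<eta> c = l c (R (FO F c)) (\<tau> (FO F c))" for c
  have e: "\<eta> c \<in> Hom C c (R (FO F c))" "FA F (\<eta> c) = \<tau> (FO F c)" if "c \<in> Obj C" for c
    using l[OF that R[OF Fo[OF that]] t[OF Fo[OF that]]] by (simp_all add: \<eta>_def)
  have e_iso: "iso_arr C (\<eta> c)" if c: "c \<in> Obj C" for c
  proof -
    note RFc = R[OF Fo[OF c]]
    have k: "l (R (FO F c)) c (\<sigma> (FO F c)) \<in> Hom C (R (FO F c)) c" "FA F (l (R (FO F c)) c (\<sigma> (FO F c))) = \<sigma> (FO F c)"
      using l[OF RFc c s[OF Fo[OF c]]] by simp_all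
    show ?thesis
    proof (rule C.isoI[OF e(1)[OF c] k(1)])
      show "l (R (FO F c)) c (\<sigma> (FO F c)) \<cdot>\<^bsub>C\<^esub> \<eta> c = Ide C c"
        by (rule faith[OF C.cmp_hom[OF e(1)[OF c] k(1)] C.ide_hom[OF c]])
           (simp add: Fc[OF e(1)[OF c] k(1)] k(2) e(2)[OF c] st[OF Fo[OF c]] Fi[OF c])
      show "\<eta> c \<cdot>\<^bsub>C\<^esub> l (R (FO F c)) c (\<sigma> (FO F c)) = Ide C (R (FO F c))"
        by (rule faith[OF C.cmp_hom[OF k(1) e(1)[OF c]] C.ide_hom[OF RFc]])
           (simp add: Fc[OF k(1) e(1)[OF c]] k(2) e(2)[OF c] ts[OF Fo[OF c]] Fi[OF RFc])
    qed
  qed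
  have e_nat: "\<eta> b \<cdot>\<^bsub>C\<^esub> f = FA G (FA F f) \<cdot>\<^bsub>C\<^esub> \<eta> a" if f: "f \<in> Hom C a b" for f a b
  proof -
    note o = C.hom_obj[OF f]
    note G = GA[OF Fh[OF f]]
    show ?thesis
    proof (rule faith[OF C.cmp_hom[OF f e(1)[OF o(2)]] C.cmp_hom[OF e(1)[OF o(1)] G(1)]])
      note Ff = Fh[OF f] and sa = s[OF Fo[OF o(1)]] and ta = t[OF Fo[OF o(1)]] and tb = t[OF Fo[OF o(2)]]
      have "(\<tau> (FO F b) \<cdot>\<^bsub>D\<^esub> (FA F f \<cdot>\<^bsub>D\<^esub> \<sigma> (FO F a))) \<cdot>\<^bsub>D\<^esub> \<tau> (FO F a) =
          \<tau> (FO F b) \<cdot>\<^bsub>D\<^esub> ((FA F f \<cdot>\<^bsub>D\<^esub> \<sigma> (FO F a)) \<cdot>\<^bsub>D\<^esub> \<tau> (FO F a))"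
        by (rule D.cmp_assoc[symmetric, OF ta D.cmp_hom[OF sa Ff] tb])
      also have "(FA F f \<cdot>\<^bsub>D\<^esub> \<sigma> (FO F a)) \<cdot>\<^bsub>D\<^esub> \<tau> (FO F a) = FA F f"
        using D.cmp_assoc[OF ta sa Ff] st[OF Fo[OF o(1)]] D.cmp_ide_right[OF Ff] by simp
      finally show "FA F (\<eta> b \<cdot>\<^bsub>C\<^esub> f) = FA F (FA G (FA F f) \<cdot>\<^bsub>C\<^esub> \<eta> a)"
        by (simp only: Fc[OF f e(1)[OF o(2)]] Fc[OF e(1)[OF o(1)] G(1)] e(2)[OF o(1)] e(2)[OF o(2)] G(2))
    qed
  qed
  have "nat_iso C C id_functor (comp_functor G F) \<eta>"
    unfolding nat_iso_def nat_trans_def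
    using e e_iso e_nat[OF HomI] by (simp add: GO)
  moreover have "nat_iso D D (comp_functor F G) id_functor \<sigma>"
    unfolding nat_iso_def nat_trans_def
    using s sG[OF HomI] D.isoI[OF s t ts st] by (simp add: GO)
  ultimately show ?thesis unfolding equivalent_def using F fG by blast
qed

text \<open>Both functors are faithful, since the natural isomorphisms recover an arrow from its
  double image. For fullness, \<open>FA G h\<close> is conjugated by \<eta>; the image under
  \<open>F\<close> of the resulting arrow agrees with \<open>h\<close> after \<open>G\<close>, and
  faithfulness of \<open>G\<close> cancels \<open>G\<close>.\<close>

theorem equivalentD:
  assumes "equivalent C D"
  obtains F where "fully_faithful_surjective C D F"
proof -
  obtain F G \<eta> \<epsilon> where F: "is_functor C D F" and G: "is_functor D C G"
    and e: "nat_iso C C id_functor (comp_functor G F) \<eta>" and eps: "nat_iso D D (comp_functor F G) id_functor \<epsilon>"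
    using assms unfolding equivalent_def by blast
  interpret C: category C using F by (simp add: is_functor_def)
  interpret D: category D using F by (simp add: is_functor_def)
  have eh: "\<eta> a \<in> Hom C a (FO G (FO F a))" "iso_arr C (\<eta> a)" if "a \<in> Obj C" for a
    using e that by (simp_all add: nat_iso_def nat_trans_def)
  have en: "\<eta> b \<cdot>\<^bsub>C\<^esub> f = FA G (FA F f) \<cdot>\<^bsub>C\<^esub> \<eta> a" if "f \<in> Hom C a b" for f a b
    using e HomD[OF that] unfolding nat_iso_def nat_trans_def by auto
  have ph: "\<epsilon> d \<in> Hom D (FO F (FO G d)) d" "iso_arr D (\<epsilon> d)" if "d \<in> Obj D" for d
    using eps that by (simp_all add: nat_iso_def nat_trans_def)
  have pn: "\<epsilon> d' \<cdot>\<^bsub>D\<^esub> FA F (FA G g) = g \<cdot>\<^bsub>D\<^esub> \<epsilon> d" if "g \<in> Hom D d d'" for g d d'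
    using eps HomD[OF that] unfolding nat_iso_def nat_trans_def by auto
  have faithF: "f = g" if f: "f \<in> Hom C a b" and g: "g \<in> Hom C a b" and fg: "FA F f = FA F g" for f g a b
  proof -
    note o = C.hom_obj(2)[OF f]
    have "\<eta> b \<cdot>\<^bsub>C\<^esub> f = \<eta> b \<cdot>\<^bsub>C\<^esub> g" by (simp only: en[OF f] en[OF g] fg)
    then show ?thesis using C.monicD[OF C.iso_monic[OF eh(2)[OF o]], of f a g] f g HomD(2)[OF eh(1)[OF o]] by simp
  qed
  have faithG: "f = g" if f: "f \<in> Hom D a b" and g: "g \<in> Hom D a b" and fg: "FA G f = FA G g" for f g a b
  proof -
    note o = D.hom_obj(1)[OF f]
    have "f \<cdot>\<^bsub>D\<^esub> \<epsilon> a = g \<cdot>\<^bsub>D\<^esub> \<epsilon> a" by (simp only: pn[OF f, symmetric] pn[OF g, symmetric] fg)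
    then show ?thesis using D.epicD[OF D.iso_epic[OF ph(2)[OF o]], of f b g] f g HomD(3)[OF ph(1)[OF o]] by simp
  qed
  have full: "\<exists>f. f \<in> Hom C a b \<and> FA F f = h" if a: "a \<in> Obj C" and b: "b \<in> Obj C" and h: "h \<in> Hom D (FO F a) (FO F b)" for a b h
  proof -
    obtain k where k: "k \<in> Hom C (FO G (FO F b)) b" "k \<cdot>\<^bsub>C\<^esub> \<eta> b = Ide C b" "\<eta> b \<cdot>\<^bsub>C\<^esub> k = Ide C (FO G (FO F b))"
      using C.isoE[OF eh(2)[OF b]] HomD[OF eh(1)[OF b]] by metis
    note Gh = functor_hom[OF G h]
    note x = C.cmp_hom[OF eh(1)[OF a] Gh]
    let ?f = "k \<cdot>\<^bsub>C\<^esub> (FA G h \<cdot>\<^bsub>C\<^esub> \<eta> a)"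
    have f: "?f \<in> Hom C a b" by (rule C.cmp_hom[OF x k(1)])
    have "\<eta> b \<cdot>\<^bsub>C\<^esub> ?f = Ide C (FO G (FO F b)) \<cdot>\<^bsub>C\<^esub> (FA G h \<cdot>\<^bsub>C\<^esub> \<eta> a)"
      by (rule C.cmp_eq_right1[OF k(3) x k(1) eh(1)[OF b]])
    then have *: "FA G (FA F ?f) \<cdot>\<^bsub>C\<^esub> \<eta> a = FA G h \<cdot>\<^bsub>C\<^esub> \<eta> a"
      using en[OF f] C.cmp_ide_left[OF x] by simp
    have "FA G (FA F ?f) = FA G h"
      by (rule C.epicD[OF C.iso_epic[OF eh(2)[OF a]] _ _ *])
         (use functor_hom[OF G functor_hom[OF F f]] Gh HomD(3)[OF eh(1)[OF a]] in simp_all)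
    then have "FA F ?f = h" by (rule faithG[OF functor_hom[OF F f] h])
    then show ?thesis using f by blast
  qed
  have "fully_faithful_surjective C D F"
    unfolding fully_faithful_surjective_def
  proof (intro conjI ballI F)
    fix a b assume ab: "a \<in> Obj C" "b \<in> Obj C"
    show "bij_betw (FA F) (Hom C a b) (Hom D (FO F a) (FO F b))"
      unfolding bij_betw_def
    proof (intro conjI inj_onI equalityI subsetI)
      fix h assume "h \<in> FA F ` Hom C a b"
      then show "h \<in> Hom D (FO F a) (FO F b)" using functor_hom[OF F] by auto
    next
      fix h assume "h \<in> Hom D (FO F a) (FO F b)"
      then show "h \<in> FA F ` Hom C a b" using full[OF ab] by (metis imageI)
    qed (rule faithF)
  next
    fix d assume d: "d \<in> Obj D"
    then show "\<exists>c\<in>Obj C. isomorphic D (FO F c) d"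
      using ph[OF d] functor_obj[OF G d] unfolding isomorphic_def by blast
  qed
  then show thesis by (rule that)
qed


section \<open>Modules over a preadditive category\<close>

lemma Ab_simps [simp]:
  "Obj (Ab \<kappa>) = {G. comm_group G \<and> small \<kappa> (carrier G)}"
  "Dom (Ab \<kappa>) (G, H, f) = G" "Cod (Ab \<kappa>) (G, H, f) = H"
  "Ide (Ab \<kappa>) G = (G, G, \<lambda>x\<in>carrier G. x)"
  "(H', K, g) \<cdot>\<^bsub>Ab \<kappa>\<^esub> (G, H, f) = (G, K, \<lambda>x\<in>carrier G. g (f x))"
  "Add (Ab \<kappa>) (G, H, f) (G', H', f') = (G, H, \<lambda>x\<in>carrier G. f x \<otimes>\<^bsub>H\<^esub> f' x)"
  by (simp_all add: Ab_def)

lemma Hom_Ab: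
  "t \<in> Hom (Ab \<kappa>) G H \<longleftrightarrow> (\<exists>f. t = (G, H, f) \<and> G \<in> Obj (Ab \<kappa>) \<and> H \<in> Obj (Ab \<kappa>) \<and> f \<in> hom G H \<and> f \<in> extensional (carrier G))"
  by (cases t) (auto simp: Hom_def Ab_def)

lemma hom_restrict: "f \<in> hom G H \<Longrightarrow> monoid G \<Longrightarrow> (\<lambda>x\<in>carrier G. f x) \<in> hom G H"
  by (auto simp: hom_def monoid.m_closed)

lemma category_Ab: "category (Ab \<kappa>)"
proof
  fix a assume a: "a \<in> Obj (Ab \<kappa>)"
  then have "monoid a" using comm_group.axioms(2) group.is_monoid by auto
  then have "(\<lambda>x\<in>carrier a. x) \<in> hom a a" by (auto simp: hom_def monoid.m_closed)
  then show "Ide (Ab \<kappa>) a \<in> Hom (Ab \<kappa>) a a" using a by (auto simp: Hom_Ab)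
next
  fix f a b g c assume "f \<in> Hom (Ab \<kappa>) a b" "g \<in> Hom (Ab \<kappa>) b c"
  then obtain f' g' where f: "f = (a, b, f')" "a \<in> Obj (Ab \<kappa>)" "f' \<in> hom a b"
      and g: "g = (b, c, g')" "c \<in> Obj (Ab \<kappa>)" "g' \<in> hom b c"
    by (auto simp only: Hom_Ab)
  have "monoid a" using f(2) comm_group.axioms(2) group.is_monoid by auto
  then have "(\<lambda>x\<in>carrier a. g' (f' x)) \<in> hom a c" using f(3) g(3) by (auto simp: hom_def monoid.m_closed Pi_iff)
  then show "g \<cdot>\<^bsub>Ab \<kappa>\<^esub> f \<in> Hom (Ab \<kappa>) a c" using f g by (auto simp: Hom_Ab)
next
  fix f assume "f \<in> Arr (Ab \<kappa>)"
  then show "Dom (Ab \<kappa>) f \<in> Obj (Ab \<kappa>)" "Cod (Ab \<kappa>) f \<in> Obj (Ab \<kappa>)" by (cases f; simp add: Ab_def)+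
next
  fix f a b assume "f \<in> Hom (Ab \<kappa>) a b"
  then show "f \<cdot>\<^bsub>Ab \<kappa>\<^esub> Ide (Ab \<kappa>) a = f" "Ide (Ab \<kappa>) b \<cdot>\<^bsub>Ab \<kappa>\<^esub> f = f"
    by (auto simp: Hom_Ab hom_def extensional_def Pi_iff fun_eq_iff)
next
  fix f a b g c h d assume "f \<in> Hom (Ab \<kappa>) a b" "g \<in> Hom (Ab \<kappa>) b c" "h \<in> Hom (Ab \<kappa>) c d"
  then show "h \<cdot>\<^bsub>Ab \<kappa>\<^esub> (g \<cdot>\<^bsub>Ab \<kappa>\<^esub> f) = h \<cdot>\<^bsub>Ab \<kappa>\<^esub> g \<cdot>\<^bsub>Ab \<kappa>\<^esub> f"
    by (auto simp: Hom_Ab hom_def Pi_iff fun_eq_iff)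
qed

lemma opposite_simps [simp]:
  "Obj (opposite D) = Obj D" "Arr (opposite D) = Arr D" "Dom (opposite D) = Cod D" "Cod (opposite D) = Dom D"
  "Ide (opposite D) = Ide D" "g \<cdot>\<^bsub>opposite D\<^esub> f = f \<cdot>\<^bsub>D\<^esub> g" "Add (opposite D) = Add D"
  by (simp_all add: opposite_def)

lemma Hom_opposite [simp]: "Hom (opposite D) a b = Hom D b a"
  by (auto simp: Hom_def)

lemma category_opposite: "category D \<Longrightarrow> category (opposite D)"
proof -
  assume "category D"
  then interpret category D .
  show ?thesis
    by unfold_locales (auto simp: cmp_assoc cmp_ide_left cmp_ide_right intro: ide_hom cmp_hom)
qed

section \<open>Modules as families of groups with an action\<close>

text \<open>Modules are functors on \<open>opposite D\<close>: an arrow from \<open>d\<close> to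
  \<open>c\<close> acts from the group at \<open>c\<close> to the group at \<open>d\<close>. This is
  the underlying map of the triple that \<open>Ab\<close> uses as an arrow.\<close>

definition act :: "('c, 'd, 'u monoid, 'u monoid \<times> 'u monoid \<times> ('u \<Rightarrow> 'u)) ftor \<Rightarrow> 'd \<Rightarrow> 'u \<Rightarrow> 'u" where
  "act M f = snd (snd (FA M f))"

definition component :: "('c, 'd, 'u monoid, 'u monoid \<times> 'u monoid \<times> ('u \<Rightarrow> 'u)) functor_arr \<Rightarrow> 'c \<Rightarrow> 'u \<Rightarrow> 'u" where
  "component t c = snd (snd (snd (snd t) c))"

text \<open>The restrictions make the functor extensional, as the objects of the module category
  have to be.\<close>

definition make_module :: "('c, 'd) precat \<Rightarrow> ('c \<Rightarrow> 'u monoid) \<Rightarrow> ('d \<Rightarrow> 'u \<Rightarrow> 'u) \<Rightarrow>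
    ('c, 'd, 'u monoid, 'u monoid \<times> 'u monoid \<times> ('u \<Rightarrow> 'u)) ftor" where
  "make_module D G \<rho> = \<lparr>FO = (\<lambda>c\<in>Obj D. G c),
     FA = (\<lambda>f\<in>Arr D. (G (Cod D f), G (Dom D f), \<lambda>x\<in>carrier (G (Cod D f)). \<rho> f x))\<rparr>"

locale small_preadditive = preadditive_category D
  for D :: "('c, 'd) precat" +
  fixes \<kappa> :: "'u rel"
  assumes universe: "universe \<kappa>" and small_D: "small_category \<kappa> D"
begin

abbreviation "MOD \<equiv> module_category \<kappa> D"

lemma Mod_Obj: "M \<in> Obj MOD \<longleftrightarrow> additive_functor (opposite D) (Ab \<kappa>) M \<and> FO M \<in> extensional (Obj D) \<and> FA M \<in> extensional (Arr D)"
  by (simp add: module_category_def additive_functor_category_def additive_functors_def)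

lemma Mod_functor: "M \<in> Obj MOD \<Longrightarrow> is_functor (opposite D) (Ab \<kappa>) M"
  by (simp add: Mod_Obj additive_functor_def)

lemma module_group: "M \<in> Obj MOD \<Longrightarrow> c \<in> Obj D \<Longrightarrow> comm_group (FO M c)"
  and module_small: "M \<in> Obj MOD \<Longrightarrow> c \<in> Obj D \<Longrightarrow> small \<kappa> (carrier (FO M c))"
  using functor_obj[OF Mod_functor, of M c] by simp_all

lemma module_arr:
  assumes "M \<in> Obj MOD" "f \<in> Hom D d c"
  shows "FA M f = (FO M c, FO M d, act M f)" "act M f \<in> hom (FO M c) (FO M d)" "act M f \<in> extensional (carrier (FO M c))"
  using functor_hom[OF Mod_functor[OF assms(1)], of f c d] assms(2) by (auto simp: Hom_Ab act_def)

lemma act_closed: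
  assumes "M \<in> Obj MOD" "f \<in> Hom D d c" "x \<in> carrier (FO M c)"
  shows "act M f x \<in> carrier (FO M d)"
  using module_arr(2)[OF assms(1,2)] assms(3) by (auto simp: hom_def)

lemma act_mult:
  assumes "M \<in> Obj MOD" "f \<in> Hom D d c" "x \<in> carrier (FO M c)" "y \<in> carrier (FO M c)"
  shows "act M f (x \<otimes>\<^bsub>FO M c\<^esub> y) = act M f x \<otimes>\<^bsub>FO M d\<^esub> act M f y"
  using module_arr(2)[OF assms(1,2)] assms(3,4) by (auto simp: hom_def)

lemma act_ide:
  assumes "M \<in> Obj MOD" "x \<in> carrier (FO M c)" "c \<in> Obj D"
  shows "act M (Ide D c) x = x"
  using functor_ide[OF Mod_functor[OF assms(1)], of c] assms(2,3) by (simp add: act_def)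

lemma act_cmp:
  assumes "M \<in> Obj MOD" "f \<in> Hom D d c" "g \<in> Hom D e d" "x \<in> carrier (FO M c)"
  shows "act M (f \<cdot>\<^bsub>D\<^esub> g) x = act M g (act M f x)"
  using functor_cmp[OF Mod_functor[OF assms(1)], of f c d g e] assms(2-4)
    module_arr(1)[OF assms(1,2)] module_arr(1)[OF assms(1,3)] module_arr(1)[OF assms(1) cmp_hom[OF assms(3,2)]]
  by simp

lemma act_add:
  assumes "M \<in> Obj MOD" "f \<in> Hom D d c" "g \<in> Hom D d c" "x \<in> carrier (FO M c)"
  shows "act M (Add D f g) x = act M f x \<otimes>\<^bsub>FO M d\<^esub> act M g x"
proof -
  have "FA M (Add D f g) = Add (Ab \<kappa>) (FA M f) (FA M g)"
    using assms(1-3) hom_obj[OF assms(2)] by (simp add: Mod_Obj additive_functor_def)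
  then show ?thesis
    using assms(4) module_arr(1)[OF assms(1,2)] module_arr(1)[OF assms(1,3)] module_arr(1)[OF assms(1) add_hom[OF assms(2,3)]]
    by simp
qed

lemma make_module_simps:
  "c \<in> Obj D \<Longrightarrow> FO (make_module D G \<rho>) c = G c"
  "f \<in> Hom D d c \<Longrightarrow> x \<in> carrier (G c) \<Longrightarrow> act (make_module D G \<rho>) f x = \<rho> f x"
  by (auto simp: make_module_def act_def HomD)

text \<open>Replaces functoriality into \<open>Ab\<close> by the elementwise laws of a right action;
  modules are constructed through it.\<close>

lemma make_module_Obj:
  assumes G: "\<And>c. c \<in> Obj D \<Longrightarrow> comm_group (G c)" "\<And>c. c \<in> Obj D \<Longrightarrow> small \<kappa> (carrier (G c))"
    and hom: "\<And>f d c. f \<in> Hom D d c \<Longrightarrow> \<rho> f \<in> hom (G c) (G d)"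
    and ide: "\<And>c x. c \<in> Obj D \<Longrightarrow> x \<in> carrier (G c) \<Longrightarrow> \<rho> (Ide D c) x = x"
    and cmp: "\<And>f g c d e x. f \<in> Hom D d c \<Longrightarrow> g \<in> Hom D e d \<Longrightarrow> x \<in> carrier (G c) \<Longrightarrow> \<rho> (f \<cdot>\<^bsub>D\<^esub> g) x = \<rho> g (\<rho> f x)"
    and add: "\<And>f g c d x. f \<in> Hom D d c \<Longrightarrow> g \<in> Hom D d c \<Longrightarrow> x \<in> carrier (G c) \<Longrightarrow>
      \<rho> (Add D f g) x = \<rho> f x \<otimes>\<^bsub>G d\<^esub> \<rho> g x"
  shows "make_module D G \<rho> \<in> Obj MOD"
proof -
  let ?M = "make_module D G \<rho>"
  have FO: "FO ?M c = G c" if "c \<in> Obj D" for c using that by (simp add: make_module_def)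
  have FA: "FA ?M f = (G c, G d, \<lambda>x\<in>carrier (G c). \<rho> f x)" if "f \<in> Hom D d c" for f c d
    using HomD[OF that] by (simp add: make_module_def)
  have mon: "monoid (G c)" if "c \<in> Obj D" for c using G(1)[OF that] comm_group.axioms(2) group.is_monoid by blast
  have closed: "\<rho> f x \<in> carrier (G d)" if "f \<in> Hom D d c" "x \<in> carrier (G c)" for f c d x
    using hom[OF that(1)] that(2) by (auto simp: hom_def)
  have "is_functor (opposite D) (Ab \<kappa>) ?M"
  proof (rule functorI[OF category_opposite[OF category_axioms] category_Ab])
    fix c assume "c \<in> Obj (opposite D)"
    then have c: "c \<in> Obj D" by simp
    show "FO ?M c \<in> Obj (Ab \<kappa>)" using G[OF c] FO[OF c] by simp
    have "(\<lambda>x\<in>carrier (G c). \<rho> (Ide D c) x) = (\<lambda>x\<in>carrier (G c). x)" using ide[OF c] by (intro restrict_ext) simp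
    then show "FA ?M (Ide (opposite D) c) = Ide (Ab \<kappa>) (FO ?M c)" using FO[OF c] FA[OF ide_hom[OF c]] by simp
  next
    fix f c d assume "f \<in> Hom (opposite D) c d"
    then have f: "f \<in> Hom D d c" by simp
    note o = hom_obj[OF f]
    show "FA ?M f \<in> Hom (Ab \<kappa>) (FO ?M c) (FO ?M d)"
      unfolding Hom_Ab FA[OF f] FO[OF o(1)] FO[OF o(2)]
      using G[OF o(1)] G[OF o(2)] hom_restrict[OF hom[OF f] mon[OF o(2)]] by simp
  next
    fix f g c d e assume "f \<in> Hom (opposite D) c d" "g \<in> Hom (opposite D) d e"
    then have f: "f \<in> Hom D d c" and g: "g \<in> Hom D e d" by simp_all
    have "(\<lambda>x\<in>carrier (G c). \<rho> (f \<cdot>\<^bsub>D\<^esub> g) x) = (\<lambda>x\<in>carrier (G c). (\<lambda>x\<in>carrier (G d). \<rho> g x) ((\<lambda>x\<in>carrier (G c). \<rho> f x) x))"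
      by (intro restrict_ext) (simp add: cmp[OF f g] closed[OF f])
    then show "FA ?M (g \<cdot>\<^bsub>opposite D\<^esub> f) = FA ?M g \<cdot>\<^bsub>Ab \<kappa>\<^esub> FA ?M f"
      using FA[OF f] FA[OF g] FA[OF cmp_hom[OF g f]] by simp
  qed
  moreover have "FA ?M (Add D f g) = Add (Ab \<kappa>) (FA ?M f) (FA ?M g)" if f: "f \<in> Hom D d c" and g: "g \<in> Hom D d c" for f g c d
  proof -
    have "(\<lambda>x\<in>carrier (G c). \<rho> (Add D f g) x) = (\<lambda>x\<in>carrier (G c). (\<lambda>x\<in>carrier (G c). \<rho> f x) x \<otimes>\<^bsub>G d\<^esub> (\<lambda>x\<in>carrier (G c). \<rho> g x) x)"
      by (intro restrict_ext) (simp add: add[OF f g])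
    then show ?thesis using FA[OF f] FA[OF g] FA[OF add_hom[OF f g]] by simp
  qed
  ultimately show ?thesis unfolding Mod_Obj additive_functor_def by (auto simp: make_module_def)
qed

section \<open>Arrows of the module category as families of components\<close>

lemma Mod_simps [simp]:
  "Dom MOD (F, G, \<eta>) = F" "Cod MOD (F, G, \<eta>) = G"
  "Ide MOD F = (F, F, \<lambda>a\<in>Obj D. Ide (Ab \<kappa>) (FO F a))"
  "(G', H, \<theta>) \<cdot>\<^bsub>MOD\<^esub> (F, G, \<eta>) = (F, H, \<lambda>a\<in>Obj D. \<theta> a \<cdot>\<^bsub>Ab \<kappa>\<^esub> \<eta> a)"
  by (simp_all add: module_category_def additive_functor_category_def)

lemma Hom_Mod_iff: "t \<in> Hom MOD M N \<longleftrightarrow> (\<exists>\<eta>. t = (M, N, \<eta>) \<and> M \<in> Obj MOD \<and> N \<in> Obj MOD \<and>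
    nat_trans (opposite D) (Ab \<kappa>) M N \<eta> \<and> \<eta> \<in> extensional (Obj D))"
  by (cases t) (auto simp: Hom_def module_category_def additive_functor_category_def)

lemma Mod_hom_obj: "t \<in> Hom MOD M N \<Longrightarrow> M \<in> Obj MOD" "t \<in> Hom MOD M N \<Longrightarrow> N \<in> Obj MOD"
  unfolding Hom_Mod_iff by blast+

lemma component_eq:
  assumes "t \<in> Hom MOD M N" "c \<in> Obj D"
  shows "snd (snd t) c = (FO M c, FO N c, component t c)" "component t c \<in> hom (FO M c) (FO N c)"
    "component t c \<in> extensional (carrier (FO M c))"
  using assms by (auto simp: Hom_Mod_iff nat_trans_def component_def Hom_Ab)

lemma component_closed:
  assumes "t \<in> Hom MOD M N" "c \<in> Obj D" "x \<in> carrier (FO M c)"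
  shows "component t c x \<in> carrier (FO N c)"
  using component_eq(2)[OF assms(1,2)] assms(3) by (auto simp: hom_def)

lemma component_mult:
  assumes "t \<in> Hom MOD M N" "c \<in> Obj D" "x \<in> carrier (FO M c)" "y \<in> carrier (FO M c)"
  shows "component t c (x \<otimes>\<^bsub>FO M c\<^esub> y) = component t c x \<otimes>\<^bsub>FO N c\<^esub> component t c y"
  using component_eq(2)[OF assms(1,2)] assms(3,4) by (auto simp: hom_def)

lemma component_group_hom:
  assumes "t \<in> Hom MOD M N" "c \<in> Obj D"
  shows "group_hom (FO M c) (FO N c) (component t c)"
  using component_eq(2)[OF assms] module_group[OF Mod_hom_obj(1)[OF assms(1)] assms(2)]
    module_group[OF Mod_hom_obj(2)[OF assms(1)] assms(2)] comm_group.axioms(2)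
  by (intro group_hom.intro group_hom_axioms.intro)

lemma component_natural:
  assumes "t \<in> Hom MOD M N" "f \<in> Hom D d c" "x \<in> carrier (FO M c)"
  shows "component t d (act M f x) = act N f (component t c x)"
proof -
  note o = hom_obj[OF assms(2)]
  have "snd (snd t) d \<cdot>\<^bsub>Ab \<kappa>\<^esub> FA M f = FA N f \<cdot>\<^bsub>Ab \<kappa>\<^esub> snd (snd t) c"
    using assms(1) HomD[OF assms(2)] by (auto simp: Hom_Mod_iff nat_trans_def)
  then show ?thesis
    using assms(3) component_eq(1)[OF assms(1) o(1)] component_eq(1)[OF assms(1) o(2)]
      module_arr(1)[OF Mod_hom_obj(1)[OF assms(1)] assms(2)] module_arr(1)[OF Mod_hom_obj(2)[OF assms(1)] assms(2)]
    by (auto simp: fun_eq_iff split: if_splits dest: spec[of _ x])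
qed

text \<open>Arrows are extensional, both as families over the objects of \<open>D\<close> and as
  maps on each carrier, so agreement on the carriers is equality.\<close>

lemma Mod_hom_eqI:
  assumes "t \<in> Hom MOD M N" "t' \<in> Hom MOD M N"
    and "\<And>c x. c \<in> Obj D \<Longrightarrow> x \<in> carrier (FO M c) \<Longrightarrow> component t c x = component t' c x"
  shows "t = t'"
proof -
  obtain \<eta> \<eta>' where t: "t = (M, N, \<eta>)" "\<eta> \<in> extensional (Obj D)" and t': "t' = (M, N, \<eta>')" "\<eta>' \<in> extensional (Obj D)"
    using assms(1,2) unfolding Hom_Mod_iff by blast
  have "\<eta> c = \<eta>' c" if c: "c \<in> Obj D" for c
  proof -
    have "component t c = component t' c"
      by (rule extensionalityI[OF component_eq(3)[OF assms(1) c] component_eq(3)[OF assms(2) c] assms(3)[OF c]])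
    then show ?thesis using component_eq(1)[OF assms(1) c] component_eq(1)[OF assms(2) c] t(1) t'(1) by simp
  qed
  then show ?thesis using t t' extensionalityI[OF t(2) t'(2)] by simp
qed

text \<open>The maps \<open>h c\<close> may take any values outside the carriers; their restrictions
  form the extensional arrow.\<close>

lemma Mod_homI:
  assumes M: "M \<in> Obj MOD" and N: "N \<in> Obj MOD"
    and hom: "\<And>c. c \<in> Obj D \<Longrightarrow> h c \<in> hom (FO M c) (FO N c)"
    and nat: "\<And>f c d x. f \<in> Hom D d c \<Longrightarrow> x \<in> carrier (FO M c) \<Longrightarrow> h d (act M f x) = act N f (h c x)"
  obtains t where "t \<in> Hom MOD M N" "\<forall>c\<in>Obj D. \<forall>x\<in>carrier (FO M c). component t c x = h c x"
proof -
  define \<eta> where "\<eta> = (\<lambda>c\<in>Obj D. (FO M c, FO N c, \<lambda>x\<in>carrier (FO M c). h c x))"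
  have mon: "monoid (FO M c)" if "c \<in> Obj D" for c
    using module_group[OF M that] comm_group.axioms(2) group.is_monoid by blast
  have "nat_trans (opposite D) (Ab \<kappa>) M N \<eta>"
    unfolding nat_trans_def
  proof (intro conjI ballI)
    fix c assume "c \<in> Obj (opposite D)"
    then have c: "c \<in> Obj D" by simp
    show "\<eta> c \<in> Hom (Ab \<kappa>) (FO M c) (FO N c)"
      unfolding Hom_Ab using c hom_restrict[OF hom[OF c] mon[OF c]] module_group[OF _ c] module_small[OF _ c] M N
      by (simp add: \<eta>_def)
  next
    fix f assume "f \<in> Arr (opposite D)"
    then have f: "f \<in> Hom D (Dom D f) (Cod D f)" by (simp add: Hom_def)
    note o = hom_obj[OF f]
    note Mf = module_arr(1)[OF M f] and Nf = module_arr(1)[OF N f]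
    have "(\<lambda>x\<in>carrier (FO M (Cod D f)). (\<lambda>x\<in>carrier (FO M (Dom D f)). h (Dom D f) x) (act M f x)) =
        (\<lambda>x\<in>carrier (FO M (Cod D f)). act N f ((\<lambda>x\<in>carrier (FO M (Cod D f)). h (Cod D f) x) x))"
      by (intro restrict_ext) (simp add: nat[OF f] act_closed[OF M f])
    then show "\<eta> (Cod (opposite D) f) \<cdot>\<^bsub>Ab \<kappa>\<^esub> FA M f = FA N f \<cdot>\<^bsub>Ab \<kappa>\<^esub> \<eta> (Dom (opposite D) f)"
      using o Mf Nf by (simp add: \<eta>_def)
  qed
  then have "(M, N, \<eta>) \<in> Hom MOD M N" unfolding Hom_Mod_iff using M N by (simp add: \<eta>_def)
  then show thesis by (rule that) (simp add: component_def \<eta>_def)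
qed

lemma Mod_ide:
  assumes "M \<in> Obj MOD"
  shows "Ide MOD M \<in> Hom MOD M M" "c \<in> Obj D \<Longrightarrow> x \<in> carrier (FO M c) \<Longrightarrow> component (Ide MOD M) c x = x"
proof -
  show c: "c \<in> Obj D \<Longrightarrow> x \<in> carrier (FO M c) \<Longrightarrow> component (Ide MOD M) c x = x" for c x
    by (simp add: component_def)
  have hom: "(\<lambda>x. x) \<in> hom (FO M c) (FO M c)" for c by (simp add: hom_def)
  obtain t where t: "t \<in> Hom MOD M M" "\<forall>c\<in>Obj D. \<forall>x\<in>carrier (FO M c). component t c x = x"
    by (rule Mod_homI[OF assms assms hom]) auto
  obtain \<eta> where eta: "t = (M, M, \<eta>)" "\<eta> \<in> extensional (Obj D)" using t(1) unfolding Hom_Mod_iff by blast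
  have "\<eta> = (\<lambda>a\<in>Obj D. Ide (Ab \<kappa>) (FO M a))"
  proof (rule extensionalityI[OF eta(2) restrict_extensional])
    fix c assume c: "c \<in> Obj D"
    have "component t c = (\<lambda>x\<in>carrier (FO M c). x)"
      by (rule extensionalityI[OF component_eq(3)[OF t(1) c]]) (use t(2) c in simp_all)
    then show "\<eta> c = (\<lambda>a\<in>Obj D. Ide (Ab \<kappa>) (FO M a)) c"
      using component_eq(1)[OF t(1) c] eta(1) c by simp
  qed
  then show "Ide MOD M \<in> Hom MOD M M" using t(1) eta(1) by simp
qed

lemma Mod_cmp:
  assumes "t \<in> Hom MOD M N" "s \<in> Hom MOD N L"
  shows "s \<cdot>\<^bsub>MOD\<^esub> t \<in> Hom MOD M L"
    "c \<in> Obj D \<Longrightarrow> x \<in> carrier (FO M c) \<Longrightarrow> component (s \<cdot>\<^bsub>MOD\<^esub> t) c x = component s c (component t c x)"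
proof -
  obtain \<eta> \<theta> where t: "t = (M, N, \<eta>)" and s: "s = (N, L, \<theta>)" using assms unfolding Hom_Mod_iff by blast
  have pt: "\<theta> c \<cdot>\<^bsub>Ab \<kappa>\<^esub> \<eta> c = (FO M c, FO L c, \<lambda>x\<in>carrier (FO M c). component s c (component t c x))" if "c \<in> Obj D" for c
    using component_eq(1)[OF assms(1) that] component_eq(1)[OF assms(2) that] t s by simp
  show cc: "component (s \<cdot>\<^bsub>MOD\<^esub> t) c x = component s c (component t c x)" if "c \<in> Obj D" "x \<in> carrier (FO M c)" for c x
    using pt[OF that(1)] that by (simp add: component_def t s)
  \<comment> \<open>An arrow with the right components is constructed and then identified with the
    composite as defined, which shows that the composite is an arrow.\<close>
  obtain r where r: "r \<in> Hom MOD M L" "\<forall>c\<in>Obj D. \<forall>x\<in>carrier (FO M c). component r c x = component s c (component t c x)"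
  proof (rule Mod_homI[OF Mod_hom_obj(1)[OF assms(1)] Mod_hom_obj(2)[OF assms(2)]])
    fix c assume c: "c \<in> Obj D"
    show "(\<lambda>x. component s c (component t c x)) \<in> hom (FO M c) (FO L c)"
      using component_eq(2)[OF assms(1) c] component_eq(2)[OF assms(2) c] by (auto simp: hom_def Pi_iff)
  next
    fix f c d x assume f: "f \<in> Hom D d c" and x: "x \<in> carrier (FO M c)"
    show "component s d (component t d (act M f x)) = act L f (component s c (component t c x))"
      using component_natural[OF assms(1) f x] component_natural[OF assms(2) f component_closed[OF assms(1) hom_obj(2)[OF f]
          x]] by simp
  qed
  obtain \<zeta> where z: "r = (M, L, \<zeta>)" "\<zeta> \<in> extensional (Obj D)" using r(1) unfolding Hom_Mod_iff by blast
  have "\<zeta> = (\<lambda>a\<in>Obj D. \<theta> a \<cdot>\<^bsub>Ab \<kappa>\<^esub> \<eta> a)"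
  proof (rule extensionalityI[OF z(2) restrict_extensional])
    fix c assume c: "c \<in> Obj D"
    have "component r c = (\<lambda>x\<in>carrier (FO M c). component s c (component t c x))"
      by (rule extensionalityI[OF component_eq(3)[OF r(1) c]]) (use r(2) c in simp_all)
    then show "\<zeta> c = (\<lambda>a\<in>Obj D. \<theta> a \<cdot>\<^bsub>Ab \<kappa>\<^esub> \<eta> a) c"
      using component_eq(1)[OF r(1) c] z(1) c pt[OF c] by simp
  qed
  then show "s \<cdot>\<^bsub>MOD\<^esub> t \<in> Hom MOD M L" using r(1) z(1) t s by simp
qed

lemma category_Mod: "category MOD"
proof
  fix f assume "f \<in> Arr MOD"
  then have "f \<in> Hom MOD (Dom MOD f) (Cod MOD f)" by (simp add: Hom_def)
  then show "Dom MOD f \<in> Obj MOD" "Cod MOD f \<in> Obj MOD" by (rule Mod_hom_obj)+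
next
  fix a assume "a \<in> Obj MOD" then show "Ide MOD a \<in> Hom MOD a a" by (rule Mod_ide)
next
  fix f a b g c assume "f \<in> Hom MOD a b" "g \<in> Hom MOD b c"
  then show "g \<cdot>\<^bsub>MOD\<^esub> f \<in> Hom MOD a c" by (rule Mod_cmp)
next
  fix f a b assume f: "f \<in> Hom MOD a b"
  note a = Mod_ide[OF Mod_hom_obj(1)[OF f]] and b = Mod_ide[OF Mod_hom_obj(2)[OF f]]
  show "f \<cdot>\<^bsub>MOD\<^esub> Ide MOD a = f"
    by (rule Mod_hom_eqI[OF Mod_cmp(1)[OF a(1) f] f]) (simp only: Mod_cmp(2)[OF a(1) f] a(2))
  show "Ide MOD b \<cdot>\<^bsub>MOD\<^esub> f = f"
    by (rule Mod_hom_eqI[OF Mod_cmp(1)[OF f b(1)] f]) (simp only: Mod_cmp(2)[OF f b(1)] b(2) component_closed[OF f])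
next
  fix f a b g c h d assume f: "f \<in> Hom MOD a b" and g: "g \<in> Hom MOD b c" and h: "h \<in> Hom MOD c d"
  note gf = Mod_cmp[OF f g] and hg = Mod_cmp[OF g h]
  show "h \<cdot>\<^bsub>MOD\<^esub> (g \<cdot>\<^bsub>MOD\<^esub> f) = h \<cdot>\<^bsub>MOD\<^esub> g \<cdot>\<^bsub>MOD\<^esub> f"
    by (rule Mod_hom_eqI[OF Mod_cmp(1)[OF gf(1) h] Mod_cmp(1)[OF f hg(1)]])
       (simp only: Mod_cmp(2)[OF gf(1) h] Mod_cmp(2)[OF f hg(1)] gf(2) hg(2) component_closed[OF f])
qed

sublocale MOD: category MOD
  by (rule category_Mod)

text \<open>The inverses of the components are again additive and natural.\<close>

lemma Mod_isoI:
  assumes t: "t \<in> Hom MOD M N" and bij: "\<And>c. c \<in> Obj D \<Longrightarrow> bij_betw (component t c) (carrier (FO M c)) (carrier (FO N c))"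
  shows "isomorphic MOD M N"
proof -
  define h where "h c = inv_into (carrier (FO M c)) (component t c)" for c
  have h: "h c y \<in> carrier (FO M c)" "component t c (h c y) = y" if "c \<in> Obj D" "y \<in> carrier (FO N c)" for c y
    using bij[OF that(1)] that(2) by (auto simp: h_def bij_betw_def inv_into_into f_inv_into_f)
  have hx: "h c (component t c x) = x" if "c \<in> Obj D" "x \<in> carrier (FO M c)" for c x
    using bij[OF that(1)] that(2) by (simp add: h_def bij_betw_def)
  note MN = Mod_hom_obj[OF t]
  obtain s where s: "s \<in> Hom MOD N M" "\<forall>c\<in>Obj D. \<forall>y\<in>carrier (FO N c). component s c y = h c y"
  proof (rule Mod_homI[OF MN(2,1), of h])
    fix c assume c: "c \<in> Obj D"
    interpret M: comm_group "FO M c" by (rule module_group[OF MN(1) c])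
    show "h c \<in> hom (FO N c) (FO M c)"
    proof (rule homI)
      fix x y assume "x \<in> carrier (FO N c)" "y \<in> carrier (FO N c)"
      then show "h c (x \<otimes>\<^bsub>FO N c\<^esub> y) = h c x \<otimes>\<^bsub>FO M c\<^esub> h c y"
        using hx[OF c M.m_closed, of "h c x" "h c y"] h[OF c] component_mult[OF t c, of "h c x" "h c y"] by simp
    qed (rule h(1)[OF c])
  next
    fix f c d y assume f: "f \<in> Hom D d c" and y: "y \<in> carrier (FO N c)"
    note o = hom_obj[OF f]
    have "component t d (act M f (h c y)) = act N f y"
      using component_natural[OF t f h(1)[OF o(2) y]] h(2)[OF o(2) y] by simp
    then show "h d (act N f y) = act M f (h c y)"
      using hx[OF o(1) act_closed[OF MN(1) f h(1)[OF o(2) y]]] by simp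
  qed
  have "s \<cdot>\<^bsub>MOD\<^esub> t = Ide MOD M"
    by (rule Mod_hom_eqI[OF Mod_cmp(1)[OF t s(1)] Mod_ide(1)[OF MN(1)]])
       (simp add: Mod_cmp(2)[OF t s(1)] s(2) component_closed[OF t] hx Mod_ide(2)[OF MN(1)] del: Mod_simps)
  moreover have "t \<cdot>\<^bsub>MOD\<^esub> s = Ide MOD N"
    by (rule Mod_hom_eqI[OF Mod_cmp(1)[OF s(1) t] Mod_ide(1)[OF MN(2)]])
       (simp add: Mod_cmp(2)[OF s(1) t] s(2) h Mod_ide(2)[OF MN(2)] del: Mod_simps)
  ultimately show ?thesis by (rule MOD.isomorphicI[OF t s(1)])
qed

end


section \<open>Self-small presenting sets yield module categories\<close>

text \<open>For \<open>e\<close> injective on the carrier this is a copy of \<open>G\<close>; it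
  places the hom groups of \<open>A\<close> inside \<open>'u\<close>.\<close>

definition transport_group :: "('a \<Rightarrow> 'b) \<Rightarrow> ('a, 'x) monoid_scheme \<Rightarrow> 'b monoid" where
  "transport_group e G = \<lparr>carrier = e ` carrier G,
     monoid.mult = (\<lambda>u v. e (inv_into (carrier G) e u \<otimes>\<^bsub>G\<^esub> inv_into (carrier G) e v)), one = e \<one>\<^bsub>G\<^esub>\<rparr>"

lemma carrier_transport_group [simp]: "carrier (transport_group e G) = e ` carrier G"
  and one_transport_group [simp]: "\<one>\<^bsub>transport_group e G\<^esub> = e \<one>\<^bsub>G\<^esub>"
  by (simp_all add: transport_group_def)

lemma mult_transport_group:
  assumes "inj_on e (carrier G)" "x \<in> carrier G" "y \<in> carrier G"
  shows "e x \<otimes>\<^bsub>transport_group e G\<^esub> e y = e (x \<otimes>\<^bsub>G\<^esub> y)"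
  using assms by (simp add: transport_group_def)

lemma comm_group_transport:
  assumes "comm_group G" "inj_on e (carrier G)"
  shows "comm_group (transport_group e G)"
proof -
  interpret comm_group G by fact
  have "e \<in> hom G (transport_group e G)" using mult_transport_group[OF assms(2)] by (auto simp: hom_def)
  then have "e \<in> iso G (transport_group e G)" using assms(2) by (simp add: iso_def bij_betw_def)
  from iso_imp_img_comm_group[OF this] show ?thesis by (simp add: transport_group_def)
qed

lemma group_hom_finprod:
  assumes "comm_group G" "comm_group H" "h \<in> hom G H" "finite F" "f \<in> F \<rightarrow> carrier G"
  shows "h (finprod G f F) = finprod H (\<lambda>i. h (f i)) F"
proof -
  interpret G: comm_group G by fact
  interpret H: comm_group H by fact
  interpret group_hom G H h
    using assms(3) by (simp add: group_hom_def group_hom_axioms_def G.group_axioms H.group_axioms)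
  show ?thesis
    using assms(4,5)
  proof (induction F)
    case (insert i F)
    have "(\<lambda>i. h (f i)) \<in> F \<rightarrow> carrier H" using insert.prems by (auto simp: Pi_iff)
    then show ?case using insert by (simp add: Pi_iff)
  qed simp
qed

text \<open>Surjectivity of the canonical map writes \<open>x\<close> as a finite sum of arrows
  \<open>\<iota> i \<cdot> z\<close>, and the induction runs over the finite support. The index set
  may have any type; it is moved into \<open>'u\<close>, where \<open>self_small\<close>
  applies.\<close>

lemma self_small_induct [consumes 6, case_names zero add inj]:
  fixes A :: "('o, 'm, 'x) precat_scheme" and \<kappa> :: "'u rel" and I :: "'i set"
  assumes "preadditive_category A" "universe \<kappa>" "self_small \<kappa> A \<U>" "U \<in> \<U>" "small \<kappa> I"
    and "x \<in> Hom A U P" and cP: "is_coproduct A I X P \<iota>" and XU: "\<forall>i\<in>I. X i \<in> \<U>"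
    and zero: "Q (Zero A U P)"
    and add: "\<And>x y. x \<in> Hom A U P \<Longrightarrow> y \<in> Hom A U P \<Longrightarrow> Q x \<Longrightarrow> Q y \<Longrightarrow> Q (Add A x y)"
    and inj: "\<And>i z. i \<in> I \<Longrightarrow> z \<in> Hom A U (X i) \<Longrightarrow> Q (\<iota> i \<cdot>\<^bsub>A\<^esub> z)"
  shows "Q x"
proof -
  interpret preadditive_category A by fact
  obtain g :: "'i \<Rightarrow> 'u" where g: "inj_on g I" using small_embed[OF assms(2,5)] .
  let ?J = "g ` I" and ?g = "the_inv_into I g"
  have gi: "?g j \<in> I" if "j \<in> ?J" for j using the_inv_into_into[OF g that] by simp
  have "bij_betw ?g ?J I"
    using g by (metis bij_betw_the_inv_into inj_on_imp_bij_betw)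
  note cJ = coproduct_reindex[OF this cP]
  have UP: "U \<in> Obj A" "P \<in> Obj A" using hom_obj[OF assms(6)] .
  have o: "X (?g j) \<in> Obj A" if "j \<in> ?J" for j using coproduct_summand_obj[OF cJ that] .
  let ?c = "canonical_map A U ?J (\<lambda>j. X (?g j)) P (\<lambda>j. \<iota> (?g j))"
  have "?c \<in> iso (sum_group ?J (\<lambda>j. hom_group A U (X (?g j)))) (hom_group A U P)"
    by (rule assms(3)[unfolded self_small_def, THEN spec, THEN spec, THEN spec, THEN spec, THEN bspec, OF assms(4), THEN mp])
       (simp add: small_image[OF assms(5)] cJ XU gi)
  then have "x \<in> ?c ` carrier (sum_group ?J (\<lambda>j. hom_group A U (X (?g j))))"
    using assms(6) by (simp add: iso_def bij_betw_def)
  then obtain y where y: "y \<in> carrier (sum_group ?J (\<lambda>j. hom_group A U (X (?g j))))" and x: "x = ?c y"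
    by blast
  have grp: "j \<in> ?J \<Longrightarrow> group (hom_group A U (X (?g j)))" for j using group_hom_group[OF UP(1) o] .
  let ?H = "\<lambda>j. hom_group A U (X (?g j))"
  have "carrier (sum_group ?J ?H) = {x \<in> \<Pi>\<^sub>E j\<in>?J. carrier (?H j). finite {j \<in> ?J. x j \<noteq> \<one>\<^bsub>?H j\<^esub>}}"
    by (rule carrier_sum_group[OF grp])
  then have yP: "y \<in> (\<Pi>\<^sub>E j\<in>?J. carrier (?H j))" and fin: "finite {j \<in> ?J. y j \<noteq> Zero A U (X (?g j))}"
    using y by simp_all
  have yh: "y j \<in> Hom A U (X (?g j))" if "j \<in> ?J" for j
    using PiE_mem[OF yP that] by simp
  interpret G: comm_group "hom_group A U P" by (rule hom_comm_group[OF UP])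
  have "finite F \<Longrightarrow> F \<subseteq> ?J \<Longrightarrow> Q (finprod (hom_group A U P) (\<lambda>j. \<iota> (?g j) \<cdot>\<^bsub>A\<^esub> y j) F)" for F
  proof (induction F rule: finite_induct)
    case empty then show ?case using zero by simp
  next
    case (insert j F)
    have h: "\<iota> (?g j) \<cdot>\<^bsub>A\<^esub> y j \<in> Hom A U P" if "j \<in> ?J" for j
      by (rule cmp_hom[OF yh[OF that] coproduct_inj[OF cJ that]])
    have j: "j \<in> ?J" using insert.prems by simp
    have "(\<lambda>j. \<iota> (?g j) \<cdot>\<^bsub>A\<^esub> y j) \<in> F \<rightarrow> Hom A U P" using h insert.prems by blast
    moreover have "finprod (hom_group A U P) (\<lambda>j. \<iota> (?g j) \<cdot>\<^bsub>A\<^esub> y j) F \<in> Hom A U P"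
      by (rule finprod_hom[OF UP]) (use h insert.prems in blast)
    moreover have "Q (finprod (hom_group A U P) (\<lambda>j. \<iota> (?g j) \<cdot>\<^bsub>A\<^esub> y j) F)" using insert by simp
    moreover have "Q (\<iota> (?g j) \<cdot>\<^bsub>A\<^esub> y j)" by (rule inj[OF gi[OF j] yh[OF j]])
    ultimately show ?case using insert.hyps add h[OF j] by simp
  qed
  from this[OF fin] show ?thesis unfolding x canonical_map_def by auto
qed

section \<open>The functor from \<open>B\<close> to modules that is represented by \<U>\<close>

text \<open>\<open>K\<close> is a fully faithful additive functor from \<open>D\<close> onto \<U>.
  Leaving \<open>D\<close> open covers both a copy of \<U> inside \<open>'u\<close> and the
  endomorphism ring of a single object.\<close>

locale module_data = presented A \<kappa> B \<U> + D: small_preadditive D \<kappa>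
  for A :: "('o, 'm, 'x) precat_scheme" (structure) and \<kappa> :: "'u rel" and B :: "'o set" and \<U> :: "'o set"
    and D :: "('c, 'd) precat" +
  fixes K :: "('c, 'd, 'o, 'm) ftor"
  assumes self_small: "self_small \<kappa> A \<U>"
    and K_functor: "is_functor D A K"
    and K_add: "f \<in> Hom D c d \<Longrightarrow> g \<in> Hom D c d \<Longrightarrow> FA K (Add D f g) = Add A (FA K f) (FA K g)"
    and K_ff: "c \<in> Obj D \<Longrightarrow> d \<in> Obj D \<Longrightarrow> bij_betw (FA K) (Hom D c d) (Hom A (FO K c) (FO K d))"
    and K_Obj: "FO K ` Obj D = \<U>"
begin

abbreviation "Ko \<equiv> FO K"
abbreviation "Ka \<equiv> FA K"

lemma K_U: "c \<in> Obj D \<Longrightarrow> Ko c \<in> \<U>" using K_Obj by blast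
lemma K_obj: "c \<in> Obj D \<Longrightarrow> Ko c \<in> Obj A" using K_U U_obj by blast
lemmas K_hom = functor_hom[OF K_functor]
lemmas K_cmp = functor_cmp[OF K_functor]
lemmas K_ide = functor_ide[OF K_functor]

definition Kinv :: "'c \<Rightarrow> 'c \<Rightarrow> 'm \<Rightarrow> 'd" where
  "Kinv c d h = inv_into (Hom D c d) Ka h"

lemma Kinv_hom: "c \<in> Obj D \<Longrightarrow> d \<in> Obj D \<Longrightarrow> h \<in> Hom A (Ko c) (Ko d) \<Longrightarrow> Kinv c d h \<in> Hom D c d"
  and K_Kinv: "c \<in> Obj D \<Longrightarrow> d \<in> Obj D \<Longrightarrow> h \<in> Hom A (Ko c) (Ko d) \<Longrightarrow> Ka (Kinv c d h) = h"
  using K_ff[of c d] unfolding Kinv_def bij_betw_def by (auto intro: inv_into_into f_inv_into_f)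

lemma Kinv_K: "f \<in> Hom D c d \<Longrightarrow> Kinv c d (Ka f) = f"
  using K_ff[OF D.hom_obj] unfolding Kinv_def bij_betw_def by (simp add: D.hom_obj)

lemma K_full:
  assumes "c \<in> Obj D" "d \<in> Obj D" "h \<in> Hom A (Ko c) (Ko d)"
  obtains f where "f \<in> Hom D c d" "Ka f = h"
  using Kinv_hom[OF assms] K_Kinv[OF assms] that by blast

lemma K_zero:
  assumes c: "c \<in> Obj D" "d \<in> Obj D"
  shows "Ka (Zero D c d) = Zero A (Ko c) (Ko d)"
proof -
  have z: "Zero D c d \<in> Hom D c d" using c by (rule D.zero_hom)
  note Kz = K_hom[OF z] and zA = zero_hom[OF K_obj K_obj, OF c]
  have "Add A (Ka (Zero D c d)) (Ka (Zero D c d)) = Add A (Ka (Zero D c d)) (Zero A (Ko c) (Ko d))"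
    using K_add[OF z z] D.add_zero_left[OF z] add_zero_right[OF Kz] by simp
  then show ?thesis by (rule add_left_cancel[OF Kz Kz zA])
qed

lemma Kinv_zero: "c \<in> Obj D \<Longrightarrow> d \<in> Obj D \<Longrightarrow> Kinv c d (Zero A (Ko c) (Ko d)) = Zero D c d"
  using Kinv_K[OF D.zero_hom] K_zero by simp

lemma Kinv_add:
  assumes "c \<in> Obj D" "d \<in> Obj D" "h \<in> Hom A (Ko c) (Ko d)" "h' \<in> Hom A (Ko c) (Ko d)"
  shows "Kinv c d (Add A h h') = Add D (Kinv c d h) (Kinv c d h')"
  using Kinv_K[OF D.add_hom[OF Kinv_hom[OF assms(1-3)] Kinv_hom[OF assms(1,2,4)]]]
    K_add[OF Kinv_hom[OF assms(1-3)] Kinv_hom[OF assms(1,2,4)]] K_Kinv[OF assms(1-3)] K_Kinv[OF assms(1,2,4)] by simp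

lemma Kinv_cmp:
  assumes "f \<in> Hom D b c" "d \<in> Obj D" "h \<in> Hom A (Ko c) (Ko d)"
  shows "Kinv b d (h \<cdot> Ka f) = Kinv c d h \<cdot>\<^bsub>D\<^esub> f"
proof -
  note c = D.hom_obj(2)[OF assms(1)]
  show ?thesis
    using Kinv_K[OF D.cmp_hom[OF assms(1) Kinv_hom[OF c assms(2,3)]]]
      K_cmp[OF assms(1) Kinv_hom[OF c assms(2,3)]] K_Kinv[OF c assms(2,3)] by simp
qed

text \<open>\<open>X\<close> is covered by a sum of objects of \<U>, so arrows from \<U> to
  \<open>X\<close> separate the arrows out of \<open>X\<close>.\<close>

lemma B_hom_eqI:
  assumes "X \<in> B" "f \<in> Hom A X Y" "g \<in> Hom A X Y"
    and "\<And>c x. c \<in> Obj D \<Longrightarrow> x \<in> Hom A (Ko c) X \<Longrightarrow> f \<cdot> x = g \<cdot> x"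
  shows "f = g"
proof -
  obtain P p where P: "P \<in> Sum \<kappa> A \<U>" and p: "p \<in> Hom A P X" "epic A p" using B_Gen[OF assms(1)] by (rule GenE)
  obtain I :: "'u set" and Z \<iota> where I: "\<forall>i\<in>I. Z i \<in> \<U>" "is_coproduct A I Z P \<iota>" using P by (rule SumE)
  have "f \<cdot> p = g \<cdot> p"
  proof (rule coproduct_eqI[OF I(2) cmp_hom[OF p(1) assms(2)] cmp_hom[OF p(1) assms(3)]])
    fix i assume i: "i \<in> I"
    obtain c where c: "c \<in> Obj D" "Z i = Ko c" using I(1) i K_Obj by blast
    note ii = coproduct_inj[OF I(2) i]
    have "f \<cdot> (p \<cdot> \<iota> i) = g \<cdot> (p \<cdot> \<iota> i)" by (rule assms(4)[OF c(1)]) (use cmp_hom[OF ii p(1)] c(2) in simp)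
    then show "f \<cdot> p \<cdot> \<iota> i = g \<cdot> p \<cdot> \<iota> i" using cmp_assoc[OF ii p(1) assms(2)] cmp_assoc[OF ii p(1) assms(3)] by simp
  qed
  then show ?thesis using epicD[OF p(2), of f Y g] assms(2,3) HomD(3)[OF p(1)] by simp
qed

lemma small_Obj_D: "small \<kappa> (Obj D)"
  using D.small_D by (simp add: small_category_def)

lemma small_Hom_K: "c \<in> Obj D \<Longrightarrow> X \<in> Obj A \<Longrightarrow> small \<kappa> (Hom A (Ko c) X)"
  using small_Hom K_obj by blast

text \<open>The elements of the modules live in \<open>'u\<close>, so the groups \<open>A(K c, X)\<close> are transported along arbitrary injections.\<close>

definition enc :: "'c \<Rightarrow> 'o \<Rightarrow> 'm \<Rightarrow> 'u" where
  "enc c X = (SOME g. inj_on g (Hom A (Ko c) X))"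

lemma inj_enc: "c \<in> Obj D \<Longrightarrow> X \<in> Obj A \<Longrightarrow> inj_on (enc c X) (Hom A (Ko c) X)"
  unfolding enc_def using small_embed[OF universe small_Hom_K] by (metis someI_ex)

definition dec :: "'c \<Rightarrow> 'o \<Rightarrow> 'u \<Rightarrow> 'm" where
  "dec c X = inv_into (Hom A (Ko c) X) (enc c X)"

lemma dec_enc [simp]: "c \<in> Obj D \<Longrightarrow> x \<in> Hom A (Ko c) X \<Longrightarrow> dec c X (enc c X x) = x"
  using inj_enc[OF _ hom_obj(2)] by (simp add: dec_def)

text \<open>The functor \<open>A(K -, X)\<close> in encoded form: an element is the code of an arrow
  to \<open>X\<close>, and an arrow of \<open>D\<close> acts by precomposition with its image under
  \<open>K\<close>.\<close>

definition hom_module :: "'o \<Rightarrow> ('c, 'd, 'u monoid, 'u monoid \<times> 'u monoid \<times> ('u \<Rightarrow> 'u)) ftor" where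
  "hom_module X = make_module D (\<lambda>c. transport_group (enc c X) (hom_group A (Ko c) X))
     (\<lambda>f u. enc (Dom D f) X (dec (Cod D f) X u \<cdot> Ka f))"

lemma FO_hom_module: "c \<in> Obj D \<Longrightarrow> FO (hom_module X) c = transport_group (enc c X) (hom_group A (Ko c) X)"
  unfolding hom_module_def by (rule D.make_module_simps)

lemma carrier_hom_module: "c \<in> Obj D \<Longrightarrow> carrier (FO (hom_module X) c) = enc c X ` Hom A (Ko c) X"
  by (simp add: FO_hom_module)

lemma one_hom_module: "c \<in> Obj D \<Longrightarrow> \<one>\<^bsub>FO (hom_module X) c\<^esub> = enc c X (Zero A (Ko c) X)"
  by (simp add: FO_hom_module)

lemma mult_hom_module:
  assumes "c \<in> Obj D" "x \<in> Hom A (Ko c) X" "y \<in> Hom A (Ko c) X"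
  shows "enc c X x \<otimes>\<^bsub>FO (hom_module X) c\<^esub> enc c X y = enc c X (Add A x y)"
  using mult_transport_group[of "enc c X" "hom_group A (Ko c) X" x y] inj_enc[OF assms(1) hom_obj(2)[OF assms(2)]] assms
  by (simp add: FO_hom_module)

lemma act_hom_module:
  assumes "f \<in> Hom D d c" "x \<in> Hom A (Ko c) X"
  shows "act (hom_module X) f (enc c X x) = enc d X (x \<cdot> Ka f)"
  unfolding hom_module_def
  using D.make_module_simps(2)[OF assms(1), of "enc c X x" "\<lambda>c. transport_group (enc c X) (hom_group A (Ko c) X)"
      "\<lambda>f u. enc (Dom D f) X (dec (Cod D f) X u \<cdot> Ka f)"] assms D.hom_obj[OF assms(1)]
  by (simp add: HomD[OF assms(1)])

lemma hom_module_Obj: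
  assumes X: "X \<in> Obj A"
  shows "hom_module X \<in> Obj D.MOD"
  unfolding hom_module_def
proof (rule D.make_module_Obj)
  fix c assume c: "c \<in> Obj D"
  show "comm_group (transport_group (enc c X) (hom_group A (Ko c) X))"
    by (rule comm_group_transport[OF hom_comm_group[OF K_obj[OF c] X]]) (simp add: inj_enc[OF c X])
  show "small \<kappa> (carrier (transport_group (enc c X) (hom_group A (Ko c) X)))"
    by (simp add: small_image small_Hom_K[OF c X])
next
  fix f c d assume f: "f \<in> Hom D d c"
  note o = D.hom_obj[OF f]
  note Kf = K_hom[OF f]
  show "(\<lambda>u. enc (Dom D f) X (dec (Cod D f) X u \<cdot> Ka f)) \<in> hom (transport_group (enc c X) (hom_group A (Ko c) X))
      (transport_group (enc d X) (hom_group A (Ko d) X))"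
    unfolding HomD[OF f]
  proof (rule Group.homI)
    fix u assume "u \<in> carrier (transport_group (enc c X) (hom_group A (Ko c) X))"
    then obtain x where x: "u = enc c X x" "x \<in> Hom A (Ko c) X" by auto
    show "enc d X (dec c X u \<cdot> Ka f) \<in> carrier (transport_group (enc d X) (hom_group A (Ko d) X))"
      using x cmp_hom[OF Kf x(2)] o by simp
    fix v assume "v \<in> carrier (transport_group (enc c X) (hom_group A (Ko c) X))"
    then obtain y where y: "v = enc c X y" "y \<in> Hom A (Ko c) X" by auto
    have i: "inj_on (enc c X) (carrier (hom_group A (Ko c) X))" "inj_on (enc d X) (carrier (hom_group A (Ko d) X))"
      using inj_enc o X by simp_all
    have "u \<otimes>\<^bsub>transport_group (enc c X) (hom_group A (Ko c) X)\<^esub> v = enc c X (Add A x y)"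
      using mult_transport_group[OF i(1), of x y] x y by simp
    moreover have "enc d X (x \<cdot> Ka f) \<otimes>\<^bsub>transport_group (enc d X) (hom_group A (Ko d) X)\<^esub> enc d X (y \<cdot> Ka f)
        = enc d X (Add A (x \<cdot> Ka f) (y \<cdot> Ka f))"
      using mult_transport_group[OF i(2), of "x \<cdot> Ka f" "y \<cdot> Ka f"] cmp_hom[OF Kf x(2)] cmp_hom[OF Kf y(2)] by simp
    ultimately show "enc d X (dec c X (u \<otimes>\<^bsub>transport_group (enc c X) (hom_group A (Ko c) X)\<^esub> v) \<cdot> Ka f) =
        enc d X (dec c X u \<cdot> Ka f) \<otimes>\<^bsub>transport_group (enc d X) (hom_group A (Ko d) X)\<^esub> enc d X (dec c X v \<cdot> Ka f)"
      using x y o cmp_add_left[OF Kf x(2) y(2)] add_hom[OF x(2) y(2)] by simp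
  qed
next
  fix c u assume c: "c \<in> Obj D" and "u \<in> carrier (transport_group (enc c X) (hom_group A (Ko c) X))"
  then obtain x where x: "u = enc c X x" "x \<in> Hom A (Ko c) X" by auto
  show "enc (Dom D (Ide D c)) X (dec (Cod D (Ide D c)) X u \<cdot> Ka (Ide D c)) = u"
    using c x K_ide[OF c] cmp_ide_right[OF x(2)] by simp
next
  fix f g c d e u assume f: "f \<in> Hom D d c" and g: "g \<in> Hom D e d"
    and "u \<in> carrier (transport_group (enc c X) (hom_group A (Ko c) X))"
  then obtain x where x: "u = enc c X x" "x \<in> Hom A (Ko c) X" by auto
  show "enc (Dom D (f \<cdot>\<^bsub>D\<^esub> g)) X (dec (Cod D (f \<cdot>\<^bsub>D\<^esub> g)) X u \<cdot> Ka (f \<cdot>\<^bsub>D\<^esub> g)) =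
      enc (Dom D g) X (dec (Cod D g) X (enc (Dom D f) X (dec (Cod D f) X u \<cdot> Ka f)) \<cdot> Ka g)"
    using x K_cmp[OF g f] cmp_hom[OF K_hom[OF f] x(2)] cmp_assoc[OF K_hom[OF g] K_hom[OF f] x(2)] D.hom_obj[OF f] D.hom_obj[OF g]
      HomD[OF f] HomD[OF g] by simp
next
  fix f g c d u assume f: "f \<in> Hom D d c" and g: "g \<in> Hom D d c"
    and "u \<in> carrier (transport_group (enc c X) (hom_group A (Ko c) X))"
  then obtain x where x: "u = enc c X x" "x \<in> Hom A (Ko c) X" by auto
  note o = D.hom_obj[OF f]
  have "inj_on (enc d X) (carrier (hom_group A (Ko d) X))" using inj_enc o X by simp
  then show "enc (Dom D (Add D f g)) X (dec (Cod D (Add D f g)) X u \<cdot> Ka (Add D f g)) =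
      enc (Dom D f) X (dec (Cod D f) X u \<cdot> Ka f) \<otimes>\<^bsub>transport_group (enc d X) (hom_group A (Ko d) X)\<^esub>
      enc (Dom D g) X (dec (Cod D g) X u \<cdot> Ka g)"
    using x o K_add[OF f g] cmp_add_right[OF K_hom[OF f] K_hom[OF g] x(2)]
      mult_transport_group[of "enc d X" "hom_group A (Ko d) X" "x \<cdot> Ka f" "x \<cdot> Ka g"]
      cmp_hom[OF K_hom[OF f] x(2)] cmp_hom[OF K_hom[OF g] x(2)] HomD[OF f] HomD[OF g] HomD[OF D.add_hom[OF f g]]
    by simp
qed

lemma hom_arrow_ex:
  assumes f: "f \<in> Hom A X Y"
  obtains t where "t \<in> Hom D.MOD (hom_module X) (hom_module Y)"
    "\<forall>c\<in>Obj D. \<forall>x\<in>Hom A (Ko c) X. component t c (enc c X x) = enc c Y (f \<cdot> x)"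
proof -
  note o = hom_obj[OF f]
  obtain t where t: "t \<in> Hom D.MOD (hom_module X) (hom_module Y)"
    "\<forall>c\<in>Obj D. \<forall>u\<in>carrier (FO (hom_module X) c). component t c u = enc c Y (f \<cdot> dec c X u)"
  proof (rule D.Mod_homI[OF hom_module_Obj[OF o(1)] hom_module_Obj[OF o(2)], of "\<lambda>c u. enc c Y (f \<cdot> dec c X u)"])
    fix c assume c: "c \<in> Obj D"
    show "(\<lambda>u. enc c Y (f \<cdot> dec c X u)) \<in> hom (FO (hom_module X) c) (FO (hom_module Y) c)"
    proof (rule Group.homI)
      fix u assume "u \<in> carrier (FO (hom_module X) c)"
      then obtain x where x: "u = enc c X x" "x \<in> Hom A (Ko c) X" by (auto simp: carrier_hom_module[OF c])
      show "enc c Y (f \<cdot> dec c X u) \<in> carrier (FO (hom_module Y) c)"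
        using x c cmp_hom[OF x(2) f] by (simp add: carrier_hom_module)
      fix v assume "v \<in> carrier (FO (hom_module X) c)"
      then obtain y where y: "v = enc c X y" "y \<in> Hom A (Ko c) X" by (auto simp: carrier_hom_module[OF c])
      show "enc c Y (f \<cdot> dec c X (u \<otimes>\<^bsub>FO (hom_module X) c\<^esub> v)) =
          enc c Y (f \<cdot> dec c X u) \<otimes>\<^bsub>FO (hom_module Y) c\<^esub> enc c Y (f \<cdot> dec c X v)"
        using x y c mult_hom_module[OF c x(2) y(2)] mult_hom_module[OF c cmp_hom[OF x(2) f] cmp_hom[OF y(2) f]]
          cmp_add_right[OF x(2) y(2) f] add_hom[OF x(2) y(2)] by simp
    qed
  next
    fix g c d u assume g: "g \<in> Hom D d c" and "u \<in> carrier (FO (hom_module X) c)"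
    then obtain x where x: "u = enc c X x" "x \<in> Hom A (Ko c) X" by (auto simp: carrier_hom_module[OF D.hom_obj(2)[OF g]])
    show "enc d Y (f \<cdot> dec d X (act (hom_module X) g u)) = act (hom_module Y) g (enc c Y (f \<cdot> dec c X u))"
      using x act_hom_module[OF g x(2)] act_hom_module[OF g cmp_hom[OF x(2) f]] D.hom_obj[OF g]
        cmp_hom[OF K_hom[OF g] x(2)] cmp_assoc[OF K_hom[OF g] x(2) f] by simp
  qed
  then show thesis by (intro that[OF t(1)]) (auto simp: carrier_hom_module)
qed

text \<open>Postcomposition with \<open>f\<close>. It is chosen from an existence statement; its
  values on codes determine it.\<close>

definition hom_arrow where
  "hom_arrow f = (SOME t. t \<in> Hom D.MOD (hom_module (Dom A f)) (hom_module (Cod A f)) \<and>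
     (\<forall>c\<in>Obj D. \<forall>x\<in>Hom A (Ko c) (Dom A f). component t c (enc c (Dom A f) x) = enc c (Cod A f) (f \<cdot> x)))"

lemma hom_arrow:
  assumes f: "f \<in> Hom A X Y"
  shows "hom_arrow f \<in> Hom D.MOD (hom_module X) (hom_module Y)"
    "c \<in> Obj D \<Longrightarrow> x \<in> Hom A (Ko c) X \<Longrightarrow> component (hom_arrow f) c (enc c X x) = enc c Y (f \<cdot> x)"
proof -
  let ?Q = "\<lambda>t. t \<in> Hom D.MOD (hom_module X) (hom_module Y) \<and>
     (\<forall>c\<in>Obj D. \<forall>x\<in>Hom A (Ko c) X. component t c (enc c X x) = enc c Y (f \<cdot> x))"
  have eq: "hom_arrow f = (SOME t. ?Q t)" by (simp add: hom_arrow_def HomD[OF f])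
  have "\<exists>t. ?Q t" by (rule hom_arrow_ex[OF f]) blast
  from someI_ex[OF this]
  show "hom_arrow f \<in> Hom D.MOD (hom_module X) (hom_module Y)"
    "c \<in> Obj D \<Longrightarrow> x \<in> Hom A (Ko c) X \<Longrightarrow> component (hom_arrow f) c (enc c X x) = enc c Y (f \<cdot> x)"
    unfolding eq[symmetric] by auto
qed

lemma hom_module_arrow_eqI:
  assumes "t \<in> Hom D.MOD (hom_module X) M" "t' \<in> Hom D.MOD (hom_module X) M"
    and "\<And>c x. c \<in> Obj D \<Longrightarrow> x \<in> Hom A (Ko c) X \<Longrightarrow> component t c (enc c X x) = component t' c (enc c X x)"
  shows "t = t'"
  by (rule D.Mod_hom_eqI[OF assms(1,2)]) (use assms(3) carrier_hom_module in auto)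

definition hom_functor where
  "hom_functor = \<lparr>FO = hom_module, FA = hom_arrow\<rparr>"

lemma hom_functor: "is_functor (full_subcategory A B) D.MOD hom_functor"
proof (rule functorI[OF full.category_axioms D.category_Mod])
  fix a assume "a \<in> Obj (full_subcategory A B)"
  then have a: "a \<in> Obj A" using B_obj by simp
  show "FO hom_functor a \<in> Obj D.MOD" using hom_module_Obj[OF a] by (simp add: hom_functor_def)
  show "FA hom_functor (Ide (full_subcategory A B) a) = Ide D.MOD (FO hom_functor a)"
    unfolding hom_functor_def ftor.simps full_subcategory_simps
  proof (rule hom_module_arrow_eqI[OF hom_arrow(1)[OF ide_hom[OF a]] D.Mod_ide(1)[OF hom_module_Obj[OF a]]])
    fix c x assume c: "c \<in> Obj D" and x: "x \<in> Hom A (Ko c) a"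
    then show "component (hom_arrow (Ide A a)) c (enc c a x) = component (Ide D.MOD (hom_module a)) c (enc c a x)"
      using hom_arrow(2)[OF ide_hom[OF a] c x] D.Mod_ide(2)[OF hom_module_Obj[OF a] c, of "enc c a x"]
      by (simp add: carrier_hom_module cmp_ide_left del: D.Mod_simps)
  qed
next
  fix f a b assume "f \<in> Hom (full_subcategory A B) a b"
  then show "FA hom_functor f \<in> Hom D.MOD (FO hom_functor a) (FO hom_functor b)"
    using hom_arrow(1) by (simp add: hom_functor_def Hom_full_iff)
next
  fix f g a b c assume "f \<in> Hom (full_subcategory A B) a b" "g \<in> Hom (full_subcategory A B) b c"
  then have f: "f \<in> Hom A a b" and g: "g \<in> Hom A b c" by (simp_all add: Hom_full_iff)
  note F = hom_arrow[OF f] and G = hom_arrow[OF g] and GF = hom_arrow[OF cmp_hom[OF f g]]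
  show "FA hom_functor (g \<cdot>\<^bsub>full_subcategory A B\<^esub> f) = FA hom_functor g \<cdot>\<^bsub>D.MOD\<^esub> FA hom_functor f"
    unfolding hom_functor_def ftor.simps full_subcategory_simps
  proof (rule hom_module_arrow_eqI[OF GF(1) D.Mod_cmp(1)[OF F(1) G(1)]])
    fix d x assume d: "d \<in> Obj D" and x: "x \<in> Hom A (Ko d) a"
    have "component (hom_arrow g \<cdot>\<^bsub>D.MOD\<^esub> hom_arrow f) d (enc d a x) = enc d c (g \<cdot> (f \<cdot> x))"
      using D.Mod_cmp(2)[OF F(1) G(1) d, of "enc d a x"] F(2)[OF d x] G(2)[OF d cmp_hom[OF x f]] x d
      by (simp add: carrier_hom_module)
    then show "component (hom_arrow (g \<cdot> f)) d (enc d a x) = component (hom_arrow g \<cdot>\<^bsub>D.MOD\<^esub> hom_arrow f) d (enc d a x)"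
      using GF(2)[OF d x] cmp_assoc[OF x f g] by simp
  qed
qed

text \<open>Equal images mean that \<open>f\<close> and \<open>g\<close> agree on all arrows from
  \<U> to \<open>X\<close>, and these separate.\<close>

lemma hom_arrow_faithful:
  assumes "X \<in> B" "f \<in> Hom A X Y" "g \<in> Hom A X Y" "hom_arrow f = hom_arrow g"
  shows "f = g"
proof (rule B_hom_eqI[OF assms(1-3)])
  fix c x assume c: "c \<in> Obj D" and x: "x \<in> Hom A (Ko c) X"
  have "enc c Y (f \<cdot> x) = enc c Y (g \<cdot> x)" using hom_arrow(2)[OF assms(2) c x] hom_arrow(2)[OF assms(3) c x] assms(4) by simp
  then have "dec c Y (enc c Y (f \<cdot> x)) = dec c Y (enc c Y (g \<cdot> x))" by (simp only:)
  then show "f \<cdot> x = g \<cdot> x"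
    by (simp only: dec_enc[OF c cmp_hom[OF x assms(2)]] dec_enc[OF c cmp_hom[OF x assms(3)]])
qed

text \<open>The coproduct is indexed by an object of \<open>D\<close> together with an arrow, so
  each summand remembers the place in the module to which its element belongs. The map
  \<open>q\<close> is epic because arrows from \<U> separate.\<close>

lemma epic_trace:
  assumes "X \<in> B"
  obtains P \<iota> q where "is_coproduct A (SIGMA c:Obj D. Hom A (Ko c) X) (\<lambda>i. Ko (fst i)) P \<iota>" "P \<in> Sum \<kappa> A \<U>"
    "q \<in> Hom A P X" "epic A q" "\<forall>i\<in>(SIGMA c:Obj D. Hom A (Ko c) X). q \<cdot> \<iota> i = snd i"
    "small \<kappa> (SIGMA c:Obj D. Hom A (Ko c) X)"
proof -
  let ?I = "SIGMA c:Obj D. Hom A (Ko c) X"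
  have sm: "small \<kappa> ?I"
    by (rule small_Sigma[OF universe small_Obj_D small_Hom_K[OF _ B_obj[OF assms]]])
  have "\<forall>i\<in>?I. Ko (fst i) \<in> Obj A" using K_obj by auto
  then obtain P \<iota> where P: "is_coproduct A ?I (\<lambda>i. Ko (fst i)) P \<iota>" by (rule coproduct_ex[OF sm])
  have "\<forall>i\<in>?I. snd i \<in> Hom A (Ko (fst i)) X" by auto
  then obtain q where q: "q \<in> Hom A P X" "\<forall>i\<in>?I. q \<cdot> \<iota> i = snd i" by (rule coproduct_desc[OF P B_obj[OF assms]])
  have PS: "P \<in> Sum \<kappa> A \<U>" by (rule Sum_I[OF sm _ P]) (use K_U in auto)
  have "epic A q"
    unfolding epic_def HomD[OF q(1)]
  proof (intro conjI ballI impI)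
    fix Y f g assume fg: "f \<in> Hom A X Y" "g \<in> Hom A X Y" "f \<cdot> q = g \<cdot> q"
    show "f = g"
    proof (rule B_hom_eqI[OF assms fg(1,2)])
      fix c x assume "c \<in> Obj D" "x \<in> Hom A (Ko c) X"
      then have i: "(c, x) \<in> ?I" by simp
      note ii = coproduct_inj[OF P i]
      have "f \<cdot> (q \<cdot> \<iota> (c, x)) = g \<cdot> (q \<cdot> \<iota> (c, x))" by (rule cmp_eq_right[OF fg(3) ii q(1) fg(1) q(1) fg(2)])
      then show "f \<cdot> x = g \<cdot> x" using bspec[OF q(2) i] by simp
    qed
  qed (rule HomD(1)[OF q(1)])
  then show thesis using that[OF P PS q(1) _ q(2) sm] by blast
qed

text \<open>Decoded, a module map is a natural family \<theta> of additive maps from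
  \<open>A(K c, X)\<close> to \<open>A(K c, Y)\<close>. On the canonical cover \<open>q\<close> of
  \<open>X\<close> it prescribes an arrow \<open>h\<close> summand by summand. Self-smallness gives
  \<open>h \<cdot> y = \<theta> d (q \<cdot> y)\<close> for all \<open>y\<close> from \<U>, so
  \<open>h\<close> kills the kernel of \<open>q\<close> and descends to \<open>X\<close>.\<close>

lemma hom_arrow_full:
  assumes X: "X \<in> B" and Y: "Y \<in> B" and t: "t \<in> Hom D.MOD (hom_module X) (hom_module Y)"
  shows "\<exists>f. f \<in> Hom A X Y \<and> hom_arrow f = t"
proof -
  define \<theta> where "\<theta> c x = dec c Y (component t c (enc c X x))" for c x
  have XY: "X \<in> Obj A" "Y \<in> Obj A" using B_obj X Y by auto
  have th: "\<theta> c x \<in> Hom A (Ko c) Y" "component t c (enc c X x) = enc c Y (\<theta> c x)" if c: "c \<in> Obj D"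
      and x: "x \<in> Hom A (Ko c) X" for c x
  proof -
    have "component t c (enc c X x) \<in> carrier (FO (hom_module Y) c)"
      by (rule D.component_closed[OF t c]) (simp add: carrier_hom_module[OF c] x)
    then obtain y where "y \<in> Hom A (Ko c) Y" "component t c (enc c X x) = enc c Y y"
      by (auto simp: carrier_hom_module[OF c])
    then show "\<theta> c x \<in> Hom A (Ko c) Y" "component t c (enc c X x) = enc c Y (\<theta> c x)" by (simp_all add: \<theta>_def c)
  qed
  have th_add: "\<theta> c (Add A x y) = Add A (\<theta> c x) (\<theta> c y)" if c: "c \<in> Obj D" and x: "x \<in> Hom A (Ko c) X"
      and y: "y \<in> Hom A (Ko c) X" for c x y
  proof -
    have "component t c (enc c X x \<otimes>\<^bsub>FO (hom_module X) c\<^esub> enc c X y) = enc c Y (\<theta> c x) \<otimes>\<^bsub>FO (hom_module Y) c\<^esub> enc c Y (\<theta> c y)"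
      using D.component_mult[OF t c, of "enc c X x" "enc c X y"] th(2)[OF c x] th(2)[OF c y] x y
          by (simp add: carrier_hom_module[OF c])
    then have "component t c (enc c X (Add A x y)) = enc c Y (Add A (\<theta> c x) (\<theta> c y))"
      using mult_hom_module[OF c x y] mult_hom_module[OF c th(1)[OF c x] th(1)[OF c y]] by simp
    then show ?thesis using dec_enc[OF c add_hom[OF th(1)[OF c x] th(1)[OF c y]]] unfolding \<theta>_def by simp
  qed
  have th_zero: "\<theta> c (Zero A (Ko c) X) = Zero A (Ko c) Y" if c: "c \<in> Obj D" for c
  proof -
    have "component t c \<one>\<^bsub>FO (hom_module X) c\<^esub> = \<one>\<^bsub>FO (hom_module Y) c\<^esub>"
      by (rule group_hom.hom_one[OF D.component_group_hom[OF t c]])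
    then show ?thesis using dec_enc[OF c zero_hom[OF K_obj[OF c] XY(2)]] by (simp add: one_hom_module[OF c] \<theta>_def)
  qed
  have th_nat: "\<theta> d (x \<cdot> Ka g) = \<theta> c x \<cdot> Ka g" if g: "g \<in> Hom D d c" and x: "x \<in> Hom A (Ko c) X" for c d g x
  proof -
    note o = D.hom_obj[OF g]
    have "component t d (act (hom_module X) g (enc c X x)) = act (hom_module Y) g (component t c (enc c X x))"
      by (rule D.component_natural[OF t g]) (simp add: carrier_hom_module[OF o(2)] x)
    then have "component t d (enc d X (x \<cdot> Ka g)) = enc d Y (\<theta> c x \<cdot> Ka g)"
      using act_hom_module[OF g x] act_hom_module[OF g th(1)[OF o(2) x]] th(2)[OF o(2) x] by simp
    then show ?thesis using dec_enc[OF o(1) cmp_hom[OF K_hom[OF g] th(1)[OF o(2) x]]] unfolding \<theta>_def by simp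
  qed
  let ?I = "SIGMA c:Obj D. Hom A (Ko c) X"
  obtain P \<iota> q where cP: "is_coproduct A ?I (\<lambda>i. Ko (fst i)) P \<iota>" and P: "P \<in> Sum \<kappa> A \<U>"
    and q: "q \<in> Hom A P X" "epic A q" and qi: "\<forall>i\<in>?I. q \<cdot> \<iota> i = snd i" and sm: "small \<kappa> ?I"
    by (rule epic_trace[OF X])
  have "\<forall>i\<in>?I. \<theta> (fst i) (snd i) \<in> Hom A (Ko (fst i)) Y" using th(1) by auto
  then obtain h where h: "h \<in> Hom A P Y" "\<forall>i\<in>?I. h \<cdot> \<iota> i = \<theta> (fst i) (snd i)"
    by (rule coproduct_desc[OF cP XY(2)])
  have Po: "P \<in> Obj A" using Sum_obj[OF P] .
  have IU: "\<forall>i\<in>?I. Ko (fst i) \<in> \<U>" using K_U by auto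
  \<comment> \<open>On a summand, \<open>z\<close> is the image of an arrow of \<open>D\<close>
    because \<open>K\<close> is full, so naturality of \<theta> applies.\<close>
  have key: "h \<cdot> y = \<theta> d (q \<cdot> y)" if d: "d \<in> Obj D" and y: "y \<in> Hom A (Ko d) P" for d y
    using preadditive_category_axioms universe self_small K_U[OF d] sm y
  proof (induct rule: self_small_induct[OF _ _ _ _ _ _ cP IU, consumes 6, case_names zero add inj])
    case zero
    show ?case using th_zero[OF d] cmp_zero_right[OF h(1) K_obj[OF d]] cmp_zero_right[OF q(1) K_obj[OF d]] by simp
  next
    case (add x y)
    then show ?case
      using cmp_add_right[OF add(1,2) h(1)] cmp_add_right[OF add(1,2) q(1)]
        th_add[OF d cmp_hom[OF add(1) q(1)] cmp_hom[OF add(2) q(1)]] by simp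
  next
    case (inj i z)
    obtain c x where i: "i = (c, x)" "c \<in> Obj D" "x \<in> Hom A (Ko c) X" using inj(1) by auto
    have z: "z \<in> Hom A (Ko d) (Ko c)" using inj(2) i by simp
    obtain g where g: "g \<in> Hom D d c" "Ka g = z" by (rule K_full[OF d i(2) z])
    note ii = coproduct_inj[OF cP inj(1)]
    have zi: "z \<in> Hom A (Ko d) (Ko (fst i))" using z i by simp
    have "h \<cdot> (\<iota> i \<cdot> z) = \<theta> c x \<cdot> z" using cmp_eq_right1[OF bspec[OF h(2) inj(1)] zi ii h(1)] i by simp
    also have "\<dots> = \<theta> d (x \<cdot> z)" using th_nat[OF g(1) i(3)] g(2) by simp
    also have "x \<cdot> z = q \<cdot> (\<iota> i \<cdot> z)" using cmp_eq_right1[OF bspec[OF qi inj(1)] zi ii q(1)] i by simp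
    finally show ?case .
  qed
  obtain k L where k: "is_kernel A q k" "k \<in> Hom A L P" by (rule kernel_ex[OF q(1)])
  note KD = kernelD[OF k(1) q(1), unfolded HomD(2)[OF k(2)]]
  have L: "L \<in> B" using B_kernel[OF q(1) Sum_B[OF P] X k(1)] HomD(2)[OF k(2)] by simp
  note Lo = B_obj[OF L]
  \<comment> \<open>The kernel lies in \<open>B\<close>, so vanishing on it can be tested on arrows
    from \<U>.\<close>
  have "h \<cdot> k = Zero A L Y"
  proof (rule B_hom_eqI[OF L cmp_hom[OF k(2) h(1)] zero_hom[OF Lo XY(2)]])
    fix c x assume c: "c \<in> Obj D" and x: "x \<in> Hom A (Ko c) L"
    note kx = cmp_hom[OF x k(2)]
    have "q \<cdot> (k \<cdot> x) = Zero A L X \<cdot> x" by (rule cmp_eq_right1[OF KD(2) x k(2) q(1)])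
    then have "h \<cdot> (k \<cdot> x) = Zero A (Ko c) Y" using key[OF c kx] cmp_zero_left[OF x XY(1)] th_zero[OF c] by simp
    then show "h \<cdot> k \<cdot> x = Zero A L Y \<cdot> x" using cmp_assoc[OF x k(2) h(1)] cmp_zero_left[OF x XY(2)] by simp
  qed
  then obtain f where f: "f \<in> Hom A X Y" "f \<cdot> q = h"
    using cokernelD(4)[OF epic_cokernel_of_kernel[OF q(2) k(1) q(1)] k(2) h(1)] HomD(3)[OF q(1)] by auto
  have "hom_arrow f = t"
  proof (rule hom_module_arrow_eqI[OF hom_arrow(1)[OF f(1)] t])
    fix c x assume c: "c \<in> Obj D" and x: "x \<in> Hom A (Ko c) X"
    then have i: "(c, x) \<in> ?I" by simp
    note ii = coproduct_inj[OF cP i]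
    have "f \<cdot> (q \<cdot> \<iota> (c, x)) = h \<cdot> \<iota> (c, x)" by (rule cmp_eq_right1[OF f(2) ii q(1) f(1)])
    then have "f \<cdot> x = \<theta> c x" using bspec[OF qi i] bspec[OF h(2) i] by simp
    then show "component (hom_arrow f) c (enc c X x) = component t c (enc c X x)"
      using hom_arrow(2)[OF f(1) c x] th(2)[OF c x] by simp
  qed
  then show ?thesis using f(1) by blast
qed

text \<open>A module \<open>M\<close> is the cokernel of \<open>\<Coprod>\<^sub>j V\<^sub>j \<rightarrow> \<Coprod>\<^bsub>(c, m)\<^esub> K c\<close>, where \<open>m\<close> runs over the elements of \<open>M\<close> and \<open>j\<close> over
  the arrows into the second coproduct that are killed by the evaluation \<open>x \<mapsto> \<Sum>\<^bsub>(c, m)\<^esub> m \<pi>\<^bsub>(c, m)\<^esub> x\<close>.\<close>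

lemma hom_module_surj:
  assumes M: "M \<in> Obj D.MOD"
  shows "\<exists>X\<in>B. isomorphic D.MOD (hom_module X) M"
proof -
  let ?I = "SIGMA c:Obj D. carrier (FO M c)"
  have smI: "small \<kappa> ?I"
    by (rule small_Sigma[OF universe small_Obj_D D.module_small[OF M]])
  have "\<forall>i\<in>?I. Ko (fst i) \<in> Obj A" using K_obj by auto
  then obtain P \<iota> where cP: "is_coproduct A ?I (\<lambda>i. Ko (fst i)) P \<iota>" by (rule coproduct_ex[OF smI])
  have IU: "\<forall>i\<in>?I. Ko (fst i) \<in> \<U>" using K_U by auto
  have P: "P \<in> Sum \<kappa> A \<U>" by (rule Sum_I[OF smI IU cP])
  have Po: "P \<in> Obj A" using Sum_obj[OF P] .
  obtain \<pi> where pi: "\<forall>i\<in>?I. \<pi> i \<in> Hom A P (Ko (fst i))"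
    and pii: "\<forall>i\<in>?I. \<forall>j\<in>?I. \<pi> i \<cdot> \<iota> j = (if i = j then Ide A (Ko (fst i)) else Zero A (Ko (fst j)) (Ko (fst i)))"
    by (rule coproduct_projections[OF cP])
  have grp: "comm_group (FO M c)" if "c \<in> Obj D" for c using D.module_group[OF M that] .
  have act0: "act M (Zero D d c) m = \<one>\<^bsub>FO M d\<^esub>" if d: "d \<in> Obj D" and c: "c \<in> Obj D" and m: "m \<in> carrier (FO M c)" for c d m
  proof -
    interpret comm_group "FO M d" by (rule grp[OF d])
    note z = D.zero_hom[OF d c]
    have "act M (Zero D d c) m \<otimes>\<^bsub>FO M d\<^esub> act M (Zero D d c) m = act M (Zero D d c) m"
      using D.act_add[OF M z z m] D.add_zero_left[OF z] by simp
    then show ?thesis using D.act_closed[OF M z m] by simp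
  qed
  \<comment> \<open>The contribution of the index \<open>i\<close> to the evaluation: the arrow
    \<open>\<pi> i \<cdot> x\<close> of \<open>A\<close> is pulled back to \<open>D\<close> by
    \<open>Kinv\<close> so that it can act on the element \<open>snd i\<close>.\<close>
  define summand where "summand d x i = act M (Kinv d (fst i) (\<pi> i \<cdot> x)) (snd i)" for d x i
  define supp where "supp d x = {i \<in> ?I. \<pi> i \<cdot> x \<noteq> Zero A (Ko d) (Ko (fst i))}" for d x
  define \<phi> where "\<phi> d x = finprod (FO M d) (summand d x) (supp d x)" for d x
  have px: "\<pi> i \<cdot> x \<in> Hom A (Ko d) (Ko (fst i))" if "i \<in> ?I" "x \<in> Hom A (Ko d) P" for i d x
    by (rule cmp_hom[OF that(2) bspec[OF pi that(1)]])
  have summand_closed: "summand d x i \<in> carrier (FO M d)" if "d \<in> Obj D" "x \<in> Hom A (Ko d) P" "i \<in> ?I" for d x i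
    unfolding summand_def using that(3) by (intro D.act_closed[OF M Kinv_hom[OF that(1) _ px[OF that(3,2)]]]) auto
  have summand_off: "summand d x i = \<one>\<^bsub>FO M d\<^esub>" if "d \<in> Obj D" "i \<in> ?I" "i \<notin> supp d x" for d x i
    using that act0 Kinv_zero by (auto simp: summand_def supp_def)
  have summand_add: "summand d (Add A x y) i = summand d x i \<otimes>\<^bsub>FO M d\<^esub> summand d y i"
    if d: "d \<in> Obj D" and x: "x \<in> Hom A (Ko d) P" and y: "y \<in> Hom A (Ko d) P" and i: "i \<in> ?I" for d x y i
  proof -
    have c: "fst i \<in> Obj D" "snd i \<in> carrier (FO M (fst i))" using i by auto
    show ?thesis
      unfolding summand_def cmp_add_right[OF x y bspec[OF pi i]] Kinv_add[OF d c(1) px[OF i x] px[OF i y]]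
      by (rule D.act_add[OF M Kinv_hom[OF d c(1) px[OF i x]] Kinv_hom[OF d c(1) px[OF i y]] c(2)])
  qed
  have summand_nat: "summand e (x \<cdot> Ka g) i = act M g (summand d x i)"
    if g: "g \<in> Hom D e d" and x: "x \<in> Hom A (Ko d) P" and i: "i \<in> ?I" for d e g x i
  proof -
    have c: "fst i \<in> Obj D" "snd i \<in> carrier (FO M (fst i))" using i by auto
    note d = D.hom_obj(2)[OF g]
    show ?thesis
      unfolding summand_def cmp_assoc[OF K_hom[OF g] x bspec[OF pi i]] Kinv_cmp[OF g c(1) px[OF i x]]
      by (rule D.act_cmp[OF M Kinv_hom[OF d c(1) px[OF i x]] g c(2)])
  qed
  have supp_inj: "supp d (\<iota> j \<cdot> z) \<subseteq> {j}" if d: "d \<in> Obj D" and j: "j \<in> ?I" and z: "z \<in> Hom A (Ko d) (Ko (fst j))" for d j z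
  proof
    fix i assume i: "i \<in> supp d (\<iota> j \<cdot> z)"
    then have iI: "i \<in> ?I" by (simp add: supp_def)
    have c: "fst i \<in> Obj D" using iI by auto
    have "\<pi> i \<cdot> (\<iota> j \<cdot> z) = (\<pi> i \<cdot> \<iota> j) \<cdot> z" by (rule cmp_assoc[OF z coproduct_inj[OF cP j] bspec[OF pi iI]])
    then have "i \<noteq> j \<Longrightarrow> \<pi> i \<cdot> (\<iota> j \<cdot> z) = Zero A (Ko d) (Ko (fst i))"
      using bspec[OF bspec[OF pii iI] j] cmp_zero_left[OF z K_obj[OF c]] by simp
    then show "i \<in> {j}" using i by (auto simp: supp_def)
  qed
  \<comment> \<open>Self-smallness makes the support finite, so the product that defines
    \<open>\<phi>\<close> is a genuine sum and not the default value on infinite sets.\<close>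
  have fin: "finite (supp d x)" if d: "d \<in> Obj D" and x: "x \<in> Hom A (Ko d) P" for d x
    using preadditive_category_axioms universe self_small K_U[OF d] smI x
  proof (induct rule: self_small_induct[OF _ _ _ _ _ _ cP IU, consumes 6, case_names zero add inj])
    case zero
    have "supp d (Zero A (Ko d) P) = {}"
      using cmp_zero_right[OF bspec[OF pi] K_obj[OF d]] by (auto simp: supp_def)
    then show ?case by simp
  next
    case (add x y)
    have "supp d (Add A x y) \<subseteq> supp d x \<union> supp d y"
    proof
      fix i assume i: "i \<in> supp d (Add A x y)"
      then have iI: "i \<in> ?I" by (simp add: supp_def)
      have c: "fst i \<in> Obj D" using iI by auto
      have "\<pi> i \<cdot> Add A x y = Add A (\<pi> i \<cdot> x) (\<pi> i \<cdot> y)" by (rule cmp_add_right[OF add(1,2) bspec[OF pi iI]])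
      then show "i \<in> supp d x \<union> supp d y" using i add_zero_left[OF zero_hom[OF K_obj[OF d] K_obj[OF c]]] by (auto simp: supp_def)
    qed
    then show ?case using add(3,4) finite_subset by blast
  next
    case (inj i z)
    then show ?case using supp_inj[OF d inj] finite_subset by blast
  qed
  \<comment> \<open>The sum may be taken over any larger finite set; this brings arrows with
    different supports to a common index set.\<close>
  have phi_eq: "\<phi> d x = finprod (FO M d) (summand d x) F"
    if d: "d \<in> Obj D" and x: "x \<in> Hom A (Ko d) P" and F: "finite F" "F \<subseteq> ?I" "supp d x \<subseteq> F" for d x F
  proof -
    interpret comm_group "FO M d" by (rule grp[OF d])
    show ?thesis
      unfolding \<phi>_def
      by (rule finprod_mono_neutral_cong_left[OF F(1,3)])
         (use F(2) summand_off[OF d] summand_closed[OF d x] in auto)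
  qed
  have suppI: "supp d x \<subseteq> ?I" for d x by (auto simp: supp_def)
  have phi_closed: "\<phi> d x \<in> carrier (FO M d)" if d: "d \<in> Obj D" and x: "x \<in> Hom A (Ko d) P" for d x
  proof -
    interpret comm_group "FO M d" by (rule grp[OF d])
    show ?thesis unfolding \<phi>_def by (rule finprod_closed) (use summand_closed[OF d x] suppI in blast)
  qed
  have phi_add: "\<phi> d (Add A x y) = \<phi> d x \<otimes>\<^bsub>FO M d\<^esub> \<phi> d y"
    if d: "d \<in> Obj D" and x: "x \<in> Hom A (Ko d) P" and y: "y \<in> Hom A (Ko d) P" for d x y
  proof -
    interpret comm_group "FO M d" by (rule grp[OF d])
    note xy = add_hom[OF x y]
    define F where "F = supp d x \<union> supp d y \<union> supp d (Add A x y)"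
    have F: "finite F" "F \<subseteq> ?I" using fin[OF d x] fin[OF d y] fin[OF d xy] suppI by (simp_all add: F_def)
    have tx: "summand d x \<in> F \<rightarrow> carrier (FO M d)" "summand d y \<in> F \<rightarrow> carrier (FO M d)"
        "summand d (Add A x y) \<in> F \<rightarrow> carrier (FO M d)"
      using F(2) summand_closed[OF d x] summand_closed[OF d y] summand_closed[OF d xy] by blast+
    have "\<phi> d (Add A x y) = finprod (FO M d) (summand d (Add A x y)) F"
      by (rule phi_eq[OF d xy F]) (simp add: F_def)
    also have "\<dots> = finprod (FO M d) (\<lambda>i. summand d x i \<otimes>\<^bsub>FO M d\<^esub> summand d y i) F"
      by (rule finprod_cong') (use F(2) summand_add[OF d x y] tx in \<open>auto simp: Pi_iff\<close>)
    also have "\<dots> = finprod (FO M d) (summand d x) F \<otimes>\<^bsub>FO M d\<^esub> finprod (FO M d) (summand d y) F"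
      by (rule finprod_multf[OF tx(1,2)])
    also have "finprod (FO M d) (summand d x) F = \<phi> d x" by (rule phi_eq[symmetric, OF d x F]) (auto simp: F_def)
    also have "finprod (FO M d) (summand d y) F = \<phi> d y" by (rule phi_eq[symmetric, OF d y F]) (auto simp: F_def)
    finally show ?thesis .
  qed
  have phi_zero: "\<phi> d (Zero A (Ko d) P) = \<one>\<^bsub>FO M d\<^esub>" if d: "d \<in> Obj D" for d
  proof -
    interpret comm_group "FO M d" by (rule grp[OF d])
    have z: "Zero A (Ko d) P \<in> Hom A (Ko d) P" by (rule zero_hom[OF K_obj[OF d] Po])
    have "\<phi> d (Zero A (Ko d) P) \<otimes>\<^bsub>FO M d\<^esub> \<phi> d (Zero A (Ko d) P) = \<phi> d (Zero A (Ko d) P)"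
      using phi_add[OF d z z] add_zero_left[OF z] by simp
    then show ?thesis using phi_closed[OF d z] by simp
  qed
  have phi_nat: "\<phi> e (x \<cdot> Ka g) = act M g (\<phi> d x)" if g: "g \<in> Hom D e d" and x: "x \<in> Hom A (Ko d) P" for d e g x
  proof -
    note o = D.hom_obj[OF g]
    note xg = cmp_hom[OF K_hom[OF g] x]
    interpret e: comm_group "FO M e" by (rule grp[OF o(1)])
    define F where "F = supp d x \<union> supp e (x \<cdot> Ka g)"
    have F: "finite F" "F \<subseteq> ?I" using fin[OF o(2) x] fin[OF o(1) xg] suppI by (simp_all add: F_def)
    have tx: "summand d x \<in> F \<rightarrow> carrier (FO M d)" "summand e (x \<cdot> Ka g) \<in> F \<rightarrow> carrier (FO M e)"
      using F(2) summand_closed[OF o(2) x] summand_closed[OF o(1) xg] by blast+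
    have "\<phi> e (x \<cdot> Ka g) = finprod (FO M e) (summand e (x \<cdot> Ka g)) F" by (rule phi_eq[OF o(1) xg F]) (simp add: F_def)
    also have "\<dots> = finprod (FO M e) (\<lambda>i. act M g (summand d x i)) F"
      by (rule e.finprod_cong') (use F(2) summand_nat[OF g x] tx(1) D.act_closed[OF M g] in \<open>auto simp: Pi_iff\<close>)
    also have "\<dots> = act M g (finprod (FO M d) (summand d x) F)"
      by (rule group_hom_finprod[symmetric, OF grp[OF o(2)] grp[OF o(1)] D.module_arr(2)[OF M g] F(1) tx(1)])
    also have "finprod (FO M d) (summand d x) F = \<phi> d x" by (rule phi_eq[symmetric, OF o(2) x F]) (simp add: F_def)
    finally show ?thesis .
  qed
  \<comment> \<open>This makes the evaluation surjective: every element \<open>m\<close> is the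
    value at the injection of its own summand.\<close>
  have phi_inj: "\<phi> c (\<iota> (c, m)) = m" if c: "c \<in> Obj D" and m: "m \<in> carrier (FO M c)" for c m
  proof -
    interpret comm_group "FO M c" by (rule grp[OF c])
    have i: "(c, m) \<in> ?I" using c m by simp
    note ii = coproduct_inj[OF cP i, unfolded fst_conv]
    have "Ide A (Ko c) \<in> Hom A (Ko c) (Ko (fst (c, m)))" using ide_hom[OF K_obj[OF c]] by simp
    from supp_inj[OF c i this] have "supp c (\<iota> (c, m)) \<subseteq> {(c, m)}" using cmp_ide_right[OF ii] by simp
    then have "\<phi> c (\<iota> (c, m)) = finprod (FO M c) (summand c (\<iota> (c, m))) {(c, m)}"
      by (intro phi_eq[OF c ii]) (use i in auto)
    also have "\<dots> = summand c (\<iota> (c, m)) (c, m)" using summand_closed[OF c ii i] by simp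
    also have "\<dots> = act M (Kinv c c (Ide A (Ko c))) m" using bspec[OF bspec[OF pii i] i] by (simp add: summand_def)
    also have "Kinv c c (Ide A (Ko c)) = Ide D c" using Kinv_K[OF D.ide_hom[OF c]] K_ide[OF c] by simp
    finally show ?thesis using D.act_ide[OF M m c] by simp
  qed
  \<comment> \<open>All arrows from \<U> to \<open>P\<close> that the evaluation kills; they are
    imposed as relations.\<close>
  let ?J = "SIGMA d:Obj D. {x \<in> Hom A (Ko d) P. \<phi> d x = \<one>\<^bsub>FO M d\<^esub>}"
  have smJ: "small \<kappa> ?J"
  proof (rule small_Sigma[OF universe small_Obj_D])
    show "small \<kappa> {x \<in> Hom A (Ko d) P. \<phi> d x = \<one>\<^bsub>FO M d\<^esub>}" if "d \<in> Obj D" for d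
      by (rule small_mono[OF small_Hom_K[OF that Po]]) blast
  qed
  have "\<forall>i\<in>?J. Ko (fst i) \<in> Obj A" using K_obj by auto
  then obtain P' \<iota>' where cP': "is_coproduct A ?J (\<lambda>i. Ko (fst i)) P' \<iota>'" by (rule coproduct_ex[OF smJ])
  have JU: "\<forall>i\<in>?J. Ko (fst i) \<in> \<U>" using K_U by auto
  have P': "P' \<in> Sum \<kappa> A \<U>" by (rule Sum_I[OF smJ JU cP'])
  have "\<forall>i\<in>?J. snd i \<in> Hom A (Ko (fst i)) P" by auto
  then obtain s where s: "s \<in> Hom A P' P" "\<forall>i\<in>?J. s \<cdot> \<iota>' i = snd i" by (rule coproduct_desc[OF cP' Po])
  obtain q X where q: "is_cokernel A s q" "q \<in> Hom A P X" by (rule cokernel_ex[OF s(1)])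
  note QD = cokernelD[OF q(1) s(1), unfolded HomD(3)[OF q(2)]]
  have X: "X \<in> B" using B_cokernel[OF s(1) Sum_B[OF P'] Sum_B[OF P] q(1)] HomD(3)[OF q(2)] by simp
  note Xo = B_obj[OF X]
  obtain k L where k: "is_kernel A q k" "k \<in> Hom A L P" by (rule kernel_ex[OF q(2)])
  note KD = kernelD[OF k(1) q(2), unfolded HomD(2)[OF k(2)]]
  have L: "L \<in> B" using B_kernel[OF q(2) Sum_B[OF P] X k(1)] HomD(2)[OF k(2)] by simp
  obtain e where e: "e \<in> Hom A P' L" "epic A e" "k \<cdot> e = s"
    using image_factorization[OF s(1) q(1) k(1)] HomD(2)[OF k(2)] by auto
  have s_one: "\<phi> d (s \<cdot> y) = \<one>\<^bsub>FO M d\<^esub>" if d: "d \<in> Obj D" and y: "y \<in> Hom A (Ko d) P'" for d y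
    using preadditive_category_axioms universe self_small K_U[OF d] smJ y
  proof (induct rule: self_small_induct[OF _ _ _ _ _ _ cP' JU, consumes 6, case_names zero add inj])
    case zero
    show ?case using cmp_zero_right[OF s(1) K_obj[OF d]] phi_zero[OF d] by simp
  next
    case (add x y)
    interpret comm_group "FO M d" by (rule grp[OF d])
    show ?case
      using cmp_add_right[OF add(1,2) s(1)] phi_add[OF d cmp_hom[OF add(1) s(1)] cmp_hom[OF add(2) s(1)]] add(3,4) by simp
  next
    case (inj i z)
    obtain c x where i: "i = (c, x)" "c \<in> Obj D" "x \<in> Hom A (Ko c) P" "\<phi> c x = \<one>\<^bsub>FO M c\<^esub>" using inj(1) by auto
    have z: "z \<in> Hom A (Ko d) (Ko c)" using inj(2) i by simp
    obtain g where g: "g \<in> Hom D d c" "Ka g = z" by (rule K_full[OF d i(2) z])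
    have "s \<cdot> (\<iota>' i \<cdot> z) = x \<cdot> Ka g"
      using cmp_eq_right1[OF bspec[OF s(2) inj(1)] inj(2) coproduct_inj[OF cP' inj(1)] s(1)] i g(2) by simp
    then have "\<phi> d (s \<cdot> (\<iota>' i \<cdot> z)) = act M g \<one>\<^bsub>FO M c\<^esub>" using phi_nat[OF g(1) i(3)] i(4) by simp
    also have "\<dots> = \<one>\<^bsub>FO M d\<^esub>"
      by (rule hom_one[OF D.module_arr(2)[OF M g(1)]]) (use grp[OF i(2)] grp[OF d] comm_group.axioms(2) in auto)
    finally show ?case .
  qed
  \<comment> \<open>An arrow killed by \<open>q\<close> lands in the kernel of \<open>q\<close>,
    which \<open>e\<close> covers, so by (b) it has the form \<open>s \<cdot> y\<close>; there the
    evaluation vanishes by \<open>s_one\<close>. Conversely, an arrow killed by the evaluation is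
    one of the relations.\<close>
  have ker: "q \<cdot> x = Zero A (Ko d) X \<longleftrightarrow> \<phi> d x = \<one>\<^bsub>FO M d\<^esub>" if d: "d \<in> Obj D" and x: "x \<in> Hom A (Ko d) P" for d x
  proof
    assume "q \<cdot> x = Zero A (Ko d) X"
    then obtain l where l: "l \<in> Hom A (Ko d) L" "k \<cdot> l = x" using KD(4)[OF x] by blast
    obtain y where y: "y \<in> Hom A (Ko d) P'" "e \<cdot> y = l" by (rule epic_lift[OF e(2,1) P' L K_U[OF d] l(1)])
    have "k \<cdot> (e \<cdot> y) = s \<cdot> y" by (rule cmp_eq_right1[OF e(3) y(1) e(1) k(2)])
    then show "\<phi> d x = \<one>\<^bsub>FO M d\<^esub>" using s_one[OF d y(1)] y(2) l(2) by simp
  next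
    assume "\<phi> d x = \<one>\<^bsub>FO M d\<^esub>"
    then have j: "(d, x) \<in> ?J" using d x by simp
    note jj = coproduct_inj[OF cP' j, unfolded fst_conv]
    have "q \<cdot> (s \<cdot> \<iota>' (d, x)) = Zero A P' X \<cdot> \<iota>' (d, x)" by (rule cmp_eq_right1[OF QD(2) jj s(1) q(2)])
    then show "q \<cdot> x = Zero A (Ko d) X" using bspec[OF s(2) j] cmp_zero_left[OF jj Xo] by simp
  qed
  have ker2: "q \<cdot> x = q \<cdot> y \<longleftrightarrow> \<phi> d x = \<phi> d y" if d: "d \<in> Obj D" and x: "x \<in> Hom A (Ko d) P" and y: "y \<in> Hom A (Ko d) P" for d x y
  proof -
    interpret comm_group "FO M d" by (rule grp[OF d])
    note n = add_hom[OF x neg_hom[OF y]] and cl = phi_closed[OF d]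
    have "q \<cdot> Add A x (neg y) = Add A (q \<cdot> x) (neg (q \<cdot> y))"
      using cmp_add_right[OF x neg_hom[OF y] q(2)] cmp_neg_right[OF y q(2)] by simp
    then have "q \<cdot> x = q \<cdot> y \<longleftrightarrow> \<phi> d (Add A x (neg y)) = \<one>\<^bsub>FO M d\<^esub>"
      using sub_eq_zero[OF cmp_hom[OF x q(2)] cmp_hom[OF y q(2)]] ker[OF d n] by simp
    also have "\<dots> \<longleftrightarrow> \<phi> d x \<otimes>\<^bsub>FO M d\<^esub> \<phi> d (neg y) = \<one>\<^bsub>FO M d\<^esub>" using phi_add[OF d x neg_hom[OF y]] by simp
    also have "\<dots> \<longleftrightarrow> \<phi> d x = \<phi> d y"
    proof -
      have "\<phi> d y \<otimes>\<^bsub>FO M d\<^esub> \<phi> d (neg y) = \<one>\<^bsub>FO M d\<^esub>"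
        using phi_add[OF d y neg_hom[OF y]] add_neg[OF y] phi_zero[OF d] by simp
      then show ?thesis
        using cl[OF x] cl[OF y] cl[OF neg_hom[OF y]] right_cancel[of "\<phi> d (neg y)" "\<phi> d x" "\<phi> d y"] by auto
    qed
    finally show ?thesis .
  qed
  \<comment> \<open>By (b) every arrow from \<U> to \<open>X\<close> lifts to \<open>P\<close>. The
    value of \<open>\<phi>\<close> at the lift is independent of the choice by \<open>ker2\<close>,
    so it defines the isomorphism.\<close>
  define lift where "lift d x = (SOME y. y \<in> Hom A (Ko d) P \<and> q \<cdot> y = x)" for d x
  have lift: "lift d x \<in> Hom A (Ko d) P" "q \<cdot> lift d x = x" if d: "d \<in> Obj D" and x: "x \<in> Hom A (Ko d) X" for d x
  proof -
    have "\<exists>y. y \<in> Hom A (Ko d) P \<and> q \<cdot> y = x" by (rule epic_lift[OF QD(3) q(2) P X K_U[OF d] x]) blast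
    from someI_ex[OF this] show "lift d x \<in> Hom A (Ko d) P" "q \<cdot> lift d x = x" by (simp_all add: lift_def)
  qed
  have phl: "\<phi> d (lift d (q \<cdot> y)) = \<phi> d y" if d: "d \<in> Obj D" and y: "y \<in> Hom A (Ko d) P" for d y
    using ker2[OF d lift(1)[OF d cmp_hom[OF y q(2)]] y] lift(2)[OF d cmp_hom[OF y q(2)]] by simp
  obtain t where t: "t \<in> Hom D.MOD (hom_module X) M"
    "\<forall>c\<in>Obj D. \<forall>u\<in>carrier (FO (hom_module X) c). component t c u = \<phi> c (lift c (dec c X u))"
  proof (rule D.Mod_homI[OF hom_module_Obj[OF Xo] M, of "\<lambda>c u. \<phi> c (lift c (dec c X u))"])
    fix c assume c: "c \<in> Obj D"
    show "(\<lambda>u. \<phi> c (lift c (dec c X u))) \<in> hom (FO (hom_module X) c) (FO M c)"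
    proof (rule Group.homI)
      fix u assume "u \<in> carrier (FO (hom_module X) c)"
      then obtain x where x: "u = enc c X x" "x \<in> Hom A (Ko c) X" by (auto simp: carrier_hom_module[OF c])
      show "\<phi> c (lift c (dec c X u)) \<in> carrier (FO M c)" using x c phi_closed[OF c lift(1)[OF c x(2)]] by simp
      fix v assume "v \<in> carrier (FO (hom_module X) c)"
      then obtain y where y: "v = enc c X y" "y \<in> Hom A (Ko c) X" by (auto simp: carrier_hom_module[OF c])
      note lx = lift[OF c x(2)] and ly = lift[OF c y(2)]
      have "\<phi> c (lift c (Add A x y)) = \<phi> c (Add A (lift c x) (lift c y))"
        using phl[OF c add_hom[OF lx(1) ly(1)]] cmp_add_right[OF lx(1) ly(1) q(2)] lx(2) ly(2) by simp
      then show "\<phi> c (lift c (dec c X (u \<otimes>\<^bsub>FO (hom_module X) c\<^esub> v))) =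
          \<phi> c (lift c (dec c X u)) \<otimes>\<^bsub>FO M c\<^esub> \<phi> c (lift c (dec c X v))"
        using x y c mult_hom_module[OF c x(2) y(2)] add_hom[OF x(2) y(2)] phi_add[OF c lx(1) ly(1)] by simp
    qed
  next
    fix g c d u assume g: "g \<in> Hom D d c" and "u \<in> carrier (FO (hom_module X) c)"
    note o = D.hom_obj[OF g]
    obtain x where x: "u = enc c X x" "x \<in> Hom A (Ko c) X" using \<open>u \<in> _\<close> by (auto simp: carrier_hom_module[OF o(2)])
    note lx = lift[OF o(2) x(2)]
    have "q \<cdot> (lift c x \<cdot> Ka g) = x \<cdot> Ka g" by (rule cmp_eq_right1[OF lx(2) K_hom[OF g] lx(1) q(2)])
    then have "\<phi> d (lift d (x \<cdot> Ka g)) = act M g (\<phi> c (lift c x))"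
      using phl[OF o(1) cmp_hom[OF K_hom[OF g] lx(1)]] phi_nat[OF g lx(1)] by simp
    then show "\<phi> d (lift d (dec d X (act (hom_module X) g u))) = act M g (\<phi> c (lift c (dec c X u)))"
      using x o act_hom_module[OF g x(2)] cmp_hom[OF K_hom[OF g] x(2)] by simp
  qed
  have tx: "component t c (enc c X x) = \<phi> c (lift c x)" if c: "c \<in> Obj D" and x: "x \<in> Hom A (Ko c) X" for c x
    using bspec[OF bspec[OF t(2) c], of "enc c X x"] c x by (simp add: carrier_hom_module)
  have "isomorphic D.MOD (hom_module X) M"
  proof (rule D.Mod_isoI[OF t(1)])
    fix c assume c: "c \<in> Obj D"
    show "bij_betw (component t c) (carrier (FO (hom_module X) c)) (carrier (FO M c))"
      unfolding bij_betw_def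
    proof (intro conjI inj_onI equalityI subsetI)
      fix u v assume "u \<in> carrier (FO (hom_module X) c)" "v \<in> carrier (FO (hom_module X) c)"
          and eq: "component t c u = component t c v"
      then obtain x y where x: "u = enc c X x" "x \<in> Hom A (Ko c) X" and y: "v = enc c X y" "y \<in> Hom A (Ko c) X"
        by (auto simp: carrier_hom_module[OF c])
      then have "x = y"
        using eq tx[OF c] ker2[OF c lift(1)[OF c x(2)] lift(1)[OF c y(2)]] lift(2)[OF c x(2)] lift(2)[OF c y(2)] by simp
      then show "u = v" using x y by simp
    next
      fix m assume "m \<in> component t c ` carrier (FO (hom_module X) c)"
      then show "m \<in> carrier (FO M c)" using D.component_closed[OF t(1) c] by auto
    next
      fix m assume m: "m \<in> carrier (FO M c)"
      then have i: "(c, m) \<in> ?I" using c by simp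
      note ii = coproduct_inj[OF cP i, unfolded fst_conv]
      have "m = component t c (enc c X (q \<cdot> \<iota> (c, m)))"
        using tx[OF c cmp_hom[OF ii q(2)]] phl[OF c ii] phi_inj[OF c m] by simp
      then show "m \<in> component t c ` carrier (FO (hom_module X) c)"
        using cmp_hom[OF ii q(2)] carrier_hom_module[OF c] by blast
    qed
  qed
  then show ?thesis using X by blast
qed

theorem equivalent_module_category: "equivalent (full_subcategory A B) (module_category \<kappa> D)"
proof (rule equivalentI)
  show "fully_faithful_surjective (full_subcategory A B) D.MOD hom_functor"
    unfolding fully_faithful_surjective_def
  proof (intro conjI ballI hom_functor)
    fix a b assume "a \<in> Obj (full_subcategory A B)" "b \<in> Obj (full_subcategory A B)"
    then have ab: "a \<in> B" "b \<in> B" by simp_all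
    show "bij_betw (FA hom_functor) (Hom (full_subcategory A B) a b) (Hom D.MOD (FO hom_functor a) (FO hom_functor b))"
      unfolding bij_betw_def hom_functor_def ftor.simps Hom_full[OF ab]
    proof (intro conjI inj_onI equalityI subsetI)
      fix t assume "t \<in> hom_arrow ` Hom A a b"
      then show "t \<in> Hom D.MOD (hom_module a) (hom_module b)" using hom_arrow(1) by auto
    next
      fix t assume "t \<in> Hom D.MOD (hom_module a) (hom_module b)"
      then show "t \<in> hom_arrow ` Hom A a b" using hom_arrow_full[OF ab] by (metis imageI)
    qed (rule hom_arrow_faithful[OF ab(1)])
  next
    fix M assume "M \<in> Obj D.MOD"
    then show "\<exists>c\<in>Obj (full_subcategory A B). isomorphic D.MOD (FO hom_functor c) M"
      using hom_module_surj by (simp add: hom_functor_def)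
  qed
qed

end


section \<open>Preadditive categories and rings of small size\<close>

lemma comm_group_image:
  assumes "comm_group G" "h \<in> hom G H" "h ` carrier G = carrier H" "h \<one>\<^bsub>G\<^esub> = \<one>\<^bsub>H\<^esub>"
  shows "comm_group (H :: 'b monoid)"
  using comm_group.hom_imp_img_comm_group[OF assms(1,2)] assms(3,4) by simp

context presented
begin

text \<open>The full subcategory on \<U> is small, but its objects and arrows have the types
  \<open>'o\<close> and \<open>'m\<close>. It is copied into \<open>'u\<close> along injections of
  its objects and of its arrows, and \<open>K\<close> decodes.\<close>

lemma small_model_ex:
  obtains D :: "('u, 'u) precat" and K :: "('u, 'u, 'o, 'm) ftor" where
    "preadditive_category D" "small_category \<kappa> D" "is_functor D A K"
    "\<And>f g c d. f \<in> Hom D c d \<Longrightarrow> g \<in> Hom D c d \<Longrightarrow> FA K (Add D f g) = Add A (FA K f) (FA K g)"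
    "\<And>c d. c \<in> Obj D \<Longrightarrow> d \<in> Obj D \<Longrightarrow> bij_betw (FA K) (Hom D c d) (Hom A (FO K c) (FO K d))"
    "FO K ` Obj D = \<U>"
proof -
  let ?S = "{f \<in> Arr A. Dom A f \<in> \<U> \<and> Cod A f \<in> \<U>}"
  have S: "?S = (\<Union>U\<in>\<U>. \<Union>V\<in>\<U>. Hom A U V)" by (auto simp: Hom_def)
  have smS: "small \<kappa> ?S"
    unfolding S by (intro small_UN[OF universe U_small] small_Hom) (use U_obj in auto)
  obtain o' :: "'o \<Rightarrow> 'u" where o': "inj_on o' \<U>" using small_embed[OF universe U_small] .
  obtain a :: "'m \<Rightarrow> 'u" where a: "inj_on a ?S" using small_embed[OF universe smS] .
  define oi where "oi = inv_into \<U> o'"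
  define ai where "ai = inv_into ?S a"
  define D :: "('u, 'u) precat" where "D = \<lparr>Obj = o' ` \<U>, Arr = a ` ?S,
     Dom = (\<lambda>u. o' (Dom A (ai u))), Cod = (\<lambda>u. o' (Cod A (ai u))), Ide = (\<lambda>u. a (Ide A (oi u))),
     Cmp = (\<lambda>u v. a (ai u \<cdot> ai v)), Add = (\<lambda>u v. a (Add A (ai u) (ai v))),
     Zero = (\<lambda>u v. a (Zero A (oi u) (oi v)))\<rparr>"
  have oi: "oi (o' U) = U" if "U \<in> \<U>" for U using that o' by (simp add: oi_def)
  have ai: "ai (a f) = f" if "f \<in> Hom A U V" "U \<in> \<U>" "V \<in> \<U>" for f U V
    unfolding ai_def by (rule inv_into_f_f[OF a]) (use that in \<open>auto simp: Hom_def\<close>)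
  have Ds: "Obj D = o' ` \<U>" "Ide D u = a (Ide A (oi u))" "u \<cdot>\<^bsub>D\<^esub> v = a (ai u \<cdot> ai v)"
    "Add D u v = a (Add A (ai u) (ai v))" "Zero D u v = a (Zero A (oi u) (oi v))" for u v
    by (simp_all add: D_def)
  have HomD: "Hom D (o' U) (o' V) = a ` Hom A U V" if "U \<in> \<U>" "V \<in> \<U>" for U V
  proof (intro equalityI subsetI)
    fix u assume "u \<in> Hom D (o' U) (o' V)"
    then obtain f where f: "u = a f" "f \<in> ?S" "o' (Dom A (ai u)) = o' U" "o' (Cod A (ai u)) = o' V"
      by (auto simp: D_def Hom_def)
    then have "ai u = f" using ai[of f "Dom A f" "Cod A f"] by (simp add: Hom_def)
    then have "Dom A f = U" "Cod A f = V" using f that inj_onD[OF o'] by auto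
    then show "u \<in> a ` Hom A U V" using f by (auto simp: Hom_def)
  next
    fix u assume "u \<in> a ` Hom A U V"
    then obtain f where "u = a f" "f \<in> Hom A U V" by blast
    then show "u \<in> Hom D (o' U) (o' V)"
      using ai[OF _ that, of f] that by (auto simp: D_def Hom_def)
  qed
  have HomD_obj: "\<exists>U V f. U \<in> \<U> \<and> V \<in> \<U> \<and> x = o' U \<and> y = o' V \<and> f \<in> Hom A U V \<and> u = a f" if u: "u \<in> Hom D x y" for u x y
  proof -
    obtain f where f: "u = a f" "f \<in> ?S" "x = o' (Dom A (ai u))" "y = o' (Cod A (ai u))"
      using u by (auto simp: D_def Hom_def)
    then have "ai u = f" using ai[of f "Dom A f" "Cod A f"] by (simp add: Hom_def)
    then show ?thesis using f by (intro exI[of _ "Dom A f"] exI[of _ "Cod A f"] exI[of _ f]) (simp add: Hom_def)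
  qed
  have Uo: "U \<in> \<U> \<Longrightarrow> U \<in> Obj A" for U using U_obj by blast
  have cat: "category D"
  proof
    fix u assume "u \<in> Arr D"
    then have "u \<in> Hom D (Dom D u) (Cod D u)" by (simp add: Hom_def)
    from HomD_obj[OF this] show "Dom D u \<in> Obj D" "Cod D u \<in> Obj D" by (auto simp: Ds(1))
  next
    fix x assume "x \<in> Obj D"
    then obtain U where U: "U \<in> \<U>" "x = o' U" by (auto simp: Ds(1))
    show "Ide D x \<in> Hom D x x" using HomD[OF U(1) U(1)] ide_hom[OF Uo[OF U(1)]] U(2) by (simp add: Ds(2) oi[OF U(1)])
  next
    fix u x y v z assume "u \<in> Hom D x y" and v: "v \<in> Hom D y z"
    then obtain U V f where f: "U \<in> \<U>" "V \<in> \<U>" "x = o' U" "y = o' V" "f \<in> Hom A U V" "u = a f" using HomD_obj by blast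
    obtain V' W g where g: "V' \<in> \<U>" "W \<in> \<U>" "y = o' V'" "z = o' W" "g \<in> Hom A V' W" "v = a g" using HomD_obj[OF v] by blast
    have V: "V' = V" using f g inj_onD[OF o'] by auto
    have g': "g \<in> Hom A V W" using g(5) V by simp
    show "v \<cdot>\<^bsub>D\<^esub> u \<in> Hom D x z"
      using HomD[OF f(1) g(2)] cmp_hom[OF f(5) g'] f(3,6) g(4,6) ai[OF f(5,1,2)] ai[OF g' f(2) g(2)] by (simp add: Ds(3))
  next
    fix u x y assume "u \<in> Hom D x y"
    then obtain U V f where f: "U \<in> \<U>" "V \<in> \<U>" "x = o' U" "y = o' V" "f \<in> Hom A U V" "u = a f" using HomD_obj by blast
    note i = ide_hom[OF Uo[OF f(1)]] ide_hom[OF Uo[OF f(2)]]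
    show "u \<cdot>\<^bsub>D\<^esub> Ide D x = u" "Ide D y \<cdot>\<^bsub>D\<^esub> u = u"
      using f ai[OF f(5,1,2)] ai[OF i(1) f(1,1)] ai[OF i(2) f(2,2)] cmp_ide_left[OF f(5)] cmp_ide_right[OF f(5)]
      by (simp_all add: Ds(2,3) oi)
  next
    fix u x y v z w t assume "u \<in> Hom D x y" and v: "v \<in> Hom D y z" and w: "w \<in> Hom D z t"
    then obtain U V f where f: "U \<in> \<U>" "V \<in> \<U>" "x = o' U" "y = o' V" "f \<in> Hom A U V" "u = a f" using HomD_obj by blast
    obtain V' W g where g: "V' \<in> \<U>" "W \<in> \<U>" "y = o' V'" "z = o' W" "g \<in> Hom A V' W" "v = a g" using HomD_obj[OF v] by blast
    obtain W' T h where h: "W' \<in> \<U>" "T \<in> \<U>" "z = o' W'" "t = o' T" "h \<in> Hom A W' T" "w = a h" using HomD_obj[OF w] by blast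
    have V: "V' = V" "W' = W" using f g h inj_onD[OF o'] by auto
    have g': "g \<in> Hom A V W" and h': "h \<in> Hom A W T" using g(5) h(5) V by simp_all
    note gf = cmp_hom[OF f(5) g'] and hg = cmp_hom[OF g' h']
    show "w \<cdot>\<^bsub>D\<^esub> (v \<cdot>\<^bsub>D\<^esub> u) = w \<cdot>\<^bsub>D\<^esub> v \<cdot>\<^bsub>D\<^esub> u"
      using f(6) g(6) h(6) ai[OF f(5,1,2)] ai[OF g' f(2) g(2)] ai[OF h' g(2) h(2)] ai[OF gf f(1) g(2)] ai[OF hg f(2) h(2)]
        cmp_assoc[OF f(5) g' h'] by (simp add: Ds(3))
  qed
  have grp: "comm_group (hom_group D (o' U) (o' V))" if U: "U \<in> \<U>" and V: "V \<in> \<U>" for U V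
  proof (rule comm_group_image[OF hom_comm_group[OF Uo[OF U] Uo[OF V]]])
    show "a \<in> hom (hom_group A U V) (hom_group D (o' U) (o' V))"
      using HomD[OF U V] ai[OF _ U V] by (auto simp: hom_def hom_group_def Ds(4))
  qed (simp_all add: hom_group_def HomD[OF U V] Ds(5) oi U V)
  have pre: "preadditive_category D"
  proof (intro preadditive_category.intro preadditive_category_axioms.intro cat)
    fix x y assume "x \<in> Obj D" "y \<in> Obj D"
    then show "comm_group (hom_group D x y)" using grp by (auto simp: Ds(1))
  next
    fix u x y v z w assume "u \<in> Hom D x y" and v: "v \<in> Hom D y z" and w: "w \<in> Hom D y z"
    then obtain U V f where f: "U \<in> \<U>" "V \<in> \<U>" "x = o' U" "y = o' V" "f \<in> Hom A U V" "u = a f" using HomD_obj by blast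
    obtain V' W g where g: "V' \<in> \<U>" "W \<in> \<U>" "y = o' V'" "z = o' W" "g \<in> Hom A V' W" "v = a g" using HomD_obj[OF v] by blast
    have V: "V' = V" using f g inj_onD[OF o'] by auto
    have g': "g \<in> Hom A V W" using g(5) V by simp
    obtain h where h: "h \<in> Hom A V W" "w = a h" using w HomD[OF f(2) g(2)] f(4) g(4) by auto
    show "Add D v w \<cdot>\<^bsub>D\<^esub> u = Add D (v \<cdot>\<^bsub>D\<^esub> u) (w \<cdot>\<^bsub>D\<^esub> u)"
      using f(6) g(6) h(2) ai[OF f(5,1,2)] ai[OF g' f(2) g(2)] ai[OF h(1) f(2) g(2)] ai[OF add_hom[OF g' h(1)] f(2) g(2)]
        ai[OF cmp_hom[OF f(5) g'] f(1) g(2)] ai[OF cmp_hom[OF f(5) h(1)] f(1) g(2)] cmp_add_left[OF f(5) g' h(1)]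
      by (simp add: Ds(3,4))
  next
    fix u x y v z w assume u: "u \<in> Hom D x y" and v: "v \<in> Hom D x y" and w: "w \<in> Hom D y z"
    then obtain U V f where f: "U \<in> \<U>" "V \<in> \<U>" "x = o' U" "y = o' V" "f \<in> Hom A U V" "u = a f" using HomD_obj by blast
    obtain V' W h where h: "V' \<in> \<U>" "W \<in> \<U>" "y = o' V'" "z = o' W" "h \<in> Hom A V' W" "w = a h" using HomD_obj[OF w] by blast
    have V: "V' = V" using f h inj_onD[OF o'] by auto
    have h': "h \<in> Hom A V W" using h(5) V by simp
    obtain g where g: "g \<in> Hom A U V" "v = a g" using v HomD[OF f(1,2)] f(3,4) by auto
    show "w \<cdot>\<^bsub>D\<^esub> Add D u v = Add D (w \<cdot>\<^bsub>D\<^esub> u) (w \<cdot>\<^bsub>D\<^esub> v)"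
      using f(6) g(2) h(6) ai[OF f(5,1,2)] ai[OF g(1) f(1,2)] ai[OF h' f(2) h(2)] ai[OF add_hom[OF f(5) g(1)] f(1,2)]
        ai[OF cmp_hom[OF f(5) h'] f(1) h(2)] ai[OF cmp_hom[OF g(1) h'] f(1) h(2)] cmp_add_right[OF f(5) g(1) h']
      by (simp add: Ds(3,4))
  qed
  have sm: "small_category \<kappa> D"
    unfolding small_category_def using cat small_image[OF U_small, of o'] small_image[OF smS, of a] by (simp add: D_def)
  define K where "K = \<lparr>FO = oi, FA = ai\<rparr>"
  have Ks: "FO K = oi" "FA K = ai" by (simp_all add: K_def)
  have fct: "is_functor D A K"
  proof (rule functorI[OF cat category_axioms])
    fix x assume "x \<in> Obj D"
    then obtain U where U: "U \<in> \<U>" "x = o' U" by (auto simp: Ds(1))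
    show "FO K x \<in> Obj A" "FA K (Ide D x) = Ide A (FO K x)"
      using U Uo[OF U(1)] ai[OF ide_hom[OF Uo[OF U(1)]] U(1,1)] by (simp_all add: Ks Ds(2) oi)
  next
    fix u x y assume "u \<in> Hom D x y"
    then obtain U V f where f: "U \<in> \<U>" "V \<in> \<U>" "x = o' U" "y = o' V" "f \<in> Hom A U V" "u = a f" using HomD_obj by blast
    then show "FA K u \<in> Hom A (FO K x) (FO K y)" using ai[OF f(5,1,2)] by (simp add: Ks oi)
  next
    fix u v x y z assume "u \<in> Hom D x y" and v: "v \<in> Hom D y z"
    then obtain U V f where f: "U \<in> \<U>" "V \<in> \<U>" "x = o' U" "y = o' V" "f \<in> Hom A U V" "u = a f" using HomD_obj by blast
    obtain V' W g where g: "V' \<in> \<U>" "W \<in> \<U>" "y = o' V'" "z = o' W" "g \<in> Hom A V' W" "v = a g" using HomD_obj[OF v] by blast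
    have V: "V' = V" using f g inj_onD[OF o'] by auto
    have g': "g \<in> Hom A V W" using g(5) V by simp
    show "FA K (v \<cdot>\<^bsub>D\<^esub> u) = FA K v \<cdot> FA K u"
      using ai[OF cmp_hom[OF f(5) g'] f(1) g(2)] f(6) g(6) ai[OF f(5,1,2)] ai[OF g' f(2) g(2)] by (simp add: Ks Ds(3))
  qed
  have add: "FA K (Add D u v) = Add A (FA K u) (FA K v)" if u: "u \<in> Hom D x y" and v: "v \<in> Hom D x y" for u v x y
  proof -
    obtain U V f where f: "U \<in> \<U>" "V \<in> \<U>" "x = o' U" "y = o' V" "f \<in> Hom A U V" "u = a f" using HomD_obj[OF u] by blast
    obtain g where g: "g \<in> Hom A U V" "v = a g" using v HomD[OF f(1,2)] f(3,4) by auto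
    show ?thesis using f(6) g(2) ai[OF f(5,1,2)] ai[OF g(1) f(1,2)] ai[OF add_hom[OF f(5) g(1)] f(1,2)] by (simp add: Ks Ds(4))
  qed
  have bij: "bij_betw (FA K) (Hom D x y) (Hom A (FO K x) (FO K y))" if xy: "x \<in> Obj D" "y \<in> Obj D" for x y
  proof -
    obtain U V where UV: "U \<in> \<U>" "x = o' U" "V \<in> \<U>" "y = o' V" using xy by (auto simp: Ds(1))
    have "bij_betw ai (a ` Hom A U V) (Hom A U V)"
      by (rule bij_betw_byWitness[where f' = a]) (use ai[OF _ UV(1,3)] in auto)
    then show ?thesis using UV HomD[OF UV(1,3)] by (simp add: Ks oi)
  qed
  have obj: "FO K ` Obj D = \<U>" using oi by (force simp: Ks Ds(1))
  show thesis by (rule that[OF pre sm fct add bij obj])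
qed

theorem module_category_over_preadditive:
  assumes "self_small \<kappa> A \<U>"
  shows "is_module_category_over_preadditive \<kappa> (full_subcategory A B)"
proof -
  obtain D :: "('u, 'u) precat" and K :: "('u, 'u, 'o, 'm) ftor" where
    D: "preadditive_category D" "small_category \<kappa> D" and K: "is_functor D A K"
    "\<And>f g c d. f \<in> Hom D c d \<Longrightarrow> g \<in> Hom D c d \<Longrightarrow> FA K (Add D f g) = Add A (FA K f) (FA K g)"
    "\<And>c d. c \<in> Obj D \<Longrightarrow> d \<in> Obj D \<Longrightarrow> bij_betw (FA K) (Hom D c d) (Hom A (FO K c) (FO K d))"
    "FO K ` Obj D = \<U>"
    by (rule small_model_ex) blast
  interpret preadditive: preadditive_category D by (rule D(1))
  interpret D: small_preadditive D \<kappa> by unfold_locales (rule universe D(2))+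
  interpret module_data A \<kappa> B \<U> D K by unfold_locales (rule assms K; assumption?)+
  show ?thesis
    unfolding is_module_category_over_preadditive_def using D equivalent_module_category by blast
qed

end

section \<open>Rings as categories with one object\<close>

lemma ring_category_simps [simp]:
  "Obj (ring_category R) = {()}" "Hom (ring_category R) x y = carrier R" "Arr (ring_category R) = carrier R"
  "Ide (ring_category R) x = \<one>\<^bsub>R\<^esub>" "r \<cdot>\<^bsub>ring_category R\<^esub> s = r \<otimes>\<^bsub>R\<^esub> s"
  "Add (ring_category R) r s = r \<oplus>\<^bsub>R\<^esub> s" "Zero (ring_category R) x y = \<zero>\<^bsub>R\<^esub>"
  by (auto simp: ring_category_def Hom_def)

lemma preadditive_ring_category:
  fixes R :: "'a ring"
  assumes "ring R"
  shows "preadditive_category (ring_category R)"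
proof -
  interpret ring R by fact
  have "category (ring_category R)" by unfold_locales (auto simp: m_assoc)
  moreover have "hom_group (ring_category R) x y = add_monoid R" for x y
    by (simp add: hom_group_def ring_category_def Hom_def)
  ultimately show ?thesis
    using a_comm_group
    by (intro preadditive_category.intro preadditive_category_axioms.intro) (simp_all add: l_distr r_distr)
qed

lemma small_ring_category:
  fixes R :: "'a ring"
  assumes "ring R" "universe \<kappa>" "small \<kappa> (carrier R)"
  shows "small_category \<kappa> (ring_category R)"
  unfolding small_category_def
  using preadditive_ring_category[OF assms(1)] assms(2,3) by (auto simp: preadditive_category_def small_finite)

text \<open>\<open>R\<close> is the endomorphism ring of \<open>U\<close>, encoded in
  \<open>'u\<close>, with composition as multiplication. Its one-object category is a model of \<U>,
  and \<open>K\<close> is the decoding.\<close>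

theorem (in presented) module_category_over_ring:
  assumes "self_small \<kappa> A \<U>" "\<U> = {U}"
  shows "is_module_category_over_ring \<kappa> (full_subcategory A B)"
proof -
  have U: "U \<in> Obj A" using U_obj assms(2) by simp
  let ?E = "Hom A U U"
  have smE: "small \<kappa> ?E" by (rule small_Hom[OF U U])
  obtain a :: "'m \<Rightarrow> 'u" where a: "inj_on a ?E" using small_embed[OF universe smE] .
  define ai where "ai = inv_into ?E a"
  have ai: "ai (a f) = f" if "f \<in> ?E" for f using a that by (simp add: ai_def)
  define R :: "'u ring" where "R = \<lparr>carrier = a ` ?E, monoid.mult = (\<lambda>u v. a (ai u \<cdot> ai v)), one = a (Ide A U),
    zero = a (Zero A U U), add = (\<lambda>u v. a (Add A (ai u) (ai v)))\<rparr>"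
  have Rs: "carrier R = a ` ?E" "u \<otimes>\<^bsub>R\<^esub> v = a (ai u \<cdot> ai v)" "\<one>\<^bsub>R\<^esub> = a (Ide A U)" "u \<oplus>\<^bsub>R\<^esub> v = a (Add A (ai u) (ai v))"
    "\<zero>\<^bsub>R\<^esub> = a (Zero A U U)" for u v
    by (simp_all add: R_def)
  note i = ide_hom[OF U] and z = zero_hom[OF U U]
  have ring: "ring R"
  proof (rule ringI)
    have "comm_group (add_monoid R)"
    proof (rule comm_group_image[OF hom_comm_group[OF U U]])
      show "a \<in> hom (hom_group A U U) (add_monoid R)" using ai by (auto simp: hom_def Rs)
    qed (simp_all add: Rs)
    then show "abelian_group R" by (rule comm_group_abelian_groupI)
    show "monoid R"
    proof
      fix x y assume "x \<in> carrier R" "y \<in> carrier R"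
      then obtain f g where f: "x = a f" "f \<in> ?E" and g: "y = a g" "g \<in> ?E" by (auto simp: Rs)
      show "x \<otimes>\<^bsub>R\<^esub> y \<in> carrier R" using f g ai cmp_hom[OF g(2) f(2)] by (simp add: Rs)
      fix w assume "w \<in> carrier R"
      then obtain h where h: "w = a h" "h \<in> ?E" by (auto simp: Rs)
      show "x \<otimes>\<^bsub>R\<^esub> y \<otimes>\<^bsub>R\<^esub> w = x \<otimes>\<^bsub>R\<^esub> (y \<otimes>\<^bsub>R\<^esub> w)"
        using f g h ai cmp_hom[OF g(2) f(2)] cmp_hom[OF h(2) g(2)] cmp_assoc[OF h(2) g(2) f(2)] by (simp add: Rs)
    next
      fix x assume "x \<in> carrier R"
      then obtain f where f: "x = a f" "f \<in> ?E" by (auto simp: Rs)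
      show "\<one>\<^bsub>R\<^esub> \<otimes>\<^bsub>R\<^esub> x = x" "x \<otimes>\<^bsub>R\<^esub> \<one>\<^bsub>R\<^esub> = x"
        using f ai i cmp_ide_left[OF f(2)] cmp_ide_right[OF f(2)] by (simp_all add: Rs)
    qed (use i in \<open>simp add: Rs\<close>)
    fix x y w assume "x \<in> carrier R" "y \<in> carrier R" "w \<in> carrier R"
    then obtain f g h where f: "x = a f" "f \<in> ?E" and g: "y = a g" "g \<in> ?E" and h: "w = a h" "h \<in> ?E" by (auto simp: Rs)
    note c = cmp_hom[OF h(2) f(2)] cmp_hom[OF h(2) g(2)] cmp_hom[OF f(2) h(2)] cmp_hom[OF g(2) h(2)] add_hom[OF f(2) g(2)]
    show "(x \<oplus>\<^bsub>R\<^esub> y) \<otimes>\<^bsub>R\<^esub> w = x \<otimes>\<^bsub>R\<^esub> w \<oplus>\<^bsub>R\<^esub> y \<otimes>\<^bsub>R\<^esub> w"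
      using f g h ai c cmp_add_left[OF h(2) f(2) g(2)] by (simp add: Rs)
    show "w \<otimes>\<^bsub>R\<^esub> (x \<oplus>\<^bsub>R\<^esub> y) = w \<otimes>\<^bsub>R\<^esub> x \<oplus>\<^bsub>R\<^esub> w \<otimes>\<^bsub>R\<^esub> y"
      using f g h ai c cmp_add_right[OF f(2) g(2) h(2)] by (simp add: Rs)
  qed
  have smR: "small \<kappa> (carrier R)" by (simp add: Rs small_image[OF smE])
  interpret preadditive: preadditive_category "ring_category R" by (rule preadditive_ring_category[OF ring])
  interpret D: small_preadditive "ring_category R" \<kappa>
    by unfold_locales (rule universe small_ring_category[OF ring universe smR])+
  define K :: "(unit, 'u, 'o, 'm) ftor" where "K = \<lparr>FO = (\<lambda>_. U), FA = ai\<rparr>"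
  have Ks: "FO K x = U" "FA K = ai" for x by (simp_all add: K_def)
  have K1: "is_functor (ring_category R) A K"
  proof (rule functorI[OF preadditive.category_axioms category_axioms])
    fix f g :: 'u and x y z assume "f \<in> Hom (ring_category R) x y" "g \<in> Hom (ring_category R) y z"
    then obtain f' g' where f: "f = a f'" "f' \<in> ?E" and g: "g = a g'" "g' \<in> ?E" by (auto simp: Rs)
    show "FA K (g \<cdot>\<^bsub>ring_category R\<^esub> f) = FA K g \<cdot> FA K f" using f g ai cmp_hom[OF f(2) g(2)] by (simp add: Ks Rs)
  qed (use U ai i in \<open>auto simp: Ks Rs\<close>)
  have K2: "FA K (Add (ring_category R) f g) = Add A (FA K f) (FA K g)"
    if "f \<in> Hom (ring_category R) c d" "g \<in> Hom (ring_category R) c d" for f g c d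
    using that ai add_hom by (auto simp: Ks Rs)
  have K3: "bij_betw (FA K) (Hom (ring_category R) c d) (Hom A (FO K c) (FO K d))" for c d
    unfolding Ks ring_category_simps Rs by (rule bij_betw_byWitness[where f' = a]) (use ai in auto)
  have K4: "FO K ` Obj (ring_category R) = \<U>" using assms(2) by (simp add: Ks)
  interpret module_data A \<kappa> B \<U> "ring_category R" K
    by unfold_locales (rule assms(1) K1 K3 K4 | erule (1) K2)+
  show ?thesis unfolding is_module_category_over_ring_def using ring smR equivalent_module_category by blast
qed


section \<open>Module categories yield self-small presenting sets\<close>

context small_preadditive
begin

text \<open>The functor \<open>D(-, c)\<close>. Its elements are arrows of \<open>D\<close>, so it
  is an object of \<open>module_category\<close> when these have type \<open>'u\<close>; that it is
  one is therefore proved outside this context.\<close>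

definition representable :: "'c \<Rightarrow> ('c, 'd, 'd monoid, 'd monoid \<times> 'd monoid \<times> ('d \<Rightarrow> 'd)) ftor" where
  "representable c = make_module D (\<lambda>d. hom_group D d c) (\<lambda>f x. x \<cdot>\<^bsub>D\<^esub> f)"

text \<open>\<open>Q\<close> carries the operations of \<open>M\<close> restricted to
  \<open>S\<close>, so a module map whose values lie in \<open>S\<close> is also a map into
  \<open>Q\<close>.\<close>

lemma submodule:
  assumes M: "M \<in> Obj MOD"
    and sub: "\<And>c. c \<in> Obj D \<Longrightarrow> subgroup (S c) (FO M c)"
    and act: "\<And>f c d x. f \<in> Hom D d c \<Longrightarrow> x \<in> S c \<Longrightarrow> act M f x \<in> S d"
  obtains Q j where "j \<in> Hom MOD Q M" "\<forall>c\<in>Obj D. carrier (FO Q c) = S c"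
    "\<forall>c\<in>Obj D. \<forall>x\<in>S c. component j c x = x"
    "\<forall>N t. t \<in> Hom MOD N M \<and> (\<forall>c\<in>Obj D. \<forall>x\<in>carrier (FO N c). component t c x \<in> S c) \<longrightarrow>
       (\<exists>r. r \<in> Hom MOD N Q \<and> j \<cdot>\<^bsub>MOD\<^esub> r = t)"
proof -
  define Q where "Q = make_module D (\<lambda>c. FO M c\<lparr>carrier := S c\<rparr>) (act M)"
  have SM: "x \<in> carrier (FO M c)" if "c \<in> Obj D" "x \<in> S c" for c x
    using subgroup.subset[OF sub[OF that(1)]] that(2) by blast
  have Q: "Q \<in> Obj MOD"
    unfolding Q_def
  proof (rule make_module_Obj)
    fix c assume c: "c \<in> Obj D"
    interpret M: comm_group "FO M c" by (rule module_group[OF M c])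
    interpret G: group "FO M c\<lparr>carrier := S c\<rparr>" by (rule M.subgroup_imp_group[OF sub[OF c]])
    show "comm_group (FO M c\<lparr>carrier := S c\<rparr>)"
      by (rule G.group_comm_groupI) (use SM[OF c] M.m_comm in simp)
    show "small \<kappa> (carrier (FO M c\<lparr>carrier := S c\<rparr>))"
      using small_mono[OF module_small[OF M c]] SM[OF c] by auto
  next
    fix f c d assume f: "f \<in> Hom D d c"
    show "act M f \<in> hom (FO M c\<lparr>carrier := S c\<rparr>) (FO M d\<lparr>carrier := S d\<rparr>)"
      using act[OF f] act_mult[OF M f] SM[OF hom_obj(2)[OF f]] by (auto simp: hom_def)
  next
    fix c x assume "c \<in> Obj D" "x \<in> carrier (FO M c\<lparr>carrier := S c\<rparr>)"
    then show "act M (Ide D c) x = x" using act_ide[OF M] SM by simp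
  next
    fix f g c d e x assume f: "f \<in> Hom D d c" and g: "g \<in> Hom D e d" and "x \<in> carrier (FO M c\<lparr>carrier := S c\<rparr>)"
    then show "act M (f \<cdot>\<^bsub>D\<^esub> g) x = act M g (act M f x)" using act_cmp[OF M f g] SM[OF hom_obj(2)[OF f]] by simp
  next
    fix f g c d x assume f: "f \<in> Hom D d c" and g: "g \<in> Hom D d c" and "x \<in> carrier (FO M c\<lparr>carrier := S c\<rparr>)"
    then show "act M (Add D f g) x = act M f x \<otimes>\<^bsub>FO M d\<lparr>carrier := S d\<rparr>\<^esub> act M g x"
      using act_add[OF M f g] SM[OF hom_obj(2)[OF f]] by simp
  qed
  have FQ: "FO Q c = FO M c\<lparr>carrier := S c\<rparr>" if "c \<in> Obj D" for c
    unfolding Q_def by (rule make_module_simps(1)[OF that])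
  have aQ: "act Q f x = act M f x" if "f \<in> Hom D d c" "x \<in> S c" for f d c x
    unfolding Q_def by (rule make_module_simps(2)[OF that(1)]) (simp add: that(2))
  obtain j where j: "j \<in> Hom MOD Q M" "\<forall>c\<in>Obj D. \<forall>x\<in>carrier (FO Q c). component j c x = x"
  proof (rule Mod_homI[OF Q M, of "\<lambda>c x. x"])
    show "(\<lambda>x. x) \<in> hom (FO Q c) (FO M c)" if "c \<in> Obj D" for c
      using SM[OF that] by (auto simp: hom_def FQ[OF that])
    show "act Q f x = act M f x" if "f \<in> Hom D d c" "x \<in> carrier (FO Q c)" for f c d x
      using that aQ[OF that(1)] FQ[OF hom_obj(2)[OF that(1)]] by simp
  qed
  show thesis
  proof (rule that[OF j(1)])
    show "\<forall>c\<in>Obj D. carrier (FO Q c) = S c" using FQ by simp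
    show jx: "\<forall>c\<in>Obj D. \<forall>x\<in>S c. component j c x = x" using j(2) FQ by simp
    show "\<forall>N t. t \<in> Hom MOD N M \<and> (\<forall>c\<in>Obj D. \<forall>x\<in>carrier (FO N c). component t c x \<in> S c) \<longrightarrow>
       (\<exists>r. r \<in> Hom MOD N Q \<and> j \<cdot>\<^bsub>MOD\<^esub> r = t)"
    proof (intro allI impI, elim conjE)
      fix N t assume t: "t \<in> Hom MOD N M" and tS: "\<forall>c\<in>Obj D. \<forall>x\<in>carrier (FO N c). component t c x \<in> S c"
      obtain r where r: "r \<in> Hom MOD N Q" "\<forall>c\<in>Obj D. \<forall>x\<in>carrier (FO N c). component r c x = component t c x"
      proof (rule Mod_homI[OF Mod_hom_obj(1)[OF t] Q, of "component t"])
        show "component t c \<in> hom (FO N c) (FO Q c)" if c: "c \<in> Obj D" for c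
          using component_mult[OF t c] tS c by (auto simp: hom_def FQ[OF c])
        show "component t d (act N f x) = act Q f (component t c x)" if f: "f \<in> Hom D d c" and x: "x \<in> carrier (FO N c)"
            for f c d x
          using component_natural[OF t f x] aQ[OF f] tS x hom_obj(2)[OF f] by simp
      qed
      have "j \<cdot>\<^bsub>MOD\<^esub> r = t"
        by (rule Mod_hom_eqI[OF Mod_cmp(1)[OF r(1) j(1)] t]) (use Mod_cmp(2)[OF r(1) j(1)] r(2) jx tS in simp)
      then show "\<exists>r. r \<in> Hom MOD N Q \<and> j \<cdot>\<^bsub>MOD\<^esub> r = t" using r(1) by blast
    qed
  qed
qed

end

lemma representable_Obj:
  fixes \<kappa> :: "'u rel" and D :: "('c, 'u) precat"
  assumes "small_preadditive D \<kappa>" "c \<in> Obj D"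
  shows "small_preadditive.representable D c \<in> Obj (module_category \<kappa> D)"
proof -
  interpret small_preadditive D \<kappa> by fact
  show ?thesis
    unfolding representable_def
  proof (rule make_module_Obj)
    fix d assume d: "d \<in> Obj D"
    show "comm_group (hom_group D d c)" by (rule hom_comm_group[OF d assms(2)])
    have "small \<kappa> (Arr D)" using small_D by (simp add: small_category_def)
    then show "small \<kappa> (carrier (hom_group D d c))"
      using small_mono[of \<kappa> "Arr D" "Hom D d c"] by (auto simp: Hom_def)
  next
    fix f d e assume f: "f \<in> Hom D e d"
    show "(\<lambda>x. x \<cdot>\<^bsub>D\<^esub> f) \<in> hom (hom_group D d c) (hom_group D e c)"
      using cmp_hom[OF f] cmp_add_left[OF f] by (auto simp: hom_def)
  next
    fix d x assume "x \<in> carrier (hom_group D d c)"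
    then show "x \<cdot>\<^bsub>D\<^esub> Ide D d = x" using cmp_ide_right by simp
  next
    fix f g d e e' x assume f: "f \<in> Hom D e d" and g: "g \<in> Hom D e' e" and "x \<in> carrier (hom_group D d c)"
    then show "x \<cdot>\<^bsub>D\<^esub> (f \<cdot>\<^bsub>D\<^esub> g) = x \<cdot>\<^bsub>D\<^esub> f \<cdot>\<^bsub>D\<^esub> g" using cmp_assoc[OF g f] by simp
  next
    fix f g d e x assume f: "f \<in> Hom D e d" and g: "g \<in> Hom D e d" and "x \<in> carrier (hom_group D d c)"
    then show "x \<cdot>\<^bsub>D\<^esub> Add D f g = (x \<cdot>\<^bsub>D\<^esub> f) \<otimes>\<^bsub>hom_group D e c\<^esub> (x \<cdot>\<^bsub>D\<^esub> g)" using cmp_add_right[OF f g] by simp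
  qed
qed

context preadditive_category
begin

text \<open>Composition with \<open>\<pi> i\<close> distributes over the sum and annihilates every
  term but the one with index \<open>i\<close>.\<close>

lemma finite_sum_projection:
  assumes cP: "is_coproduct C I X P \<iota>" and pi: "\<forall>i\<in>I. \<pi> i \<in> Hom C P (X i)"
    and pii: "\<forall>i\<in>I. \<forall>j\<in>I. \<pi> i \<cdot> \<iota> j = (if i = j then Ide C (X i) else Zero C (X j) (X i))"
    and U: "U \<in> Obj C" and F: "finite F" "F \<subseteq> I" and y: "\<And>j. j \<in> F \<Longrightarrow> y j \<in> Hom C U (X j)" and i: "i \<in> I"
  shows "\<pi> i \<cdot> finprod (hom_group C U P) (\<lambda>j. \<iota> j \<cdot> y j) F = (if i \<in> F then y i else Zero C U (X i))"
proof -
  note Xo = coproduct_summand_obj[OF cP i]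
  interpret comm_group "hom_group C U (X i)" by (rule hom_comm_group[OF U Xo])
  have iy: "\<iota> j \<cdot> y j \<in> Hom C U P" if "j \<in> F" for j
    using cmp_hom[OF y[OF that] coproduct_inj[OF cP]] that F(2) by blast
  have t: "\<pi> i \<cdot> (\<iota> j \<cdot> y j) = (if i = j then y j else Zero C U (X i))" if j: "j \<in> F" for j
  proof -
    have jI: "j \<in> I" using j F(2) by blast
    have "\<pi> i \<cdot> (\<iota> j \<cdot> y j) = (\<pi> i \<cdot> \<iota> j) \<cdot> y j"
      by (rule cmp_assoc[OF y[OF j] coproduct_inj[OF cP jI] bspec[OF pi i]])
    then show ?thesis using bspec[OF bspec[OF pii i] jI] cmp_ide_left[OF y[OF j]] cmp_zero_left[OF y[OF j] Xo] by simp
  qed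
  have "\<pi> i \<cdot> finprod (hom_group C U P) (\<lambda>j. \<iota> j \<cdot> y j) F = finprod (hom_group C U (X i)) (\<lambda>j. \<pi> i \<cdot> (\<iota> j \<cdot> y j)) F"
    by (rule cmp_finprod_right[OF U bspec[OF pi i] F(1) iy])
  also have "\<dots> = finprod (hom_group C U (X i)) (\<lambda>j. if i = j then y j else Zero C U (X i)) F"
    by (rule finprod_cong') (use t y zero_hom[OF U Xo] in \<open>auto simp: Pi_iff\<close>)
  also have "\<dots> = (if i \<in> F then y i else Zero C U (X i))"
  proof (cases "i \<in> F")
    case True
    have "finprod (hom_group C U (X i)) (\<lambda>j. if i = j then (if i = j then y j else Zero C U (X i)) else \<one>\<^bsub>hom_group C U (X i)\<^esub>) F
        = (if i = i then y i else Zero C U (X i))"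
      by (rule finprod_singleton[OF True F(1)]) (use y zero_hom[OF U Xo] in \<open>auto simp: Pi_iff\<close>)
    moreover have "(\<lambda>j. if i = j then (if i = j then y j else Zero C U (X i)) else \<one>\<^bsub>hom_group C U (X i)\<^esub>) =
        (\<lambda>j. if i = j then y j else Zero C U (X i))" by auto
    ultimately show ?thesis using True by simp
  next
    case False
    have "finprod (hom_group C U (X i)) (\<lambda>j. if i = j then y j else Zero C U (X i)) F = \<one>\<^bsub>hom_group C U (X i)\<^esub>"
      by (rule finprod_one_eqI) (use False in auto)
    then show ?thesis using False by simp
  qed
  finally show ?thesis .
qed

text \<open>The inverse sends \<open>x\<close> to the family of all
  \<open>\<pi> i \<cdot> x\<close>. It undoes the canonical map on families of finite support in any
  case; the hypothesis \<open>fin\<close> supplies the finite support of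
  \<open>\<pi> i \<cdot> x\<close> and the other composite.\<close>

lemma canonical_map_iso:
  assumes cP: "is_coproduct C I X P \<iota>" and pi: "\<forall>i\<in>I. \<pi> i \<in> Hom C P (X i)"
    and pii: "\<forall>i\<in>I. \<forall>j\<in>I. \<pi> i \<cdot> \<iota> j = (if i = j then Ide C (X i) else Zero C (X j) (X i))"
    and U: "U \<in> Obj C"
    and fin: "\<And>x. x \<in> Hom C U P \<Longrightarrow> \<exists>F. finite F \<and> F \<subseteq> I \<and> x = finprod (hom_group C U P) (\<lambda>i. \<iota> i \<cdot> (\<pi> i \<cdot> x)) F"
  shows "canonical_map C U I X P \<iota> \<in> iso (sum_group I (\<lambda>i. hom_group C U (X i))) (hom_group C U P)"
proof -
  let ?c = "canonical_map C U I X P \<iota>" and ?S = "sum_group I (\<lambda>i. hom_group C U (X i))"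
  note P = coproduct_obj[OF cP] and Xo = coproduct_summand_obj[OF cP]
  interpret UP: comm_group "hom_group C U P" by (rule hom_comm_group[OF U P])
  have carr: "carrier ?S = {y \<in> \<Pi>\<^sub>E i\<in>I. Hom C U (X i). finite {i \<in> I. y i \<noteq> Zero C U (X i)}}"
    using carrier_sum_group[of I "\<lambda>i. hom_group C U (X i)"] group_hom_group[OF U Xo] by simp
  define r where "r x = (\<lambda>i\<in>I. \<pi> i \<cdot> x)" for x
  have rx: "r x \<in> carrier ?S" "?c (r x) = x" if x: "x \<in> Hom C U P" for x
  proof -
    obtain F where F: "finite F" "F \<subseteq> I" "x = finprod (hom_group C U P) (\<lambda>i. \<iota> i \<cdot> (\<pi> i \<cdot> x)) F" using fin[OF x] by blast
    have px: "\<pi> i \<cdot> x \<in> Hom C U (X i)" if "i \<in> I" for i by (rule cmp_hom[OF x bspec[OF pi that]])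
    have ix: "\<iota> i \<cdot> (\<pi> i \<cdot> x) \<in> Hom C U P" if "i \<in> I" for i by (rule cmp_hom[OF px[OF that] coproduct_inj[OF cP that]])
    let ?supp = "{i \<in> I. r x i \<noteq> Zero C U (X i)}"
    have supp: "?supp \<subseteq> F"
    proof
      fix i assume "i \<in> ?supp"
      then have i: "i \<in> I" "\<pi> i \<cdot> x \<noteq> Zero C U (X i)" by (auto simp: r_def)
      have "\<pi> i \<cdot> finprod (hom_group C U P) (\<lambda>i. \<iota> i \<cdot> (\<pi> i \<cdot> x)) F = (if i \<in> F then \<pi> i \<cdot> x else Zero C U (X i))"
        by (rule finite_sum_projection[OF cP pi pii U F(1,2) _ i(1)]) (use px F(2) in blast)
      then show "i \<in> F" using F(3) i(2) by (metis (no_types))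
    qed
    show "r x \<in> carrier ?S" unfolding carr using px finite_subset[OF supp F(1)] by (auto simp: r_def)
    have "?c (r x) = finprod (hom_group C U P) (\<lambda>i. \<iota> i \<cdot> r x i) ?supp" by (simp add: canonical_map_def)
    also have "\<dots> = finprod (hom_group C U P) (\<lambda>i. \<iota> i \<cdot> (\<pi> i \<cdot> x)) F"
    proof (rule UP.finprod_mono_neutral_cong_left[OF F(1) supp])
      fix i assume "i \<in> F - ?supp"
      then have "i \<in> I" "\<pi> i \<cdot> x = Zero C U (X i)" using F(2) by (auto simp: r_def)
      then show "\<iota> i \<cdot> (\<pi> i \<cdot> x) = \<one>\<^bsub>hom_group C U P\<^esub>" using cmp_zero_right[OF coproduct_inj[OF cP] U] by simp
    qed (use F(2) ix in \<open>auto simp: r_def\<close>)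
    finally show "?c (r x) = x" using F(3) by (metis (no_types))
  qed
  have cr: "?c y \<in> Hom C U P" "r (?c y) = y" if y: "y \<in> carrier ?S" for y
  proof -
    let ?supp = "{i \<in> I. y i \<noteq> Zero C U (X i)}"
    have yP: "y \<in> (\<Pi>\<^sub>E i\<in>I. Hom C U (X i))" and f: "finite ?supp" using y unfolding carr by auto
    have yh: "y i \<in> Hom C U (X i)" if "i \<in> I" for i using PiE_mem[OF yP that] .
    have c: "?c y = finprod (hom_group C U P) (\<lambda>i. \<iota> i \<cdot> y i) ?supp" by (simp add: canonical_map_def)
    show "?c y \<in> Hom C U P"
      unfolding c by (rule finprod_hom[OF U P]) (use yh cmp_hom coproduct_inj[OF cP] in blast)
    show "r (?c y) = y"
    proof (rule extensionalityI[of _ I])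
      show "r (?c y) \<in> extensional I" by (simp add: r_def)
      show "y \<in> extensional I" using yP by (simp add: PiE_def)
      fix i assume i: "i \<in> I"
      have "\<pi> i \<cdot> ?c y = (if i \<in> ?supp then y i else Zero C U (X i))"
        unfolding c by (rule finite_sum_projection[OF cP pi pii U f _ _ i]) (use yh in auto)
      then show "r (?c y) i = y i" using i by (auto simp: r_def)
    qed
  qed
  show ?thesis
  proof (rule Group.isoI)
    show "bij_betw ?c (carrier ?S) (carrier (hom_group C U P))"
      by (rule bij_betw_byWitness[where f' = r]) (use rx cr in auto)
    show "?c \<in> hom ?S (hom_group C U P)"
    proof (rule Group.homI)
      show "?c y \<in> carrier (hom_group C U P)" if "y \<in> carrier ?S" for y using cr(1)[OF that] by simp
      fix y z assume y: "y \<in> carrier ?S" and z: "z \<in> carrier ?S"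
      note cy = cr[OF y] and cz = cr[OF z]
      \<comment> \<open>Additivity is derived from that of the inverse \<open>r\<close>, which
        avoids comparing sums over different supports.\<close>
      have "y \<otimes>\<^bsub>?S\<^esub> z = (\<lambda>i\<in>I. Add C (r (?c y) i) (r (?c z) i))" using cy(2) cz(2) by simp
      also have "\<dots> = r (Add C (?c y) (?c z))"
        unfolding r_def by (rule restrict_ext) (use cmp_add_right[OF cy(1) cz(1) bspec[OF pi]] in simp)
      finally show "?c (y \<otimes>\<^bsub>?S\<^esub> z) = ?c y \<otimes>\<^bsub>hom_group C U P\<^esub> ?c z"
        using rx(2)[OF add_hom[OF cy(1) cz(1)]] by simp
    qed
  qed
qed

end

section \<open>The objects of \<open>B\<close> that correspond to representable modules\<close>

text \<open>The arrows of \<open>D\<close> have type \<open>'u\<close>, so that the representable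
  modules are objects of the module category.\<close>

locale module_equivalence = coreflective_abelian A \<kappa> B + D: small_preadditive D \<kappa>
  for A :: "('o, 'm, 'x) precat_scheme" (structure) and \<kappa> :: "'u rel" and B :: "'o set" and D :: "('c, 'u) precat" +
  fixes F :: "('o, 'm, ('c, 'u, 'u monoid, 'u monoid \<times> 'u monoid \<times> ('u \<Rightarrow> 'u)) ftor,
    ('c, 'u, 'u monoid, 'u monoid \<times> 'u monoid \<times> ('u \<Rightarrow> 'u)) functor_arr) ftor"
  assumes F_equivalence: "fully_faithful_surjective (full_subcategory A B) (module_category \<kappa> D) F"
begin

lemma F_hom: "f \<in> Hom A X Y \<Longrightarrow> X \<in> B \<Longrightarrow> Y \<in> B \<Longrightarrow> FA F f \<in> Hom D.MOD (FO F X) (FO F Y)"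
  using functor_hom[OF fully_faithful_surjectiveD(1)[OF F_equivalence], of f X Y] by simp

lemma F_obj: "X \<in> B \<Longrightarrow> FO F X \<in> Obj D.MOD"
  using functor_obj[OF fully_faithful_surjectiveD(1)[OF F_equivalence]] by simp

lemma F_cmp: "f \<in> Hom A X Y \<Longrightarrow> g \<in> Hom A Y Z \<Longrightarrow> X \<in> B \<Longrightarrow> Y \<in> B \<Longrightarrow> Z \<in> B \<Longrightarrow> FA F (g \<cdot> f) = FA F g \<cdot>\<^bsub>D.MOD\<^esub> FA F f"
  using functor_cmp[OF fully_faithful_surjectiveD(1)[OF F_equivalence], of f X Y g Z] by simp

lemma F_ide: "X \<in> B \<Longrightarrow> FA F (Ide A X) = Ide D.MOD (FO F X)"
  using functor_ide[OF fully_faithful_surjectiveD(1)[OF F_equivalence], of X] by simp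

lemma F_full: "h \<in> Hom D.MOD (FO F X) (FO F Y) \<Longrightarrow> X \<in> B \<Longrightarrow> Y \<in> B \<Longrightarrow> \<exists>f. f \<in> Hom A X Y \<and> FA F f = h"
  using fully_faithful_surjectiveD(2)[OF F_equivalence, of X Y h] by simp

lemma F_faithful: "f \<in> Hom A X Y \<Longrightarrow> g \<in> Hom A X Y \<Longrightarrow> X \<in> B \<Longrightarrow> Y \<in> B \<Longrightarrow> FA F f = FA F g \<Longrightarrow> f = g"
  using fully_faithful_surjectiveD(3)[OF F_equivalence, of f X Y g] by simp

lemma F_surj:
  assumes "M \<in> Obj D.MOD"
  obtains X s t where "X \<in> B" "s \<in> Hom D.MOD (FO F X) M" "t \<in> Hom D.MOD M (FO F X)"
    "t \<cdot>\<^bsub>D.MOD\<^esub> s = Ide D.MOD (FO F X)" "s \<cdot>\<^bsub>D.MOD\<^esub> t = Ide D.MOD M"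
proof -
  obtain X where X: "X \<in> B" "isomorphic D.MOD (FO F X) M"
    using fully_faithful_surjectiveD(4)[OF F_equivalence assms] by auto
  show thesis by (rule D.MOD.isomorphicE[OF X(2)]) (rule that[OF X(1)])
qed

lemma generator_ex:
  "\<forall>c\<in>Obj D. \<exists>X s t. X \<in> B \<and> s \<in> Hom D.MOD (FO F X) (D.representable c) \<and> t \<in> Hom D.MOD (D.representable c) (FO F X) \<and>
     t \<cdot>\<^bsub>D.MOD\<^esub> s = Ide D.MOD (FO F X) \<and> s \<cdot>\<^bsub>D.MOD\<^esub> t = Ide D.MOD (D.representable c)"
proof
  fix c assume "c \<in> Obj D"
  then have "D.representable c \<in> Obj D.MOD" by (rule representable_Obj[OF D.small_preadditive_axioms])
  then show "\<exists>X s t. X \<in> B \<and> s \<in> Hom D.MOD (FO F X) (D.representable c) \<and> t \<in> Hom D.MOD (D.representable c) (FO F X) \<and>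
     t \<cdot>\<^bsub>D.MOD\<^esub> s = Ide D.MOD (FO F X) \<and> s \<cdot>\<^bsub>D.MOD\<^esub> t = Ide D.MOD (D.representable c)"
    by (rule F_surj) blast
qed

text \<open>The object of \<open>B\<close> that corresponds to the module
  \<open>D(-, c)\<close>.\<close>

definition generator :: "'c \<Rightarrow> 'o" where
  "generator c = (SOME X. \<exists>s t. X \<in> B \<and> s \<in> Hom D.MOD (FO F X) (D.representable c) \<and> t \<in> Hom D.MOD (D.representable c) (FO F X) \<and>
     t \<cdot>\<^bsub>D.MOD\<^esub> s = Ide D.MOD (FO F X) \<and> s \<cdot>\<^bsub>D.MOD\<^esub> t = Ide D.MOD (D.representable c))"

lemma generator:
  assumes "c \<in> Obj D"
  shows "generator c \<in> B"
    "\<exists>s t. s \<in> Hom D.MOD (FO F (generator c)) (D.representable c) \<and> t \<in> Hom D.MOD (D.representable c) (FO F (generator c)) \<and>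
     t \<cdot>\<^bsub>D.MOD\<^esub> s = Ide D.MOD (FO F (generator c)) \<and> s \<cdot>\<^bsub>D.MOD\<^esub> t = Ide D.MOD (D.representable c)"
  using someI_ex[OF bspec[OF generator_ex assms], folded generator_def] by blast+

text \<open>The Yoneda lemma, transported along the equivalence \<open>F\<close>: the element of \<open>F (generator c)\<close> at \<open>c\<close> that corresponds
  to the identity is universal.\<close>

lemma universal_element_ex:
  assumes c: "c \<in> Obj D"
  shows "\<exists>w\<in>carrier (FO (FO F (generator c)) c). \<forall>X\<in>B.
    bij_betw (\<lambda>x. component (FA F x) c w) (Hom A (generator c) X) (carrier (FO (FO F X) c))"
proof -
  let ?R = "D.representable c" and ?U = "generator c"
  note U = generator(1)[OF c]
  obtain s t where s: "s \<in> Hom D.MOD (FO F ?U) ?R" and t: "t \<in> Hom D.MOD ?R (FO F ?U)"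
    and ts: "t \<cdot>\<^bsub>D.MOD\<^esub> s = Ide D.MOD (FO F ?U)" and st: "s \<cdot>\<^bsub>D.MOD\<^esub> t = Ide D.MOD ?R"
    using generator(2)[OF c] by blast
  have R: "?R \<in> Obj D.MOD" by (rule representable_Obj[OF D.small_preadditive_axioms c])
  have FR: "carrier (FO ?R d) = Hom D d c" if "d \<in> Obj D" for d
    unfolding D.representable_def by (simp add: D.make_module_simps(1)[OF that])
  have aR: "act ?R f x = x \<cdot>\<^bsub>D\<^esub> f" if "f \<in> Hom D e d" "x \<in> Hom D d c" for f e d x
    unfolding D.representable_def by (rule D.make_module_simps(2)[OF that(1)]) (simp add: that(2))
  have ic: "Ide D c \<in> carrier (FO ?R c)" using D.ide_hom[OF c] FR[OF c] by simp
  have yoneda: "component v d x = act M x (component v c (Ide D c))" if v: "v \<in> Hom D.MOD ?R M" and x: "x \<in> Hom D d c" for v M d x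
    using D.component_natural[OF v x ic] aR[OF x D.ide_hom[OF c]] D.cmp_ide_left[OF x] by simp
  have yoneda_eq: "v = v'" if v: "v \<in> Hom D.MOD ?R M" and v': "v' \<in> Hom D.MOD ?R M"
    and eq: "component v c (Ide D c) = component v' c (Ide D c)" for v v' M
  proof (rule D.Mod_hom_eqI[OF v v'])
    fix d x assume "d \<in> Obj D" "x \<in> carrier (FO ?R d)"
    then show "component v d x = component v' d x" using yoneda[OF v] yoneda[OF v'] eq FR by simp
  qed
  let ?w = "component t c (Ide D c)"
  have w: "?w \<in> carrier (FO (FO F ?U) c)" by (rule D.component_closed[OF t c ic])
  have tF: "component (FA F x \<cdot>\<^bsub>D.MOD\<^esub> t) c (Ide D c) = component (FA F x) c ?w" if "x \<in> Hom A ?U X" "X \<in> B" for x X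
    by (rule D.Mod_cmp(2)[OF t F_hom[OF that(1) U that(2)] c ic])
  have "bij_betw (\<lambda>x. component (FA F x) c ?w) (Hom A ?U X) (carrier (FO (FO F X) c))" if X: "X \<in> B" for X
    unfolding bij_betw_def
  proof (intro conjI inj_onI equalityI subsetI)
    fix x y assume x: "x \<in> Hom A ?U X" and y: "y \<in> Hom A ?U X" and eq: "component (FA F x) c ?w = component (FA F y) c ?w"
    note Fx = F_hom[OF x U X] and Fy = F_hom[OF y U X]
    have "FA F x \<cdot>\<^bsub>D.MOD\<^esub> t = FA F y \<cdot>\<^bsub>D.MOD\<^esub> t"
      by (rule yoneda_eq[OF D.Mod_cmp(1)[OF t Fx] D.Mod_cmp(1)[OF t Fy]]) (use tF[OF x X] tF[OF y X] eq in simp)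
    moreover have "epic D.MOD t" by (rule D.MOD.retraction_epic[OF t s ts])
    ultimately have "FA F x = FA F y"
      using D.MOD.epicD[of t "FA F x" "FO F X" "FA F y"] Fx Fy HomD(3)[OF t] by simp
    then show "x = y" by (rule F_faithful[OF x y U X])
  next
    fix m assume "m \<in> (\<lambda>x. component (FA F x) c ?w) ` Hom A ?U X"
    then show "m \<in> carrier (FO (FO F X) c)" using D.component_closed[OF F_hom[OF _ U X] c w] by auto
  next
    fix m assume m: "m \<in> carrier (FO (FO F X) c)"
    note FX = F_obj[OF X]
    \<comment> \<open>Surjectivity: the element \<open>m\<close> determines the arrow from
      \<open>D(-, c)\<close> that sends \<open>x\<close> to the action of \<open>x\<close> on
      \<open>m\<close>; composed with the isomorphism \<open>s\<close>, it comes from an arrow of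
      \<open>B\<close>.\<close>
    obtain v where v: "v \<in> Hom D.MOD ?R (FO F X)" "\<forall>d\<in>Obj D. \<forall>x\<in>carrier (FO ?R d). component v d x = act (FO F X) x m"
    proof (rule D.Mod_homI[OF R FX, of "\<lambda>d x. act (FO F X) x m"])
      fix d assume d: "d \<in> Obj D"
      show "(\<lambda>x. act (FO F X) x m) \<in> hom (FO ?R d) (FO (FO F X) d)"
      proof (rule Group.homI)
        fix x assume "x \<in> carrier (FO ?R d)"
        then have x: "x \<in> Hom D d c" using FR[OF d] by simp
        show "act (FO F X) x m \<in> carrier (FO (FO F X) d)" by (rule D.act_closed[OF FX x m])
        fix y assume "y \<in> carrier (FO ?R d)"
        then have y: "y \<in> Hom D d c" using FR[OF d] by simp
        have "x \<otimes>\<^bsub>FO ?R d\<^esub> y = Add D x y"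
          unfolding D.representable_def by (simp add: D.make_module_simps(1)[OF d])
        then show "act (FO F X) (x \<otimes>\<^bsub>FO ?R d\<^esub> y) m = act (FO F X) x m \<otimes>\<^bsub>FO (FO F X) d\<^esub> act (FO F X) y m"
          using D.act_add[OF FX x y m] by simp
      qed
    next
      fix f d e x assume f: "f \<in> Hom D e d" and "x \<in> carrier (FO ?R d)"
      then have x: "x \<in> Hom D d c" using FR[OF D.hom_obj(2)[OF f]] by simp
      show "act (FO F X) (act ?R f x) m = act (FO F X) f (act (FO F X) x m)"
        using aR[OF f x] D.act_cmp[OF FX x f m] by simp
    qed
    obtain x where x: "x \<in> Hom A ?U X" "FA F x = v \<cdot>\<^bsub>D.MOD\<^esub> s"
      using F_full[OF D.Mod_cmp(1)[OF s v(1)] U X] by blast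
    have "component (FA F x) c ?w = component v c (component s c ?w)"
      unfolding x(2) by (rule D.Mod_cmp(2)[OF s v(1) c w])
    also have "component s c ?w = component (s \<cdot>\<^bsub>D.MOD\<^esub> t) c (Ide D c)"
      by (rule D.Mod_cmp(2)[symmetric, OF t s c ic])
    also have "\<dots> = Ide D c" unfolding st by (rule D.Mod_ide(2)[OF R c ic])
    also have "component v c (Ide D c) = act (FO F X) (Ide D c) m" using v(2) c ic by simp
    also have "\<dots> = m" by (rule D.act_ide[OF FX m c])
    finally have "m = component (FA F x) c ?w" by (rule sym)
    then show "m \<in> (\<lambda>x. component (FA F x) c ?w) ` Hom A ?U X" using x(1) by (rule image_eqI)
  qed
  then show ?thesis using w by blast
qed

definition universal_element :: "'c \<Rightarrow> 'u" where
  "universal_element c = (SOME w. w \<in> carrier (FO (FO F (generator c)) c) \<and>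
     (\<forall>X\<in>B. bij_betw (\<lambda>x. component (FA F x) c w) (Hom A (generator c) X) (carrier (FO (FO F X) c))))"

text \<open>The Yoneda bijection from \<open>A(generator c, X)\<close> to the group of
  \<open>F X\<close> at \<open>c\<close>.\<close>

definition ev :: "'c \<Rightarrow> 'm \<Rightarrow> 'u" where
  "ev c x = component (FA F x) c (universal_element c)"

lemma universal_element:
  assumes "c \<in> Obj D"
  shows "universal_element c \<in> carrier (FO (FO F (generator c)) c)"
    "X \<in> B \<Longrightarrow> bij_betw (ev c) (Hom A (generator c) X) (carrier (FO (FO F X) c))"
proof -
  have "\<exists>w. w \<in> carrier (FO (FO F (generator c)) c) \<and>
     (\<forall>X\<in>B. bij_betw (\<lambda>x. component (FA F x) c w) (Hom A (generator c) X) (carrier (FO (FO F X) c)))"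
    using universal_element_ex[OF assms] by blast
  from someI_ex[OF this] show "universal_element c \<in> carrier (FO (FO F (generator c)) c)"
    "X \<in> B \<Longrightarrow> bij_betw (ev c) (Hom A (generator c) X) (carrier (FO (FO F X) c))"
    unfolding universal_element_def[symmetric] ev_def by simp_all
qed

lemma ev_closed: "c \<in> Obj D \<Longrightarrow> X \<in> B \<Longrightarrow> x \<in> Hom A (generator c) X \<Longrightarrow> ev c x \<in> carrier (FO (FO F X) c)"
  by (rule bij_betw_apply[OF universal_element(2)])

lemma ev_inj: "c \<in> Obj D \<Longrightarrow> X \<in> B \<Longrightarrow> x \<in> Hom A (generator c) X \<Longrightarrow> y \<in> Hom A (generator c) X \<Longrightarrow> ev c x = ev c y \<Longrightarrow> x = y"
  using bij_betw_imp_inj_on[OF universal_element(2)] by (rule inj_onD)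

lemma ev_surj:
  assumes "c \<in> Obj D" "X \<in> B" "m \<in> carrier (FO (FO F X) c)"
  obtains x where "x \<in> Hom A (generator c) X" "ev c x = m"
proof -
  have "m \<in> ev c ` Hom A (generator c) X" using universal_element(2)[OF assms(1,2)] assms(3) by (simp add: bij_betw_def)
  then show thesis using that by (elim imageE) simp
qed

lemma ev_cmp:
  assumes "c \<in> Obj D" "X \<in> B" "Y \<in> B" "x \<in> Hom A (generator c) X" "g \<in> Hom A X Y"
  shows "ev c (g \<cdot> x) = component (FA F g) c (ev c x)"
  unfolding ev_def F_cmp[OF assms(4,5) generator(1)[OF assms(1)] assms(2,3)]
  by (rule D.Mod_cmp(2)[OF F_hom[OF assms(4) generator(1)[OF assms(1)] assms(2)] F_hom[OF assms(5,2,3)] assms(1)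
        universal_element(1)[OF assms(1)]])

text \<open>Every element of \<open>F X\<close> is of the form \<open>ev c x\<close>, so agreement
  on all \<open>x\<close> gives equal components of the images, and \<open>F\<close> is
  faithful.\<close>

lemma hom_eqI_generators:
  assumes X: "X \<in> B" and Y: "Y \<in> B" and f: "f \<in> Hom A X Y" and g: "g \<in> Hom A X Y"
    and eq: "\<And>c x. c \<in> Obj D \<Longrightarrow> x \<in> Hom A (generator c) X \<Longrightarrow> f \<cdot> x = g \<cdot> x"
  shows "f = g"
proof (rule F_faithful[OF f g X Y], rule D.Mod_hom_eqI[OF F_hom[OF f X Y] F_hom[OF g X Y]])
  fix c m assume c: "c \<in> Obj D" and m: "m \<in> carrier (FO (FO F X) c)"
  obtain x where x: "x \<in> Hom A (generator c) X" "ev c x = m" by (rule ev_surj[OF c X m])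
  show "component (FA F f) c m = component (FA F g) c m"
    using ev_cmp[OF c X Y x(1) f] ev_cmp[OF c X Y x(1) g] eq[OF c x(1)] x(2) by simp
qed

text \<open>Submodules of \<open>F X\<close> are used through this factorisation property only; it replaces quotient modules and explicit
  direct sums of modules.\<close>

lemma subobject_of_submodule:
  assumes X: "X \<in> B"
    and sub: "\<And>c. c \<in> Obj D \<Longrightarrow> subgroup (S c) (FO (FO F X) c)"
    and act: "\<And>f c d x. f \<in> Hom D d c \<Longrightarrow> x \<in> S c \<Longrightarrow> act (FO F X) f x \<in> S d"
  obtains Y m where "Y \<in> B" "m \<in> Hom A Y X"
    "\<forall>Z\<in>B. \<forall>g\<in>Hom A Z X. (\<forall>c\<in>Obj D. \<forall>x\<in>Hom A (generator c) Z. ev c (g \<cdot> x) \<in> S c) \<longrightarrow> (\<exists>g'\<in>Hom A Z Y. m \<cdot> g' = g)"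
    "epic A m \<longrightarrow> (\<forall>c\<in>Obj D. S c = carrier (FO (FO F X) c))"
proof -
  obtain Q j where j: "j \<in> Hom D.MOD Q (FO F X)" and QS: "\<forall>c\<in>Obj D. carrier (FO Q c) = S c"
    and jS: "\<forall>c\<in>Obj D. \<forall>x\<in>S c. component j c x = x"
    and fac: "\<forall>N t. t \<in> Hom D.MOD N (FO F X) \<and> (\<forall>c\<in>Obj D. \<forall>x\<in>carrier (FO N c). component t c x \<in> S c) \<longrightarrow>
       (\<exists>r. r \<in> Hom D.MOD N Q \<and> j \<cdot>\<^bsub>D.MOD\<^esub> r = t)"
    by (rule D.submodule[OF F_obj[OF X] sub act])
  obtain Y s t where Y: "Y \<in> B" and s: "s \<in> Hom D.MOD (FO F Y) Q" and t: "t \<in> Hom D.MOD Q (FO F Y)"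
    and ts: "t \<cdot>\<^bsub>D.MOD\<^esub> s = Ide D.MOD (FO F Y)" and st: "s \<cdot>\<^bsub>D.MOD\<^esub> t = Ide D.MOD Q"
    by (rule F_surj[OF D.Mod_hom_obj(1)[OF j]])
  note js = D.Mod_cmp(1)[OF s j]
  obtain m where m: "m \<in> Hom A Y X" "FA F m = j \<cdot>\<^bsub>D.MOD\<^esub> s" using F_full[OF js Y X] by blast
  show thesis
  proof (rule that[OF Y m(1)])
    show "\<forall>Z\<in>B. \<forall>g\<in>Hom A Z X. (\<forall>c\<in>Obj D. \<forall>x\<in>Hom A (generator c) Z. ev c (g \<cdot> x) \<in> S c) \<longrightarrow> (\<exists>g'\<in>Hom A Z Y. m \<cdot> g' = g)"
    proof (intro ballI impI)
      fix Z g assume Z: "Z \<in> B" and g: "g \<in> Hom A Z X"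
        and gS: "\<forall>c\<in>Obj D. \<forall>x\<in>Hom A (generator c) Z. ev c (g \<cdot> x) \<in> S c"
      note Fg = F_hom[OF g Z X]
      have "component (FA F g) c z \<in> S c" if c: "c \<in> Obj D" and z: "z \<in> carrier (FO (FO F Z) c)" for c z
      proof -
        obtain x where x: "x \<in> Hom A (generator c) Z" "ev c x = z" by (rule ev_surj[OF c Z z])
        show ?thesis using bspec[OF bspec[OF gS c] x(1)] unfolding ev_cmp[OF c Z X x(1) g] x(2) .
      qed
      then obtain r where r: "r \<in> Hom D.MOD (FO F Z) Q" "j \<cdot>\<^bsub>D.MOD\<^esub> r = FA F g" using fac Fg by blast
      note tr = D.Mod_cmp(1)[OF r(1) t]
      obtain g' where g': "g' \<in> Hom A Z Y" "FA F g' = t \<cdot>\<^bsub>D.MOD\<^esub> r" using F_full[OF tr Z Y] by blast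
      have "FA F (m \<cdot> g') = j \<cdot>\<^bsub>D.MOD\<^esub> s \<cdot>\<^bsub>D.MOD\<^esub> (t \<cdot>\<^bsub>D.MOD\<^esub> r)" using F_cmp[OF g'(1) m(1) Z Y X] m(2) g'(2) by simp
      also have "\<dots> = j \<cdot>\<^bsub>D.MOD\<^esub> (s \<cdot>\<^bsub>D.MOD\<^esub> (t \<cdot>\<^bsub>D.MOD\<^esub> r))" by (rule D.MOD.cmp_assoc[symmetric, OF tr s j])
      also have "s \<cdot>\<^bsub>D.MOD\<^esub> (t \<cdot>\<^bsub>D.MOD\<^esub> r) = Ide D.MOD Q \<cdot>\<^bsub>D.MOD\<^esub> r" by (rule D.MOD.cmp_eq_right1[OF st r(1) t s])
      also have "\<dots> = r" by (rule D.MOD.cmp_ide_left[OF r(1)])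
      finally have "FA F (m \<cdot> g') = FA F g" using r(2) by simp
      then have "m \<cdot> g' = g" by (rule F_faithful[OF cmp_hom[OF g'(1) m(1)] g Z X])
      then show "\<exists>g'\<in>Hom A Z Y. m \<cdot> g' = g" using g'(1) by blast
    qed
    show "epic A m \<longrightarrow> (\<forall>c\<in>Obj D. S c = carrier (FO (FO F X) c))"
    proof (intro impI ballI)
      fix c assume e: "epic A m" and c: "c \<in> Obj D"
      have mF: "m \<in> Hom (full_subcategory A B) Y X" using m(1) X Y by simp
      \<comment> \<open>The inclusion \<open>j\<close> is injective on elements and \<open>s\<close>
        is an isomorphism, so \<open>m\<close> is monic in \<open>B\<close>. Being epic as well, it
        is invertible there, and its inverse exhibits every element of \<open>F X\<close> as a value
        of \<open>j\<close>.\<close>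
      have "monic (full_subcategory A B) m"
        unfolding monic_def HomD[OF mF]
      proof (intro conjI ballI impI)
        fix Z g h assume "Z \<in> Obj (full_subcategory A B)" "g \<in> Hom (full_subcategory A B) Z Y"
            "h \<in> Hom (full_subcategory A B) Z Y"
          and "m \<cdot>\<^bsub>full_subcategory A B\<^esub> g = m \<cdot>\<^bsub>full_subcategory A B\<^esub> h"
        then have Z: "Z \<in> B" and g: "g \<in> Hom A Z Y" and h: "h \<in> Hom A Z Y" and eq: "m \<cdot> g = m \<cdot> h" by (simp_all add: Hom_full_iff)
        note Fg = F_hom[OF g Z Y] and Fh = F_hom[OF h Z Y]
        note sg = D.Mod_cmp[OF Fg s] and sh = D.Mod_cmp[OF Fh s]
        have eqF: "j \<cdot>\<^bsub>D.MOD\<^esub> (s \<cdot>\<^bsub>D.MOD\<^esub> FA F g) = j \<cdot>\<^bsub>D.MOD\<^esub> (s \<cdot>\<^bsub>D.MOD\<^esub> FA F h)"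
          using F_cmp[OF g m(1) Z Y X] F_cmp[OF h m(1) Z Y X] eq m(2) D.MOD.cmp_assoc[OF Fg s j] D.MOD.cmp_assoc[OF Fh s j]
              by simp
        have "s \<cdot>\<^bsub>D.MOD\<^esub> FA F g = s \<cdot>\<^bsub>D.MOD\<^esub> FA F h"
        proof (rule D.Mod_hom_eqI[OF sg(1) sh(1)])
          fix d x assume d: "d \<in> Obj D" and x: "x \<in> carrier (FO (FO F Z) d)"
          have in_S: "component (s \<cdot>\<^bsub>D.MOD\<^esub> FA F g) d x \<in> S d" "component (s \<cdot>\<^bsub>D.MOD\<^esub> FA F h) d x \<in> S d"
            using D.component_closed[OF sg(1) d x] D.component_closed[OF sh(1) d x] bspec[OF QS d] by simp_all
          have "component j d (component (s \<cdot>\<^bsub>D.MOD\<^esub> FA F g) d x) = component j d (component (s \<cdot>\<^bsub>D.MOD\<^esub> FA F h) d x)"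
            using D.Mod_cmp(2)[OF sg(1) j d x] D.Mod_cmp(2)[OF sh(1) j d x] eqF by simp
          then show "component (s \<cdot>\<^bsub>D.MOD\<^esub> FA F g) d x = component (s \<cdot>\<^bsub>D.MOD\<^esub> FA F h) d x"
            using bspec[OF bspec[OF jS d] in_S(1)] bspec[OF bspec[OF jS d] in_S(2)] by simp
        qed
        moreover have "monic D.MOD s" by (rule D.MOD.section_monic[OF s t ts])
        ultimately have "FA F g = FA F h"
          using D.MOD.monicD[of s "FA F g" "FO F Z" "FA F h"] Fg Fh HomD(2)[OF s] by simp
        then show "g = h" by (rule F_faithful[OF g h Z Y])
      qed (rule HomD(1)[OF mF])
      moreover have "epic (full_subcategory A B) m" by (rule epic_fullI[OF e B_sub m(1) Y X])
      ultimately obtain n where "n \<in> Hom (full_subcategory A B) X Y" "m \<cdot>\<^bsub>full_subcategory A B\<^esub> n = Ide (full_subcategory A B) X"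
        by (rule fullab.monic_epic_iso[OF _ _ mF])
      then have n: "n \<in> Hom A X Y" "m \<cdot> n = Ide A X" by (simp_all add: Hom_full_iff)
      note Fn = F_hom[OF n(1) X Y]
      have id: "j \<cdot>\<^bsub>D.MOD\<^esub> (s \<cdot>\<^bsub>D.MOD\<^esub> FA F n) = Ide D.MOD (FO F X)"
        using F_cmp[OF n(1) m(1) X Y X] n(2) m(2) F_ide[OF X] D.MOD.cmp_assoc[OF Fn s j] by simp
      show "S c = carrier (FO (FO F X) c)"
      proof
        show "S c \<subseteq> carrier (FO (FO F X) c)" by (rule subgroup.subset[OF sub[OF c]])
        show "carrier (FO (FO F X) c) \<subseteq> S c"
        proof
          fix y assume y: "y \<in> carrier (FO (FO F X) c)"
          note sn = D.Mod_cmp(1)[OF Fn s]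
          have z: "component (s \<cdot>\<^bsub>D.MOD\<^esub> FA F n) c y \<in> S c" using D.component_closed[OF sn c y] bspec[OF QS c] by simp
          have "component j c (component (s \<cdot>\<^bsub>D.MOD\<^esub> FA F n) c y) = component (Ide D.MOD (FO F X)) c y"
            unfolding id[symmetric] by (rule D.Mod_cmp(2)[symmetric, OF sn j c y])
          then show "y \<in> S c" using z bspec[OF bspec[OF jS c] z] D.Mod_ide(2)[OF F_obj[OF X] c y] by simp
        qed
      qed
    qed
  qed
qed

section \<open>Projectivity and self-smallness of the generators\<close>

text \<open>The components of \<open>FA F e\<close> are not known in advance to be surjective. Since
  \<open>e\<close> factors through the subobject given by their image, the inclusion of that
  subobject is epic and the image is everything. So \<open>ev c f\<close> has a preimage, and
  \<open>ev\<close> turns it into a lift of \<open>f\<close>.\<close>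

lemma generator_projective:
  assumes c: "c \<in> Obj D"
  shows "projective (full_subcategory A B) (generator c)"
  unfolding projective_def
proof (intro conjI allI impI)
  show "generator c \<in> Obj (full_subcategory A B)" using generator(1)[OF c] by simp
  fix e f assume "epic (full_subcategory A B) e \<and> f \<in> Hom (full_subcategory A B) (generator c) (Cod (full_subcategory A B) e)"
  then have ef: "epic (full_subcategory A B) e" and f: "f \<in> Hom A (generator c) (Cod A e)" by (auto simp: Hom_full_iff)
  then have "e \<in> Arr (full_subcategory A B)" by (simp add: epic_def)
  then have e: "e \<in> Hom A (Dom A e) (Cod A e)" and X: "Dom A e \<in> B" and Y: "Cod A e \<in> B" by (auto simp: Hom_def)
  let ?X = "Dom A e" and ?Y = "Cod A e"
  note Fe = F_hom[OF e X Y]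
  define S where "S d = component (FA F e) d ` carrier (FO (FO F ?X) d)" for d
  have sub: "subgroup (S d) (FO (FO F ?Y) d)" if d: "d \<in> Obj D" for d
    unfolding S_def by (rule group_hom.img_is_subgroup[OF D.component_group_hom[OF Fe d]])
  have act: "act (FO F ?Y) g y \<in> S d'" if g: "g \<in> Hom D d' d" and y: "y \<in> S d" for g d d' y
  proof -
    obtain x where x: "x \<in> carrier (FO (FO F ?X) d)" "y = component (FA F e) d x" using y by (auto simp: S_def)
    show ?thesis
      unfolding S_def x(2) D.component_natural[OF Fe g x(1), symmetric]
      by (rule imageI[OF D.act_closed[OF F_obj[OF X] g x(1)]])
  qed
  obtain Z m where Z: "Z \<in> B" and m: "m \<in> Hom A Z ?Y"
    and fac: "\<forall>Z'\<in>B. \<forall>g\<in>Hom A Z' ?Y. (\<forall>c\<in>Obj D. \<forall>x\<in>Hom A (generator c) Z'. ev c (g \<cdot> x) \<in> S c) \<longrightarrow> (\<exists>g'\<in>Hom A Z' Z. m \<cdot> g' = g)"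
    and ep: "epic A m \<longrightarrow> (\<forall>c\<in>Obj D. S c = carrier (FO (FO F ?Y) c))"
    by (rule subobject_of_submodule[OF Y sub act])
  have "ev d (e \<cdot> x) \<in> S d" if d: "d \<in> Obj D" and x: "x \<in> Hom A (generator d) ?X" for d x
    unfolding ev_cmp[OF d X Y x e] S_def by (rule imageI[OF ev_closed[OF d X x]])
  then obtain e' where e': "e' \<in> Hom A ?X Z" "m \<cdot> e' = e" using fac X e by blast
  have "epic A m"
    by (rule epic_factor[of m e']) (use epic_full_A[OF ef] e' HomD[OF e'(1)] HomD[OF m] in simp_all)
  then have "ev c f \<in> S c" using ep c ev_closed[OF c Y f] by blast
  then obtain z where z: "z \<in> carrier (FO (FO F ?X) c)" "ev c f = component (FA F e) c z" by (auto simp: S_def)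
  obtain x where x: "x \<in> Hom A (generator c) ?X" "ev c x = z" by (rule ev_surj[OF c X z(1)])
  have "ev c (e \<cdot> x) = ev c f" using ev_cmp[OF c X Y x(1) e] z(2) x(2) by simp
  then have "e \<cdot> x = f" by (rule ev_inj[OF c Y cmp_hom[OF x(1) e] f])
  then show "\<exists>g\<in>Hom (full_subcategory A B) (generator c) (Dom (full_subcategory A B) e). e \<cdot>\<^bsub>full_subcategory A B\<^esub> g = f"
    using x(1) X generator(1)[OF c] by auto
qed

text \<open>The coproduct over all arrows from generators to \<open>Y\<close> stays in
  \<open>B\<close>, and its canonical arrow to \<open>Y\<close> is epic because the generators
  separate the arrows of \<open>B\<close>.\<close>

lemma generators_set: "set_of_projective_generators \<kappa> (full_subcategory A B) (generator ` Obj D)"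
  unfolding set_of_projective_generators_def
proof (intro conjI ballI)
  have smD: "small \<kappa> (Obj D)" using D.small_D by (simp add: small_category_def)
  then show "small \<kappa> (generator ` Obj D)" by (rule small_image)
  show "projective (full_subcategory A B) P" if "P \<in> generator ` Obj D" for P using that generator_projective by blast
  show "Obj (full_subcategory A B) \<subseteq> Gen \<kappa> (full_subcategory A B) (generator ` Obj D)"
  proof
    fix Y assume "Y \<in> Obj (full_subcategory A B)"
    then have Y: "Y \<in> B" by simp
    let ?I = "SIGMA c:Obj D. Hom A (generator c) Y"
    have sm: "small \<kappa> ?I"
      by (rule small_Sigma[OF universe smD small_Hom[OF B_obj[OF generator(1)] B_obj[OF Y]]])
    have IB: "\<forall>i\<in>?I. generator (fst i) \<in> B" using generator(1) by auto
    then have "\<forall>i\<in>?I. generator (fst i) \<in> Obj A" using B_sub by blast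
    then obtain P \<iota> where P: "is_coproduct A ?I (\<lambda>i. generator (fst i)) P \<iota>" by (rule coproduct_ex[OF sm])
    have PB: "P \<in> B" by (rule B_coproduct[OF P IB])
    have "\<forall>i\<in>?I. snd i \<in> Hom A (generator (fst i)) Y" by auto
    then obtain q where q: "q \<in> Hom A P Y" "\<forall>i\<in>?I. q \<cdot> \<iota> i = snd i" by (rule coproduct_desc[OF P B_obj[OF Y]])
    have qF: "q \<in> Hom (full_subcategory A B) P Y" using q(1) PB Y by simp
    have "epic (full_subcategory A B) q"
      unfolding epic_def HomD[OF qF]
    proof (intro conjI ballI impI)
      fix Z g h assume "Z \<in> Obj (full_subcategory A B)" "g \<in> Hom (full_subcategory A B) Y Z" "h \<in> Hom (full_subcategory A B) Y Z"
        and "g \<cdot>\<^bsub>full_subcategory A B\<^esub> q = h \<cdot>\<^bsub>full_subcategory A B\<^esub> q"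
      then have Z: "Z \<in> B" and g: "g \<in> Hom A Y Z" and h: "h \<in> Hom A Y Z" and eq: "g \<cdot> q = h \<cdot> q" by (simp_all add: Hom_full_iff)
      show "g = h"
      proof (rule hom_eqI_generators[OF Y Z g h])
        fix c x assume "c \<in> Obj D" "x \<in> Hom A (generator c) Y"
        then have i: "(c, x) \<in> ?I" by simp
        have "g \<cdot> (q \<cdot> \<iota> (c, x)) = h \<cdot> (q \<cdot> \<iota> (c, x))" by (rule cmp_eq_right[OF eq coproduct_inj[OF P i] q(1) g q(1) h])
        then show "g \<cdot> x = h \<cdot> x" using bspec[OF q(2) i] by simp
      qed
    qed (rule HomD(1)[OF qF])
    moreover have "P \<in> Sum \<kappa> (full_subcategory A B) (generator ` Obj D)"
      by (rule SumI[OF full.category_axioms universe sm _ is_coproduct_fullI[OF P B_sub IB PB]]) auto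
    ultimately show "Y \<in> Gen \<kappa> (full_subcategory A B) (generator ` Obj D)" unfolding Gen_def using qF by blast
  qed
qed

text \<open>The submodule \<open>S\<close> of elements of \<open>F P\<close> fixed by some finite
  sum \<open>e J\<close> corresponds to a subobject through which all injections factor. These
  factors glue to a section of its inclusion, so \<open>S\<close> is all of \<open>F P\<close>.
  Hence every \<open>x\<close> from a generator satisfies \<open>x = e J \<cdot> x\<close> for some
  finite \<open>J\<close>, which is the finiteness that \<open>canonical_map_iso\<close> asks
  for.\<close>

lemma generators_self_small: "self_small \<kappa> A (generator ` Obj D)"
  unfolding self_small_def
proof (intro allI ballI impI, elim conjE)
  fix I :: "'u set" and X P \<iota> U
  assume "U \<in> generator ` Obj D" and XU: "\<forall>i\<in>I. X i \<in> generator ` Obj D" and cP: "is_coproduct A I X P \<iota>"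
  then obtain c where c: "c \<in> Obj D" "U = generator c" by blast
  have XB: "\<forall>i\<in>I. X i \<in> B" using XU generator(1) by auto
  have P: "P \<in> B" by (rule B_coproduct[OF cP XB])
  note Po = B_obj[OF P]
  obtain \<pi> where pi: "\<forall>i\<in>I. \<pi> i \<in> Hom A P (X i)"
    and pii: "\<forall>i\<in>I. \<forall>j\<in>I. \<pi> i \<cdot> \<iota> j = (if i = j then Ide A (X i) else Zero A (X j) (X i))"
    by (rule coproduct_projections[OF cP])
  have ip: "\<iota> i \<cdot> \<pi> i \<in> Hom A P P" if "i \<in> I" for i by (rule cmp_hom[OF bspec[OF pi that] coproduct_inj[OF cP that]])
  interpret PP: comm_group "hom_group A P P" by (rule hom_comm_group[OF Po Po])
  define e where "e J = finprod (hom_group A P P) (\<lambda>i. \<iota> i \<cdot> \<pi> i) J" for J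
  have eh: "e J \<in> Hom A P P" if "J \<subseteq> I" for J
    unfolding e_def by (rule finprod_hom[OF Po Po]) (use ip that in blast)
  have ei: "e J \<cdot> \<iota> i = \<iota> i" if J: "finite J" "J \<subseteq> I" and i: "i \<in> J" for J i
  proof -
    have iI: "i \<in> I" using J i by blast
    note ii = coproduct_inj[OF cP iI] and Xo = B_obj[OF bspec[OF XB iI]]
    interpret XP: comm_group "hom_group A (X i) P" by (rule hom_comm_group[OF Xo Po])
    have "e J \<cdot> \<iota> i = finprod (hom_group A (X i) P) (\<lambda>j. (\<iota> j \<cdot> \<pi> j) \<cdot> \<iota> i) J"
      unfolding e_def by (rule cmp_finprod_left[OF Po ii J(1)]) (use ip J(2) in blast)
    also have "\<dots> = finprod (hom_group A (X i) P) (\<lambda>j. if i = j then \<iota> j else \<one>\<^bsub>hom_group A (X i) P\<^esub>) J"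
    proof (rule XP.finprod_cong'[OF refl])
      show "(\<lambda>j. if i = j then \<iota> j else \<one>\<^bsub>hom_group A (X i) P\<^esub>) \<in> J \<rightarrow> carrier (hom_group A (X i) P)"
        using ii zero_hom[OF Xo Po] by auto
      fix j assume "j \<in> J"
      then have j: "j \<in> I" using J(2) by blast
      show "(\<iota> j \<cdot> \<pi> j) \<cdot> \<iota> i = (if i = j then \<iota> j else \<one>\<^bsub>hom_group A (X i) P\<^esub>)"
        using cmp_assoc[OF ii bspec[OF pi j] coproduct_inj[OF cP j]] bspec[OF bspec[OF pii j] iI]
          cmp_ide_right[OF coproduct_inj[OF cP j]] cmp_zero_right[OF coproduct_inj[OF cP j] Xo] by auto
    qed
    also have "\<dots> = \<iota> i"
    proof -
      have "finprod (hom_group A (X i) P) (\<lambda>j. if i = j then \<iota> i else \<one>\<^bsub>hom_group A (X i) P\<^esub>) J = \<iota> i"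
        by (rule XP.finprod_singleton[OF i J(1), of "\<lambda>_. \<iota> i"]) (use ii in simp)
      moreover have "(\<lambda>j. if i = j then \<iota> j else \<one>\<^bsub>hom_group A (X i) P\<^esub>) = (\<lambda>j. if i = j then \<iota> i else \<one>\<^bsub>hom_group A (X i) P\<^esub>)"
        by auto
      ultimately show ?thesis by simp
    qed
    finally show ?thesis .
  qed
  \<comment> \<open>This makes the fixed elements grow with \<open>J\<close>, so that any two
    elements of \<open>S\<close> are fixed by a common \<open>e J\<close>.\<close>
  have ee: "e J' \<cdot> e J = e J" if J: "J \<subseteq> J'" "finite J'" "J' \<subseteq> I" for J J'
  proof -
    have f: "finite J" "J \<subseteq> I" using J finite_subset by auto
    have "e J' \<cdot> e J = finprod (hom_group A P P) (\<lambda>i. e J' \<cdot> (\<iota> i \<cdot> \<pi> i)) J"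
      unfolding e_def[of J] by (rule cmp_finprod_right[OF Po eh[OF J(3)] f(1)]) (use ip f(2) in blast)
    also have "\<dots> = e J"
      unfolding e_def[of J]
    proof (rule PP.finprod_cong'[OF refl])
      show "(\<lambda>i. \<iota> i \<cdot> \<pi> i) \<in> J \<rightarrow> carrier (hom_group A P P)" using ip f(2) by auto
      fix i assume i: "i \<in> J"
      then have iI: "i \<in> I" "i \<in> J'" using f(2) J(1) by auto
      show "e J' \<cdot> (\<iota> i \<cdot> \<pi> i) = \<iota> i \<cdot> \<pi> i"
        by (rule cmp_eq_right1[OF ei[OF J(2,3) iI(2)] bspec[OF pi iI(1)] coproduct_inj[OF cP iI(1)] eh[OF J(3)]])
    qed
    finally show ?thesis .
  qed
  let ?fix = "\<lambda>d J y. component (FA F (e J)) d y = y"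
  define S where "S d = {y \<in> carrier (FO (FO F P) d). \<exists>J. finite J \<and> J \<subseteq> I \<and> ?fix d J y}" for d
  note FP = F_obj[OF P]
  have Fe: "FA F (e J) \<in> Hom D.MOD (FO F P) (FO F P)" if "J \<subseteq> I" for J by (rule F_hom[OF eh[OF that] P P])
  have fix_mono: "?fix d J' y" if y: "?fix d J y" "y \<in> carrier (FO (FO F P) d)" and d: "d \<in> Obj D"
      and J: "J \<subseteq> J'" "finite J'" "J' \<subseteq> I" for d J J' y
  proof -
    have JI: "J \<subseteq> I" using J by blast
    have "component (FA F (e J')) d (component (FA F (e J)) d y) = component (FA F (e J)) d y"
      using D.Mod_cmp(2)[OF Fe[OF JI] Fe[OF J(3)] d y(2)] F_cmp[OF eh[OF JI] eh[OF J(3)] P P P] ee[OF J] by simp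
    then show ?thesis using y(1) by simp
  qed
  have sub: "subgroup (S d) (FO (FO F P) d)" if d: "d \<in> Obj D" for d
  proof -
    interpret G: comm_group "FO (FO F P) d" by (rule D.module_group[OF FP d])
    have gh: "group_hom (FO (FO F P) d) (FO (FO F P) d) (component (FA F (e J)) d)" if "J \<subseteq> I" for J
      by (rule D.component_group_hom[OF Fe[OF that] d])
    show ?thesis
    proof (rule G.subgroupI)
      show "S d \<subseteq> carrier (FO (FO F P) d)" by (auto simp: S_def)
      have "?fix d {} \<one>\<^bsub>FO (FO F P) d\<^esub>" by (rule group_hom.hom_one[OF gh]) simp
      then have "\<one>\<^bsub>FO (FO F P) d\<^esub> \<in> S d" unfolding S_def by blast
      then show "S d \<noteq> {}" by blast
    next
      fix y assume "y \<in> S d"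
      then obtain J where y: "y \<in> carrier (FO (FO F P) d)" and J: "finite J" "J \<subseteq> I" "?fix d J y" by (auto simp: S_def)
      have "?fix d J (inv\<^bsub>FO (FO F P) d\<^esub> y)" using group_hom.hom_inv[OF gh[OF J(2)] y] J(3) by simp
      then show "inv\<^bsub>FO (FO F P) d\<^esub> y \<in> S d" unfolding S_def using y J by blast
    next
      fix y z assume "y \<in> S d" "z \<in> S d"
      then obtain J J' where y: "y \<in> carrier (FO (FO F P) d)" and J: "finite J" "J \<subseteq> I" "?fix d J y"
        and z: "z \<in> carrier (FO (FO F P) d)" and J': "finite J'" "J' \<subseteq> I" "?fix d J' z" by (auto simp: S_def)
      have u: "finite (J \<union> J')" "J \<union> J' \<subseteq> I" using J J' by auto
      have "?fix d (J \<union> J') y" by (rule fix_mono[OF J(3) y d _ u]) simp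
      moreover have "?fix d (J \<union> J') z" by (rule fix_mono[OF J'(3) z d _ u]) simp
      ultimately have "?fix d (J \<union> J') (y \<otimes>\<^bsub>FO (FO F P) d\<^esub> z)" using D.component_mult[OF Fe[OF u(2)] d y z] by simp
      then show "y \<otimes>\<^bsub>FO (FO F P) d\<^esub> z \<in> S d" unfolding S_def using y z u by blast
    qed
  qed
  have act: "act (FO F P) g y \<in> S d'" if g: "g \<in> Hom D d' d" and y: "y \<in> S d" for g d d' y
  proof -
    obtain J where y': "y \<in> carrier (FO (FO F P) d)" and J: "finite J" "J \<subseteq> I" "?fix d J y" using y by (auto simp: S_def)
    have "?fix d' J (act (FO F P) g y)" using D.component_natural[OF Fe[OF J(2)] g y'] J(3) by simp
    then show ?thesis unfolding S_def using D.act_closed[OF FP g y'] J by blast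
  qed
  obtain Y m where Y: "Y \<in> B" and m: "m \<in> Hom A Y P"
    and fac: "\<forall>Z\<in>B. \<forall>g\<in>Hom A Z P. (\<forall>c\<in>Obj D. \<forall>x\<in>Hom A (generator c) Z. ev c (g \<cdot> x) \<in> S c) \<longrightarrow> (\<exists>g'\<in>Hom A Z Y. m \<cdot> g' = g)"
    and ep: "epic A m \<longrightarrow> (\<forall>c\<in>Obj D. S c = carrier (FO (FO F P) c))"
    by (rule subobject_of_submodule[OF P sub act])
  have "\<forall>i\<in>I. \<exists>g. g \<in> Hom A (X i) Y \<and> m \<cdot> g = \<iota> i"
  proof
    fix i assume i: "i \<in> I"
    note ii = coproduct_inj[OF cP i] and Xi = bspec[OF XB i]
    have "ev d (\<iota> i \<cdot> x) \<in> S d" if d: "d \<in> Obj D" and x: "x \<in> Hom A (generator d) (X i)" for d x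
    proof -
      \<comment> \<open>An element that comes from the summand \<open>i\<close> is fixed by the
        idempotent of that summand alone.\<close>
      have iI: "finite {i}" "{i} \<subseteq> I" using i by auto
      note ix = cmp_hom[OF x ii]
      have "e {i} \<cdot> (\<iota> i \<cdot> x) = \<iota> i \<cdot> x" by (rule cmp_eq_right1[OF ei[OF iI] x ii eh[OF iI(2)]]) simp
      then have "?fix d {i} (ev d (\<iota> i \<cdot> x))" using ev_cmp[OF d P P ix eh[OF iI(2)]] by simp
      then show ?thesis unfolding S_def using ev_closed[OF d P ix] iI by blast
    qed
    then show "\<exists>g. g \<in> Hom A (X i) Y \<and> m \<cdot> g = \<iota> i" using fac Xi ii by blast
  qed
  then obtain g where g: "\<forall>i\<in>I. g i \<in> Hom A (X i) Y \<and> m \<cdot> g i = \<iota> i" by (rule bchoice[THEN exE])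
  then have "\<forall>i\<in>I. g i \<in> Hom A (X i) Y" by blast
  then obtain h where h: "h \<in> Hom A P Y" "\<forall>i\<in>I. h \<cdot> \<iota> i = g i" by (rule coproduct_desc[OF cP B_obj[OF Y]])
  have "m \<cdot> h = Ide A P"
  proof (rule coproduct_eqI[OF cP cmp_hom[OF h(1) m] ide_hom[OF Po]])
    fix i assume i: "i \<in> I"
    show "m \<cdot> h \<cdot> \<iota> i = Ide A P \<cdot> \<iota> i"
      using cmp_assoc[OF coproduct_inj[OF cP i] h(1) m] bspec[OF h(2) i] bspec[OF g i] cmp_ide_left[OF coproduct_inj[OF cP
          i]] by simp
  qed
  then have "epic A m" by (rule retraction_epic[OF m h(1)])
  then have S: "S c = carrier (FO (FO F P) c)" using ep c(1) by blast
  note Uo = B_obj[OF generator(1)[OF c(1)]]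
  show "canonical_map A U I X P \<iota> \<in> iso (sum_group I (\<lambda>i. hom_group A U (X i))) (hom_group A U P)"
    unfolding c(2)
  proof (rule canonical_map_iso[OF cP pi pii Uo])
    fix x assume x: "x \<in> Hom A (generator c) P"
    have "ev c x \<in> S c" using ev_closed[OF c(1) P x] S by simp
    then obtain J where J: "finite J" "J \<subseteq> I" "?fix c J (ev c x)" by (auto simp: S_def)
    have "ev c (e J \<cdot> x) = ev c x" using ev_cmp[OF c(1) P P x eh[OF J(2)]] J(3) by simp
    then have "x = e J \<cdot> x" using ev_inj[OF c(1) P cmp_hom[OF x eh[OF J(2)]] x] by simp
    also have "\<dots> = finprod (hom_group A (generator c) P) (\<lambda>i. (\<iota> i \<cdot> \<pi> i) \<cdot> x) J"
      unfolding e_def by (rule cmp_finprod_left[OF Po x J(1)]) (use ip J(2) in blast)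
    also have "\<dots> = finprod (hom_group A (generator c) P) (\<lambda>i. \<iota> i \<cdot> (\<pi> i \<cdot> x)) J"
    proof -
      interpret UP: comm_group "hom_group A (generator c) P" by (rule hom_comm_group[OF Uo Po])
      show ?thesis
      proof (rule UP.finprod_cong'[OF refl])
        show "(\<lambda>i. \<iota> i \<cdot> (\<pi> i \<cdot> x)) \<in> J \<rightarrow> carrier (hom_group A (generator c) P)"
        proof
          fix i assume "i \<in> J"
          then have i: "i \<in> I" using J(2) by blast
          show "\<iota> i \<cdot> (\<pi> i \<cdot> x) \<in> carrier (hom_group A (generator c) P)"
            using cmp_hom[OF cmp_hom[OF x bspec[OF pi i]] coproduct_inj[OF cP i]] by simp
        qed
        fix i assume "i \<in> J"
        then have i: "i \<in> I" using J(2) by blast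
        show "\<iota> i \<cdot> \<pi> i \<cdot> x = \<iota> i \<cdot> (\<pi> i \<cdot> x)"
          by (rule cmp_assoc[symmetric, OF x bspec[OF pi i] coproduct_inj[OF cP i]])
      qed
    qed
    finally show "\<exists>J. finite J \<and> J \<subseteq> I \<and> x = finprod (hom_group A (generator c) P) (\<lambda>i. \<iota> i \<cdot> (\<pi> i \<cdot> x)) J"
      using J by blast
  qed
qed

theorem presenting_generators:
  "presenting_set \<kappa> A B (generator ` Obj D) \<and> self_small \<kappa> A (generator ` Obj D)"
  using presenting_set_of_generators[OF generators_set] generators_self_small by simp

end

section \<open>The characterisations assembled\<close>

text \<open>The presenting set is indexed by the objects of \<open>D\<close>, so that a ring, whose
  category has one object, yields a singleton.\<close>

lemma (in coreflective_abelian) self_small_presenting_set: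
  fixes D :: "('c, 'u) precat"
  assumes "preadditive_category D" "small_category \<kappa> D" "equivalent (full_subcategory A B) (module_category \<kappa> D)"
  shows "\<exists>U. presenting_set \<kappa> A B (U ` Obj D) \<and> self_small \<kappa> A (U ` Obj D)"
proof -
  obtain F where F: "fully_faithful_surjective (full_subcategory A B) (module_category \<kappa> D) F"
    by (rule equivalentD[OF assms(3)])
  interpret D: preadditive_category D by fact
  interpret D: small_preadditive D \<kappa> by unfold_locales (rule universe assms(2))+
  interpret module_equivalence A \<kappa> B D F by unfold_locales (rule F)
  show ?thesis using presenting_generators by blast
qed

theorem corollary9p6:
  fixes \<kappa> :: "'u rel"
    and A :: "('o, 'm) precat"
    and B :: "'o set"
  assumes "universe \<kappa>"
    and "abelian_category A" and "locally_small \<kappa> A" and "cocomplete \<kappa> A"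
    and "additive_subcategory A B"
  shows "(coreflective_abelian_exact_with_generators \<kappa> A B \<longleftrightarrow> (\<exists>\<U>. presenting_set \<kappa> A B \<U>)) \<and>
    (coreflective_abelian_exact_with_generators \<kappa> A B \<longrightarrow>
      (is_module_category_over_preadditive \<kappa> (full_subcategory A B) \<longleftrightarrow>
        (\<exists>\<U>. presenting_set \<kappa> A B \<U> \<and> self_small \<kappa> A \<U>)) \<and>
      (is_module_category_over_ring \<kappa> (full_subcategory A B) \<longleftrightarrow>
        (\<exists>U. presenting_set \<kappa> A B {U} \<and> self_small \<kappa> A {U})))"
proof -
  interpret A: abelian_category A by fact
  interpret additive_sub A \<kappa> B by unfold_locales (rule assms)+
  have pr: "presented A \<kappa> B \<U>" if "presenting_set \<kappa> A B \<U>" for \<U>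
    by unfold_locales (rule that)
  have ca: "coreflective_abelian A \<kappa> B" if "coreflective_abelian_exact_with_generators \<kappa> A B"
    by unfold_locales (use that in \<open>simp_all add: coreflective_abelian_exact_with_generators_def\<close>)
  have 1: "coreflective_abelian_exact_with_generators \<kappa> A B \<longleftrightarrow> (\<exists>\<U>. presenting_set \<kappa> A B \<U>)"
  proof
    assume c: "coreflective_abelian_exact_with_generators \<kappa> A B"
    then obtain \<G> where "set_of_projective_generators \<kappa> (full_subcategory A B) \<G>"
      by (auto simp: coreflective_abelian_exact_with_generators_def)
    then show "\<exists>\<U>. presenting_set \<kappa> A B \<U>" using coreflective_abelian.presenting_set_of_generators[OF ca[OF c]] by blast
  next
    assume "\<exists>\<U>. presenting_set \<kappa> A B \<U>"
    then show "coreflective_abelian_exact_with_generators \<kappa> A B" using presented.coreflective_abelian_exact[OF pr] by blast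
  qed
  have 2: "is_module_category_over_preadditive \<kappa> (full_subcategory A B) \<longleftrightarrow> (\<exists>\<U>. presenting_set \<kappa> A B \<U> \<and> self_small \<kappa> A \<U>)"
    if c: "coreflective_abelian_exact_with_generators \<kappa> A B"
  proof
    assume "is_module_category_over_preadditive \<kappa> (full_subcategory A B)"
    then obtain D :: "('u, 'u) precat" where "preadditive_category D" "small_category \<kappa> D"
      "equivalent (full_subcategory A B) (module_category \<kappa> D)" by (auto simp: is_module_category_over_preadditive_def)
    then show "\<exists>\<U>. presenting_set \<kappa> A B \<U> \<and> self_small \<kappa> A \<U>"
      using coreflective_abelian.self_small_presenting_set[OF ca[OF c], of D] by blast
  next
    assume "\<exists>\<U>. presenting_set \<kappa> A B \<U> \<and> self_small \<kappa> A \<U>"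
    then show "is_module_category_over_preadditive \<kappa> (full_subcategory A B)"
      using presented.module_category_over_preadditive[OF pr] by blast
  qed
  have 3: "is_module_category_over_ring \<kappa> (full_subcategory A B) \<longleftrightarrow> (\<exists>U. presenting_set \<kappa> A B {U} \<and> self_small \<kappa> A {U})"
    if c: "coreflective_abelian_exact_with_generators \<kappa> A B"
  proof
    assume "is_module_category_over_ring \<kappa> (full_subcategory A B)"
    then obtain R :: "'u ring" where R: "ring R" "small \<kappa> (carrier R)"
      "equivalent (full_subcategory A B) (module_category \<kappa> (ring_category R))" by (auto simp: is_module_category_over_ring_def)
    obtain U where "presenting_set \<kappa> A B (U ` Obj (ring_category R)) \<and> self_small \<kappa> A (U ` Obj (ring_category R))"
      using coreflective_abelian.self_small_presenting_set[OF ca[OF c] preadditive_ring_category[OF R(1)]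
        small_ring_category[OF R(1) universe R(2)] R(3)] by blast
    then show "\<exists>U. presenting_set \<kappa> A B {U} \<and> self_small \<kappa> A {U}" by auto
  next
    assume "\<exists>U. presenting_set \<kappa> A B {U} \<and> self_small \<kappa> A {U}"
    then obtain U where U: "presenting_set \<kappa> A B {U}" "self_small \<kappa> A {U}" by blast
    show "is_module_category_over_ring \<kappa> (full_subcategory A B)"
      by (rule presented.module_category_over_ring[OF pr[OF U(1)] U(2) refl])
  qed
  show ?thesis using 1 2 3 by blast
qed

end
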